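(* Let $0<\beta\le 1$, $0<p<\infty$, $1<q<\infty$, $\alpha\in\mathbb R$, and let $w_1\in A_{q_1}$ and $w_2\in A_{q_2}$ be weights on $\mathbb R^n$. Suppose that either of the following holds: (i) $w_1=w_2$, $1\le q_1=q_2\le q$ and $-nq_1/q<\alpha q_1<n(1-q_2/q)$; (ii) $w_1\ne w_2$, $1\le q_1<\infty$, $1\le q_2\le q$ and $0<\alpha q_1<n(1-q_2/q)$. Then the intrinsic Littlewood-Paley $\mathcal G$-function $\mathcal G_\beta$ is bounded on $\dot K^{\alpha,p}_q(w_1,w_2)$ and on $K^{\alpha,p}_q(w_1,w_2)$; that is, there is a constant $C>0$ independent of $f$ such that $$\|\mathcal G_\beta(f)\|_{\dot K^{\alpha,p}_q(w_1,w_2)}\le C\|f\|_{\dot K^{\alpha,p}_q(w_1,w_2)}\quad\text{for all } f\in\dot K^{\alpha,p}_q(w_1,w_2),$$ and $$\|\mathcal G_\beta(f)\|_{K^{\alpha,p}_q(w_1,w_2)}\le C\|f\|_{K^{\alpha,p}_q(w_1,w_2)}\quad\text{for all } f\in K^{\alpha,p}_q(w_1,w_2).$$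
   Context: **Weights.** A weight $w$ is a nonnegative, locally integrable function on $\mathbb R^n$, not identically zero (a.e.); $w(E)=\int_E w(x)\,dx$. For $1<s<\infty$, $w\in A_s$ means there is $C>0$ such that for every ball $B\subseteq\mathbb R^n$, $\big(\frac1{|B|}\int_B w\,dx\big)\big(\frac1{|B|}\int_B w^{-1/(s-1)}\,dx\big)^{s-1}\le C$; $w\in A_1$ means there is $C>0$ with $\frac1{|B|}\int_B w\,dx\le C\,\operatorname{ess\,inf}_{x\in B}w(x)$ for every ball $B$. $\|f\|_{L^q_w}=\big(\int_{\mathbb R^n}|f|^q w\,dx\big)^{1/q}$. **Weighted Herz spaces.** Let $B_k=\{x\in\mathbb R^n:|x|\le 2^k\}$, $C_k=B_k\setminus B_{k-1}$ for $k\in\mathbb Z$, $\chi_k=\chi_{C_k}$ (characteristic function), $\widetilde\chi_k=\chi_k$ for integers $k\ge1$ and $\widetilde\chi_0=\chi_{B_0}$. The homogeneous space $\dot K^{\alpha,p}_q(w_1,w_2)$ consists of all $f\in L^q_{loc}(\mathbb R^n\setminus\{0\},w_2)$ with $$\|f\|_{\dot K^{\alpha,p}_q(w_1,w_2)}=\Big(\sum_{k\in\mathbb Z}[w_1(B_k)]^{\alpha p/n}\|f\chi_k\|_{L^q_{w_2}}^p\Big)^{1/p}<\infty,$$ and the non-homogeneous space $K^{\alpha,p}_q(w_1,w_2)$ consists of all $f\in L^q_{loc}(\mathbb R^n,w_2)$ with $$\|f\|_{K^{\alpha,p}_q(w_1,w_2)}=\Big(\sum_{k=0}^\infty[w_1(B_k)]^{\alpha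 p/n}\|f\widetilde\chi_k\|_{L^q_{w_2}}^p\Big)^{1/p}<\infty.$$ **Intrinsic $\mathcal G$-function.** For $0<\beta\le1$, $\mathcal C_\beta$ is the family of functions $\varphi$ on $\mathbb R^n$ with support contained in $\{|x|\le1\}$, $\int_{\mathbb R^n}\varphi\,dx=0$, and $|\varphi(x)-\varphi(x')|\le|x-x'|^\beta$ for all $x,x'\in\mathbb R^n$. With $\varphi_t(x)=t^{-n}\varphi(x/t)$, for $f\in L^1_{loc}(\mathbb R^n)$ and $(y,t)\in\mathbb R^n\times(0,\infty)$ put $A_\beta(f)(y,t)=\sup_{\varphi\in\mathcal C_\beta}|f*\varphi_t(y)|$. Then $$\mathcal G_\beta(f)(x)=\Big(\int_0^\infty\big(A_\beta(f)(x,t)\big)^2\frac{dt}{t}\Big)^{1/2}.$$ *)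

theory Defs
  imports "HOL-Analysis.Analysis"
begin

text \<open>
  Throughout, \<open>\<real>\<^sup>n\<close> is \<^typ>\<open>real^'n\<close> with \<open>n = CARD('n)\<close>, and integrals are taken with respect to
  Lebesgue measure. Quantities that may be infinite (norms, \<open>w\<close>-measures, the values of
  the \<open>\<G>\<close>-function) are elements of \<^typ>\<open>ennreal\<close>.
\<close>

text \<open>
  Real powers on \<open>[0, \<infinity>]\<close>, with \<open>0\<^sup>r = \<infinity>\<close> and \<open>\<infinity>\<^sup>r = 0\<close> for \<open>r < 0\<close>. Unlike \<open>powr\<close> on the reals,
  where \<open>0 powr r = 0\<close>, this gives \<open>w\<^bsup>-1/(s-1)\<^esup> = \<infinity>\<close> where the weight \<open>w\<close> vanishes.
\<close>
definition epowr :: "ennreal \<Rightarrow> real \<Rightarrow> ennreal"  (infixr "epowr" 80) where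
  "x epowr r =
    (if r = 0 then 1
     else if x = 0 then (if r > 0 then 0 else \<infinity>)
     else if x = \<infinity> then (if r > 0 then \<infinity> else 0)
     else ennreal (enn2real x powr r))"

definition locally_integrable :: "(real^'n \<Rightarrow> real) \<Rightarrow> bool" where
  "locally_integrable f \<longleftrightarrow> (\<forall>K. compact K \<longrightarrow> set_integrable lebesgue K f)"

definition weight :: "(real^'n \<Rightarrow> real) \<Rightarrow> bool" where
  "weight w \<longleftrightarrow> w \<in> borel_measurable lebesgue \<and> (\<forall>x. 0 \<le> w x) \<and> locally_integrable w
     \<and> \<not> (AE x in lebesgue. w x = 0)"

definition wmeasure :: "(real^'n \<Rightarrow> real) \<Rightarrow> (real^'n) set \<Rightarrow> ennreal" where
  "wmeasure w E = (\<integral>\<^sup>+x\<in>E. ennreal (w x) \<partial>lebesgue)"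

definition average :: "(real^'n) set \<Rightarrow> (real^'n \<Rightarrow> ennreal) \<Rightarrow> ennreal" where
  "average B g = (\<integral>\<^sup>+x\<in>B. g x \<partial>lebesgue) / emeasure lebesgue B"

definition ess_inf_on :: "(real^'n) set \<Rightarrow> (real^'n \<Rightarrow> ennreal) \<Rightarrow> ennreal" where
  "ess_inf_on B g = Sup {c. AE x in lebesgue. x \<in> B \<longrightarrow> c \<le> g x}"

text \<open>The weight class \<open>A\<^sub>s\<close>; it is empty for \<open>s < 1\<close>.\<close>
definition muckenhoupt :: "real \<Rightarrow> (real^'n \<Rightarrow> real) set" where
  "muckenhoupt s = {w. weight w \<and>
     (if s = 1 then
        (\<exists>C>0. \<forall>x r. 0 < r \<longrightarrow>
           average (ball x r) (\<lambda>y. ennreal (w y))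
             \<le> ennreal C * ess_inf_on (ball x r) (\<lambda>y. ennreal (w y)))
      else
        1 < s \<and> (\<exists>C>0. \<forall>x r. 0 < r \<longrightarrow>
           average (ball x r) (\<lambda>y. ennreal (w y))
             * (average (ball x r) (\<lambda>y. ennreal (w y) epowr (- 1 / (s - 1)))) epowr (s - 1)
             \<le> ennreal C))}"

text \<open>
  The norms and spaces below are set up for \<open>[0, \<infinity>]\<close>-valued functions, so that they apply to
  \<open>\<G>\<^sub>\<beta>(f)\<close>; for a real-valued \<open>f\<close> they are applied to \<open>|f|\<close>.
\<close>
definition Lq_norm :: "real \<Rightarrow> (real^'n \<Rightarrow> real) \<Rightarrow> (real^'n \<Rightarrow> ennreal) \<Rightarrow> ennreal" where
  "Lq_norm q w F = (\<integral>\<^sup>+x. F x epowr q * ennreal (w x) \<partial>lebesgue) epowr (1 / q)"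

definition Lq_loc :: "real \<Rightarrow> (real^'n) set \<Rightarrow> (real^'n \<Rightarrow> real) \<Rightarrow> (real^'n \<Rightarrow> ennreal) set" where
  "Lq_loc q U w = {F \<in> borel_measurable lebesgue.
     \<forall>K. compact K \<and> K \<subseteq> U \<longrightarrow> Lq_norm q w (\<lambda>x. F x * indicator K x) < \<infinity>}"

definition dyadic_ball :: "int \<Rightarrow> (real^'n) set" where
  "dyadic_ball k = {x. norm x \<le> 2 powi k}"

definition annulus :: "int \<Rightarrow> (real^'n) set" where
  "annulus k = dyadic_ball k - dyadic_ball (k - 1)"

text \<open>The support of the modified characteristic functions used in the non-homogeneous space.\<close>
definition annulus_nonhom :: "nat \<Rightarrow> (real^'n) set" where
  "annulus_nonhom k = (if k = 0 then dyadic_ball 0 else annulus (int k))"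

definition herz_hom_norm ::
  "real \<Rightarrow> real \<Rightarrow> real \<Rightarrow> (real^'n \<Rightarrow> real) \<Rightarrow> (real^'n \<Rightarrow> real) \<Rightarrow> (real^'n \<Rightarrow> ennreal) \<Rightarrow> ennreal" where
  "herz_hom_norm \<alpha> p q w1 w2 F =
    (\<Sum>\<^sub>\<infinity>k\<in>(UNIV :: int set).
       wmeasure w1 (dyadic_ball k) epowr (\<alpha> * p / real CARD('n))
         * Lq_norm q w2 (\<lambda>x. F x * indicator (annulus k) x) epowr p) epowr (1 / p)"

definition herz_nonhom_norm ::
  "real \<Rightarrow> real \<Rightarrow> real \<Rightarrow> (real^'n \<Rightarrow> real) \<Rightarrow> (real^'n \<Rightarrow> real) \<Rightarrow> (real^'n \<Rightarrow> ennreal) \<Rightarrow> ennreal" where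
  "herz_nonhom_norm \<alpha> p q w1 w2 F =
    (\<Sum>\<^sub>\<infinity>k\<in>(UNIV :: nat set).
       wmeasure w1 (dyadic_ball (int k)) epowr (\<alpha> * p / real CARD('n))
         * Lq_norm q w2 (\<lambda>x. F x * indicator (annulus_nonhom k) x) epowr p) epowr (1 / p)"

definition herz_hom ::
  "real \<Rightarrow> real \<Rightarrow> real \<Rightarrow> (real^'n \<Rightarrow> real) \<Rightarrow> (real^'n \<Rightarrow> real) \<Rightarrow> (real^'n \<Rightarrow> ennreal) set" where
  "herz_hom \<alpha> p q w1 w2 = {F \<in> Lq_loc q (- {0}) w2. herz_hom_norm \<alpha> p q w1 w2 F < \<infinity>}"

definition herz_nonhom ::
  "real \<Rightarrow> real \<Rightarrow> real \<Rightarrow> (real^'n \<Rightarrow> real) \<Rightarrow> (real^'n \<Rightarrow> real) \<Rightarrow> (real^'n \<Rightarrow> ennreal) set" where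
  "herz_nonhom \<alpha> p q w1 w2 = {F \<in> Lq_loc q UNIV w2. herz_nonhom_norm \<alpha> p q w1 w2 F < \<infinity>}"

abbreviation eabs :: "(real^'n \<Rightarrow> real) \<Rightarrow> real^'n \<Rightarrow> ennreal" where
  "eabs f \<equiv> (\<lambda>x. ennreal \<bar>f x\<bar>)"

definition C_class :: "real \<Rightarrow> (real^'n \<Rightarrow> real) set" where
  "C_class \<beta> = {\<phi>. closure {x. \<phi> x \<noteq> 0} \<subseteq> cball 0 1
     \<and> (LINT x|lebesgue. \<phi> x) = 0
     \<and> (\<forall>x x'. \<bar>\<phi> x - \<phi> x'\<bar> \<le> norm (x - x') powr \<beta>)}"

definition dilate :: "real \<Rightarrow> (real^'n \<Rightarrow> real) \<Rightarrow> real^'n \<Rightarrow> real" where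
  "dilate t \<phi> x = \<phi> (x /\<^sub>R t) / t ^ CARD('n)"

definition convolution :: "(real^'n \<Rightarrow> real) \<Rightarrow> (real^'n \<Rightarrow> real) \<Rightarrow> real^'n \<Rightarrow> real" where
  "convolution f g y = (LINT z|lebesgue. f z * g (y - z))"

definition A_sup :: "real \<Rightarrow> (real^'n \<Rightarrow> real) \<Rightarrow> real^'n \<Rightarrow> real \<Rightarrow> ennreal" where
  "A_sup \<beta> f y t = (SUP \<phi>\<in>C_class \<beta>. ennreal \<bar>convolution f (dilate t \<phi>) y\<bar>)"

definition intrinsic_G :: "real \<Rightarrow> (real^'n \<Rightarrow> real) \<Rightarrow> real^'n \<Rightarrow> ennreal" where
  "intrinsic_G \<beta> f x = (\<integral>\<^sup>+t\<in>{0<..}. (A_sup \<beta> f x t)\<^sup>2 / ennreal t \<partial>lebesgue) epowr (1 / 2)"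

end

theory Submission
 imports Defs
begin

text \<open>
 The function \<open>\<G>\<^sub>\<beta>(f)\<close> is dominated by the square function of \<open>A\<^sub>\<beta>(f)\<close> over the dyadic scales \<open>t = 2\<^sup>j\<close>.
 The kernels at different scales are almost orthogonal, which gives an \<open>L\<^sup>2\<close> bound by the \<open>T T\<^sup>*\<close> method;
 the Calderon-Zygmund decomposition gives weak type \<open>(1, 1)\<close>, and a good-\<open>\<lambda>\<close> inequality against the maximal
 function, which Lerner's argument bounds on \<open>L\<^sup>q(w)\<close>, gives \<open>L\<^sup>q(w)\<close> for \<open>w \<in> A\<^sub>q\<close>. On the annulus \<open>C\<^sub>i\<close> the part of \<open>f\<close> on
 neighbouring annuli is controlled by this weighted bound, and the part on \<open>C\<^sub>k\<close>, \<open>\<bar>i - k\<bar> \<ge> 2\<close>, by the crude estimate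
 \<open>2\<^bsup>-n max(i,k)\<^esup> \<integral>\<^bsub>C\<^sub>k\<^esub> \<bar>f\<bar>\<close>. Doubling and reverse doubling of the weights together with the restrictions on \<open>\<alpha>\<close>
 turn the latter into geometric decay in \<open>\<bar>i - k\<bar>\<close>, which is summable in \<open>\<ell>\<^sup>p\<close> for every \<open>p > 0\<close>.
\<close>

text \<open>Three obstacles shape the argument. A member of a Herz space is not known to be locally
  integrable, although every kernel integral requires it; the decay that yields the norm inequality
  also sums the integrals of \<bar>f\<bar> over the annuli inside a ball, so
  \<open>herz_bound\<close> delivers both. A good-\<lambda> inequality can absorb its left side only
  if that is finite, so the weighted bounds start with finitely many scales and bounded functions of
  bounded support, with constants that depend on neither. The supremum over kernels is not linear in
  f, so an almost optimal kernel is fixed at every point before adjoints are taken. After one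
  conversion the Muckenhoupt condition is used in a single form, (\<integral>_B f)^s w(B) \<le> C
  |B|^s \<integral>_B f^s w for all f \<ge> 0. Different choices of f give the dual weight,
  doubling, reverse doubling, the loss of mass on small subsets of cubes, and the L^1 bound on an
  annulus. The lower bound on \<alpha> gives decay when f sits on a larger annulus, the upper bound
  when it sits on a smaller one.\<close>

abbreviation absf :: "('a \<Rightarrow> real) \<Rightarrow> 'a \<Rightarrow> ennreal" where
 "absf f \<equiv> \<lambda>x. ennreal \<bar>f x\<bar>"

abbreviation mass :: "('a::euclidean_space \<Rightarrow> real) \<Rightarrow> 'a set \<Rightarrow> ennreal" where
 "mass w S \<equiv> \<integral>\<^sup>+x\<in>S. ennreal (w x) \<partial>lborel"

abbreviation abs_nint :: "('a::euclidean_space \<Rightarrow> real) \<Rightarrow> 'a set \<Rightarrow> ennreal" where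
 "abs_nint f S \<equiv> \<integral>\<^sup>+x\<in>S. ennreal \<bar>f x\<bar> \<partial>lborel"

abbreviation wint :: "real \<Rightarrow> ('a::euclidean_space \<Rightarrow> real) \<Rightarrow> ('a \<Rightarrow> ennreal) \<Rightarrow> ennreal" where
 "wint q w F \<equiv> \<integral>\<^sup>+x. F x epowr q * ennreal (w x) \<partial>lborel"

abbreviation wint_on :: "'a set \<Rightarrow> real \<Rightarrow> ('a::euclidean_space \<Rightarrow> real) \<Rightarrow> ('a \<Rightarrow> ennreal) \<Rightarrow> ennreal" where
 "wint_on S q w F \<equiv> \<integral>\<^sup>+x\<in>S. F x epowr q * ennreal (w x) \<partial>lborel"

section \<open>Powers and integrals of extended nonnegative functions\<close>

lemma epowr_ennreal: "0 \<le> a \<Longrightarrow> 0 < r \<Longrightarrow> ennreal a epowr r = ennreal (a powr r)"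
 by (auto simp: epowr_def)

lemma epowr_pos_simps [simp]:
 "0 < r \<Longrightarrow> 0 epowr r = 0" "0 < r \<Longrightarrow> \<infinity> epowr r = \<infinity>" "1 epowr r = 1" "0 < r \<Longrightarrow> top epowr r = top"
 by (auto simp: epowr_def infinity_ennreal_def)

lemma epowr_one [simp]: "x epowr 1 = x"
 by (cases x) (auto simp: epowr_def)

lemma epowr_mono:
 assumes "x \<le> y" "0 \<le> r" shows "x epowr r \<le> y epowr r"
proof (cases "r = 0")
 case False
 with assms have "0 < r" by auto
 then show ?thesis using assms
  by (cases x; cases y) (auto simp: epowr_ennreal powr_mono2 top_unique)
qed (auto simp: epowr_def)

lemma epowr_mult: "0 < r \<Longrightarrow> (x * y) epowr r = x epowr r * y epowr r"
 apply (cases x; cases y)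
   apply (auto simp: epowr_ennreal powr_mult ennreal_mult[symmetric] ennreal_mult_top ennreal_top_mult)
 done

lemma epowr_epowr: "0 < r \<Longrightarrow> 0 < s \<Longrightarrow> (x epowr r) epowr s = x epowr (r * s)"
 by (cases x) (auto simp: epowr_ennreal powr_powr)

lemma epowr_add: "0 < r \<Longrightarrow> 0 < s \<Longrightarrow> x epowr (r + s) = x epowr r * x epowr s"
 by (cases x) (auto simp: epowr_ennreal powr_add ennreal_mult ennreal_top_mult)

lemma epowr_numeral: "x epowr (numeral n) = x ^ numeral n"
proof (cases x)
 case (real a)
 then show ?thesis by (cases "a = 0") (simp_all add: epowr_ennreal powr_numeral ennreal_power zero_power)
qed (simp add: top_power_ennreal)

lemma epowr_eq_top_iff: "0 < r \<Longrightarrow> x epowr r = top \<longleftrightarrow> x = top"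
 by (cases x) (auto simp: epowr_ennreal)

lemma epowr_less_top_iff: "0 < r \<Longrightarrow> x epowr r < top \<longleftrightarrow> x < top"
 using epowr_eq_top_iff[of r x] by (auto simp: less_top[symmetric])

lemma epowr_eq_0_iff: "0 < r \<Longrightarrow> x epowr r = 0 \<longleftrightarrow> x = 0"
 by (cases x) (auto simp: epowr_ennreal)

lemma epowr_le_iff:
 assumes "0 < r" shows "x epowr r \<le> y epowr r \<longleftrightarrow> x \<le> y"
proof
 assume "x epowr r \<le> y epowr r"
 from epowr_mono[OF this, of "1/r"] show "x \<le> y" using assms by (simp add: epowr_epowr)
qed (use assms epowr_mono[of x y r] in auto)

lemma epowr_le_swap:
 assumes "0 < r" shows "x epowr r \<le> y \<longleftrightarrow> x \<le> y epowr (1 / r)"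
 using epowr_le_iff[of r x "y epowr (1/r)"] assms by (simp add: epowr_epowr)

lemma measurable_epowr [measurable (raw)]:
 assumes [measurable]: "f \<in> borel_measurable M"
 shows "(\<lambda>x. f x epowr r) \<in> borel_measurable M"
 unfolding epowr_def by measurable

text \<open>Every term is at most the maximum \<open>m\<close>, so the sum is at most
  \<open>card I * m\<close>, and \<open>m epowr r\<close> is one of the terms on the right. The
  argument treats \<open>r < 1\<close> and \<open>r \<ge> 1\<close> alike.\<close>

lemma epowr_sum_le:
 assumes "finite I" "0 < r"
 shows "(\<Sum>i\<in>I. x i) epowr r \<le> ennreal (real (card I) powr r) * (\<Sum>i\<in>I. x i epowr r)"
proof (cases "I = {}")
 case False
 define m where "m = Max (x ` I)"
 from False assms have "m \<in> x ` I" unfolding m_def by (intro Max_in) auto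
 then obtain i where i: "i \<in> I" "x i = m" by auto
 have "(\<Sum>i\<in>I. x i) \<le> of_nat (card I) * m"
  by (rule sum_bounded_above) (auto simp: m_def assms)
 then have "(\<Sum>i\<in>I. x i) epowr r \<le> (of_nat (card I) * m) epowr r"
  using assms by (intro epowr_mono) auto
 also have "... = ennreal (real (card I) powr r) * m epowr r"
  using assms by (simp add: epowr_mult epowr_ennreal ennreal_of_nat_eq_real_of_nat)
 also have "... \<le> ennreal (real (card I) powr r) * (\<Sum>i\<in>I. x i epowr r)"
  using i assms by (intro mult_left_mono) (auto intro!: member_le_sum)
 finally show ?thesis .
qed (use assms in auto)

lemma epowr_add_le:
 assumes "0 < r"
 shows "(x + y) epowr r \<le> ennreal (2 powr r) * (x epowr r + y epowr r)"
 using epowr_sum_le[of "UNIV :: bool set" r "\<lambda>b. if b then x else y"] assms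
 by (simp add: UNIV_bool add.commute)

text \<open>The factors \<open>1 / p\<close> and \<open>1 / q\<close> of the sharp inequality are
  bounded by 1. This loss is the origin of the factor 2 in
  \<open>nn_integral_Hoelder\<close>.\<close>

lemma Youngs_inequality_ennreal:
 fixes x y :: ennreal
 assumes "1 < p" "1 < q" "1/p + 1/q = 1"
 shows "x * y \<le> x epowr p + y epowr q"
proof (cases "x = top \<or> y = top")
 case True
 then show ?thesis using assms by (auto simp: )
next
 case False
 then obtain a b where ab: "x = ennreal a" "y = ennreal b" "0 \<le> a" "0 \<le> b"
  by (metis enn2real_nonneg ennreal_enn2real_if)
 have "a * b \<le> a powr p / p + b powr q / q"
  using Youngs_inequality[of p q a b] ab assms by auto
 also have "... \<le> a powr p + b powr q"
  using assms by (intro add_mono) (auto simp: divide_le_eq mult_left_le mult_le_cancel_left1)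
 finally show ?thesis using ab assms
  by (simp add: epowr_ennreal ennreal_mult[symmetric] ennreal_plus[symmetric] del: ennreal_plus)
qed

text \<open>The extra factor \<open>2\<close> spares the sharp form of Young's inequality.\<close>
lemma nn_integral_Hoelder:
 fixes f g :: "'a \<Rightarrow> ennreal"
 assumes [measurable]: "f \<in> borel_measurable M" "g \<in> borel_measurable M"
  and pq: "1 < p" "1 < q" "1/p + 1/q = 1"
 shows "(\<integral>\<^sup>+x. f x * g x \<partial>M)
  \<le> 2 * ((\<integral>\<^sup>+x. f x epowr p \<partial>M) epowr (1/p) * (\<integral>\<^sup>+x. g x epowr q \<partial>M) epowr (1/q))"
proof -
 let ?A = "\<integral>\<^sup>+x. f x epowr p \<partial>M" and ?B = "\<integral>\<^sup>+x. g x epowr q \<partial>M"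
 consider "?A = 0" | "?B = 0" | "?A \<noteq> 0" "?B \<noteq> 0" "?A = top \<or> ?B = top"
  | "?A \<noteq> 0" "?B \<noteq> 0" "?A \<noteq> top" "?B \<noteq> top" by blast
 then show ?thesis
 proof cases
  case 1
  then have "AE x in M. f x epowr p = 0" by (subst (asm) nn_integral_0_iff_AE) auto
  then have "AE x in M. f x * g x = 0" using pq by (auto simp: epowr_eq_0_iff)
  then have "(\<integral>\<^sup>+x. f x * g x \<partial>M) = 0" by (subst nn_integral_0_iff_AE) auto
  then show ?thesis by simp
 next
  case 2
  then have "AE x in M. g x epowr q = 0" by (subst (asm) nn_integral_0_iff_AE) auto
  then have "AE x in M. f x * g x = 0" using pq by (auto simp: epowr_eq_0_iff)
  then have "(\<integral>\<^sup>+x. f x * g x \<partial>M) = 0" by (subst nn_integral_0_iff_AE) auto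
  then show ?thesis by simp
 next
  case 3
  then have "?A epowr (1/p) * ?B epowr (1/q) = top"
   using pq by (auto simp: ennreal_mult_eq_top_iff epowr_eq_top_iff epowr_eq_0_iff)
  then show ?thesis by (simp add: ennreal_mult_top)
 next
  case 4
  \<comment> \<open>Dividing \<open>f\<close> and \<open>g\<close> by their norms makes both
    integrals equal to 1, so the two terms of Young's inequality add up to 2.\<close>
  define a where "a = ?A epowr (1/p)"
  define b where "b = ?B epowr (1/q)"
  have ab: "a \<noteq> 0" "a \<noteq> top" "b \<noteq> 0" "b \<noteq> top" and ap: "a epowr p = ?A" and bq: "b epowr q = ?B"
   using 4 pq by (auto simp: a_def b_def epowr_epowr epowr_eq_0_iff epowr_eq_top_iff)
  have inv: "(x / c) epowr r = x epowr r / c epowr r" if "c \<noteq> 0" "c \<noteq> top" "0 < r" for x c r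
   using that
   by (cases x; cases c) (auto simp: epowr_ennreal divide_ennreal powr_divide ennreal_top_divide)
  have "(\<integral>\<^sup>+x. f x * g x \<partial>M) = (\<integral>\<^sup>+x. (a * b) * ((f x / a) * (g x / b)) \<partial>M)"
  proof (intro nn_integral_cong)
   fix x
   have "(a * b) * ((f x / a) * (g x / b)) = (f x * (a / a)) * (g x * (b / b))"
    by (simp add: divide_ennreal_def mult_ac)
   then show "f x * g x = (a * b) * ((f x / a) * (g x / b))" using ab by (simp add: ennreal_divide_self less_top)
  qed
  also have "... = (a * b) * (\<integral>\<^sup>+x. (f x / a) * (g x / b) \<partial>M)"
   by (intro nn_integral_cmult) auto
  also have "... \<le> (a * b) * (\<integral>\<^sup>+x. (f x / a) epowr p + (g x / b) epowr q \<partial>M)"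
   by (intro mult_left_mono nn_integral_mono Youngs_inequality_ennreal pq) auto
  also have "(\<integral>\<^sup>+x. (f x / a) epowr p + (g x / b) epowr q \<partial>M) = ?A / ?A + ?B / ?B"
   using ab pq by (simp add: inv nn_integral_add nn_integral_divide ap bq)
  also have "... = 2" using 4 by (simp add: ennreal_divide_self less_top)
  finally show ?thesis by (simp add: a_def b_def mult_ac)
 qed
qed

section \<open>Distribution functions and the absorption argument\<close>

lemma layer_cake_pointwise:
 assumes p: "0 < p"
 shows "(\<integral>\<^sup>+l. ennreal (p * l powr (p - 1)) * indicator {l. 0 < l \<and> ennreal l < x} l \<partial>lborel) = x epowr p"
proof -
 have fin: "(\<integral>\<^sup>+l. ennreal (p * l powr (p - 1)) * indicator {l. 0 < l \<and> l < a} l \<partial>lborel) = ennreal (a powr p)"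
  if a: "0 \<le> a" for a
 proof -
  have "((\<lambda>l. l powr (p - 1)) has_integral (a powr (p - 1 + 1) / (p - 1 + 1))) {0..a}"
   by (rule has_integral_powr_from_0) (use p a in auto)
  then have "((\<lambda>l. p * l powr (p - 1)) has_integral p * (a powr (p - 1 + 1) / (p - 1 + 1))) {0..a}"
   by (rule has_integral_mult_right)
  then have I: "((\<lambda>l. p * l powr (p - 1)) has_integral a powr p) {0..a}" using p by simp
  have eq: "(\<lambda>l. indicator {0..a} l * (p * l powr (p - 1)))
    = (\<lambda>l. if l \<in> {0..a} then p * l powr (p - 1) else 0)"
   by (auto simp: indicator_def)
  have "((\<lambda>l. indicator {0..a} l * (p * l powr (p - 1))) has_integral a powr p) UNIV"
   unfolding eq has_integral_restrict_UNIV by (rule I)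
  from nn_integral_has_integral_lborel[OF _ _ this]
  have "(\<integral>\<^sup>+l. indicator {0..a} l * (p * l powr (p - 1)) \<partial>lborel) = ennreal (a powr p)"
   using p by auto
  moreover have "(\<integral>\<^sup>+l. ennreal (p * l powr (p - 1)) * indicator {l. 0 < l \<and> l < a} l \<partial>lborel)
    = (\<integral>\<^sup>+l. indicator {0..a} l * (p * l powr (p - 1)) \<partial>lborel)"
   by (intro nn_integral_cong_AE, use AE_lborel_singleton[of a] AE_lborel_singleton[of 0] in eventually_elim)
     (auto simp: indicator_def)
  ultimately show ?thesis by simp
 qed
 show ?thesis
 proof (cases x)
  case (real a)
  then have "{l. 0 < l \<and> ennreal l < x} = {l. 0 < l \<and> l < a}" by (auto simp: ennreal_less_iff)
  then show ?thesis using fin[of a] real p by (simp add: epowr_ennreal)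
 next
  case top
  let ?I = "\<integral>\<^sup>+l. ennreal (p * l powr (p - 1)) * indicator {l. 0 < l \<and> ennreal l < x} l \<partial>lborel"
  \<comment> \<open>For \<open>x = \<infinity>\<close> the part of the integral below
    \<open>real n powr (1/p)\<close> already equals \<open>n\<close>, so the integral exceeds every
    natural number.\<close>
  have "ennreal (real n) \<le> ?I" for n :: nat
  proof -
   have "ennreal (real n) = ennreal ((real n powr (1/p)) powr p)" using p by (simp add: powr_powr)
   also have "... \<le> ?I"
    by (subst fin[symmetric], simp, intro nn_integral_mono) (auto simp: indicator_def top)
   finally show ?thesis .
  qed
  then have "?I = top" by (metis ennreal_of_nat_eq_real_of_nat ennreal_Ex_less_of_nat less_top not_le)
  then show ?thesis using top p by simp
 qed
qed

text \<open>Fubini turns the pointwise formula into an integral of the distribution function, the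
  form into which weak type and good-\<lambda> estimates can be inserted.\<close>

lemma (in sigma_finite_measure) layer_cake:
 fixes F :: "'a \<Rightarrow> ennreal"
 assumes [measurable]: "F \<in> borel_measurable M" and p: "0 < p"
 shows "(\<integral>\<^sup>+x. F x epowr p \<partial>M)
  = (\<integral>\<^sup>+l. ennreal (p * l powr (p - 1)) * (emeasure M {x\<in>space M. ennreal l < F x} * indicator {0<..} l) \<partial>lborel)"
proof -
 interpret L: pair_sigma_finite M "lborel :: real measure" ..
 have "(\<integral>\<^sup>+x. F x epowr p \<partial>M)
   = (\<integral>\<^sup>+x. (\<integral>\<^sup>+l. ennreal (p * l powr (p - 1)) * indicator {l. 0 < l \<and> ennreal l < F x} l \<partial>lborel) \<partial>M)"
  by (intro nn_integral_cong) (rule layer_cake_pointwise[OF p, symmetric])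
 also have "... = (\<integral>\<^sup>+x. (\<integral>\<^sup>+l. ennreal (p * l powr (p - 1)) * (if 0 < l \<and> ennreal l < F x then 1 else 0) \<partial>lborel) \<partial>M)"
  by (intro nn_integral_cong) (auto simp: indicator_def)
 also have "... = (\<integral>\<^sup>+l. (\<integral>\<^sup>+x. ennreal (p * l powr (p - 1)) * (if 0 < l \<and> ennreal l < F x then 1 else 0) \<partial>M) \<partial>lborel)"
  by (rule L.Fubini'[symmetric]) measurable
 also have "... = (\<integral>\<^sup>+l. ennreal (p * l powr (p - 1)) * (emeasure M {x\<in>space M. ennreal l < F x} * indicator {0<..} l) \<partial>lborel)"
 proof (intro nn_integral_cong)
  fix l :: real
  have "(\<integral>\<^sup>+x. ennreal (p * l powr (p - 1)) * (if 0 < l \<and> ennreal l < F x then 1 else 0) \<partial>M)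
   = (\<integral>\<^sup>+x. (ennreal (p * l powr (p - 1)) * indicator {0<..} l) * indicator {x\<in>space M. ennreal l < F x} x \<partial>M)"
   by (intro nn_integral_cong) (auto simp: indicator_def)
  also have "... = (ennreal (p * l powr (p - 1)) * indicator {0<..} l) * emeasure M {x\<in>space M. ennreal l < F x}"
   by (subst nn_integral_cmult_indicator) auto
  finally show "(\<integral>\<^sup>+x. ennreal (p * l powr (p - 1)) * (if 0 < l \<and> ennreal l < F x then 1 else 0) \<partial>M)
   = ennreal (p * l powr (p - 1)) * (emeasure M {x\<in>space M. ennreal l < F x} * indicator {0<..} l)"
   by (simp add: mult_ac)
 qed
 finally show ?thesis .
qed

text \<open>Integrating the hypothesis against \<open>p * l powr (p - 1)\<close> gives
  \<open>(1 / \<rho>) powr p * I \<le> \<epsilon> * I + h\<close>, with \<open>I\<close> and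
  \<open>h\<close> the integrals of the powers of \<open>F\<close> and \<open>H\<close>. Since
  \<open>\<epsilon> * \<rho> powr p < 1\<close>, the term with \<open>I\<close> on the right is
  absorbed by the left side; the subtraction is legitimate because \<open>I\<close> is
  finite.\<close>

lemma (in sigma_finite_measure) good_lambda:
 fixes F H :: "'a \<Rightarrow> ennreal"
 assumes [measurable]: "F \<in> borel_measurable M" "H \<in> borel_measurable M"
  and p: "0 < p" and rho: "1 < \<rho>" and eps: "0 \<le> \<epsilon>" "\<epsilon> * \<rho> powr p < 1"
  and fin: "(\<integral>\<^sup>+x. F x epowr p \<partial>M) < top"
  and le: "\<And>l. 0 < l \<Longrightarrow> emeasure M {x\<in>space M. ennreal (\<rho> * l) < F x}
    \<le> ennreal \<epsilon> * emeasure M {x\<in>space M. ennreal l < F x} + emeasure M {x\<in>space M. ennreal l < H x}"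
 shows "(\<integral>\<^sup>+x. F x epowr p \<partial>M) \<le> ennreal (\<rho> powr p / (1 - \<epsilon> * \<rho> powr p)) * (\<integral>\<^sup>+x. H x epowr p \<partial>M)"
proof -
 define I where "I = (\<integral>\<^sup>+x. F x epowr p \<partial>M)"
 define h where "h = (\<integral>\<^sup>+x. H x epowr p \<partial>M)"
 define \<kappa> where "\<kappa> l = ennreal (p * l powr (p - 1))" for l
 have [measurable]: "\<kappa> \<in> borel_measurable borel" unfolding \<kappa>_def by measurable
 have [measurable]: "(\<lambda>l. emeasure M {x\<in>space M. ennreal l < G x}) \<in> borel_measurable borel"
  if [measurable]: "G \<in> borel_measurable M" for G
 proof -
  have "(\<lambda>l. emeasure M (Pair l -` {z\<in>space (borel \<Otimes>\<^sub>M M). ennreal (fst z) < G (snd z)})) \<in> borel_measurable borel"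
   by (rule measurable_emeasure_Pair) measurable
  moreover have "Pair l -` {z\<in>space (borel \<Otimes>\<^sub>M M). ennreal (fst z) < G (snd z)} = {x\<in>space M. ennreal l < G x}" for l
   by (auto simp: space_pair_measure)
  ultimately show ?thesis by simp
 qed
 have scale: "ennreal l < ennreal (1/\<rho>) * y \<longleftrightarrow> ennreal (\<rho> * l) < y" if "0 < l" for l y
  using rho that by (cases y) (auto simp: ennreal_mult[symmetric] ennreal_mult_top field_simps ennreal_less_iff)
 \<comment> \<open>The layer cake formula is applied to \<open>F\<close> divided by
   \<open>\<rho>\<close>, whose superlevel set at height \<open>l\<close> is that of
   \<open>F\<close> at height \<open>\<rho> * l\<close>.\<close>
 have "ennreal ((1/\<rho>) powr p) * I = (\<integral>\<^sup>+x. (ennreal (1/\<rho>) * F x) epowr p \<partial>M)"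
  unfolding I_def using rho p by (simp add: epowr_mult nn_integral_cmult epowr_ennreal)
 also have "... = (\<integral>\<^sup>+l. \<kappa> l * (emeasure M {x\<in>space M. ennreal l < ennreal (1/\<rho>) * F x} * indicator {0<..} l) \<partial>lborel)"
  unfolding \<kappa>_def by (intro layer_cake p) measurable
 also have "... \<le> (\<integral>\<^sup>+l. ennreal \<epsilon> * (\<kappa> l * (emeasure M {x\<in>space M. ennreal l < F x} * indicator {0<..} l))
   + \<kappa> l * (emeasure M {x\<in>space M. ennreal l < H x} * indicator {0<..} l) \<partial>lborel)"
 proof (intro nn_integral_mono)
  fix l :: real
  show "\<kappa> l * (emeasure M {x\<in>space M. ennreal l < ennreal (1/\<rho>) * F x} * indicator {0<..} l)
   \<le> ennreal \<epsilon> * (\<kappa> l * (emeasure M {x\<in>space M. ennreal l < F x} * indicator {0<..} l))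
   + \<kappa> l * (emeasure M {x\<in>space M. ennreal l < H x} * indicator {0<..} l)"
  proof (cases "0 < l")
   case True
   have "\<kappa> l * emeasure M {x\<in>space M. ennreal (\<rho> * l) < F x}
    \<le> \<kappa> l * (ennreal \<epsilon> * emeasure M {x\<in>space M. ennreal l < F x} + emeasure M {x\<in>space M. ennreal l < H x})"
    by (intro mult_left_mono le True) auto
   with True show ?thesis by (simp add: scale distrib_left mult.left_commute)
  qed auto
 qed
 also have "... = ennreal \<epsilon> * I + h"
  unfolding I_def h_def layer_cake[OF assms(1) p] layer_cake[OF assms(2) p] \<kappa>_def[symmetric]
  by (subst nn_integral_add) (auto simp: nn_integral_cmult)
 finally have main: "ennreal ((1/\<rho>) powr p) * I \<le> ennreal \<epsilon> * I + h" .
 show ?thesis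
 proof (cases "h = top")
  case True
  then show ?thesis using rho eps by (simp add: h_def ennreal_mult_top)
 next
  case False
  then obtain b where b: "h = ennreal b" "0 \<le> b" by (cases h) auto
  obtain a where a: "I = ennreal a" "0 \<le> a" using fin by (cases I) (auto simp: I_def)
  from main have "(1/\<rho>) powr p * a \<le> \<epsilon> * a + b"
   using a b eps by (simp add: ennreal_mult[symmetric] ennreal_plus[symmetric] del: ennreal_plus)
  then have "\<rho> powr p * ((1/\<rho>) powr p * a) \<le> \<rho> powr p * (\<epsilon> * a + b)"
   by (intro mult_left_mono) auto
  moreover have "\<rho> powr p * ((1/\<rho>) powr p * a) = a" using rho by (simp add: powr_divide)
  ultimately have "a \<le> \<rho> powr p * (\<epsilon> * a + b)" by metis
  then have "(1 - \<epsilon> * \<rho> powr p) * a \<le> \<rho> powr p * b"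
   by (simp add: algebra_simps)
  then have "a \<le> \<rho> powr p / (1 - \<epsilon> * \<rho> powr p) * b"
   using eps by (simp add: field_simps)
  then show ?thesis using a b eps
   unfolding I_def[symmetric] h_def[symmetric] by (simp add: ennreal_mult[symmetric])
 qed
qed

section \<open>The maximal function\<close>

lemma sets_borel_balls [measurable]:
 fixes c :: "'a::metric_space"
 shows "ball c r \<in> sets borel" "cball c r \<in> sets borel"
 by auto

lemma nn_integral_count_space_indicator_disjoint:
 assumes disj: "disjoint_family_on X I"
 shows "(\<integral>\<^sup>+i. indicator (X i) x \<partial>count_space I) = (indicator (\<Union>i\<in>I. X i) x :: ennreal)"
proof (cases "x \<in> (\<Union>i\<in>I. X i)")
 case True
 then obtain j where j: "x \<in> X j" "j \<in> I" by auto
 with disj have "\<And>i. i \<in> I \<Longrightarrow> indicator (X i) x = (indicator {j} i::ennreal)"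
  by (auto simp: disjoint_family_on_def split: split_indicator)
 with True j show ?thesis by (simp cong: nn_integral_cong_simp)
qed (auto simp: nn_integral_0_iff_AE)

text \<open>Sums over countable families are written as integrals over \<open>count_space\<close>:
  exchanging a sum with an integral becomes an instance of Fubini, and families of cubes or balls
  need no enumeration.\<close>

lemma nn_integral_disjoint_family:
 assumes "countable I" and "disjoint_family_on X I"
  and [measurable]: "\<And>i. i \<in> I \<Longrightarrow> X i \<in> sets M" "f \<in> borel_measurable M"
 shows "(\<integral>\<^sup>+i. (\<integral>\<^sup>+x\<in>X i. f x \<partial>M) \<partial>count_space I) = (\<integral>\<^sup>+x\<in>(\<Union>i\<in>I. X i). f x \<partial>M)"
 by (subst nn_integral_count_space_nn_integral[symmetric])
   (auto simp: assms nn_integral_cmult nn_integral_count_space_indicator_disjoint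
    intro!: nn_integral_cong)

text \<open>The supremum runs over all balls that contain \<open>x\<close>, not only those centred
  at \<open>x\<close>. Superlevel sets are then unions of balls, hence open, for every
  \<open>f\<close> and every measure.\<close>

definition max_fun :: "'a::euclidean_space measure \<Rightarrow> ('a \<Rightarrow> ennreal) \<Rightarrow> 'a \<Rightarrow> ennreal" where
 "max_fun M f x = (SUP (c, r)\<in>{(c, r). x \<in> ball c r}. (\<integral>\<^sup>+y\<in>ball c r. f y \<partial>M) / emeasure M (ball c r))"

text \<open>The factor 5 is the enlargement in Vitali's covering lemma. Positive finite mass of
  balls lets averages be multiplied out in \<open>ennreal\<close>.\<close>

definition doubling_measure :: "'a::euclidean_space measure \<Rightarrow> real \<Rightarrow> bool" where
 "doubling_measure M D \<longleftrightarrow> sets M = sets borel \<and> 0 \<le> D \<and>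
  (\<forall>c r. 0 < r \<longrightarrow> 0 < emeasure M (ball c r) \<and> emeasure M (ball c r) < top \<and>
   emeasure M (ball c (5 * r)) \<le> ennreal D * emeasure M (ball c r))"

lemma less_max_fun_iff:
 "l < max_fun M f x \<longleftrightarrow> (\<exists>c r. x \<in> ball c r \<and> l < (\<integral>\<^sup>+y\<in>ball c r. f y \<partial>M) / emeasure M (ball c r))"
 unfolding max_fun_def by (auto simp: less_SUP_iff)

lemma open_less_max_fun: "open {x. l < max_fun M f x}"
proof -
 have "{x. l < max_fun M f x}
  = (\<Union>(c, r)\<in>{(c, r). l < (\<integral>\<^sup>+y\<in>ball c r. f y \<partial>M) / emeasure M (ball c r)}. ball c r)"
  by (auto simp: less_max_fun_iff simp del: mem_ball)
 then show ?thesis by auto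
qed

lemma borel_measurable_max_fun [measurable]: "max_fun M f \<in> borel_measurable borel"
 by (rule borel_measurableI_greater) (auto intro!: borel_open open_less_max_fun)

lemma max_fun_upper:
 assumes "doubling_measure M D" "x \<in> ball c r"
 shows "(\<integral>\<^sup>+y\<in>ball c r. f y \<partial>M) \<le> max_fun M f x * emeasure M (ball c r)"
proof -
 have r: "0 < r" using assms(2) by (metis empty_iff ball_empty not_le)
 have *: "(\<integral>\<^sup>+y\<in>ball c r. f y \<partial>M) / emeasure M (ball c r) \<le> max_fun M f x"
  unfolding max_fun_def using assms by (auto intro!: SUP_upper2[of "(c,r)"])
 have "(\<integral>\<^sup>+y\<in>ball c r. f y \<partial>M) = (\<integral>\<^sup>+y\<in>ball c r. f y \<partial>M) / emeasure M (ball c r) * emeasure M (ball c r)"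
  using assms(1) r by (auto simp: doubling_measure_def ennreal_divide_times less_top
    ennreal_times_divide mult_divide_eq_ennreal order.strict_iff_not[of 0])
 also have "... \<le> max_fun M f x * emeasure M (ball c r)"
  by (intro mult_right_mono *) auto
 finally show ?thesis .
qed

lemma sigma_finite_doubling:
 assumes "doubling_measure M D" shows "sigma_finite_measure M"
proof
 have s: "sets M = sets borel" using assms by (simp add: doubling_measure_def)
 then have sp: "space M = UNIV" using sets_eq_imp_space_eq by fastforce
 have "\<exists>n::nat. x \<in> ball 0 (Suc n)" for x :: 'a
  using reals_Archimedean2[of "norm x"] by (metis lessI mem_ball_0 of_nat_less_iff order.strict_trans)
 then have "(\<Union>n::nat. ball (0::'a) (Suc n)) = UNIV" by blast
 then show "\<exists>A. countable A \<and> A \<subseteq> sets M \<and> \<Union> A = space M \<and> (\<forall>a\<in>A. emeasure M a \<noteq> \<infinity>)"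
  using assms s sp
  by (intro exI[of _ "range (\<lambda>n::nat. ball 0 (Suc n))"]) (auto simp: doubling_measure_def less_top[symmetric])
qed

text \<open>Vitali's lemma picks disjoint balls with large averages whose five-fold enlargements
  cover the superlevel set; doubling pays for the enlargement, and disjointness adds up the
  integrals. The covering lemma asks for bounded radii, hence the sets \<open>S R\<close>, which
  exhaust the superlevel set as \<open>R\<close> grows.\<close>

lemma max_fun_weak_type:
 assumes dbl: "doubling_measure M D" and f [measurable]: "f \<in> borel_measurable borel"
 shows "l * emeasure M {x. l < max_fun M f x} \<le> ennreal D * (\<integral>\<^sup>+x. f x \<partial>M)"
proof -
 have s [measurable_cong]: "sets M = sets borel" using dbl by (simp add: doubling_measure_def)
 have ind_ball: "indicator (ball c r) \<in> borel_measurable M" for c r by measurable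
 define K where "K R = {(c, r). 0 < r \<and> r \<le> R \<and> l < (\<integral>\<^sup>+y\<in>ball c r. f y \<partial>M) / emeasure M (ball c r)}" for R
 define S where "S R = (\<Union>(c, r)\<in>K R. ball c r)" for R
 have S_open: "open (S R)" for R unfolding S_def by auto
 have [measurable]: "S R \<in> sets borel" for R using S_open by auto
 have trunc: "l * emeasure M (S R) \<le> ennreal D * (\<integral>\<^sup>+x. f x \<partial>M)" for R
 proof -
  obtain C where C: "countable C" "C \<subseteq> K R"
   and disj: "pairwise (\<lambda>i j. disjnt (ball (fst i) (snd i)) (ball (fst j) (snd j))) C"
   and cov: "S R \<subseteq> (\<Union>i\<in>C. ball (fst i) (5 * snd i))"
   by (rule Vitali_covering_lemma_balls[where S="S R" and K="K R" and a=fst and r=snd and B=R])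
     (auto simp: S_def K_def case_prod_beta simp del: mem_ball)
  have df: "disjoint_family_on (\<lambda>i. ball (fst i) (snd i)) C"
   using disj by (auto simp: disjoint_family_on_def pairwise_def disjnt_def)
  have "l * emeasure M (S R) \<le> l * (\<integral>\<^sup>+x. (\<integral>\<^sup>+i. indicator (ball (fst i) (5 * snd i)) x \<partial>count_space C) \<partial>M)"
  proof (intro mult_left_mono)
   have "emeasure M (S R) = (\<integral>\<^sup>+x. indicator (S R) x \<partial>M)" by simp
   also have "... \<le> (\<integral>\<^sup>+x. (\<integral>\<^sup>+i. indicator (ball (fst i) (5 * snd i)) x \<partial>count_space C) \<partial>M)"
   proof (intro nn_integral_mono)
    fix x
    show "indicator (S R) x \<le> (\<integral>\<^sup>+i. indicator (ball (fst i) (5 * snd i)) x \<partial>count_space C)"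
    proof (cases "x \<in> S R")
     case True
     then obtain i where i: "i \<in> C" "x \<in> ball (fst i) (5 * snd i)" using cov by auto
     have "(1::ennreal) = (\<integral>\<^sup>+j. indicator {i} j \<partial>count_space C)" using i by simp
     also have "... \<le> (\<integral>\<^sup>+i. indicator (ball (fst i) (5 * snd i)) x \<partial>count_space C)"
      using i by (intro nn_integral_mono) (auto simp: indicator_def)
     finally show ?thesis using True by simp
    qed auto
   qed
   finally show "emeasure M (S R) \<le> (\<integral>\<^sup>+x. (\<integral>\<^sup>+i. indicator (ball (fst i) (5 * snd i)) x \<partial>count_space C) \<partial>M)" .
  qed auto
  also have "(\<integral>\<^sup>+x. (\<integral>\<^sup>+i. indicator (ball (fst i) (5 * snd i)) x \<partial>count_space C) \<partial>M)
   = (\<integral>\<^sup>+i. emeasure M (ball (fst i) (5 * snd i)) \<partial>count_space C)"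
   using ind_ball by (subst nn_integral_count_space_nn_integral) (auto simp: C(1) s)
  also have "l * ... = (\<integral>\<^sup>+i. l * emeasure M (ball (fst i) (5 * snd i)) \<partial>count_space C)"
   by (rule nn_integral_cmult[symmetric]) auto
  also have "... \<le> (\<integral>\<^sup>+i. ennreal D * (\<integral>\<^sup>+y\<in>ball (fst i) (snd i). f y \<partial>M) \<partial>count_space C)"
  proof (intro nn_integral_mono)
   fix i assume "i \<in> space (count_space C)"
   then have "i \<in> K R" using C by auto
   then have i: "0 < snd i" "l < (\<integral>\<^sup>+y\<in>ball (fst i) (snd i). f y \<partial>M) / emeasure M (ball (fst i) (snd i))"
    by (auto simp: K_def)
   let ?b = "emeasure M (ball (fst i) (snd i))"
   have b: "?b \<noteq> 0" "?b \<noteq> top" "emeasure M (ball (fst i) (5 * snd i)) \<le> ennreal D * ?b"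
    using dbl i(1) by (auto simp: doubling_measure_def less_top[symmetric] order.strict_iff_not[of 0])
   have "l * emeasure M (ball (fst i) (5 * snd i)) \<le> l * (ennreal D * ?b)"
    by (intro mult_left_mono b) auto
   also have "... = ennreal D * (l * ?b)" by (simp add: mult_ac)
   also have "... \<le> ennreal D * ((\<integral>\<^sup>+y\<in>ball (fst i) (snd i). f y \<partial>M) / ?b * ?b)"
    using i(2) by (intro mult_left_mono mult_right_mono) auto
   also have "(\<integral>\<^sup>+y\<in>ball (fst i) (snd i). f y \<partial>M) / ?b * ?b = (\<integral>\<^sup>+y\<in>ball (fst i) (snd i). f y \<partial>M)"
    using b by (simp add: ennreal_divide_times ennreal_divide_self less_top)
   finally show "l * emeasure M (ball (fst i) (5 * snd i)) \<le> ennreal D * (\<integral>\<^sup>+y\<in>ball (fst i) (snd i). f y \<partial>M)" .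
  qed
  also have "... = ennreal D * (\<integral>\<^sup>+x\<in>(\<Union>i\<in>C. ball (fst i) (snd i)). f x \<partial>M)"
   by (subst nn_integral_cmult, simp, subst nn_integral_disjoint_family)
     (auto simp: C df s)
  also have "... \<le> ennreal D * (\<integral>\<^sup>+x. f x \<partial>M)"
   by (intro mult_left_mono nn_integral_mono) (auto simp: indicator_def)
  finally show ?thesis .
 qed
 have rS: "range (\<lambda>n::nat. S n) \<subseteq> sets M" by (auto simp: s intro!: borel_open S_open)
 have inc: "incseq (\<lambda>n::nat. S n)"
  by (auto simp: incseq_def S_def K_def intro: order_trans)
 have "{x. l < max_fun M f x} = (\<Union>n::nat. S n)"
 proof (intro set_eqI iffI)
  fix x assume "x \<in> {x. l < max_fun M f x}"
  then obtain c r where cr: "x \<in> ball c r" "l < (\<integral>\<^sup>+y\<in>ball c r. f y \<partial>M) / emeasure M (ball c r)"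
   by (auto simp: less_max_fun_iff)
  then have "0 < r" by (metis empty_iff ball_empty not_le)
  moreover obtain n :: nat where "r \<le> n" using real_arch_simple by blast
  ultimately show "x \<in> (\<Union>n::nat. S n)" using cr by (auto simp: S_def K_def)
 qed (auto simp: S_def K_def less_max_fun_iff)
 then have "emeasure M {x. l < max_fun M f x} = (SUP n::nat. emeasure M (S n))"
  using SUP_emeasure_incseq[OF rS inc] by simp
 then show ?thesis using trunc by (simp add: SUP_mult_left_ennreal SUP_le_iff)
qed

text \<open>Marcinkiewicz interpolation between the weak type estimate and the trivial \<open>L\<^sup>\<infinity>\<close> bound.\<close>
lemma max_fun_strong_type:
 assumes dbl: "doubling_measure M D" and f [measurable]: "f \<in> borel_measurable borel" and p: "1 < p"
 shows "(\<integral>\<^sup>+x. max_fun M f x epowr p \<partial>M)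
   \<le> ennreal (D * p * 2 powr p / (p - 1)) * (\<integral>\<^sup>+x. f x epowr p \<partial>M)"
proof -
 have s [measurable_cong]: "sets M = sets borel" and D: "0 \<le> D" using dbl by (auto simp: doubling_measure_def)
 then have sp: "space M = UNIV" using sets_eq_imp_space_eq by fastforce
 interpret sigma_finite_measure M by (rule sigma_finite_doubling[OF dbl])
 interpret L: pair_sigma_finite M "lborel :: real measure" ..
 \<comment> \<open>At height \<open>l\<close> only the part \<open>g\<close> of \<open>f\<close>
   above \<open>l / 2\<close> matters: the rest contributes at most \<open>l / 2\<close> to every
   average. So the weak type estimate is applied to \<open>g\<close> at height
   \<open>l / 2\<close>.\<close>
 have level: "emeasure M {x. ennreal l < max_fun M f x}
   \<le> ennreal (2 * D / l) * (\<integral>\<^sup>+x. f x * indicator {x. ennreal l < 2 * f x} x \<partial>M)" if l: "0 < l" for l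
 proof -
  define g where "g x = f x * indicator {x. ennreal l < 2 * f x} x" for x
  have [measurable]: "g \<in> borel_measurable borel" unfolding g_def by measurable
  have f_le: "f x \<le> g x + ennreal (l/2)" for x
  proof (cases "ennreal l < 2 * f x")
   case False
   then have "2 * f x \<le> 2 * ennreal (l / 2)" using l
    by (simp add: not_less ennreal_mult[symmetric] flip: ennreal_numeral)
   then have "f x \<le> ennreal (l/2)"
    by (subst (asm) ennreal_mult_le_mult_iff) auto
   then show ?thesis by (simp add: add_increasing)
  qed (simp add: g_def)
  have sub: "{x. ennreal l < max_fun M f x} \<subseteq> {x. ennreal (l/2) < max_fun M g x}"
  proof safe
   fix x assume "ennreal l < max_fun M f x"
   then obtain c r where cr: "x \<in> ball c r" "ennreal l < (\<integral>\<^sup>+y\<in>ball c r. f y \<partial>M) / emeasure M (ball c r)"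
    by (auto simp: less_max_fun_iff)
   then have r: "0 < r" by (metis empty_iff ball_empty not_le)
   let ?b = "emeasure M (ball c r)"
   have b: "?b \<noteq> 0" "?b \<noteq> top"
    using dbl r by (auto simp: doubling_measure_def less_top[symmetric] order.strict_iff_not[of 0])
   have "(\<integral>\<^sup>+y\<in>ball c r. f y \<partial>M) \<le> (\<integral>\<^sup>+y. g y * indicator (ball c r) y + ennreal (l/2) * indicator (ball c r) y \<partial>M)"
    using f_le by (intro nn_integral_mono) (auto simp: indicator_def)
   also have "... = (\<integral>\<^sup>+y\<in>ball c r. g y \<partial>M) + ennreal (l/2) * ?b"
    by (subst nn_integral_add, measurable, subst nn_integral_cmult_indicator) (auto simp: s)
   finally have "(\<integral>\<^sup>+y\<in>ball c r. f y \<partial>M) / ?b \<le> ((\<integral>\<^sup>+y\<in>ball c r. g y \<partial>M) + ennreal (l/2) * ?b) / ?b"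
    by (rule divide_right_mono_ennreal)
   also have "... = (\<integral>\<^sup>+y\<in>ball c r. g y \<partial>M) / ?b + ennreal (l/2)"
    using b by (simp add: add_divide_distrib_ennreal mult_divide_eq_ennreal)
   finally have "ennreal l < (\<integral>\<^sup>+y\<in>ball c r. g y \<partial>M) / ?b + ennreal (l/2)"
    using cr(2) by order
   moreover have "ennreal l = ennreal (l/2) + ennreal (l/2)"
    using l by (simp flip: ennreal_plus)
   ultimately have "ennreal (l/2) < (\<integral>\<^sup>+y\<in>ball c r. g y \<partial>M) / ?b"
    by (metis add_right_mono linorder_not_le)
   then show "ennreal (l/2) < max_fun M g x" using cr(1) by (auto simp: less_max_fun_iff)
  qed
  have "ennreal (l/2) * emeasure M {x. ennreal (l/2) < max_fun M g x} \<le> ennreal D * (\<integral>\<^sup>+x. g x \<partial>M)"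
   by (rule max_fun_weak_type[OF dbl]) simp
  then have "ennreal (2/l) * (ennreal (l/2) * emeasure M {x. ennreal (l/2) < max_fun M g x})
    \<le> ennreal (2/l) * (ennreal D * (\<integral>\<^sup>+x. g x \<partial>M))"
   by (intro mult_left_mono) auto
  then have "emeasure M {x. ennreal (l/2) < max_fun M g x} \<le> ennreal (2 * D / l) * (\<integral>\<^sup>+x. g x \<partial>M)"
   using l D by (simp add: mult.assoc[symmetric] ennreal_mult[symmetric])
  moreover have "emeasure M {x. ennreal l < max_fun M f x} \<le> emeasure M {x. ennreal (l/2) < max_fun M g x}"
   using sub open_less_max_fun[of "ennreal (l/2)" M g] s by (intro emeasure_mono) auto
  ultimately show ?thesis unfolding g_def by order
 qed
 have "(\<integral>\<^sup>+x. max_fun M f x epowr p \<partial>M)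
  = (\<integral>\<^sup>+l. ennreal (p * l powr (p - 1)) * (emeasure M {x\<in>space M. ennreal l < max_fun M f x} * indicator {0<..} l) \<partial>lborel)"
  by (rule layer_cake) (use p s in auto)
 also have "... \<le> (\<integral>\<^sup>+l. (\<integral>\<^sup>+x. ennreal (2 * D * p / (p - 1)) * (f x * (ennreal ((p - 1) * l powr (p - 1 - 1)) *
    (if 0 < l \<and> ennreal l < 2 * f x then 1 else 0))) \<partial>M) \<partial>lborel)"
 proof (intro nn_integral_mono)
  fix l :: real
  show "ennreal (p * l powr (p - 1)) * (emeasure M {x\<in>space M. ennreal l < max_fun M f x} * indicator {0<..} l)
   \<le> (\<integral>\<^sup>+x. ennreal (2 * D * p / (p - 1)) * (f x * (ennreal ((p - 1) * l powr (p - 1 - 1)) *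
    (if 0 < l \<and> ennreal l < 2 * f x then 1 else 0))) \<partial>M)"
  proof (cases "0 < l")
   case True
   have "ennreal (p * l powr (p - 1)) * emeasure M {x. ennreal l < max_fun M f x}
    \<le> ennreal (p * l powr (p - 1)) * (ennreal (2 * D / l) * (\<integral>\<^sup>+x. f x * indicator {x. ennreal l < 2 * f x} x \<partial>M))"
    by (intro mult_left_mono level True) auto
   also have "... = ennreal (p * l powr (p - 1) * (2 * D / l)) * (\<integral>\<^sup>+x. f x * indicator {x. ennreal l < 2 * f x} x \<partial>M)"
    using p D True by (simp add: mult.assoc[symmetric] ennreal_mult[symmetric])
   also have "p * l powr (p - 1) * (2 * D / l) = (2 * D * p / (p - 1)) * ((p - 1) * l powr (p - 1 - 1))"
   proof -
    have "l powr (p - 1) = l * l powr (p - 1 - 1)"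
     using True powr_mult_base[of l "p - 1 - 1"] by simp
    then show ?thesis using p True by simp
   qed
   also have "ennreal ... * (\<integral>\<^sup>+x. f x * indicator {x. ennreal l < 2 * f x} x \<partial>M)
    = (\<integral>\<^sup>+x. ennreal ((2 * D * p / (p - 1)) * ((p - 1) * l powr (p - 1 - 1))) * (f x * indicator {x. ennreal l < 2 * f x} x) \<partial>M)"
    by (rule nn_integral_cmult[symmetric]) measurable
   also have "... = (\<integral>\<^sup>+x. ennreal (2 * D * p / (p - 1)) * (f x * (ennreal ((p - 1) * l powr (p - 1 - 1)) *
    (if 0 < l \<and> ennreal l < 2 * f x then 1 else 0))) \<partial>M)"
    using p D True by (intro nn_integral_cong) (subst ennreal_mult, auto simp: indicator_def mult_ac)
   finally show ?thesis using True by (simp add: sp)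
  qed auto
 qed
 also have "... = (\<integral>\<^sup>+x. (\<integral>\<^sup>+l. ennreal (2 * D * p / (p - 1)) * (f x * (ennreal ((p - 1) * l powr (p - 1 - 1)) *
    (if 0 < l \<and> ennreal l < 2 * f x then 1 else 0))) \<partial>lborel) \<partial>M)"
  by (rule L.Fubini') measurable
 also have "... = (\<integral>\<^sup>+x. ennreal (D * p * 2 powr p / (p - 1)) * f x epowr p \<partial>M)"
 proof (intro nn_integral_cong)
  fix x
  have "(\<integral>\<^sup>+l. ennreal (2 * D * p / (p - 1)) * (f x * (ennreal ((p - 1) * l powr (p - 1 - 1)) *
    (if 0 < l \<and> ennreal l < 2 * f x then 1 else 0))) \<partial>lborel)
   = ennreal (2 * D * p / (p - 1)) * (f x * (\<integral>\<^sup>+l. ennreal ((p - 1) * l powr (p - 1 - 1)) *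
    indicator {l. 0 < l \<and> ennreal l < 2 * f x} l \<partial>lborel))"
   by (subst nn_integral_cmult[symmetric], measurable, subst nn_integral_cmult[symmetric], measurable)
     (auto intro!: nn_integral_cong simp: indicator_def)
  \<comment> \<open>The weak type bound has consumed one power of \<open>l\<close>, so the integral
    in \<open>l\<close> is a layer cake formula with exponent \<open>p - 1\<close>, positive by
    \<open>1 < p\<close>. The missing power of \<open>f x\<close> is already in the
    integrand.\<close>
  also have "... = ennreal (2 * D * p / (p - 1)) * (f x * (2 * f x) epowr (p - 1))"
   by (subst layer_cake_pointwise) (use p in auto)
  also have "... = ennreal (2 * D * p / (p - 1)) * (ennreal (2 powr (p - 1)) * (f x epowr 1 * f x epowr (p - 1)))"
   using p epowr_ennreal[of 2 "p-1"] by (simp add: epowr_mult mult_ac)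
  also have "f x epowr 1 * f x epowr (p - 1) = f x epowr p"
   using p by (subst epowr_add[symmetric]) auto
  also have "ennreal (2 * D * p / (p - 1)) * (ennreal (2 powr (p - 1)) * f x epowr p)
   = ennreal (D * p * 2 powr p / (p - 1)) * f x epowr p"
  proof -
   have c: "D * p * 2 powr p / (p - 1) = 2 * D * p / (p - 1) * 2 powr (p - 1)"
    using powr_mult_base[of 2 "p - 1"] by simp
   show ?thesis unfolding c using p D by (subst ennreal_mult) (auto simp: mult_ac)
  qed
  finally show "(\<integral>\<^sup>+l. ennreal (2 * D * p / (p - 1)) * (f x * (ennreal ((p - 1) * l powr (p - 1 - 1)) *
    (if 0 < l \<and> ennreal l < 2 * f x then 1 else 0))) \<partial>lborel) = ennreal (D * p * 2 powr p / (p - 1)) * f x epowr p" .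
 qed
 also have "... = ennreal (D * p * 2 powr p / (p - 1)) * (\<integral>\<^sup>+x. f x epowr p \<partial>M)"
  by (rule nn_integral_cmult) measurable
 finally show ?thesis .
qed

section \<open>Muckenhoupt weights\<close>

text \<open>An equivalent form of the \<open>A\<^sub>s\<close> condition that covers \<open>s = 1\<close> and \<open>s > 1\<close> at once.\<close>
definition ball_avg_weight :: "real \<Rightarrow> real \<Rightarrow> ('a::euclidean_space \<Rightarrow> real) \<Rightarrow> bool" where
 "ball_avg_weight s C w \<longleftrightarrow> w \<in> borel_measurable borel \<and> (\<forall>x. 0 < w x) \<and> 0 \<le> C \<and>
   (\<forall>c r. 0 < r \<longrightarrow> (mass w (ball c r)) < top) \<and>
   (\<forall>c r f. f \<in> borel_measurable borel \<longrightarrow> 0 < r \<longrightarrow>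
    (\<integral>\<^sup>+x\<in>ball c r. f x \<partial>lborel) epowr s * mass w (ball c r)
    \<le> ennreal C * emeasure lborel (ball c r) epowr s * wint_on (ball c r) s w f)"

section \<open>Masses of balls, inclusion between the weight classes, doubling\<close>

lemma emeasure_lborel_ball_pos: "0 < r \<Longrightarrow> 0 < emeasure lborel (ball (c::'a::euclidean_space) r)"
 by (subst emeasure_ball) auto

lemma emeasure_lborel_ball_finite': "emeasure lborel (ball (c::'a::euclidean_space) r) < top"
 using emeasure_lborel_ball_finite[of c r] by simp

lemma nn_integral_ball_pos:
 fixes w :: "'a::euclidean_space \<Rightarrow> real"
 assumes [measurable]: "w \<in> borel_measurable borel" and pos: "\<And>x. 0 < w x" and r: "0 < r"
 shows "0 < mass w (ball c r)"
proof -
 have "(mass w (ball c r)) \<noteq> 0"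
 proof
  assume "mass w (ball c r) = 0"
  then have "AE x in lborel. ennreal (w x) * indicator (ball c r) x = 0"
   by (subst (asm) nn_integral_0_iff_AE) auto
  then have "AE x in lborel. x \<notin> ball c r"
   by eventually_elim (use pos in \<open>auto simp: indicator_def ennreal_eq_0_iff not_le[symmetric] split: if_splits\<close>)
  then have "emeasure lborel (ball c r) = 0"
   by (subst (asm) AE_iff_measurable[of "ball c r"]) auto
  with emeasure_lborel_ball_pos[OF r, of c] show False by simp
 qed
 then show ?thesis by (simp add: zero_less_iff_neq_zero)
qed

lemma emeasure_lborel_ball_scale:
 "0 < r \<Longrightarrow> 0 \<le> a \<Longrightarrow> emeasure lborel (ball (c::'a::euclidean_space) (a * r)) = ennreal (a ^ DIM('a)) * emeasure lborel (ball c r)"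
 by (subst (1 2) emeasure_ball) (auto simp: ennreal_mult[symmetric] power_mult_distrib mult_ac)

lemma ennreal_mult_inverse_cancel: "0 < a \<Longrightarrow> ennreal a * z * ennreal (1 / a) = z"
proof -
 assume "0 < a"
 then have "ennreal a * ennreal (1 / a) = 1" by (simp add: ennreal_mult[symmetric])
 then show ?thesis by (metis mult.assoc mult.commute mult_1)
qed

lemma ennreal_le_divideI: "x * y \<le> z \<Longrightarrow> y \<noteq> 0 \<Longrightarrow> y \<noteq> top \<Longrightarrow> x \<le> z / (y :: ennreal)"
 using divide_right_mono_ennreal[of "x * y" z y] by (simp add: mult_divide_eq_ennreal)

lemma ball_avg_weightD:
 assumes "ball_avg_weight s C w"
 shows "w \<in> borel_measurable borel" "0 < w x" "0 \<le> w x" "0 \<le> C"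
  and "mass w (ball c r) < top"
  and "f \<in> borel_measurable borel \<Longrightarrow> 0 < r \<Longrightarrow>
    (\<integral>\<^sup>+x\<in>ball c r. f x \<partial>lborel) epowr s * mass w (ball c r)
    \<le> ennreal C * emeasure lborel (ball c r) epowr s * wint_on (ball c r) s w f"
proof -
 show "mass w (ball c r) < top"
  using assms by (cases "0 < r") (auto simp: ball_avg_weight_def not_less ball_empty)
qed (use assms in \<open>auto simp: ball_avg_weight_def less_imp_le\<close>)

text \<open>The inclusion of A_s in A_q. Hoelder's inequality for w on the ball, with exponent t = q
  / s, bounds \<integral> f^s w by a multiple of (\<integral> f^q w)^(1/t) w(B)^(1 - 1/t). After
  raising the condition to the power t, the factor w(B)^(t - 1) cancels because w(B) is positive and
  finite. The case \<open>s = q\<close> stands apart since Hoelder's inequality asks for t >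
  1.\<close>

lemma ball_avg_weight_mono:
 fixes w :: "'a::euclidean_space \<Rightarrow> real"
 assumes s: "ball_avg_weight s C w" and sq: "1 \<le> s" "s \<le> q"
 shows "ball_avg_weight q ((2 * C) powr (q / s)) w \<or> s = q"
proof (cases "s = q")
 case False
 define t where "t = q / s"
 have t: "1 < t" "0 < t" using sq False by (auto simp: t_def)
 have st: "s * t = q" using sq by (simp add: t_def)
 note [measurable] = ball_avg_weightD(1)[OF s]
 note C = ball_avg_weightD(4)[OF s]
 have "(\<integral>\<^sup>+x\<in>ball c r. f x \<partial>lborel) epowr q * mass w (ball c r)
    \<le> ennreal ((2 * C) powr t) * emeasure lborel (ball c r) epowr q * wint_on (ball c r) q w f"
  if [measurable]: "f \<in> borel_measurable borel" and r: "0 < r" for c r f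
 proof -
  define W where "W = mass w (ball c r)"
  define J where "J = wint_on (ball c r) q w f"
  define F where "F = wint_on (ball c r) s w f"
  let ?b = "emeasure lborel (ball c r)" and ?f = "(\<integral>\<^sup>+x\<in>ball c r. f x \<partial>lborel)"
  have W: "W \<noteq> top" "W \<noteq> 0"
   using nn_integral_ball_pos[of w r c] ball_avg_weightD[OF s] r by (auto simp: W_def less_top[symmetric])
  have t': "1 < t / (t - 1)" "1 / t + 1 / (t / (t - 1)) = 1" using t by (auto simp: field_simps)
  \<comment> \<open>The weight is split as w^(1/t) w^(1 - 1/t) between the two factors, so that
    Hoelder's inequality for Lebesgue measure suffices.\<close>
  have e1: "(ennreal (w x) * indicator A x) epowr (1/t) * (ennreal (w x) * indicator A x) epowr (1 / (t / (t - 1)))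
   = ennreal (w x) * indicator A x" for x A
   using t t' by (subst epowr_add[symmetric]) auto
  have "F = (\<integral>\<^sup>+x. (f x epowr s * (ennreal (w x) * indicator (ball c r) x) epowr (1/t))
    * ((ennreal (w x) * indicator (ball c r) x) epowr (1 / (t / (t - 1)))) \<partial>lborel)"
   unfolding F_def mult.assoc e1 ..
  also have "... \<le> 2 * ((\<integral>\<^sup>+x. (f x epowr s * (ennreal (w x) * indicator (ball c r) x) epowr (1/t)) epowr t \<partial>lborel) epowr (1/t)
    * (\<integral>\<^sup>+x. ((ennreal (w x) * indicator (ball c r) x) epowr (1 / (t / (t - 1)))) epowr (t / (t - 1)) \<partial>lborel) epowr (1 / (t / (t - 1))))"
   by (intro nn_integral_Hoelder t t') measurable
  also have "(\<lambda>x. (f x epowr s * (ennreal (w x) * indicator (ball c r) x) epowr (1/t)) epowr t)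
    = (\<lambda>x. f x epowr q * ennreal (w x) * indicator (ball c r) x)"
   using t sq by (simp add: epowr_mult epowr_epowr st mult.assoc)
  also have "(\<lambda>x. ((ennreal (w x) * indicator (ball c r) x) epowr (1 / (t / (t - 1)))) epowr (t / (t - 1)))
    = (\<lambda>x. ennreal (w x) * indicator (ball c r) x)"
   using t by (simp add: epowr_epowr)
  finally have "F \<le> 2 * (J epowr (1/t) * W epowr (1 / (t / (t - 1))))"
   unfolding J_def W_def .
  then have "F epowr t \<le> (2 * (J epowr (1/t) * W epowr (1 / (t / (t - 1))))) epowr t"
   using t by (intro epowr_mono) auto
  also have "... = ennreal (2 powr t) * (J * W epowr (t - 1))"
   using t epowr_ennreal[of 2 t] by (simp add: epowr_mult epowr_epowr)
  finally have F: "F epowr t \<le> ennreal (2 powr t) * (J * W epowr (t - 1))" .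
  have "?f epowr s * W \<le> ennreal C * ?b epowr s * F"
   unfolding W_def F_def by (rule ball_avg_weightD(6)[OF s that])
  then have "(?f epowr s * W) epowr t \<le> (ennreal C * ?b epowr s * F) epowr t"
   using t by (intro epowr_mono) auto
  then have "?f epowr q * W epowr t \<le> ennreal (C powr t) * ?b epowr q * F epowr t"
   using t sq C by (simp add: epowr_mult epowr_epowr st epowr_ennreal)
  also have "... \<le> ennreal (C powr t) * ?b epowr q * (ennreal (2 powr t) * (J * W epowr (t - 1)))"
   by (intro mult_left_mono F) auto
  also have "... = (ennreal ((2 * C) powr t) * ?b epowr q * J) * W epowr (t - 1)"
   using C by (simp add: powr_mult ennreal_mult mult_ac)
  finally have "(?f epowr q * W) * W epowr (t - 1) \<le> (ennreal ((2 * C) powr t) * ?b epowr q * J) * W epowr (t - 1)"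
   using epowr_add[of 1 "t - 1" W] t by (simp add: mult.assoc)
  moreover have "0 < W epowr (t - 1)" "W epowr (t - 1) < top"
   using W t epowr_eq_0_iff[of "t-1" W] epowr_less_top_iff[of "t - 1" W]
   by (auto simp: zero_less_iff_neq_zero less_top)
  ultimately show ?thesis unfolding W_def[symmetric] J_def[symmetric]
   by (subst (asm) (1 2) mult.commute) (simp add: ennreal_mult_le_mult_iff)
 qed
 then show ?thesis using s by (auto simp: ball_avg_weight_def t_def)
qed auto

text \<open>The condition on the ball of radius \<open>5 * r\<close> is tested on the indicator of
  the ball of radius \<open>r\<close>. The quotient of the two Lebesgue measures, raised to the
  power \<open>q\<close>, is the factor \<open>5 powr (real DIM('a) * q)\<close>.\<close>

lemma ball_avg_weight_doubling:
 fixes w :: "'a::euclidean_space \<Rightarrow> real"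
 assumes w: "ball_avg_weight q C w" and q: "1 \<le> q"
 shows "doubling_measure (density lborel (\<lambda>x. ennreal (w x))) (C * 5 powr (real DIM('a) * q))"
 unfolding doubling_measure_def
proof (intro conjI allI impI)
 note [measurable] = ball_avg_weightD(1)[OF w]
 note D = ball_avg_weightD[OF w]
 fix c :: 'a and r :: real assume r: "0 < r"
 let ?W = "\<lambda>r. emeasure (density lborel (\<lambda>x. ennreal (w x))) (ball c r)"
 have W: "?W r = mass w (ball c r)" for r by (simp add: emeasure_density)
 show "0 < ?W r" "?W r < top"
  using nn_integral_ball_pos[of w r c] D r by (auto simp: W)
 let ?b = "emeasure lborel (ball c r)"
 have b: "0 < ?b epowr q" "?b epowr q < top"
  using emeasure_lborel_ball_pos[OF r, of c] emeasure_lborel_ball_finite'[of c r] q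
  by (auto simp: epowr_less_top_iff zero_less_iff_neq_zero epowr_eq_0_iff)
 have "(\<integral>\<^sup>+x\<in>ball c (5 * r). indicator (ball c r) x \<partial>lborel) epowr q * mass w (ball c (5 * r))
    \<le> ennreal C * emeasure lborel (ball c (5 * r)) epowr q * wint_on (ball c (5 * r)) q w (\<lambda>x. indicator (ball c r) x)"
  using r by (intro D(6)) auto
 also have "(\<integral>\<^sup>+x\<in>ball c (5 * r). indicator (ball c r) x \<partial>lborel) = (\<integral>\<^sup>+x. indicator (ball c r) x \<partial>lborel)"
  using r by (intro nn_integral_cong) (auto simp: indicator_def)
 also have "... = ?b" by simp
 also have "wint_on (ball c (5 * r)) q w (\<lambda>x. indicator (ball c r) x) = ?W r"
  unfolding W using q r by (intro nn_integral_cong) (auto simp: indicator_def)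
 also have "emeasure lborel (ball c (5 * r)) epowr q = ennreal (5 powr (real DIM('a) * q)) * ?b epowr q"
  using r q by (subst emeasure_lborel_ball_scale)
   (auto simp: epowr_mult epowr_ennreal powr_powr powr_realpow[symmetric])
 finally have "?b epowr q * ?W (5 * r) \<le> ?b epowr q * (ennreal (C * 5 powr (real DIM('a) * q)) * ?W r)"
  using D(4) by (simp add: W ennreal_mult mult_ac)
 then show "?W (5 * r) \<le> ennreal (C * 5 powr (real DIM('a) * q)) * ?W r"
  using b by (simp add: ennreal_mult_le_mult_iff)
qed (use ball_avg_weightD(4)[OF w] in auto)

section \<open>The dual weight and the weighted maximal inequality\<close>

definition dual_weight :: "real \<Rightarrow> ('a \<Rightarrow> real) \<Rightarrow> 'a \<Rightarrow> real" where
 "dual_weight q w x = w x powr (- 1 / (q - 1))"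

text \<open>With q' = q / (q - 1) the dual weight is \<sigma> = w^(1 - q'), and \<sigma>^q w =
  \<sigma>. Testing the condition on \<sigma> gives \<sigma>(B)^q w(B) \<le> C |B|^q \<sigma>(B),
  and one factor \<sigma>(B) cancels. Finiteness of \<sigma>(B) is not known in advance, so \<sigma>
  is first restricted to the set where \<open>1 / Suc m < w\<close>, on which it is bounded;
  monotone convergence removes the cutoff.\<close>

lemma dual_weight_bound:
 fixes w :: "'a::euclidean_space \<Rightarrow> real"
 assumes w: "ball_avg_weight q C w" and q: "1 < q" and r: "0 < r"
 shows "mass (dual_weight q w) (ball c r) epowr (q - 1) * mass w (ball c r)
   \<le> ennreal C * emeasure lborel (ball c r) epowr q"
proof -
 note [measurable] = ball_avg_weightD(1)[OF w]
 note D = ball_avg_weightD[OF w]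
 have [measurable]: "dual_weight q w \<in> borel_measurable borel" unfolding dual_weight_def by measurable
 let ?b = "emeasure lborel (ball c r)" and ?W = "\<integral>\<^sup>+x\<in>ball c r. ennreal (w x) \<partial>lborel"
 have W: "?W \<noteq> top" "?W \<noteq> 0"
  using nn_integral_ball_pos[of w r c] D r by (auto simp: less_top[symmetric])
 define f where "f m x = ennreal (dual_weight q w x) * indicator {x. 1 / Suc m < w x} x" for m :: nat and x
 have [measurable]: "f m \<in> borel_measurable borel" for m unfolding f_def by measurable
 define I where "I m = (\<integral>\<^sup>+x\<in>ball c r. f m x \<partial>lborel)" for m
 have "I m epowr (q - 1) * ?W \<le> ennreal C * ?b epowr q" for m
 proof (cases "I m = 0")
  case False
  have pw: "f m x epowr q * ennreal (w x) = f m x" for x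
  proof (cases "1 / Suc m < w x")
   case True
   have "dual_weight q w x powr q * w x = dual_weight q w x powr q * w x powr 1" using D(2)[of x] by simp
   also have "... = w x powr (- 1 / (q - 1) * q + 1)"
    unfolding dual_weight_def powr_powr powr_add[symmetric] ..
   also have "- 1 / (q - 1) * q + 1 = - 1 / (q - 1)" using q by (simp add: field_simps)
   finally have "dual_weight q w x powr q * w x = dual_weight q w x" by (simp add: dual_weight_def)
   then show ?thesis using True q D(3)[of x]
    by (simp add: f_def epowr_ennreal dual_weight_def ennreal_mult[symmetric])
  qed (use q in \<open>simp add: f_def\<close>)
  have f_le: "f m x \<le> ennreal (real (Suc m) powr (1 / (q - 1)))" for x
  proof (cases "1 / Suc m < w x")
   case True
   then have "w x powr (- (1 / (q - 1))) \<le> (1 / Suc m) powr (- (1 / (q - 1)))"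
    using q by (intro powr_mono2') auto
   then show ?thesis using True
    by (simp add: f_def dual_weight_def powr_minus_divide powr_divide)
  qed (simp add: f_def)
  have "I m \<le> (\<integral>\<^sup>+x\<in>ball c r. ennreal (real (Suc m) powr (1 / (q - 1))) \<partial>lborel)"
   unfolding I_def by (intro nn_integral_mono mult_right_mono f_le) auto
  also have "... < top"
   using emeasure_lborel_ball_finite'[of c r] by (subst nn_integral_cmult_indicator) (auto simp: ennreal_mult_less_top)
  finally have I: "I m < top" .
  have "I m epowr q * ?W \<le> ennreal C * ?b epowr q * I m"
   using D(6)[of "f m" r c] r by (simp add: pw I_def)
  moreover have "I m epowr q = I m * I m epowr (q - 1)"
   using epowr_add[of 1 "q - 1" "I m"] q by simp
  ultimately have "I m * (I m epowr (q - 1) * ?W) \<le> I m * (ennreal C * ?b epowr q)"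
   by (simp add: mult_ac)
  then show ?thesis using I False by (simp add: ennreal_mult_le_mult_iff less_top)
 qed (use q in simp)
 then have I: "I m \<le> (ennreal C * ?b epowr q / ?W) epowr (1 / (q - 1))" for m
  using W q ennreal_le_divideI[OF _ W(2,1)] by (simp add: epowr_le_swap[symmetric])
 have "mass (dual_weight q w) (ball c r) = (SUP m. I m)"
  unfolding I_def
 proof (subst nn_integral_monotone_convergence_SUP[symmetric])
  show "incseq (\<lambda>m x. f m x * indicator (ball c r) x)"
  proof (intro incseq_SucI le_funI mult_right_mono)
   fix m x
   have "1 / Suc (Suc m) \<le> 1 / real (Suc m)" by (simp add: field_simps)
   then show "f m x \<le> f (Suc m) x" by (auto simp: f_def indicator_def)
  qed auto
  have "(SUP m. f m x * indicator (ball c r) x) = ennreal (dual_weight q w x) * indicator (ball c r) x" for x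
  proof (rule antisym)
   obtain m where m: "1 / Suc m < w x" using D(2)[of x] by (metis inverse_eq_divide reals_Archimedean)
   show "ennreal (dual_weight q w x) * indicator (ball c r) x \<le> (SUP m. f m x * indicator (ball c r) x)"
    by (rule SUP_upper2[of m]) (use m in \<open>auto simp: f_def\<close>)
  qed (auto intro!: SUP_least simp: f_def indicator_def)
  then show "mass (dual_weight q w) (ball c r) = (\<integral>\<^sup>+x. (SUP m. f m x * indicator (ball c r) x) \<partial>lborel)"
   by simp
 qed auto
 also have "... \<le> (ennreal C * ?b epowr q / ?W) epowr (1 / (q - 1))"
  by (intro SUP_least I)
 finally have "mass (dual_weight q w) (ball c r) epowr (q - 1) \<le> ennreal C * ?b epowr q / ?W"
  using q by (simp add: epowr_le_swap)
 then have "mass (dual_weight q w) (ball c r) epowr (q - 1) * ?W \<le> ennreal C * ?b epowr q / ?W * ?W"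
  by (rule mult_right_mono) simp
 also have "... = ennreal C * ?b epowr q" using W by (simp add: ennreal_divide_times ennreal_divide_self less_top zero_less_iff_neq_zero)
 finally show ?thesis .
qed

text \<open>Two opposite estimates meet. The preceding bound on the five-fold ball gives
  \<sigma>(5B) w(5B)^(1/(q-1)) \<le> C^(1/(q-1)) |5B|^q', and Hoelder's inequality for 1 = w^(1/q)
  \<sigma>^(1/q') gives |B|^q' \<le> 2^q' w(B)^(1/(q-1)) \<sigma>(B). Since w(B) \<le> w(5B), the
  powers of w(B) cancel.\<close>

lemma dual_weight_doubling:
 fixes w :: "'a::euclidean_space \<Rightarrow> real"
 assumes w: "ball_avg_weight q C w" and q: "1 < q"
 shows "\<exists>D. doubling_measure (density lborel (\<lambda>x. ennreal (dual_weight q w x))) D"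
proof -
 note [measurable] = ball_avg_weightD(1)[OF w]
 note D = ball_avg_weightD[OF w]
 define \<sigma> where "\<sigma> = dual_weight q w"
 have [measurable]: "\<sigma> \<in> borel_measurable borel" unfolding \<sigma>_def dual_weight_def by measurable
 have pos: "0 < \<sigma> x" for x using D(2)[of x] by (simp add: \<sigma>_def dual_weight_def)
 define q' where "q' = q / (q - 1)"
 have q': "1 < q'" "1 / q + 1 / q' = 1" "q' / q = 1 / (q - 1)" using q by (auto simp: q'_def field_simps)
 let ?S = "\<lambda>c r. \<integral>\<^sup>+x\<in>ball c r. ennreal (\<sigma> x) \<partial>lborel" and ?W = "\<lambda>c r. \<integral>\<^sup>+x\<in>ball c r. ennreal (w x) \<partial>lborel"
 have W: "?W c r \<noteq> top" "?W c r \<noteq> 0" if "0 < r" for c r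
  using nn_integral_ball_pos[of w r c] D that by (auto simp: less_top[symmetric])
 have S_pos: "0 < ?S c r" if "0 < r" for c r
  using nn_integral_ball_pos[of \<sigma> r c] pos that by auto
 have prod: "?S c r * ?W c r epowr (1 / (q - 1)) \<le> ennreal (C powr (1 / (q - 1))) * emeasure lborel (ball c r) epowr q'"
  if "0 < r" for c r
 proof -
  have "(?S c r epowr (q - 1) * ?W c r) epowr (1 / (q - 1)) \<le> (ennreal C * emeasure lborel (ball c r) epowr q) epowr (1 / (q - 1))"
   using dual_weight_bound[OF w q that, of c] q by (intro epowr_mono) (auto simp: \<sigma>_def)
  then show ?thesis using q D(4) by (simp add: epowr_mult epowr_epowr epowr_ennreal q'_def)
 qed
 have fin: "?S c r < top" if r: "0 < r" for c r
 proof -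
  have "?S c r * ?W c r epowr (1 / (q - 1)) < top"
   using emeasure_lborel_ball_finite'[of c r] q'
   by (intro le_less_trans[OF prod[OF r]]) (auto simp: ennreal_mult_less_top epowr_less_top_iff)
  then show ?thesis using W(2)[OF r, of c] q by (auto simp: ennreal_mult_less_top epowr_eq_0_iff)
 qed
 have ball_le: "emeasure lborel (ball c r) epowr q' \<le> ennreal (2 powr q') * (?W c r epowr (1 / (q - 1)) * ?S c r)" for c r
 proof -
  let ?i = "\<lambda>x. indicator (ball c r) x :: ennreal"
  have one: "ennreal (w x powr (1/q)) * ennreal (\<sigma> x powr (1/q')) = 1" for x
  proof -
   have "w x powr (1/q) * \<sigma> x powr (1/q') = w x powr (1/q + (- 1 / (q - 1)) * (1/q'))"
    unfolding \<sigma>_def dual_weight_def powr_powr powr_add ..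
   also have "1/q + (- 1 / (q - 1)) * (1/q') = 0" using q by (simp add: q'_def field_simps)
   finally show ?thesis using D(2)[of x] by (simp add: ennreal_mult[symmetric])
  qed
  have "emeasure lborel (ball c r) = (\<integral>\<^sup>+x. (ennreal (w x powr (1/q)) * ?i x) * (ennreal (\<sigma> x powr (1/q')) * ?i x) \<partial>lborel)"
   by (subst nn_integral_indicator[symmetric], simp, intro nn_integral_cong)
     (auto simp: indicator_def one)
  also have "... \<le> 2 * ((\<integral>\<^sup>+x. (ennreal (w x powr (1/q)) * ?i x) epowr q \<partial>lborel) epowr (1/q)
    * (\<integral>\<^sup>+x. (ennreal (\<sigma> x powr (1/q')) * ?i x) epowr q' \<partial>lborel) epowr (1/q'))"
   by (intro nn_integral_Hoelder q q') measurable
  also have "(\<lambda>x. (ennreal (w x powr (1/q)) * ?i x) epowr q) = (\<lambda>x. ennreal (w x) * ?i x)"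
   using q D(3) by (auto simp: fun_eq_iff indicator_def epowr_ennreal powr_powr)
  also have "(\<lambda>x. (ennreal (\<sigma> x powr (1/q')) * ?i x) epowr q') = (\<lambda>x. ennreal (\<sigma> x) * ?i x)"
   using q' pos by (auto simp: fun_eq_iff indicator_def epowr_ennreal powr_powr less_imp_le)
  finally have "emeasure lborel (ball c r) epowr q' \<le> (2 * (?W c r epowr (1/q) * ?S c r epowr (1/q'))) epowr q'"
   using q' by (intro epowr_mono) auto
  then show ?thesis using q q' epowr_ennreal[of 2 q'] by (simp add: epowr_mult epowr_epowr)
 qed
 have "doubling_measure (density lborel (\<lambda>x. ennreal (\<sigma> x))) (C powr (1 / (q - 1)) * 5 powr (real DIM('a) * q') * 2 powr q')"
  unfolding doubling_measure_def
 proof (intro conjI allI impI)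
  fix c :: 'a and r :: real assume r: "0 < r"
  have S: "emeasure (density lborel (\<lambda>x. ennreal (\<sigma> x))) (ball c r) = ?S c r" for r by (simp add: emeasure_density)
  show "0 < emeasure (density lborel (\<lambda>x. ennreal (\<sigma> x))) (ball c r)"
   "emeasure (density lborel (\<lambda>x. ennreal (\<sigma> x))) (ball c r) < top"
   using S_pos[OF r] fin[OF r] by (auto simp: S)
  let ?v = "?W c r epowr (1 / (q - 1))"
  have "?S c (5 * r) * ?v \<le> ?S c (5 * r) * ?W c (5 * r) epowr (1 / (q - 1))"
   using r q by (intro mult_left_mono epowr_mono nn_integral_mono mult_right_mono) (auto simp: indicator_def)
  also have "... \<le> ennreal (C powr (1 / (q - 1))) * emeasure lborel (ball c (5 * r)) epowr q'"
   using r by (intro prod) auto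
  also have "emeasure lborel (ball c (5 * r)) epowr q' = ennreal (5 powr (real DIM('a) * q')) * emeasure lborel (ball c r) epowr q'"
   using r q' by (subst emeasure_lborel_ball_scale)
    (auto simp: epowr_mult epowr_ennreal powr_powr powr_realpow[symmetric])
  also have "ennreal (C powr (1 / (q - 1))) * ... \<le> ennreal (C powr (1 / (q - 1))) *
    (ennreal (5 powr (real DIM('a) * q')) * (ennreal (2 powr q') * (?v * ?S c r)))"
   by (intro mult_left_mono ball_le) auto
  also have "... = ennreal (C powr (1 / (q - 1)) * 5 powr (real DIM('a) * q') * 2 powr q') * ?S c r * ?v"
   by (simp add: ennreal_mult mult_ac)
  finally have "?v * ?S c (5 * r) \<le> ?v * (ennreal (C powr (1 / (q - 1)) * 5 powr (real DIM('a) * q') * 2 powr q') * ?S c r)"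
   by (simp add: mult_ac)
  then show "emeasure (density lborel (\<lambda>x. ennreal (\<sigma> x))) (ball c (5 * r))
   \<le> ennreal (C powr (1 / (q - 1)) * 5 powr (real DIM('a) * q') * 2 powr q') * emeasure (density lborel (\<lambda>x. ennreal (\<sigma> x))) (ball c r)"
   using W[OF r, of c] q by (subst (asm) ennreal_mult_le_mult_iff)
    (auto simp: S epowr_eq_top_iff epowr_eq_0_iff)
 qed auto
 then show ?thesis unfolding \<sigma>_def by blast
qed

text \<open>Lerner's pointwise bound: \<open>(M f)\<^bsup>q-1\<^esup>\<close> is at most a constant times
 \<open>M\<^sub>w (M\<^sub>\<sigma> (f / \<sigma>)\<^bsup>q-1\<^esup> / w)\<close>, which reduces the weighted bound for \<open>M\<close> to the maximal functions
 of the doubling measures \<open>w\<close> and \<open>\<sigma>\<close>.\<close>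
theorem max_fun_weighted:
 fixes w :: "'a::euclidean_space \<Rightarrow> real"
 assumes w: "ball_avg_weight q C w" and q: "1 < q"
 shows "\<exists>K\<ge>0. \<forall>f\<in>borel_measurable borel. (wint q w (max_fun lborel f))
   \<le> ennreal K * wint q w f"
proof -
 note [measurable] = ball_avg_weightD(1)[OF w]
 note D = ball_avg_weightD[OF w]
 define \<sigma> where "\<sigma> = dual_weight q w"
 have [measurable]: "\<sigma> \<in> borel_measurable borel" unfolding \<sigma>_def dual_weight_def by measurable
 have pos: "0 < \<sigma> x" for x using D(2)[of x] by (simp add: \<sigma>_def dual_weight_def)
 define q' where "q' = q / (q - 1)"
 have q': "1 < q'" using q by (auto simp: q'_def field_simps)
 define W where "W = density lborel (\<lambda>x. ennreal (w x))"
 define S where "S = density lborel (\<lambda>x. ennreal (\<sigma> x))"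
 obtain D1 where W: "doubling_measure W D1" using ball_avg_weight_doubling[OF w] q by (auto simp: W_def)
 obtain D2 where S: "doubling_measure S D2" using dual_weight_doubling[OF w q] by (auto simp: S_def \<sigma>_def)
 have D12: "0 \<le> D1" "0 \<le> D2" using W S by (auto simp: doubling_measure_def)
 define K1 where "K1 = D1 * q' * 2 powr q' / (q' - 1)"
 define K2 where "K2 = D2 * q * 2 powr q / (q - 1)"
 have K12: "0 \<le> K1" "0 \<le> K2" using D12 q q' by (auto simp: K1_def K2_def)
 have "wint q w (max_fun lborel f)
   \<le> ennreal (C powr q' * K1 * K2) * wint q w f"
  if [measurable]: "f \<in> borel_measurable borel" for f
 proof -
  define g where "g x = f x * ennreal (1 / \<sigma> x)" for x
  define N where "N = max_fun S g"
  define H where "H x = N x epowr (q - 1) * ennreal (1 / w x)" for x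
  have [measurable]: "g \<in> borel_measurable borel" "H \<in> borel_measurable borel" "N \<in> borel_measurable borel"
   unfolding g_def H_def N_def by measurable
  \<comment> \<open>Fix a ball B containing x. The integral of \<open>f\<close> over B is the
    \<open>S\<close>-integral of \<open>g\<close>, hence at most N(y) \<sigma>(B) for every y in B.
    Integrating the power q - 1 of this over y in B produces the \<open>W\<close>-integral of
    \<open>H\<close>, which is at most \<open>max_fun W H x\<close> times w(B); then
    \<sigma>(B)^(q-1) w(B) \<le> C |B|^q eliminates the weights.\<close>
  have point: "max_fun lborel f x \<le> (ennreal C * max_fun W H x) epowr (1 / (q - 1))" for x
   unfolding max_fun_def[of lborel]
  proof (rule SUP_least, clarify)
   fix c r assume x: "x \<in> ball c r"
   then have r: "0 < r" by (metis empty_iff ball_empty not_le)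
   let ?b = "emeasure lborel (ball c r)"
   have b: "?b \<noteq> 0" "?b \<noteq> top"
    using emeasure_lborel_ball_pos[OF r, of c] emeasure_lborel_ball_finite'[of c r] by auto
   let ?F = "\<integral>\<^sup>+y\<in>ball c r. f y \<partial>lborel"
   have F: "?F = (\<integral>\<^sup>+y\<in>ball c r. g y \<partial>S)"
    unfolding S_def g_def
    by (subst nn_integral_density) (auto intro!: nn_integral_cong simp: mult.assoc[symmetric] ennreal_mult_inverse_cancel[OF pos])
   have "?b * ?F epowr (q - 1) = (\<integral>\<^sup>+y\<in>ball c r. ?F epowr (q - 1) \<partial>lborel)"
    by (subst nn_integral_cmult_indicator) (auto simp: mult.commute)
   also have "... \<le> (\<integral>\<^sup>+y\<in>ball c r. emeasure S (ball c r) epowr (q - 1) * N y epowr (q - 1) \<partial>lborel)"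
   proof (intro nn_integral_mono)
    fix y
    have "?F epowr (q - 1) \<le> (N y * emeasure S (ball c r)) epowr (q - 1)" if "y \<in> ball c r"
     unfolding F N_def using max_fun_upper[OF S that, of g] q by (intro epowr_mono) auto
    then show "?F epowr (q - 1) * indicator (ball c r) y
     \<le> emeasure S (ball c r) epowr (q - 1) * N y epowr (q - 1) * indicator (ball c r) y"
     using q by (auto simp: indicator_def epowr_mult mult_ac)
   qed
   also have "... = emeasure S (ball c r) epowr (q - 1) * (\<integral>\<^sup>+y\<in>ball c r. N y epowr (q - 1) \<partial>lborel)"
    unfolding mult.assoc by (rule nn_integral_cmult) measurable
   also have "(\<integral>\<^sup>+y\<in>ball c r. N y epowr (q - 1) \<partial>lborel) = (\<integral>\<^sup>+y\<in>ball c r. H y \<partial>W)"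
    unfolding W_def H_def
    by (subst nn_integral_density) (auto intro!: nn_integral_cong simp: mult.assoc[symmetric] ennreal_mult_inverse_cancel[OF D(2)])
   also have "emeasure S (ball c r) epowr (q - 1) * ... \<le> emeasure S (ball c r) epowr (q - 1) * (max_fun W H x * emeasure W (ball c r))"
    by (intro mult_left_mono max_fun_upper[OF W x]) auto
   also have "... = (emeasure S (ball c r) epowr (q - 1) * emeasure W (ball c r)) * max_fun W H x"
    by (simp add: mult_ac)
   also have "... \<le> (ennreal C * ?b epowr q) * max_fun W H x"
    using dual_weight_bound[OF w q r, of c]
    by (intro mult_right_mono) (auto simp: S_def W_def \<sigma>_def emeasure_density dual_weight_def)
   also have "?b epowr q = ?b * ?b epowr (q - 1)" using epowr_add[of 1 "q - 1" ?b] q by simp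
   finally have "?b * ?F epowr (q - 1) \<le> ?b * (?b epowr (q - 1) * (ennreal C * max_fun W H x))"
    by (simp add: mult_ac)
   then have "?F epowr (q - 1) \<le> ?b epowr (q - 1) * (ennreal C * max_fun W H x)"
    using b by (simp add: ennreal_mult_le_mult_iff)
   then have "?F \<le> (?b epowr (q - 1) * (ennreal C * max_fun W H x)) epowr (1 / (q - 1))"
    using q by (simp add: epowr_le_swap)
   also have "... = ?b * (ennreal C * max_fun W H x) epowr (1 / (q - 1))"
    using q by (simp add: epowr_mult epowr_epowr)
   finally have "?F / ?b \<le> (?b * (ennreal C * max_fun W H x) epowr (1 / (q - 1))) / ?b"
    by (rule divide_right_mono_ennreal)
   also have "... = (ennreal C * max_fun W H x) epowr (1 / (q - 1))"
    using b by (subst mult.commute) (simp add: mult_divide_eq_ennreal)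
   finally show "?F / ?b \<le> (ennreal C * max_fun W H x) epowr (1 / (q - 1))" .
  qed
  have "wint q w (max_fun lborel f)
   \<le> (\<integral>\<^sup>+x. ennreal (C powr q') * (ennreal (w x) * max_fun W H x epowr q') \<partial>lborel)"
  proof (intro nn_integral_mono)
   fix x
   have "max_fun lborel f x epowr q \<le> ((ennreal C * max_fun W H x) epowr (1 / (q - 1))) epowr q"
    using point q by (intro epowr_mono) auto
   also have "... = ennreal (C powr q') * max_fun W H x epowr q'"
    using q D(4) q' by (simp add: epowr_mult epowr_epowr epowr_ennreal powr_powr q'_def)
   finally have "max_fun lborel f x epowr q * ennreal (w x) \<le> ennreal (C powr q') * max_fun W H x epowr q' * ennreal (w x)"
    by (rule mult_right_mono) simp
   then show "max_fun lborel f x epowr q * ennreal (w x) \<le> ennreal (C powr q') * (ennreal (w x) * max_fun W H x epowr q')"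
    by (simp add: mult_ac)
  qed
  also have "... = ennreal (C powr q') * (\<integral>\<^sup>+x. max_fun W H x epowr q' \<partial>W)"
   unfolding W_def by (subst nn_integral_cmult, measurable, subst nn_integral_density) auto
  also have "... \<le> ennreal (C powr q') * (ennreal K1 * (\<integral>\<^sup>+x. H x epowr q' \<partial>W))"
   unfolding K1_def by (intro mult_left_mono max_fun_strong_type[OF W] q') auto
  \<comment> \<open>Since \<open>(q - 1) * q' = q\<close> and w^(1 - q') = \<sigma>, the factor
    \<open>1 / w\<close> in \<open>H\<close> turns the measure \<open>W\<close> into
    \<open>S\<close>. The same computation for \<open>g\<close>, with \<sigma>^(1 - q) = w, returns
    to the original integral below.\<close>
  also have "(\<integral>\<^sup>+x. H x epowr q' \<partial>W) = (\<integral>\<^sup>+x. N x epowr q \<partial>S)"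
  proof -
   have "ennreal (w x) * H x epowr q' = ennreal (\<sigma> x) * N x epowr q" for x
   proof -
    have "w x * (1 / w x) powr q' = w x powr 1 * w x powr (- q')"
     using D(2)[of x] by (simp add: powr_divide powr_minus_divide)
    also have "... = \<sigma> x" unfolding powr_add[symmetric] \<sigma>_def dual_weight_def
     using q by (intro arg_cong[of _ _ "\<lambda>a. w x powr a"]) (simp add: q'_def field_simps)
    finally have "ennreal (w x) * ennreal ((1 / w x) powr q') = ennreal (\<sigma> x)"
     using D(3)[of x] by (simp add: ennreal_mult[symmetric])
    moreover have "H x epowr q' = N x epowr q * ennreal ((1 / w x) powr q')"
     unfolding H_def using q q' D(3)[of x] by (simp add: epowr_mult epowr_epowr epowr_ennreal q'_def)
    ultimately show ?thesis by (metis mult.commute mult.left_commute)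
   qed
   then show ?thesis unfolding W_def S_def by (subst (1 2) nn_integral_density) auto
  qed
  also have "ennreal (C powr q') * (ennreal K1 * (\<integral>\<^sup>+x. N x epowr q \<partial>S))
    \<le> ennreal (C powr q') * (ennreal K1 * (ennreal K2 * (\<integral>\<^sup>+x. g x epowr q \<partial>S)))"
   unfolding K2_def N_def by (intro mult_left_mono max_fun_strong_type[OF S] q) auto
  also have "(\<integral>\<^sup>+x. g x epowr q \<partial>S) = wint q w f"
  proof -
   have "ennreal (\<sigma> x) * g x epowr q = f x epowr q * ennreal (w x)" for x
   proof -
    have "\<sigma> x * (1 / \<sigma> x) powr q = \<sigma> x powr 1 * \<sigma> x powr (- q)"
     using pos[of x] by (simp add: powr_divide powr_minus_divide)
    also have "... = w x powr 1" unfolding powr_add[symmetric] unfolding \<sigma>_def dual_weight_def powr_powr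
     using q by (intro arg_cong[of _ _ "\<lambda>a. w x powr a"]) (simp add: field_simps)
    finally have "ennreal (\<sigma> x) * ennreal ((1 / \<sigma> x) powr q) = ennreal (w x)"
     using pos[of x] D(2)[of x] by (simp add: ennreal_mult[symmetric])
    moreover have "g x epowr q = f x epowr q * ennreal ((1 / \<sigma> x) powr q)"
     unfolding g_def using q pos[of x] by (simp add: epowr_mult epowr_ennreal less_imp_le)
    ultimately show ?thesis by (metis mult.commute mult.left_commute)
   qed
   then show ?thesis unfolding S_def by (subst nn_integral_density) auto
  qed
  finally show ?thesis using K12 by (simp add: ennreal_mult mult_ac)
 qed
 then show ?thesis using K12 by (intro exI[of _ "C powr q' * K1 * K2"]) auto
qed

section \<open>From the Muckenhoupt classes to the averaging condition\<close>

lemma weight_pos_ball: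
 fixes w :: "real^'n \<Rightarrow> real"
 assumes "weight w"
 obtains n0 :: nat where "0 < n0" "\<And>n::nat. n0 \<le> n \<Longrightarrow> 0 < (\<integral>\<^sup>+x\<in>ball 0 n. ennreal (w x) \<partial>lebesgue)"
proof -
 from assms have [measurable]: "w \<in> borel_measurable lebesgue" and w0: "\<And>x. 0 \<le> w x"
  and nz: "\<not> (AE x in lebesgue. w x = 0)"
  by (auto simp: weight_def)
 have "\<exists>n0::nat. 0 < n0 \<and> (\<integral>\<^sup>+x\<in>ball 0 n0. ennreal (w x) \<partial>lebesgue) \<noteq> 0"
 proof (rule ccontr)
  assume "\<not> ?thesis"
  then have A: "\<forall>n0::nat. 0 < n0 \<longrightarrow> (\<integral>\<^sup>+x\<in>ball 0 n0. ennreal (w x) \<partial>lebesgue) = 0" by blast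
  have "(\<integral>\<^sup>+x\<in>ball 0 (Suc n). ennreal (w x) \<partial>lebesgue) = 0" for n :: nat
   by (rule A[rule_format]) simp
  then have "AE x in lebesgue. ennreal (w x) * indicator (ball 0 (Suc n)) x = 0" for n :: nat
   by (subst (asm) nn_integral_0_iff_AE)
    (auto intro!: borel_measurable_times_ennreal borel_measurable_indicator)
  then have "AE x in lebesgue. \<forall>n::nat. ennreal (w x) * indicator (ball 0 (Suc n)) x = 0"
   by (subst AE_all_countable) blast
  then have "AE x in lebesgue. w x = 0"
  proof eventually_elim
   case (elim x)
   obtain n :: nat where "norm x < n" using reals_Archimedean2 by blast
   then have "x \<in> ball 0 (real (Suc n))" by simp
   with elim[rule_format, of n] have "ennreal (w x) = 0" by simp
   then show ?case using w0[of x] by simp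
  qed
  with nz show False by simp
 qed
 then obtain n0 :: nat where n0: "0 < real n0" "(\<integral>\<^sup>+x\<in>ball 0 n0. ennreal (w x) \<partial>lebesgue) \<noteq> 0"
  by (elim exE conjE) (rule that)
 show ?thesis
 proof (rule that[of n0])
  show "0 < n0" using n0(1) by simp
 next
  fix n :: nat assume "n0 \<le> n"
  then have "(\<integral>\<^sup>+x\<in>ball 0 n0. ennreal (w x) \<partial>lebesgue) \<le> (\<integral>\<^sup>+x\<in>ball 0 n. ennreal (w x) \<partial>lebesgue)"
   by (intro nn_integral_mono mult_left_mono indicator_leI) auto
  then show "0 < (\<integral>\<^sup>+x\<in>ball 0 n. ennreal (w x) \<partial>lebesgue)"
   using n0(2) unfolding zero_less_iff_neq_zero by (metis le_zero_eq)
 qed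
qed

lemma average_pos:
 assumes "0 < r" "0 < (\<integral>\<^sup>+x\<in>ball c r. g x \<partial>lebesgue)"
 shows "0 < average (ball c r) g"
 using assms emeasure_lborel_ball_finite'[of c r]
 by (auto simp: average_def zero_less_iff_neq_zero ennreal_divide_eq_0_iff)

text \<open>On a large ball about the origin the average of w is positive. For s = 1 the essential
  infimum there must then be positive; for s > 1 the average of w^(-1/(s-1)) must be finite, so this
  function is finite almost everywhere. The convention that 0 to a negative power is infinite makes
  that exclude zeros of w.\<close>

lemma muckenhoupt_pos:
 fixes w :: "real^'n \<Rightarrow> real"
 assumes w: "w \<in> muckenhoupt s"
 shows "AE x in lebesgue. 0 < w x"
proof -
 have wt: "weight w" using w by (simp add: muckenhoupt_def)
 then have [measurable]: "w \<in> borel_measurable lebesgue" and w0: "\<And>x. 0 \<le> w x"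
  by (auto simp: weight_def)
 obtain n0 :: nat where n0: "0 < n0" and pos: "\<And>n::nat. n0 \<le> n \<Longrightarrow> 0 < (\<integral>\<^sup>+x\<in>ball 0 n. ennreal (w x) \<partial>lebesgue)"
  using weight_pos_ball[OF wt] by metis
 have "AE x in lebesgue. x \<in> ball 0 (real n) \<longrightarrow> 0 < w x" if n: "n0 \<le> n" for n
 proof -
  have n': "0 < real n" using n n0 by simp
  have avg: "0 < average (ball (0::real^'n) n) (\<lambda>y. ennreal (w y))"
   by (rule average_pos[OF n' pos[OF n]])
  show ?thesis
  proof (cases "s = 1")
   case True
   then obtain C where C: "\<forall>x r. 0 < r \<longrightarrow> average (ball x r) (\<lambda>y. ennreal (w y))
       \<le> ennreal C * ess_inf_on (ball x r) (\<lambda>y. ennreal (w y))"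
    using w by (auto simp: muckenhoupt_def)
   from C[rule_format, OF n', of 0] avg have "0 < ess_inf_on (ball (0::real^'n) n) (\<lambda>y. ennreal (w y))"
    by (auto simp: zero_less_iff_neq_zero)
   then obtain c where c: "0 < c" "AE x in lebesgue. x \<in> ball 0 (real n) \<longrightarrow> c \<le> ennreal (w x)"
    by (auto simp: ess_inf_on_def less_Sup_iff)
   from c(2) show ?thesis
   proof eventually_elim
    case (elim x)
    then show ?case using c(1) by (auto simp flip: ennreal_less_zero_iff)
   qed
  next
   case False
   then have s: "1 < s" using w by (auto simp: muckenhoupt_def)
   let ?\<sigma> = "\<lambda>y. ennreal (w y) epowr (- 1 / (s - 1))"
   obtain C where C: "\<forall>x r. 0 < r \<longrightarrow> average (ball x r) (\<lambda>y. ennreal (w y)) * average (ball x r) ?\<sigma> epowr (s - 1) \<le> ennreal C"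
    using w False by (auto simp: muckenhoupt_def)
   from C[rule_format, OF n', of 0] have "average (ball (0::real^'n) n) (\<lambda>y. ennreal (w y)) * average (ball 0 n) ?\<sigma> epowr (s - 1) < top"
    by (rule le_less_trans) simp
   with avg have "average (ball (0::real^'n) n) ?\<sigma> epowr (s - 1) < top"
    by (auto simp: ennreal_mult_less_top)
   then have "average (ball (0::real^'n) n) ?\<sigma> < top" using s by (simp add: epowr_less_top_iff)
   then have "(\<integral>\<^sup>+x\<in>ball (0::real^'n) n. ?\<sigma> x \<partial>lebesgue) \<noteq> \<infinity>"
    using emeasure_lborel_ball_finite'[of "0::real^'n" n]
    by (auto simp: average_def ennreal_top_divide less_top[symmetric] split: if_splits)
   then have "AE x in lebesgue. ?\<sigma> x * indicator (ball 0 (real n)) x \<noteq> \<infinity>"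
    by (intro nn_integral_noteq_infinite borel_measurable_times_ennreal measurable_epowr borel_measurable_indicator) auto
   then show ?thesis
   proof eventually_elim
    case (elim x)
    then show ?case using w0[of x] s by (cases "w x = 0") (auto simp: epowr_def)
   qed
  qed
 qed
 then have "AE x in lebesgue. \<forall>n\<in>{n0..}. x \<in> ball 0 (real n) \<longrightarrow> 0 < w x"
  by (subst AE_ball_countable) auto
 then show ?thesis
 proof eventually_elim
  case (elim x)
  obtain n :: nat where "norm x < n" using reals_Archimedean2 by blast
  then have "norm x < real (n + n0)" by simp
  moreover have "n + n0 \<in> {n0..}" by simp
  ultimately show ?case using elim by (metis mem_ball_0)
 qed
qed

text \<open>For s = 1 the product of \<integral>_B f and the essential infimum of w is at most
  \<integral>_B f w. For s > 1 Hoelder's inequality for f = (f w^(1/s)) w^(-1/s) produces the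
  average of w^(-1/(s-1)), which the A_s condition controls against the average of w. A positive
  Borel representative is chosen so that all later statements hold at every point and over
  \<open>lborel\<close>.\<close>

lemma muckenhoupt_ball_avg_weight:
 fixes w :: "real^'n \<Rightarrow> real"
 assumes w: "w \<in> muckenhoupt s"
 shows "\<exists>w' C. ball_avg_weight s C w' \<and> (AE x in lborel. w x = w' x)"
proof -
 have wt: "weight w" using w by (simp add: muckenhoupt_def)
 then have wm [measurable]: "w \<in> borel_measurable lebesgue" and w0: "\<And>x. 0 \<le> w x"
  and li: "locally_integrable w" by (auto simp: weight_def)
 obtain w1 where w1 [measurable]: "w1 \<in> borel_measurable borel" and eq1: "AE x in lborel. w x = w1 x"
  using completion_ex_borel_measurable_real[OF wm] by auto
 have pos: "AE x in lborel. 0 < w x" using muckenhoupt_pos[OF w] by (simp add: AE_completion_iff)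
 \<comment> \<open>The value 1 goes where \<open>w1\<close> is not positive, a null set by
   \<open>pos\<close>; with \<open>v\<close> positive everywhere its negative powers are
   finite.\<close>
 define v where "v x = (if 0 < w1 x then w1 x else 1)" for x
 have [measurable]: "v \<in> borel_measurable borel" unfolding v_def by measurable
 have eq: "AE x in lborel. w x = v x" using eq1 pos by eventually_elim (auto simp: v_def)
 have vpos: "0 < v x" for x by (simp add: v_def)
 have I: "(\<integral>\<^sup>+x\<in>B. g (w x) \<partial>lebesgue) = (\<integral>\<^sup>+x\<in>B. g (v x) \<partial>lborel)" for B and g :: "real \<Rightarrow> ennreal"
  unfolding nn_integral_completion by (intro nn_integral_cong_AE, use eq in eventually_elim) simp
 have avg: "average (ball c r) (\<lambda>y. g (w y)) = (\<integral>\<^sup>+x\<in>ball c r. g (v x) \<partial>lborel) / emeasure lborel (ball c r)" for c r and g :: "real \<Rightarrow> ennreal"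
  by (simp add: average_def I)
 have fin: "mass v (ball c r) < top" if "0 < r" for c r
 proof -
  have "set_integrable lebesgue (cball c r) w" using li by (auto simp: locally_integrable_def)
  then have "(\<integral>\<^sup>+x. ennreal (norm (indicat_real (cball c r) x *\<^sub>R w x)) \<partial>lebesgue) < \<infinity>"
   unfolding set_integrable_def integrable_iff_bounded by simp
  moreover have "(\<integral>\<^sup>+x\<in>ball c r. ennreal (w x) \<partial>lebesgue) \<le> (\<integral>\<^sup>+x. ennreal (norm (indicat_real (cball c r) x *\<^sub>R w x)) \<partial>lebesgue)"
   using w0 by (intro nn_integral_mono) (auto simp: indicator_def)
  ultimately show ?thesis unfolding I[where g=ennreal] by (auto simp: less_top)
 qed
 have main: "\<exists>C\<ge>0. \<forall>c r f. f \<in> borel_measurable borel \<longrightarrow> 0 < r \<longrightarrow>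
    (\<integral>\<^sup>+x\<in>ball c r. f x \<partial>lborel) epowr s * mass v (ball c r)
    \<le> ennreal C * emeasure lborel (ball c r) epowr s * wint_on (ball c r) s v f"
 proof (cases "s = 1")
  case True
  then obtain C where C: "0 < C" "\<And>x r. 0 < r \<Longrightarrow> average (ball x r) (\<lambda>y. ennreal (w y))
       \<le> ennreal C * ess_inf_on (ball x r) (\<lambda>y. ennreal (w y))"
   using w by (auto simp: muckenhoupt_def)
  have "(\<integral>\<^sup>+x\<in>ball c r. f x \<partial>lborel) * mass v (ball c r)
    \<le> ennreal C * emeasure lborel (ball c r) * (\<integral>\<^sup>+x\<in>ball c r. f x * ennreal (v x) \<partial>lborel)"
   if [measurable]: "f \<in> borel_measurable borel" and r: "0 < r" for c :: "real^'n" and r f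
  proof -
   let ?b = "emeasure lborel (ball c r)" and ?F = "\<integral>\<^sup>+x\<in>ball c r. f x \<partial>lborel" and ?V = "\<integral>\<^sup>+x\<in>ball c r. ennreal (v x) \<partial>lborel"
   have b: "?b \<noteq> 0" "?b \<noteq> top"
    using emeasure_lborel_ball_pos[OF r, of c] emeasure_lborel_ball_finite'[of c r] by auto
   \<comment> \<open>The essential infimum is a supremum of lower bounds valid almost everywhere.
     The product is distributed over that supremum, and each lower bound is compared with
     \<open>v\<close> under the integral.\<close>
   have ei: "?F * ess_inf_on (ball c r) (\<lambda>y. ennreal (w y)) \<le> (\<integral>\<^sup>+x\<in>ball c r. f x * ennreal (v x) \<partial>lborel)"
    unfolding ess_inf_on_def SUP_mult_left_ennreal[of ?F "\<lambda>a. a", simplified]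
   proof (rule SUP_least)
    fix a assume "a \<in> {a. AE x in lebesgue. x \<in> ball c r \<longrightarrow> a \<le> ennreal (w x)}"
    then have a: "AE x in lborel. x \<in> ball c r \<longrightarrow> a \<le> ennreal (w x)" by (simp add: AE_completion_iff)
    have "?F * a = (\<integral>\<^sup>+x. f x * indicator (ball c r) x * a \<partial>lborel)"
     by (rule nn_integral_multc[symmetric]) measurable
    also have "... \<le> (\<integral>\<^sup>+x\<in>ball c r. f x * ennreal (v x) \<partial>lborel)"
    proof (intro nn_integral_mono_AE, use a eq in eventually_elim)
     case (elim x)
     then show ?case by (auto simp: indicator_def intro!: mult_left_mono)
    qed
    finally show "?F * a \<le> (\<integral>\<^sup>+x\<in>ball c r. f x * ennreal (v x) \<partial>lborel)" .
   qed
   have "?V = ?V / ?b * ?b" using b by (simp add: ennreal_divide_times ennreal_divide_self less_top zero_less_iff_neq_zero)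
   also have "... \<le> (ennreal C * ess_inf_on (ball c r) (\<lambda>y. ennreal (w y))) * ?b"
    using C(2)[OF r, of c] unfolding avg[where g=ennreal] by (intro mult_right_mono) auto
   finally have "?F * ?V \<le> ?F * ((ennreal C * ess_inf_on (ball c r) (\<lambda>y. ennreal (w y))) * ?b)"
    by (rule mult_left_mono) simp
   also have "... = (ennreal C * ?b) * (?F * ess_inf_on (ball c r) (\<lambda>y. ennreal (w y)))" by (simp add: mult_ac)
   also have "... \<le> (ennreal C * ?b) * (\<integral>\<^sup>+x\<in>ball c r. f x * ennreal (v x) \<partial>lborel)"
    by (intro mult_left_mono ei) auto
   finally show ?thesis .
  qed
  then show ?thesis using C(1) True by (intro exI[of _ C]) auto
 next
  case False
  then have s: "1 < s" using w by (auto simp: muckenhoupt_def)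
  define s' where "s' = s / (s - 1)"
  have s': "1 < s'" "1 / s + 1 / s' = 1" "1 / s' * s = s - 1" using s by (auto simp: s'_def field_simps)
  let ?\<sigma> = "\<lambda>y::real. ennreal y epowr (- 1 / (s - 1))"
  obtain C where C: "0 < C" "\<And>x r. 0 < r \<Longrightarrow> average (ball x r) (\<lambda>y. ennreal (w y))
    * average (ball x r) (\<lambda>y. ?\<sigma> (w y)) epowr (s - 1) \<le> ennreal C"
   using w False by (auto simp: muckenhoupt_def)
  have sg: "?\<sigma> (v x) = ennreal (v x powr (- 1 / (s - 1)))" for x
   using vpos[of x] s by (auto simp: epowr_def)
  have "(\<integral>\<^sup>+x\<in>ball c r. f x \<partial>lborel) epowr s * mass v (ball c r)
    \<le> ennreal (2 powr s * C) * emeasure lborel (ball c r) epowr s * wint_on (ball c r) s v f"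
   if [measurable]: "f \<in> borel_measurable borel" and r: "0 < r" for c :: "real^'n" and r f
  proof -
   let ?b = "emeasure lborel (ball c r)" and ?F = "\<integral>\<^sup>+x\<in>ball c r. f x \<partial>lborel" and ?V = "\<integral>\<^sup>+x\<in>ball c r. ennreal (v x) \<partial>lborel"
   let ?J = "\<integral>\<^sup>+x\<in>ball c r. f x epowr s * ennreal (v x) \<partial>lborel" and ?S = "\<integral>\<^sup>+x\<in>ball c r. ?\<sigma> (v x) \<partial>lborel"
   let ?i = "\<lambda>x. indicator (ball c r) x :: ennreal"
   have b: "?b \<noteq> 0" "?b \<noteq> top"
    using emeasure_lborel_ball_pos[OF r, of c] emeasure_lborel_ball_finite'[of c r] by auto
   have one: "ennreal (v x powr (1/s)) * ennreal (v x powr (- 1/s)) = 1" for x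
    using vpos[of x] by (simp add: ennreal_mult[symmetric] powr_minus_divide)
   have "?F = (\<integral>\<^sup>+x. (f x * ennreal (v x powr (1/s)) * ?i x) * (ennreal (v x powr (- 1/s)) * ?i x) \<partial>lborel)"
   proof (intro nn_integral_cong)
    fix x
    show "f x * ?i x = (f x * ennreal (v x powr (1/s)) * ?i x) * (ennreal (v x powr (- 1/s)) * ?i x)"
     using one[of x] by (cases "x \<in> ball c r") (simp_all add: mult.assoc del: mem_ball)
   qed
   also have "... \<le> 2 * ((\<integral>\<^sup>+x. (f x * ennreal (v x powr (1/s)) * ?i x) epowr s \<partial>lborel) epowr (1/s)
    * (\<integral>\<^sup>+x. (ennreal (v x powr (- 1/s)) * ?i x) epowr s' \<partial>lborel) epowr (1/s'))"
    by (intro nn_integral_Hoelder s s') measurable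
   also have "(\<lambda>x. (f x * ennreal (v x powr (1/s)) * ?i x) epowr s) = (\<lambda>x. f x epowr s * ennreal (v x) * ?i x)"
    using s vpos by (auto simp: fun_eq_iff indicator_def epowr_mult epowr_ennreal powr_powr less_imp_le)
   also have "(\<lambda>x. (ennreal (v x powr (- 1/s)) * ?i x) epowr s') = (\<lambda>x. ?\<sigma> (v x) * ?i x)"
   proof -
    have "(v x powr (- 1/s)) powr s' = v x powr (- 1 / (s - 1))" for x
     using s by (simp add: powr_powr s'_def)
    then show ?thesis unfolding sg using s' by (auto simp: fun_eq_iff indicator_def epowr_ennreal)
   qed
   finally have "?F epowr s \<le> (2 * (?J epowr (1/s) * ?S epowr (1/s'))) epowr s"
    using s by (intro epowr_mono) auto
   also have "... = ennreal (2 powr s) * (?J * ?S epowr (s - 1))"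
    using s s' epowr_ennreal[of 2 s] by (simp add: epowr_mult epowr_epowr)
   finally have F: "?F epowr s \<le> ennreal (2 powr s) * (?J * ?S epowr (s - 1))" .
   have "?V * ?S epowr (s - 1) = (?V / ?b * (?S / ?b) epowr (s - 1)) * ?b epowr s"
   proof -
    have "?V = ?V / ?b * ?b" "?S = ?S / ?b * ?b"
     using b by (simp_all add: ennreal_divide_times ennreal_divide_self less_top zero_less_iff_neq_zero)
    then have "?V * ?S epowr (s - 1) = (?V / ?b * ?b) * (?S / ?b * ?b) epowr (s - 1)" by simp
    also have "... = (?V / ?b * (?S / ?b) epowr (s - 1)) * (?b * ?b epowr (s - 1))"
     using s by (simp only: epowr_mult) (simp add: mult_ac)
    also have "?b * ?b epowr (s - 1) = ?b epowr s" using epowr_add[of 1 "s - 1" ?b] s by simp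
    finally show ?thesis .
   qed
   also have "... \<le> ennreal C * ?b epowr s"
    using C(2)[OF r, of c] unfolding avg[where g=ennreal] avg[where g="?\<sigma>"] by (intro mult_right_mono) auto
   finally have VS: "?V * ?S epowr (s - 1) \<le> ennreal C * ?b epowr s" .
   have "?F epowr s * ?V \<le> ennreal (2 powr s) * (?J * ?S epowr (s - 1)) * ?V"
    by (intro mult_right_mono F) auto
   also have "... = ennreal (2 powr s) * ?J * (?V * ?S epowr (s - 1))" by (simp add: mult_ac)
   also have "... \<le> ennreal (2 powr s) * ?J * (ennreal C * ?b epowr s)"
    by (intro mult_left_mono VS) auto
   also have "... = ennreal (2 powr s * C) * ?b epowr s * ?J"
    using C(1) by (simp add: ennreal_mult mult_ac)
   finally show ?thesis .
  qed
  then show ?thesis using C(1) by (intro exI[of _ "2 powr s * C"]) auto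
 qed
 then obtain C where C: "0 \<le> C" and le: "\<forall>c r f. f \<in> borel_measurable borel \<longrightarrow> 0 < r \<longrightarrow>
    (\<integral>\<^sup>+x\<in>ball c r. f x \<partial>lborel) epowr s * mass v (ball c r)
    \<le> ennreal C * emeasure lborel (ball c r) epowr s * wint_on (ball c r) s v f"
  by (elim exE conjE)
 have "ball_avg_weight s C v"
  unfolding ball_avg_weight_def
 proof (intro conjI)
  show "\<forall>c r. 0 < r \<longrightarrow> (mass v (ball c r)) < top" using fin by blast
  show "v \<in> borel_measurable borel" by measurable
  show "\<forall>x. 0 < v x" using vpos by blast
 qed (rule C le)+
 with eq show ?thesis by blast
qed

section \<open>Intrinsic kernels\<close>

text \<open>The functions \<open>z \<mapsto> \<phi>\<^sub>t(x - z)\<close> with \<open>\<phi> \<in> \<C>\<^sub>\<beta>\<close>; then \<open>sup_kern \<beta> t f x\<close> is \<open>A\<^sub>\<beta>(f)(x, t)\<close>.\<close>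
definition kern :: "real \<Rightarrow> real \<Rightarrow> 'a::euclidean_space \<Rightarrow> ('a \<Rightarrow> real) set" where
 "kern \<beta> t x = {\<psi>. (\<forall>z. t < dist x z \<longrightarrow> \<psi> z = 0)
   \<and> (\<forall>z z'. \<bar>\<psi> z - \<psi> z'\<bar> \<le> (dist z z' / t) powr \<beta> / t ^ DIM('a))
   \<and> (LINT z|lborel. \<psi> z) = 0}"

text \<open>The Borel form of local integrability: the analysis runs over \<open>lborel\<close>, and
  Lebesgue measurable functions are replaced beforehand by Borel functions that agree with them
  almost everywhere.\<close>

definition local_int :: "('a::euclidean_space \<Rightarrow> real) \<Rightarrow> bool" where
 "local_int f \<longleftrightarrow> f \<in> borel_measurable borel \<and> (\<forall>c r. (abs_nint f (cball c r)) < top)"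

definition abs_int :: "('a::euclidean_space \<Rightarrow> real) \<Rightarrow> 'a set \<Rightarrow> real" where
 "abs_int f S = (LINT z|lborel. \<bar>f z\<bar> * indicator S z)"

definition sup_kern :: "real \<Rightarrow> real \<Rightarrow> ('a::euclidean_space \<Rightarrow> real) \<Rightarrow> 'a \<Rightarrow> real" where
 "sup_kern \<beta> t f x = (SUP \<psi>\<in>kern \<beta> t x. \<bar>LINT z|lborel. f z * \<psi> z\<bar>)"

lemma local_int_measurable: "local_int f \<Longrightarrow> f \<in> borel_measurable borel"
 by (simp add: local_int_def)

lemma local_int_integrable:
 assumes "local_int f" shows "integrable lborel (\<lambda>z. \<bar>f z\<bar> * indicator (cball c r) z)"
proof -
 have [measurable]: "f \<in> borel_measurable borel" using assms by (simp add: local_int_def)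
 have "(\<integral>\<^sup>+z. ennreal (norm (\<bar>f z\<bar> * indicator (cball c r) z)) \<partial>lborel) = abs_nint f (cball c r)"
  by (intro nn_integral_cong) (auto simp: indicator_def)
 then show ?thesis using assms by (auto simp: integrable_iff_bounded local_int_def)
qed

lemma abs_int_nonneg: "0 \<le> abs_int f S"
 unfolding abs_int_def by (intro integral_nonneg_AE) auto

lemma ennreal_abs_int:
 assumes "local_int f"
 shows "ennreal (abs_int f (cball c r)) = abs_nint f (cball c r)"
proof -
 have "(\<integral>\<^sup>+z. ennreal (\<bar>f z\<bar> * indicator (cball c r) z) \<partial>lborel) = ennreal (abs_int f (cball c r))"
  unfolding abs_int_def by (rule nn_integral_eq_integral[OF local_int_integrable[OF assms]]) auto
 moreover have "(\<integral>\<^sup>+z. ennreal (\<bar>f z\<bar> * indicator (cball c r) z) \<partial>lborel) = abs_nint f (cball c r)"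
  by (intro nn_integral_cong) (auto simp: indicator_def)
 ultimately show ?thesis by simp
qed

lemma kern_outside: "\<psi> \<in> kern \<beta> t x \<Longrightarrow> t < dist x z \<Longrightarrow> \<psi> z = 0"
 by (auto simp: kern_def)

lemma kern_Hoelder:
 "\<psi> \<in> kern \<beta> t (x::'a::euclidean_space) \<Longrightarrow> \<bar>\<psi> z - \<psi> z'\<bar> \<le> (dist z z' / t) powr \<beta> / t ^ DIM('a)"
 by (auto simp: kern_def)

lemma kern_integral: "\<psi> \<in> kern \<beta> t x \<Longrightarrow> (LINT z|lborel. \<psi> z) = 0"
 by (auto simp: kern_def)

lemma zero_in_kern: "0 < t \<Longrightarrow> (\<lambda>_. 0) \<in> kern \<beta> t x"
 by (auto simp: kern_def)

lemma Hoelder_continuous: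
 fixes \<psi> :: "'a::metric_space \<Rightarrow> real"
 assumes "0 < \<beta>" "0 < t" "\<And>z z'. \<bar>\<psi> z - \<psi> z'\<bar> \<le> (dist z z' / t) powr \<beta> * K"
 shows "continuous_on UNIV \<psi>"
proof -
 have "isCont \<psi> z" for z
  unfolding isCont_def
 proof (rule Lim_null_comparison[THEN LIM_zero_cancel])
  show "\<forall>\<^sub>F y in at z. norm (\<psi> y - \<psi> z) \<le> (dist y z / t) powr \<beta> * K"
   using assms(3) by simp
  have "((\<lambda>y. (dist y z / t) powr \<beta>) \<longlongrightarrow> (dist z z / t) powr \<beta>) (at z)"
   using assms(1,2) by (intro tendsto_powr' tendsto_intros) auto
  then have "((\<lambda>y. (dist y z / t) powr \<beta> * K) \<longlongrightarrow> (dist z z / t) powr \<beta> * K) (at z)"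
   by (rule tendsto_mult_right)
  then show "((\<lambda>y. (dist y z / t) powr \<beta> * K) \<longlongrightarrow> 0) (at z)"
   by simp
 qed
 then show ?thesis by (simp add: continuous_at_imp_continuous_on)
qed

lemma kern_continuous:
 assumes "0 < \<beta>" "0 < t" "\<psi> \<in> kern \<beta> t (x::'a::euclidean_space)" shows "continuous_on UNIV \<psi>"
 by (rule Hoelder_continuous[where K="1 / t ^ DIM('a)" and \<beta>=\<beta> and t=t])
   (use assms kern_Hoelder[OF assms(3)] in auto)

lemma kern_measurable:
 assumes "0 < \<beta>" "0 < t" "\<psi> \<in> kern \<beta> t x" shows "\<psi> \<in> borel_measurable borel"
 by (rule borel_measurable_continuous_onI) (rule kern_continuous[OF assms])

text \<open>A point \<open>z'\<close> at distance \<open>2 * t\<close> from \<open>x\<close> lies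
  outside the support, and every point of the ball is within \<open>3 * t\<close> of it. The Hoelder
  condition between the two points gives the factor 3^\<beta> \<le> 3.\<close>

lemma kern_bound:
 assumes \<beta>: "0 < \<beta>" "\<beta> \<le> 1" and t: "0 < t" and \<psi>: "\<psi> \<in> kern \<beta> t (x::'a::euclidean_space)"
 shows "\<bar>\<psi> z\<bar> \<le> 3 / t ^ DIM('a) * indicator (cball x t) z"
proof (cases "z \<in> cball x t")
 case True
 obtain e :: 'a where e: "e \<in> Basis" using nonempty_Basis by blast
 define z' where "z' = x + (2 * t) *\<^sub>R e"
 have d: "dist x z' = 2 * t" using e t by (simp add: z'_def dist_norm)
 then have "\<psi> z' = 0" using kern_outside[OF \<psi>, of z'] t by auto
 then have "\<bar>\<psi> z\<bar> \<le> (dist z z' / t) powr \<beta> / t ^ DIM('a)" using kern_Hoelder[OF \<psi>, of z z'] by simp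
 also have "dist z z' \<le> 3 * t"
  using dist_triangle[of z z' x] True d by (simp add: dist_commute)
 then have "(dist z z' / t) powr \<beta> \<le> 3 powr \<beta>" using t \<beta> by (intro powr_mono2) (auto simp: field_simps)
 also have "3 powr \<beta> \<le> 3 powr (1::real)" using \<beta> by (intro powr_mono) auto
 finally show ?thesis using True t by (simp add: divide_right_mono)
next
 case False
 then show ?thesis using kern_outside[OF \<psi>, of z] by (auto simp: not_le)
qed

text \<open>If \<open>f\<close> is not Borel, neither side is integrable and both take the default
  value 0. So \<open>kern_shift\<close> can translate kernels before their measurability has been
  discussed.\<close>

lemma lborel_integral_shift:
 fixes f :: "'a::euclidean_space \<Rightarrow> real"
 shows "(LINT z|lborel. f (z + c)) = (LINT z|lborel. f z)"
proof (cases "f \<in> borel_measurable borel")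
 case True
 have "(LINT z|lborel. f z) = (LINT z|distr lborel borel ((+) c). f z)" by (simp add: lborel_distr_plus)
 also have "... = (LINT z|lborel. f (c + z))" using True by (subst integral_distr) auto
 finally show ?thesis by (simp add: add.commute)
next
 case False
 have "(\<lambda>z. f (z + c)) \<notin> borel_measurable borel"
 proof
  assume [measurable]: "(\<lambda>z. f (z + c)) \<in> borel_measurable borel"
  have "(\<lambda>z. (\<lambda>z. f (z + c)) (z - c)) \<in> borel_measurable borel" by measurable
  then show False using False by simp
 qed
 then have "\<not> integrable lborel f" "\<not> integrable lborel (\<lambda>z. f (z + c))"
  using False borel_measurable_integrable by force+
 then show ?thesis by (simp add: not_integrable_integral_eq)
qed

lemma kern_shift:
 fixes x x' :: "'a::euclidean_space"
 assumes "\<psi> \<in> kern \<beta> t x" shows "(\<lambda>z. \<psi> (z + (x - x'))) \<in> kern \<beta> t x'"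
 unfolding kern_def
proof (intro CollectI conjI allI impI)
 fix z assume "t < dist x' z"
 moreover have "dist x (z + (x - x')) = dist x' z" by (simp add: dist_norm)
 ultimately show "\<psi> (z + (x - x')) = 0" using kern_outside[OF assms] by simp
next
 fix z z'
 show "\<bar>\<psi> (z + (x - x')) - \<psi> (z' + (x - x'))\<bar> \<le> (dist z z' / t) powr \<beta> / t ^ DIM('a)"
  using kern_Hoelder[OF assms, of "z + (x - x')" "z' + (x - x')"] by simp
next
 show "(LINT z|lborel. \<psi> (z + (x - x'))) = 0"
  using kern_integral[OF assms] by (simp only: lborel_integral_shift)
qed

lemma integrable_mult_bounded_cball:
 fixes g f :: "'a::euclidean_space \<Rightarrow> real"
 assumes f: "local_int f" and [measurable]: "g \<in> borel_measurable borel"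
  and g: "\<And>z. \<bar>g z\<bar> \<le> K * indicator (cball c r) z"
 shows "integrable lborel (\<lambda>z. f z * g z)" "\<bar>LINT z|lborel. f z * g z\<bar> \<le> K * abs_int f (cball c r)"
proof -
 have [measurable]: "f \<in> borel_measurable borel" using f by (simp add: local_int_def)
 have I: "integrable lborel (\<lambda>z. K * (\<bar>f z\<bar> * indicator (cball c r) z))"
  by (intro integrable_mult_right local_int_integrable f)
 have le: "norm (f z * g z) \<le> K * (\<bar>f z\<bar> * indicator (cball c r) z)" for z
  using mult_left_mono[OF g[of z], of "\<bar>f z\<bar>"] by (simp add: abs_mult mult_ac)
 show 1: "integrable lborel (\<lambda>z. f z * g z)"
 proof (rule Bochner_Integration.integrable_bound[OF I])
  show "AE z in lborel. norm (f z * g z) \<le> norm (K * (\<bar>f z\<bar> * indicator (cball c r) z))"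
  proof (rule AE_I2)
   fix z
   show "norm (f z * g z) \<le> norm (K * (\<bar>f z\<bar> * indicator (cball c r) z))"
    using le[of z] unfolding real_norm_def by linarith
  qed
 qed measurable
 have "\<bar>LINT z|lborel. f z * g z\<bar> \<le> (LINT z|lborel. norm (f z * g z))"
  using integral_norm_bound[of lborel "\<lambda>z. f z * g z"] by simp
 also have "... \<le> (LINT z|lborel. K * (\<bar>f z\<bar> * indicator (cball c r) z))"
  using le 1 by (intro integral_mono I integrable_norm)
 finally show "\<bar>LINT z|lborel. f z * g z\<bar> \<le> K * abs_int f (cball c r)" by (simp add: abs_int_def)
qed

lemma local_int_add:
 fixes f g :: "'a::euclidean_space \<Rightarrow> real"
 assumes "local_int f" "local_int g" shows "local_int (\<lambda>z. f z + g z)"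
 unfolding local_int_def
proof (intro conjI allI)
 have [measurable]: "f \<in> borel_measurable borel" "g \<in> borel_measurable borel"
  using assms by (auto simp: local_int_def)
 show "(\<lambda>z. f z + g z) \<in> borel_measurable borel" by measurable
 fix c :: 'a and r :: real
 have "(\<integral>\<^sup>+z\<in>cball c r. ennreal \<bar>f z + g z\<bar> \<partial>lborel)
   \<le> (\<integral>\<^sup>+z. ennreal \<bar>f z\<bar> * indicator (cball c r) z + ennreal \<bar>g z\<bar> * indicator (cball c r) z \<partial>lborel)"
  by (intro nn_integral_mono) (auto simp: indicator_def simp flip: ennreal_plus)
 also have "... = abs_nint f (cball c r) + abs_nint g (cball c r)"
  by (rule nn_integral_add) measurable
 also have "... < top" using assms by (auto simp: local_int_def)
 finally show "(\<integral>\<^sup>+z\<in>cball c r. ennreal \<bar>f z + g z\<bar> \<partial>lborel) < top" .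
qed

lemma local_int_le:
 assumes "local_int f" "g \<in> borel_measurable borel" "\<And>z. \<bar>g z\<bar> \<le> \<bar>f z\<bar>"
 shows "local_int g"
 unfolding local_int_def
proof (intro conjI allI assms)
 fix c r
 have "abs_nint g (cball c r) \<le> abs_nint f (cball c r)"
  using assms(3) by (intro nn_integral_mono mult_right_mono) auto
 also have "... < top" using assms by (auto simp: local_int_def)
 finally show "abs_nint g (cball c r) < top" .
qed

section \<open>The supremum over kernels at a single scale\<close>

context
 fixes \<beta> t :: real
 assumes \<beta>: "0 < \<beta>" "\<beta> \<le> 1" and t: "0 < t"
begin

lemma kern_integrable:
 assumes "local_int f" "\<psi> \<in> kern \<beta> t (x::'a::euclidean_space)"
 shows "integrable lborel (\<lambda>z. f z * \<psi> z)"
 using integrable_mult_bounded_cball(1)[OF assms(1) kern_measurable[OF \<beta>(1) t assms(2)] kern_bound[OF \<beta> t assms(2)]] .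

lemma kern_integral_bound:
 assumes "local_int f" "\<psi> \<in> kern \<beta> t (x::'a::euclidean_space)"
 shows "\<bar>LINT z|lborel. f z * \<psi> z\<bar> \<le> 3 / t ^ DIM('a) * abs_int f (cball x t)"
 using integrable_mult_bounded_cball(2)[OF assms(1) kern_measurable[OF \<beta>(1) t assms(2)] kern_bound[OF \<beta> t assms(2)]] .

lemma sup_kern_upper:
 assumes "local_int f" "\<psi> \<in> kern \<beta> t (x::'a::euclidean_space)"
 shows "\<bar>LINT z|lborel. f z * \<psi> z\<bar> \<le> sup_kern \<beta> t f x"
 unfolding sup_kern_def using assms kern_integral_bound[OF assms(1)]
 by (intro cSUP_upper bdd_aboveI2)

lemma sup_kern_least:
 assumes "\<And>\<psi>. \<psi> \<in> kern \<beta> t (x::'a::euclidean_space) \<Longrightarrow> \<bar>LINT z|lborel. f z * \<psi> z\<bar> \<le> C"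
 shows "sup_kern \<beta> t f x \<le> C"
 unfolding sup_kern_def using assms zero_in_kern[OF t] by (intro cSUP_least) auto

lemma sup_kern_nonneg: "local_int f \<Longrightarrow> 0 \<le> sup_kern \<beta> t f (x::'a::euclidean_space)"
 using sup_kern_upper[OF _ zero_in_kern[OF t]] by fastforce

lemma sup_kern_size:
 "local_int f \<Longrightarrow> sup_kern \<beta> t f (x::'a::euclidean_space) \<le> 3 / t ^ DIM('a) * abs_int f (cball x t)"
 by (intro sup_kern_least kern_integral_bound)

lemma sup_kern_add:
 assumes "local_int f" "local_int g"
 shows "sup_kern \<beta> t (\<lambda>z. f z + g z) (x::'a::euclidean_space) \<le> sup_kern \<beta> t f x + sup_kern \<beta> t g x"
proof (rule sup_kern_least)
 fix \<psi> assume \<psi>: "\<psi> \<in> kern \<beta> t x"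
 have "(LINT z|lborel. (f z + g z) * \<psi> z) = (LINT z|lborel. f z * \<psi> z) + (LINT z|lborel. g z * \<psi> z)"
  using kern_integrable[OF assms(1) \<psi>] kern_integrable[OF assms(2) \<psi>]
  by (simp add: distrib_right)
 then show "\<bar>LINT z|lborel. (f z + g z) * \<psi> z\<bar> \<le> sup_kern \<beta> t f x + sup_kern \<beta> t g x"
  using sup_kern_upper[OF assms(1) \<psi>] sup_kern_upper[OF assms(2) \<psi>] by linarith
qed

lemma sup_kern_local:
 assumes "\<And>z. z \<in> cball x t \<Longrightarrow> f z = g z"
 shows "sup_kern \<beta> t f (x::'a::euclidean_space) = sup_kern \<beta> t g x"
 unfolding sup_kern_def
proof (intro SUP_cong refl arg_cong[of _ _ abs] Bochner_Integration.integral_cong)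
 fix \<psi> z assume "\<psi> \<in> kern \<beta> t x"
 then show "f z * \<psi> z = g z * \<psi> z"
  using assms[of z] kern_outside[of \<psi> \<beta> t x z] by (cases "z \<in> cball x t") (auto simp: not_le)
qed

lemma sup_kern_eq_0:
 assumes "\<And>z. z \<in> cball x t \<Longrightarrow> f z = 0"
 shows "sup_kern \<beta> t f (x::'a::euclidean_space) = 0"
proof -
 have "sup_kern \<beta> t (\<lambda>_. 0) x = 0"
  unfolding sup_kern_def using zero_in_kern[OF t, of \<beta> x] by (simp, subst cSUP_const) auto
 then show ?thesis using sup_kern_local[of x f "\<lambda>_. 0"] assms by simp
qed

text \<open>A kernel and its translate differ at every point by at most the Hoelder bound for the
  displacement \<open>x - x'\<close>, and both vanish outside the common ball
  \<open>cball y R\<close>.\<close>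

lemma kern_shift_integral_diff:
 assumes f: "local_int f" and \<psi>: "\<psi> \<in> kern \<beta> t (x::'a::euclidean_space)"
  and sub: "cball x t \<subseteq> cball y R" "cball x' t \<subseteq> cball y R"
 shows "\<bar>(LINT z|lborel. f z * \<psi> z) - (LINT z|lborel. f z * \<psi> (z + (x - x')))\<bar>
  \<le> (dist x x' / t) powr \<beta> / t ^ DIM('a) * abs_int f (cball y R)"
proof -
 let ?\<psi>' = "\<lambda>z. \<psi> (z + (x - x'))"
 have \<psi>': "?\<psi>' \<in> kern \<beta> t x'" by (rule kern_shift[OF \<psi>])
 note [measurable] = kern_measurable[OF \<beta>(1) t \<psi>] kern_measurable[OF \<beta>(1) t \<psi>']
 have "(LINT z|lborel. f z * \<psi> z) - (LINT z|lborel. f z * ?\<psi>' z) = (LINT z|lborel. f z * (\<psi> z - ?\<psi>' z))"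
  using kern_integrable[OF f \<psi>] kern_integrable[OF f \<psi>'] by (simp add: right_diff_distrib)
 also have "\<bar>...\<bar> \<le> (dist x x' / t) powr \<beta> / t ^ DIM('a) * abs_int f (cball y R)"
 proof (rule integrable_mult_bounded_cball(2)[OF f])
  fix z
  show "\<bar>\<psi> z - ?\<psi>' z\<bar> \<le> (dist x x' / t) powr \<beta> / t ^ DIM('a) * indicator (cball y R) z"
  proof (cases "z \<in> cball y R")
   case True
   have "dist z (z + (x - x')) = dist x x'" by (simp add: dist_norm norm_minus_commute)
   then show ?thesis using kern_Hoelder[OF \<psi>, of z "z + (x - x')"] True by simp
  next
   case False
   then have "t < dist x z" "t < dist x' z" using sub by (auto simp: subset_eq not_le[symmetric])
   then show ?thesis using kern_outside[OF \<psi>, of z] kern_outside[OF \<psi>', of z] t by (simp add: less_imp_le)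
  qed
 qed measurable
 finally show ?thesis .
qed

text \<open>Translation carries kernels at \<open>x\<close> to kernels at \<open>x'\<close>, so the
  estimate for one kernel survives the supremum. It makes \<open>sup_kern\<close> continuous, hence
  Borel, although the supremum is uncountable, and it later shows that large scales hardly vary over
  a cube.\<close>

lemma sup_kern_smooth:
 assumes f: "local_int f" and sub: "cball x t \<subseteq> cball y R" "cball x' t \<subseteq> cball y R"
 shows "sup_kern \<beta> t f (x::'a::euclidean_space)
  \<le> sup_kern \<beta> t f x' + (dist x x' / t) powr \<beta> / t ^ DIM('a) * abs_int f (cball y R)"
proof (rule sup_kern_least)
 fix \<psi> assume \<psi>: "\<psi> \<in> kern \<beta> t x"
 show "\<bar>LINT z|lborel. f z * \<psi> z\<bar> \<le> sup_kern \<beta> t f x' + (dist x x' / t) powr \<beta> / t ^ DIM('a) * abs_int f (cball y R)"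
  using kern_shift_integral_diff[OF f \<psi> sub] sup_kern_upper[OF f kern_shift[OF \<psi>, of x']] by linarith
qed

text \<open>Stated for an arbitrary \<open>u\<close> because it serves both the supremum and, in
  \<open>measurable_kernel_selection\<close>, the integrals against the translates of one
  kernel.\<close>

lemma continuous_Hoelder_local:
 fixes u :: "'a::euclidean_space \<Rightarrow> real"
 assumes f: "local_int f" and u: "\<And>x x' y R. cball x t \<subseteq> cball y R \<Longrightarrow> cball x' t \<subseteq> cball y R \<Longrightarrow>
   u x \<le> u x' + (dist x x' / t) powr \<beta> / t ^ DIM('a) * abs_int f (cball y R)"
 shows "continuous_on UNIV u"
proof -
 have "isCont u z" for z
  unfolding isCont_def
 proof (rule Lim_null_comparison[THEN LIM_zero_cancel])
  define K where "K = 1 / t ^ DIM('a) * abs_int f (cball z (t + 1))"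
  show "\<forall>\<^sub>F y in at z. norm (u y - u z) \<le> (dist y z / t) powr \<beta> * K"
  proof (rule eventually_at[THEN iffD2], intro exI[of _ 1] conjI ballI impI; (elim conjE)?)
   fix y assume "y \<noteq> z" "dist y z < 1"
   have 1: "cball y t \<subseteq> cball z (t + 1)"
   proof
    fix v assume "v \<in> cball y t"
    then show "v \<in> cball z (t + 1)"
     using dist_triangle[of z v y] \<open>dist y z < 1\<close> by (simp add: dist_commute)
   qed
   have 2: "cball z t \<subseteq> cball z (t + 1)" by auto
   show "norm (u y - u z) \<le> (dist y z / t) powr \<beta> * K"
    using u[OF 1 2] u[OF 2 1] by (auto simp: K_def dist_commute abs_le_iff algebra_simps)
  qed simp
  have "((\<lambda>y. (dist y z / t) powr \<beta>) \<longlongrightarrow> (dist z z / t) powr \<beta>) (at z)"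
   using \<beta> t by (intro tendsto_powr' tendsto_intros) auto
  then have "((\<lambda>y. (dist y z / t) powr \<beta> * K) \<longlongrightarrow> (dist z z / t) powr \<beta> * K) (at z)"
   by (rule tendsto_mult_right)
  then show "((\<lambda>y. (dist y z / t) powr \<beta> * K) \<longlongrightarrow> 0) (at z)" by simp
 qed
 then show ?thesis by (simp add: continuous_at_imp_continuous_on)
qed

lemma continuous_sup_kern:
 "local_int f \<Longrightarrow> continuous_on UNIV (sup_kern \<beta> t f :: 'a::euclidean_space \<Rightarrow> real)"
 by (rule continuous_Hoelder_local, assumption, rule sup_kern_smooth)

lemma measurable_sup_kern:
 "local_int f \<Longrightarrow> (sup_kern \<beta> t f :: 'a::euclidean_space \<Rightarrow> real) \<in> borel_measurable borel"
 by (intro borel_measurable_continuous_onI continuous_sup_kern)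

end

text \<open>A kernel of scale \<open>t\<close>, divided by \<open>2 ^ (DIM('a) + 1)\<close>, is a
  kernel of scale \<open>T\<close>: the support condition is weaker, \<open>t ^ DIM('a)\<close>
  costs \<open>2 ^ DIM('a)\<close>, and the Hoelder quotient costs 2^\<beta> \<le> 2. Thus one
  dyadic scale controls the whole octave of \<open>t\<close> below it.\<close>

lemma sup_kern_rescale:
 assumes \<beta>: "0 < \<beta>" "\<beta> \<le> 1" and t: "0 < t" and f: "local_int f" and T: "t \<le> T" "T \<le> 2 * t"
 shows "sup_kern \<beta> t f (x::'a::euclidean_space) \<le> 2 ^ (DIM('a) + 1) * sup_kern \<beta> T f x"
proof (rule sup_kern_least[OF \<beta> t])
 fix \<psi> assume \<psi>: "\<psi> \<in> kern \<beta> t x"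
 let ?c = "2 ^ (DIM('a) + 1) :: real"
 have "(\<lambda>z. \<psi> z / ?c) \<in> kern \<beta> T x"
  unfolding kern_def
 proof (intro CollectI conjI allI impI)
  fix z z'
  have "\<bar>\<psi> z / ?c - \<psi> z' / ?c\<bar> = \<bar>\<psi> z - \<psi> z'\<bar> / ?c" by (simp add: diff_divide_distrib[symmetric])
  also have "... \<le> (dist z z' / t) powr \<beta> / t ^ DIM('a) / ?c"
   using kern_Hoelder[OF \<psi>, of z z'] by (intro divide_right_mono) auto
  also have "... \<le> (2 * (dist z z' / T) powr \<beta>) * (2 ^ DIM('a) / T ^ DIM('a)) / ?c"
  proof (intro divide_right_mono)
   have "dist z z' / t \<le> 2 * (dist z z' / T)"
    using T t mult_left_mono[of T "2 * t" "dist z z'"] by (simp add: field_simps)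
   then have "(dist z z' / t) powr \<beta> \<le> (2 * (dist z z' / T)) powr \<beta>"
    using t \<beta> by (intro powr_mono2) auto
   also have "... = 2 powr \<beta> * (dist z z' / T) powr \<beta>" by (rule powr_mult)
   also have "2 powr \<beta> \<le> 2 powr (1::real)" using \<beta> by (intro powr_mono) auto
   finally have 1: "(dist z z' / t) powr \<beta> \<le> 2 * (dist z z' / T) powr \<beta>" by (simp add: mult_right_mono)
   have "T ^ DIM('a) \<le> (2 * t) ^ DIM('a)" using T t by (intro power_mono) auto
   then have 2: "1 / t ^ DIM('a) \<le> 2 ^ DIM('a) / T ^ DIM('a)"
    using t T by (simp add: field_simps power_mult_distrib)
   show "(dist z z' / t) powr \<beta> / t ^ DIM('a) \<le> (2 * (dist z z' / T) powr \<beta>) * (2 ^ DIM('a) / T ^ DIM('a))"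
    using mult_mono[OF 1 2] t by simp
  qed simp
  also have "... = (dist z z' / T) powr \<beta> / T ^ DIM('a)" by simp
  finally show "\<bar>\<psi> z / ?c - \<psi> z' / ?c\<bar> \<le> (dist z z' / T) powr \<beta> / T ^ DIM('a)" .
 qed (use T kern_outside[OF \<psi>] kern_integral[OF \<psi>] in auto)
 from sup_kern_upper[OF \<beta> _ f this] t T show "\<bar>LINT z|lborel. f z * \<psi> z\<bar> \<le> ?c * sup_kern \<beta> T f x"
  by (simp add: field_simps)
qed

section \<open>The unweighted \<open>L\<^sup>2\<close> bound\<close>

lemma sum_geometric_int_le:
 fixes r :: real
 assumes "finite J" "0 \<le> r" "r < 1" "\<And>j. j \<in> J \<Longrightarrow> j0 \<le> j"
 shows "(\<Sum>j\<in>J. r ^ nat (j - j0)) \<le> 1 / (1 - r)"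
proof -
 have inj: "inj_on (\<lambda>j. nat (j - j0)) J"
  using assms(4) by (auto simp: inj_on_def) (metis eq_diff_eq nat_eq_iff2 diff_ge_0_iff_ge nat_0_le add_diff_cancel_left' diff_add_cancel)
 have "(\<Sum>j\<in>J. r ^ nat (j - j0)) = (\<Sum>m\<in>(\<lambda>j. nat (j - j0)) ` J. r ^ m)"
  by (simp add: sum.reindex[OF inj])
 also have "... \<le> (\<Sum>m. r ^ m)"
  using assms by (intro sum_le_suminf summable_geometric) auto
 also have "... = 1 / (1 - r)" using assms by (intro suminf_geometric) auto
 finally show ?thesis .
qed

lemma sum_geometric_int_le2:
 fixes r :: real
 assumes "finite J" "0 \<le> r" "r < 1"
 shows "(\<Sum>j\<in>J. r ^ nat \<bar>j - j0\<bar>) \<le> 2 / (1 - r)"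
proof -
 have "(\<Sum>j\<in>J. r ^ nat \<bar>j - j0\<bar>) = (\<Sum>j\<in>{j\<in>J. j0 \<le> j}. r ^ nat \<bar>j - j0\<bar>) + (\<Sum>j\<in>{j\<in>J. \<not> j0 \<le> j}. r ^ nat \<bar>j - j0\<bar>)"
  using assms(1) by (subst sum.union_disjoint[symmetric]) (auto intro!: sum.cong)
 also have "(\<Sum>j\<in>{j\<in>J. j0 \<le> j}. r ^ nat \<bar>j - j0\<bar>) = (\<Sum>j\<in>{j\<in>J. j0 \<le> j}. r ^ nat (j - j0))"
  by (intro sum.cong) auto
 also have "... \<le> 1 / (1 - r)" by (rule sum_geometric_int_le) (use assms in auto)
 also have "(\<Sum>j\<in>{j\<in>J. \<not> j0 \<le> j}. r ^ nat \<bar>j - j0\<bar>) = (\<Sum>j\<in>uminus ` {j\<in>J. \<not> j0 \<le> j}. r ^ nat (j - (- j0)))"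
  by (subst sum.reindex) (auto intro!: sum.cong simp: inj_on_def)
 also have "... \<le> 1 / (1 - r)" by (rule sum_geometric_int_le) (use assms in auto)
 finally show ?thesis by simp
qed

lemma powi_2_ratio_powr:
 assumes "i \<le> j" shows "((2::real) powi i / 2 powi j) powr \<beta> = (2 powr - \<beta>) ^ nat (j - i)"
proof -
 have "(2::real) powi i / 2 powi j = 2 powr (- real (nat (j - i)))"
  using assms by (simp add: powr_real_of_int'[symmetric] powr_diff[symmetric])
 then show ?thesis by (simp add: powr_powr powr_power mult.commute)
qed

section \<open>Bounded functions of bounded support and kernel operators on them\<close>

lemma le_mult_indicatorD: "a \<le> (B::real) * indicator S x \<Longrightarrow> 0 \<le> B \<Longrightarrow> a \<le> B"
 by (cases "x \<in> S") auto

text \<open>This class is closed under sums, products, kernel operators and finite square functions,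
  and its members are integrable. Every exchange of integrals in the L^2 argument takes place inside
  it.\<close>

definition bdd_supp :: "('a::euclidean_space \<Rightarrow> real) \<Rightarrow> bool" where
 "bdd_supp u \<longleftrightarrow> u \<in> borel_measurable borel \<and> (\<exists>B R. \<forall>x. \<bar>u x\<bar> \<le> B * indicator (cball 0 R) x)"

lemma bdd_supp_measurable: "bdd_supp u \<Longrightarrow> u \<in> borel_measurable borel"
 by (simp add: bdd_supp_def)

lemma bdd_suppE:
 assumes "bdd_supp u"
 obtains B R where "0 \<le> B" "0 \<le> R" "\<And>x. \<bar>u x\<bar> \<le> B * indicator (cball 0 R) x"
proof -
 obtain B R where BR: "\<And>x. \<bar>u x\<bar> \<le> B * indicator (cball 0 R) x" using assms by (auto simp: bdd_supp_def)
 show ?thesis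
 proof (rule that[of "max 0 B" "max 0 R"])
  fix x
  have "\<bar>u x\<bar> \<le> B * indicator (cball 0 R) x" by (rule BR)
  also have "... \<le> max 0 B * indicator (cball 0 (max 0 R)) x"
   by (auto simp: indicator_def)
  finally show "\<bar>u x\<bar> \<le> max 0 B * indicator (cball 0 (max 0 R)) x" .
 qed auto
qed

lemma integrable_indicator_cball: "integrable lborel (\<lambda>x. B * indicator (cball (c::'a::euclidean_space) R) x :: real)"
 using emeasure_bounded_finite[of "cball c R"]
 by (intro integrable_mult_right integrable_real_indicator) auto

lemma bdd_supp_integrable: "bdd_supp u \<Longrightarrow> integrable lborel u"
proof -
 assume u: "bdd_supp u"
 obtain B R where "0 \<le> B" and BR: "\<And>x. \<bar>u x\<bar> \<le> B * indicator (cball 0 R) x" using bdd_suppE[OF u] by metis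
 show ?thesis
  by (rule Bochner_Integration.integrable_bound[OF integrable_indicator_cball[of B 0 R]])
    (use u order_trans[OF BR abs_ge_self] in \<open>auto simp: bdd_supp_def\<close>)
qed

lemma bdd_supp_add: "bdd_supp u \<Longrightarrow> bdd_supp v \<Longrightarrow> bdd_supp (\<lambda>x. u x + v x)"
proof -
 assume u: "bdd_supp u" and v: "bdd_supp v"
 obtain B R where BR: "0 \<le> B" "\<And>x. \<bar>u x\<bar> \<le> B * indicator (cball 0 R) x" using bdd_suppE[OF u] by metis
 obtain B' R' where BR': "0 \<le> B'" "\<And>x. \<bar>v x\<bar> \<le> B' * indicator (cball 0 R') x" using bdd_suppE[OF v] by metis
 have "\<bar>u x + v x\<bar> \<le> (B + B') * indicator (cball 0 (max R R')) x" for x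
  using BR(2)[of x] BR'(2)[of x] BR(1) BR'(1)
  by (cases "x \<in> cball 0 R"; cases "x \<in> cball 0 R'"; cases "x \<in> cball 0 (max R R')") auto
 then show ?thesis using u v by (auto simp: bdd_supp_def)
qed

lemma bdd_supp_sum: "finite I \<Longrightarrow> (\<And>i. i \<in> I \<Longrightarrow> bdd_supp (u i)) \<Longrightarrow> bdd_supp (\<lambda>x. \<Sum>i\<in>I. u i x)"
proof (induction I rule: finite_induct)
 case empty
 show ?case unfolding bdd_supp_def by (auto intro!: exI[of _ 0])
qed (simp add: bdd_supp_add)

lemma bdd_supp_mult: "bdd_supp u \<Longrightarrow> bdd_supp v \<Longrightarrow> bdd_supp (\<lambda>x. u x * v x)"
proof -
 assume u: "bdd_supp u" and v: "bdd_supp v"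
 obtain B R where BR: "0 \<le> B" "\<And>x. \<bar>u x\<bar> \<le> B * indicator (cball 0 R) x" using bdd_suppE[OF u] by metis
 obtain B' R' where BR': "0 \<le> B'" "\<And>x. \<bar>v x\<bar> \<le> B' * indicator (cball 0 R') x" using bdd_suppE[OF v] by metis
 have "\<bar>u x * v x\<bar> \<le> (B * B') * indicator (cball 0 R) x" for x
 proof -
  have "\<bar>v x\<bar> \<le> B'" by (rule le_mult_indicatorD[OF BR'(2) BR'(1)])
  then have "\<bar>u x\<bar> * \<bar>v x\<bar> \<le> (B * indicator (cball 0 R) x) * B'"
   using BR by (intro mult_mono) auto
  then show ?thesis by (simp add: abs_mult mult_ac)
 qed
 then show ?thesis using u v by (auto simp: bdd_supp_def)
qed

lemma bdd_supp_local_int: "bdd_supp u \<Longrightarrow> local_int u"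
proof -
 assume u: "bdd_supp u"
 have [measurable]: "u \<in> borel_measurable borel" by (rule bdd_supp_measurable[OF u])
 have "abs_nint u (cball c r) < top" for c r
 proof -
  have "abs_nint u (cball c r) \<le> (\<integral>\<^sup>+z. ennreal (norm (u z)) \<partial>lborel)"
   by (intro nn_integral_mono) (auto simp: indicator_def)
  also have "... < top" using bdd_supp_integrable[OF u] by (auto simp: integrable_iff_bounded)
  finally show ?thesis .
 qed
 then show ?thesis by (auto simp: local_int_def)
qed

lemma kern_bdd_supp:
 assumes "0 < \<beta>" "\<beta> \<le> 1" "0 < t" "\<psi> \<in> kern \<beta> t (x::'a::euclidean_space)"
 shows "bdd_supp \<psi>"
 unfolding bdd_supp_def
proof (intro conjI exI allI)
 show "\<psi> \<in> borel_measurable borel" by (rule kern_measurable[OF assms(1,3,4)])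
 fix z
 have "\<bar>\<psi> z\<bar> \<le> 3 / t ^ DIM('a) * indicator (cball x t) z" by (rule kern_bound[OF assms])
 also have "... \<le> 3 / t ^ DIM('a) * indicator (cball 0 (norm x + t)) z"
  using assms(3) norm_triangle_sub[of z x] by (intro mult_left_mono) (auto simp: indicator_def dist_norm norm_minus_commute)
 finally show "\<bar>\<psi> z\<bar> \<le> 3 / t ^ DIM('a) * indicator (cball 0 (norm x + t)) z" .
qed

text \<open>A jointly measurable kernel, bounded by \<open>A\<close> and supported within distance
  \<open>R\<close> of the diagonal. The conditions are symmetric in the two variables, so the
  adjoint operator is of the same kind.\<close>

definition kernel_op :: "('a::euclidean_space \<Rightarrow> 'a \<Rightarrow> real) \<Rightarrow> real \<Rightarrow> real \<Rightarrow> bool" where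
 "kernel_op k A R \<longleftrightarrow> (\<lambda>p. k (fst p) (snd p)) \<in> borel_measurable (lborel \<Otimes>\<^sub>M lborel) \<and> 0 \<le> A \<and>
   (\<forall>x z. \<bar>k x z\<bar> \<le> A * indicator (cball x R) z)"

lemma kernel_op_swap: "kernel_op k A R \<Longrightarrow> kernel_op (\<lambda>x z. k z x) A R"
proof -
 assume k: "kernel_op k A R"
 then have [measurable]: "(\<lambda>p. k (fst p) (snd p)) \<in> borel_measurable (lborel \<Otimes>\<^sub>M lborel)" by (simp add: kernel_op_def)
 have "(\<lambda>p. (\<lambda>p. k (fst p) (snd p)) (snd p, fst p)) \<in> borel_measurable (lborel \<Otimes>\<^sub>M lborel)" by measurable
 moreover have "\<bar>k z x\<bar> \<le> A * indicator (cball x R) z" for x z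
 proof -
  have "indicator (cball x R) z = (indicator (cball z R) x :: real)"
   by (auto simp: indicator_def dist_commute)
  then show ?thesis using k by (simp add: kernel_op_def)
 qed
 ultimately show ?thesis using k unfolding kernel_op_def by simp
qed

text \<open>Fubini: the integrand is dominated by a constant on the product of two balls that
  contain the supports of \<open>u\<close> and \<open>v\<close>.\<close>

lemma kernel_op_adjoint:
 fixes u v :: "'a::euclidean_space \<Rightarrow> real"
 assumes k: "kernel_op k A R" and u: "bdd_supp u" and v: "bdd_supp v"
 shows "(LINT x|lborel. u x * (LINT z|lborel. k x z * v z)) = (LINT z|lborel. v z * (LINT x|lborel. k x z * u x))"
proof -
 have [measurable]: "(\<lambda>p. k (fst p) (snd p)) \<in> borel_measurable (lborel \<Otimes>\<^sub>M lborel)"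
  "u \<in> borel_measurable borel" "v \<in> borel_measurable borel"
  using k u v by (auto simp: kernel_op_def bdd_supp_def)
 obtain B r where Br: "0 \<le> B" "\<And>x. \<bar>u x\<bar> \<le> B * indicator (cball 0 r) x" using bdd_suppE[OF u] by metis
 obtain B' r' where Br': "0 \<le> B'" "\<And>x. \<bar>v x\<bar> \<le> B' * indicator (cball 0 r') x" using bdd_suppE[OF v] by metis
 have A: "0 \<le> A" using k by (simp add: kernel_op_def)
 have kA: "\<bar>k x z\<bar> \<le> A" for x z
  by (rule le_mult_indicatorD[OF _ A, of _ "cball x R" z]) (use k in \<open>simp add: kernel_op_def\<close>)
 let ?S = "cball (0::'a) r \<times> cball (0::'a) r'"
 have fin: "emeasure (lborel \<Otimes>\<^sub>M lborel) ?S < \<infinity>"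
  using emeasure_bounded_finite[of "cball (0::'a) r"] emeasure_bounded_finite[of "cball (0::'a) r'"]
  by (subst lborel.emeasure_pair_measure_Times) (auto simp: ennreal_mult_less_top)
 have dom: "integrable (lborel \<Otimes>\<^sub>M lborel) (\<lambda>p. (B * A * B') * indicator ?S p :: real)"
  using fin by (intro integrable_mult_right integrable_real_indicator) auto
 have "integrable (lborel \<Otimes>\<^sub>M lborel) (\<lambda>p. u (fst p) * k (fst p) (snd p) * v (snd p))"
 proof (rule Bochner_Integration.integrable_bound[OF dom])
  show "AE p in lborel \<Otimes>\<^sub>M lborel. norm (u (fst p) * k (fst p) (snd p) * v (snd p)) \<le> norm ((B * A * B') * indicator ?S p :: real)"
  proof (rule AE_I2)
   fix p :: "'a \<times> 'a"
   have "\<bar>u (fst p)\<bar> * \<bar>k (fst p) (snd p)\<bar> * \<bar>v (snd p)\<bar>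
    \<le> (B * indicator (cball 0 r) (fst p)) * A * (B' * indicator (cball 0 r') (snd p))"
    using Br Br' A kA by (intro mult_mono) auto
   also have "... = (B * A * B') * indicator ?S p" by (cases p) (auto simp: indicator_def)
   finally show "norm (u (fst p) * k (fst p) (snd p) * v (snd p)) \<le> norm ((B * A * B') * indicator ?S p :: real)"
    by (simp add: abs_mult A Br(1) Br'(1))
  qed
 qed measurable
 then have I: "integrable (lborel \<Otimes>\<^sub>M lborel) (\<lambda>(x, z). u x * k x z * v z)" by (simp add: case_prod_beta')
 have F: "(LINT z|lborel. LINT x|lborel. u x * k x z * v z) = (LINT x|lborel. LINT z|lborel. u x * k x z * v z)"
  by (rule lborel_pair.Fubini_integral[OF I])
 have 1: "(LINT x|lborel. u x * k x z * v z) = v z * (LINT x|lborel. k x z * u x)" for z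
  unfolding integral_mult_right_zero[symmetric] by (simp add: mult_ac)
 have 2: "(LINT z|lborel. u x * k x z * v z) = u x * (LINT z|lborel. k x z * v z)" for x
  unfolding integral_mult_right_zero[symmetric] by (simp add: mult_ac)
 show ?thesis using F unfolding 1 2 by (rule sym)
qed

lemma kernel_op_bdd_supp:
 fixes u :: "'a::euclidean_space \<Rightarrow> real"
 assumes k: "kernel_op k A R" and u: "bdd_supp u"
 shows "bdd_supp (\<lambda>x. LINT z|lborel. k x z * u z)"
proof -
 have km [measurable]: "(\<lambda>p. k (fst p) (snd p)) \<in> borel_measurable (lborel \<Otimes>\<^sub>M lborel)"
  "u \<in> borel_measurable borel"
  using k u by (auto simp: kernel_op_def bdd_supp_def)
 have [measurable]: "(\<lambda>z. k x z) \<in> borel_measurable lborel" for x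
 proof -
  have "(\<lambda>z. (\<lambda>p. k (fst p) (snd p)) (x, z)) \<in> borel_measurable lborel" by measurable
  then show ?thesis by simp
 qed
 obtain B r where Br: "0 \<le> B" "\<And>x. \<bar>u x\<bar> \<le> B * indicator (cball 0 r) x" using bdd_suppE[OF u] by metis
 have A: "0 \<le> A" and kA: "\<bar>k x z\<bar> \<le> A * indicator (cball x R) z" for x z
  using k by (auto simp: kernel_op_def)
 have "\<bar>LINT z|lborel. k x z * u z\<bar> \<le> (A * B * measure lborel (cball (0::'a) r)) * indicator (cball 0 (R + r)) x" for x
 proof (cases "x \<in> cball 0 (R + r)")
  case True
  have le: "norm (k x z * u z) \<le> (A * B) * indicator (cball 0 r) z" for z
  proof -
   have "\<bar>k x z\<bar> \<le> A" by (rule le_mult_indicatorD[OF kA A])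
   then have "\<bar>k x z\<bar> * \<bar>u z\<bar> \<le> A * (B * indicator (cball 0 r) z)" using Br A by (intro mult_mono) auto
   then show ?thesis by (simp add: abs_mult mult_ac)
  qed
  have I: "integrable lborel (\<lambda>z. k x z * u z)"
   by (rule Bochner_Integration.integrable_bound[OF integrable_indicator_cball[of "A * B" 0 r]])
     (use order_trans[OF le abs_ge_self] in auto)
  have "\<bar>LINT z|lborel. k x z * u z\<bar> \<le> (LINT z|lborel. norm (k x z * u z))"
   using integral_norm_bound[of lborel "\<lambda>z. k x z * u z"] by simp
  also have "... \<le> (LINT z|lborel. (A * B) * indicator (cball (0::'a) r) z)"
   by (intro integral_mono integrable_norm I integrable_indicator_cball le)
  also have "... = A * B * measure lborel (cball (0::'a) r)" by simp
  finally show ?thesis using True by simp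
 next
  case False
  have z0: "k x z * u z = 0" for z
  proof (rule ccontr)
   assume "k x z * u z \<noteq> 0"
   then have "z \<in> cball x R" "z \<in> cball 0 r"
    using kA[of x z] Br(2)[of z] by (auto split: split_indicator_asm)
   then have "norm x \<le> R + r" using norm_triangle_ineq[of "x - z" z] by (simp add: dist_norm)
   with False show False by simp
  qed
  have "(LINT z|lborel. k x z * u z) = (LINT z|(lborel :: 'a measure). 0)"
   by (rule Bochner_Integration.integral_cong[OF refl]) (rule z0)
  then show ?thesis using False by simp
 qed
 moreover have "(\<lambda>x. LINT z|lborel. k x z * u z) \<in> borel_measurable borel"
 proof -
  have "(\<lambda>x. LINT z|lborel. (\<lambda>(x, z). k x z * u z) (x, z)) \<in> borel_measurable lborel"
   by (rule lborel.borel_measurable_lebesgue_integral) (simp add: case_prod_beta', measurable)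
  then show ?thesis by simp
 qed
 ultimately show ?thesis by (auto simp: bdd_supp_def)
qed

text \<open>A measurable choice of almost maximizing kernels: by Lindeloef, countably many kernels suffice.\<close>
lemma measurable_kernel_selection:
 fixes f :: "'a::euclidean_space \<Rightarrow> real"
 assumes \<beta>: "0 < \<beta>" "\<beta> \<le> 1" and t: "0 < t" and f: "local_int f"
 obtains k where "kernel_op k (3 / t ^ DIM('a)) t" "\<And>x. k x \<in> kern \<beta> t x"
  "\<And>x. sup_kern \<beta> t f x \<le> 2 * \<bar>LINT z|lborel. k x z * f z\<bar>"
proof -
 let ?a = "sup_kern \<beta> t f"
 define u where "u \<phi> x = (LINT z|lborel. f z * \<phi> (z - x))" for \<phi> x
 have shift: "(\<lambda>z. \<phi> (z - x)) \<in> kern \<beta> t x" if "\<phi> \<in> kern \<beta> t 0" for \<phi> x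
  using kern_shift[OF that, of x] by simp
 have u_cont: "continuous_on UNIV (u \<phi>)" if \<phi>: "\<phi> \<in> kern \<beta> t 0" for \<phi>
 proof (rule continuous_Hoelder_local[OF \<beta> t f])
  fix x x' y :: 'a and R assume sub: "cball x t \<subseteq> cball y R" "cball x' t \<subseteq> cball y R"
  show "u \<phi> x \<le> u \<phi> x' + (dist x x' / t) powr \<beta> / t ^ DIM('a) * abs_int f (cball y R)"
   using kern_shift_integral_diff[OF \<beta> t f shift[OF \<phi>] sub] by (auto simp: u_def algebra_simps)
 qed
 have a_cont: "continuous_on UNIV ?a" by (rule continuous_sup_kern[OF \<beta> t f])
 \<comment> \<open>\<open>U \<phi>\<close> is where the translates of the single kernel
   \<open>\<phi>\<close> reach more than half of the supremum. These sets are open by continuity and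
   cover all points with \<open>0 < ?a x\<close>, so Lindeloef's theorem leaves countably
   many.\<close>
 define U where "U \<phi> = {x. ?a x < 2 * \<bar>u \<phi> x\<bar>}" for \<phi>
 have U_open: "open (U \<phi>)" if "\<phi> \<in> kern \<beta> t 0" for \<phi>
  unfolding U_def by (intro open_Collect_less continuous_intros u_cont that a_cont)
 have ex: "\<exists>\<phi>\<in>kern \<beta> t 0. x \<in> U \<phi>" if "0 < ?a x" for x
 proof (rule ccontr)
  assume no: "\<not> ?thesis"
  have "?a x \<le> ?a x / 2"
  proof (rule sup_kern_least[OF \<beta> t])
   fix \<psi> assume "\<psi> \<in> kern \<beta> t x"
   from kern_shift[OF this, of 0] have "(\<lambda>z. \<psi> (z + x)) \<in> kern \<beta> t 0" by simp
   with no have "\<not> x \<in> U (\<lambda>z. \<psi> (z + x))" by blast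
   then show "\<bar>LINT z|lborel. f z * \<psi> z\<bar> \<le> ?a x / 2" by (simp add: U_def u_def not_less)
  qed
  with that show False by simp
 qed
 obtain F' where F': "F' \<subseteq> U ` kern \<beta> t 0" "countable F'" "\<Union>F' = \<Union>(U ` kern \<beta> t 0)"
  using Lindelof[of "U ` kern \<beta> t 0"] U_open by blast
 then obtain \<Phi> where \<Phi>: "\<Phi> \<subseteq> kern \<beta> t 0" "countable \<Phi>" "F' = U ` \<Phi>"
  by (metis countable_subset_image)
 \<comment> \<open>The zero kernel keeps the family nonempty for the enumeration. Where the supremum
   vanishes, every index is acceptable.\<close>
 define \<Phi>' where "\<Phi>' = insert (\<lambda>_. 0) \<Phi>"
 have \<Phi>': "countable \<Phi>'" "\<Phi>' \<noteq> {}" "\<Phi>' \<subseteq> kern \<beta> t 0"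
  using \<Phi> zero_in_kern[OF t] by (auto simp: \<Phi>'_def)
 define \<phi> where "\<phi> = from_nat_into \<Phi>'"
 have \<phi>: "\<phi> m \<in> kern \<beta> t 0" for m using from_nat_into[OF \<Phi>'(2)] \<Phi>'(3) by (auto simp: \<phi>_def)
 have ex_m: "\<exists>m. ?a x \<le> 2 * \<bar>u (\<phi> m) x\<bar>" for x
 proof (cases "0 < ?a x")
  case True
  then have "x \<in> \<Union>F'" using ex F'(3) by blast
  then obtain \<xi> where "\<xi> \<in> \<Phi>" "x \<in> U \<xi>" using \<Phi>(3) by auto
  moreover obtain m where "\<phi> m = \<xi>"
   using from_nat_into_surj[OF \<Phi>'(1), of \<xi>] \<open>\<xi> \<in> \<Phi>\<close> by (auto simp: \<phi>_def \<Phi>'_def)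
  ultimately show ?thesis by (auto simp: U_def intro!: exI[of _ m] less_imp_le)
 qed auto
 \<comment> \<open>The least admissible index is a Borel function of the point, because each
   admissibility condition compares Borel functions.\<close>
 define s where "s x = (LEAST m. ?a x \<le> 2 * \<bar>u (\<phi> m) x\<bar>)" for x
 have s: "?a x \<le> 2 * \<bar>u (\<phi> (s x)) x\<bar>" for x unfolding s_def by (rule LeastI_ex[OF ex_m])
 define k where "k x z = \<phi> (s x) (z - x)" for x z
 have kk: "k x \<in> kern \<beta> t x" for x unfolding k_def by (rule shift[OF \<phi>])
 have [measurable]: "?a \<in> borel_measurable borel" by (rule measurable_sup_kern[OF \<beta> t f])
 have [measurable]: "u (\<phi> m) \<in> borel_measurable borel" for m
  by (rule borel_measurable_continuous_onI[OF u_cont[OF \<phi>]])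
 have [measurable]: "\<phi> m \<in> borel_measurable borel" for m
  by (rule kern_measurable[OF \<beta>(1) t \<phi>])
 have [measurable]: "s \<in> measurable borel (count_space UNIV)" unfolding s_def by measurable
 have "(\<lambda>p. \<phi> (s (fst p)) (snd p - fst p)) \<in> borel_measurable (borel \<Otimes>\<^sub>M borel)"
  by measurable
 then have "(\<lambda>p. k (fst p) (snd p)) \<in> borel_measurable (lborel \<Otimes>\<^sub>M lborel)"
  unfolding k_def by (simp cong: measurable_cong_sets add: sets_pair_measure_cong[of lborel borel lborel borel])
 then have "kernel_op k (3 / t ^ DIM('a)) t"
  using t kern_bound[OF \<beta> t kk] by (auto simp: kernel_op_def)
 moreover have "?a x \<le> 2 * \<bar>LINT z|lborel. k x z * f z\<bar>" for x
  using s[of x] by (simp add: u_def k_def mult.commute)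
 ultimately show ?thesis using kk that by blast
qed

lemma ennreal_abs_integral_le:
 fixes f :: "'a \<Rightarrow> real"
 shows "ennreal \<bar>LINT z|M. f z\<bar> \<le> (\<integral>\<^sup>+z. ennreal \<bar>f z\<bar> \<partial>M)"
 using integral_norm_bound_ennreal[of M f] by (cases "integrable M f") (auto simp: not_integrable_integral_eq)

text \<open>The cancellation of the finer kernel meets the smoothness of the coarser one:
  \<integral> \<psi> \<psi>' = \<integral> \<psi> (\<psi>' - \<psi>'(x)), and on the support of
  \<psi> the difference is at most (t / t')^\<beta> / t'^n. The remaining constant bounds the L^1
  norm of \<psi>, and the indicator records that the supports must meet.\<close>

lemma kern_almost_orthogonal:
 fixes x x' :: "'a::euclidean_space"
 assumes \<beta>: "0 < \<beta>" "\<beta> \<le> 1" and t: "0 < t" "t \<le> t'" and \<psi>: "\<psi> \<in> kern \<beta> t x" and \<psi>': "\<psi>' \<in> kern \<beta> t' x'"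
 shows "\<bar>LINT z|lborel. \<psi> z * \<psi>' z\<bar>
  \<le> 3 * unit_ball_vol DIM('a) * (t / t') powr \<beta> / t' ^ DIM('a) * indicator (cball x (2 * t')) x'"
proof (cases "x' \<in> cball x (2 * t')")
 case False
 have z0: "\<psi> z * \<psi>' z = 0" for z
 proof (rule ccontr)
  assume "\<psi> z * \<psi>' z \<noteq> 0"
  then have "dist x z \<le> t" "dist x' z \<le> t'"
   using kern_outside[OF \<psi>, of z] kern_outside[OF \<psi>', of z] by (auto simp: not_le[symmetric])
  then have "dist x x' \<le> 2 * t'" using dist_triangle2[of x x' z] t by simp
  with False show False by simp
 qed
 have "(LINT z|lborel. \<psi> z * \<psi>' z) = (LINT z|(lborel :: 'a measure). 0)"
  by (rule Bochner_Integration.integral_cong[OF refl]) (rule z0)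
 then show ?thesis using False by simp
next
 case True
 have t': "0 < t'" using t by simp
 note [measurable] = kern_measurable[OF \<beta>(1) t(1) \<psi>] kern_measurable[OF \<beta>(1) t' \<psi>']
 have li: "local_int \<psi>" by (rule bdd_supp_local_int[OF kern_bdd_supp[OF \<beta> t(1) \<psi>]])
 have i1: "integrable lborel \<psi>" by (rule bdd_supp_integrable[OF kern_bdd_supp[OF \<beta> t(1) \<psi>]])
 have i2: "integrable lborel (\<lambda>z. \<psi> z * \<psi>' z)"
  by (intro bdd_supp_integrable bdd_supp_mult kern_bdd_supp[OF \<beta> t(1) \<psi>] kern_bdd_supp[OF \<beta> t' \<psi>'])
 define g where "g z = (\<psi>' z - \<psi>' x) * indicator (cball x t) z" for z
 have [measurable]: "g \<in> borel_measurable borel" unfolding g_def by measurable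
 have eq: "\<psi> z * g z = \<psi> z * \<psi>' z - \<psi>' x * \<psi> z" for z
  using kern_outside[OF \<psi>, of z] by (cases "z \<in> cball x t") (auto simp: g_def algebra_simps not_le)
 have "(LINT z|lborel. \<psi> z * g z) = (LINT z|lborel. \<psi> z * \<psi>' z) - \<psi>' x * (LINT z|lborel. \<psi> z)"
  unfolding eq using i1 i2 by simp
 then have "(LINT z|lborel. \<psi> z * \<psi>' z) = (LINT z|lborel. \<psi> z * g z)"
  by (simp add: kern_integral[OF \<psi>])
 also have "\<bar>...\<bar> \<le> (t / t') powr \<beta> / t' ^ DIM('a) * abs_int \<psi> (cball x t)"
 proof (rule integrable_mult_bounded_cball(2)[OF li])
  fix z
  show "\<bar>g z\<bar> \<le> (t / t') powr \<beta> / t' ^ DIM('a) * indicator (cball x t) z"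
  proof (cases "z \<in> cball x t")
   case True
   then have "\<bar>g z\<bar> \<le> (dist z x / t') powr \<beta> / t' ^ DIM('a)"
    using kern_Hoelder[OF \<psi>', of z x] by (simp add: g_def)
   also have "... \<le> (t / t') powr \<beta> / t' ^ DIM('a)"
    using True t' \<beta> by (intro divide_right_mono powr_mono2) (auto simp: dist_commute)
   finally show ?thesis using True by simp
  qed (simp add: g_def)
 qed measurable
 finally have 1: "\<bar>LINT z|lborel. \<psi> z * \<psi>' z\<bar> \<le> (t / t') powr \<beta> / t' ^ DIM('a) * abs_int \<psi> (cball x t)" .
 have "abs_int \<psi> (cball x t) \<le> (LINT z|lborel. 3 / t ^ DIM('a) * indicator (cball x t) z)"
  unfolding abs_int_def
 proof (intro integral_mono local_int_integrable li integrable_indicator_cball)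
  fix z
  show "\<bar>\<psi> z\<bar> * indicator (cball x t) z \<le> 3 / t ^ DIM('a) * indicator (cball x t) z"
   using kern_bound[OF \<beta> t(1) \<psi>, of z] by (auto split: split_indicator)
 qed
 also have "... = 3 * unit_ball_vol DIM('a)" using t by (simp add: content_cball)
 finally have "(t / t') powr \<beta> / t' ^ DIM('a) * abs_int \<psi> (cball x t) \<le> (t / t') powr \<beta> / t' ^ DIM('a) * (3 * unit_ball_vol DIM('a))"
  using t' by (intro mult_left_mono) auto
 with 1 show ?thesis using True by (simp add: mult_ac)
qed

lemma nn_integral_square_cball:
 fixes u :: "'a::euclidean_space \<Rightarrow> real"
 assumes [measurable]: "u \<in> borel_measurable borel" and \<rho>: "0 \<le> \<rho>"
 shows "(\<integral>\<^sup>+x. \<integral>\<^sup>+x'. ennreal ((u x)\<^sup>2) * indicator (cball x \<rho>) x' \<partial>lborel \<partial>lborel)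
   = ennreal (unit_ball_vol DIM('a) * \<rho> ^ DIM('a)) * (\<integral>\<^sup>+x. ennreal ((u x)\<^sup>2) \<partial>lborel)"
  and "(\<integral>\<^sup>+x. \<integral>\<^sup>+x'. ennreal ((u x')\<^sup>2) * indicator (cball x \<rho>) x' \<partial>lborel \<partial>lborel)
   = ennreal (unit_ball_vol DIM('a) * \<rho> ^ DIM('a)) * (\<integral>\<^sup>+x. ennreal ((u x)\<^sup>2) \<partial>lborel)"
proof -
 show 1: "(\<integral>\<^sup>+x. \<integral>\<^sup>+x'. ennreal ((u x)\<^sup>2) * indicator (cball x \<rho>) x' \<partial>lborel \<partial>lborel)
   = ennreal (unit_ball_vol DIM('a) * \<rho> ^ DIM('a)) * (\<integral>\<^sup>+x. ennreal ((u x)\<^sup>2) \<partial>lborel)"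
  using \<rho> by (subst nn_integral_cmult_indicator, simp)
    (simp add: emeasure_cball nn_integral_multc mult.commute[of _ "nn_integral _ _"])
 have ind: "indicator (cball x \<rho>) x' = (if dist x x' \<le> \<rho> then 1 else 0 :: ennreal)" for x x' :: 'a
  by (simp add: indicator_def)
 have "(\<integral>\<^sup>+x. \<integral>\<^sup>+x'. ennreal ((u x')\<^sup>2) * (if dist x x' \<le> \<rho> then 1 else 0) \<partial>lborel \<partial>lborel)
   = (\<integral>\<^sup>+x'. \<integral>\<^sup>+x. ennreal ((u x')\<^sup>2) * (if dist x x' \<le> \<rho> then 1 else 0) \<partial>lborel \<partial>lborel)"
  by (rule lborel_pair.Fubini') measurable
 also have "... = (\<integral>\<^sup>+x. \<integral>\<^sup>+x'. ennreal ((u x)\<^sup>2) * (if dist x x' \<le> \<rho> then 1 else 0) \<partial>lborel \<partial>lborel)"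
  by (simp add: dist_commute)
 finally show "(\<integral>\<^sup>+x. \<integral>\<^sup>+x'. ennreal ((u x')\<^sup>2) * indicator (cball x \<rho>) x' \<partial>lborel \<partial>lborel)
   = ennreal (unit_ball_vol DIM('a) * \<rho> ^ DIM('a)) * (\<integral>\<^sup>+x. ennreal ((u x)\<^sup>2) \<partial>lborel)"
  using 1 unfolding ind by simp
qed

text \<open>Schur's test in crude form: the product \<bar>u(x) v(x')\<bar> is at most u(x)^2 +
  v(x')^2, and integrating each square over a ball of radius \<open>\<rho>\<close> in the other
  variable contributes its volume. The initial bound \<open>ennreal_abs_integral_le\<close> also
  covers integrands that are not integrable, whose integral is 0 by convention, so \<open>m\<close>
  enters with a size bound only.\<close>

lemma schur_bilinear:
 fixes u v :: "'a::euclidean_space \<Rightarrow> real"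
 assumes u: "bdd_supp u" and v: "bdd_supp v" and \<rho>: "0 \<le> \<rho>" and M: "0 \<le> M"
  and m: "\<And>x x'. \<bar>m x x'\<bar> \<le> M * indicator (cball x \<rho>) x'"
 shows "\<bar>LINT x|lborel. u x * (LINT x'|lborel. v x' * m x x')\<bar>
  \<le> M * (unit_ball_vol DIM('a) * \<rho> ^ DIM('a)) * ((LINT x|lborel. (u x)\<^sup>2) + (LINT x|lborel. (v x)\<^sup>2))"
proof -
 have [measurable]: "u \<in> borel_measurable borel" "v \<in> borel_measurable borel" using u v by (auto simp: bdd_supp_def)
 let ?V = "unit_ball_vol DIM('a) * \<rho> ^ DIM('a)"
 have sq: "(\<integral>\<^sup>+x. ennreal ((w x)\<^sup>2) \<partial>lborel) = ennreal (LINT x|lborel. (w x)\<^sup>2)" if "bdd_supp w" for w :: "'a \<Rightarrow> real"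
  using bdd_supp_integrable[OF bdd_supp_mult[OF that that]]
  by (intro nn_integral_eq_integral) (auto simp: power2_eq_square)
 have "ennreal \<bar>LINT x|lborel. u x * (LINT x'|lborel. v x' * m x x')\<bar>
  \<le> (\<integral>\<^sup>+x. ennreal \<bar>u x * (LINT x'|lborel. v x' * m x x')\<bar> \<partial>lborel)"
  by (rule ennreal_abs_integral_le)
 also have "... \<le> (\<integral>\<^sup>+x. \<integral>\<^sup>+x'. ennreal M * (ennreal ((u x)\<^sup>2) * indicator (cball x \<rho>) x' + ennreal ((v x')\<^sup>2) * indicator (cball x \<rho>) x') \<partial>lborel \<partial>lborel)"
 proof (intro nn_integral_mono)
  fix x
  have "u x * (LINT x'|lborel. v x' * m x x') = (LINT x'|lborel. u x * (v x' * m x x'))"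
   by simp
  then have "ennreal \<bar>u x * (LINT x'|lborel. v x' * m x x')\<bar> \<le> (\<integral>\<^sup>+x'. ennreal \<bar>u x * (v x' * m x x')\<bar> \<partial>lborel)"
   using ennreal_abs_integral_le[of lborel "\<lambda>x'. u x * (v x' * m x x')"] by simp
  also have "... \<le> (\<integral>\<^sup>+x'. ennreal M * (ennreal ((u x)\<^sup>2) * indicator (cball x \<rho>) x' + ennreal ((v x')\<^sup>2) * indicator (cball x \<rho>) x') \<partial>lborel)"
  proof (intro nn_integral_mono)
   fix x'
   have "\<bar>u x * (v x' * m x x')\<bar> = (\<bar>u x\<bar> * \<bar>v x'\<bar>) * \<bar>m x x'\<bar>" by (simp add: abs_mult)
   also have "... \<le> ((u x)\<^sup>2 + (v x')\<^sup>2) * (M * indicator (cball x \<rho>) x')"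
   proof (intro mult_mono m)
    have "2 * (\<bar>u x\<bar> * \<bar>v x'\<bar>) \<le> (u x)\<^sup>2 + (v x')\<^sup>2"
     using sum_squares_bound[of "\<bar>u x\<bar>" "\<bar>v x'\<bar>"] by simp
    then show "\<bar>u x\<bar> * \<bar>v x'\<bar> \<le> (u x)\<^sup>2 + (v x')\<^sup>2" by (smt (verit) mult_nonneg_nonneg abs_ge_zero)
   qed auto
   also have "... = M * ((u x)\<^sup>2 * indicator (cball x \<rho>) x' + (v x')\<^sup>2 * indicator (cball x \<rho>) x')"
    by (simp add: algebra_simps)
   finally have "ennreal \<bar>u x * (v x' * m x x')\<bar> \<le> ennreal (M * ((u x)\<^sup>2 * indicator (cball x \<rho>) x' + (v x')\<^sup>2 * indicator (cball x \<rho>) x'))"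
    by (rule ennreal_leI)
   also have "... = ennreal M * (ennreal ((u x)\<^sup>2) * indicator (cball x \<rho>) x' + ennreal ((v x')\<^sup>2) * indicator (cball x \<rho>) x')"
    using M by (auto simp: ennreal_mult split: split_indicator)
   finally show "ennreal \<bar>u x * (v x' * m x x')\<bar>
    \<le> ennreal M * (ennreal ((u x)\<^sup>2) * indicator (cball x \<rho>) x' + ennreal ((v x')\<^sup>2) * indicator (cball x \<rho>) x')" .
  qed
  finally show "ennreal \<bar>u x * (LINT x'|lborel. v x' * m x x')\<bar>
    \<le> (\<integral>\<^sup>+x'. ennreal M * (ennreal ((u x)\<^sup>2) * indicator (cball x \<rho>) x' + ennreal ((v x')\<^sup>2) * indicator (cball x \<rho>) x') \<partial>lborel)" .
 qed
 also have "... = ennreal M * ((\<integral>\<^sup>+x. \<integral>\<^sup>+x'. ennreal ((u x)\<^sup>2) * indicator (cball x \<rho>) x' \<partial>lborel \<partial>lborel)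
   + (\<integral>\<^sup>+x. \<integral>\<^sup>+x'. ennreal ((v x')\<^sup>2) * indicator (cball x \<rho>) x' \<partial>lborel \<partial>lborel))"
 proof -
  have ind: "indicator (cball x \<rho>) x' = (if dist x x' \<le> \<rho> then 1 else 0 :: ennreal)" for x x' :: 'a
   by (simp add: indicator_def)
  have [measurable]: "(\<lambda>x. \<integral>\<^sup>+x'. ennreal ((v x')\<^sup>2) * (if dist x x' \<le> \<rho> then 1 else 0) \<partial>lborel) \<in> borel_measurable borel"
   "(\<lambda>x. \<integral>\<^sup>+x'. ennreal ((u x)\<^sup>2) * (if dist x x' \<le> \<rho> then 1 else 0) \<partial>lborel) \<in> borel_measurable borel"
   by measurable
  show ?thesis unfolding ind
   by (simp add: nn_integral_cmult nn_integral_add)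
 qed
 also have "... = ennreal (M * ?V * ((LINT x|lborel. (u x)\<^sup>2) + (LINT x|lborel. (v x)\<^sup>2)))"
 proof -
  have "0 \<le> (LINT x|lborel. (u x)\<^sup>2)" "0 \<le> (LINT x|lborel. (v x)\<^sup>2)" by auto
  then show ?thesis using M \<rho>
   by (simp add: nn_integral_square_cball sq u v ennreal_mult distrib_left mult.assoc)
 qed
 finally show ?thesis using M \<rho> by (subst (asm) ennreal_le_iff) auto
qed

text \<open>The \<open>T T\<^sup>*\<close> argument: after choosing a measurable almost maximizing kernel at each scale, kernels
 at different scales are almost orthogonal.\<close>
theorem sup_kern_L2:
 assumes \<beta>: "0 < \<beta>" "\<beta> \<le> 1"
 shows "\<exists>C>0. \<forall>J. \<forall>f::'a::euclidean_space \<Rightarrow> real. finite J \<longrightarrow> bdd_supp f \<longrightarrow>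
   (\<Sum>j\<in>J. LINT x|lborel. (sup_kern \<beta> (2 powi j) f x)\<^sup>2) \<le> C * (LINT x|lborel. (f x)\<^sup>2)"
proof -
 define r :: real where "r = 2 powr - \<beta>"
 have r: "0 \<le> r" "r < 1" using \<beta> by (auto simp: r_def powr_less_one)
 define v where "v = unit_ball_vol DIM('a)"
 have v: "0 < v" by (simp add: v_def)
 define c where "c = 3 * v\<^sup>2 * 2 ^ DIM('a)"
 have c: "0 < c" using v by (simp add: c_def)
 \<comment> \<open>The two-sided geometric sum \<open>2 / (1 - r)\<close> enters twice, once for
   each of the terms \<open>\<gamma> i\<close> and \<open>\<gamma> j\<close>.\<close>
 define Q where "Q = c * (4 / (1 - r))"
 have Q: "0 < Q" using c r by (simp add: Q_def)
 have "(\<Sum>j\<in>J. LINT x|lborel. (sup_kern \<beta> (2 powi j) f x)\<^sup>2) \<le> 4 * Q * (LINT x|lborel. (f x)\<^sup>2)"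
  if J: "finite J" and f: "bdd_supp f" for J and f :: "'a \<Rightarrow> real"
 proof -
  define t where "t j = (2::real) powi j" for j
  have t: "0 < t j" for j by (simp add: t_def)
  have li: "local_int f" by (rule bdd_supp_local_int[OF f])
  have "\<exists>k. kernel_op k (3 / t j ^ DIM('a)) (t j) \<and> (\<forall>x. k x \<in> kern \<beta> (t j) x) \<and>
   (\<forall>x. sup_kern \<beta> (t j) f x \<le> 2 * \<bar>LINT z|lborel. k x z * f z\<bar>)" for j
   by (rule measurable_kernel_selection[OF \<beta> t li]) blast
  then obtain k where k: "\<And>j. kernel_op (k j) (3 / t j ^ DIM('a)) (t j)"
   and kk: "\<And>j x. k j x \<in> kern \<beta> (t j) x"
   and sel: "\<And>j x. sup_kern \<beta> (t j) f x \<le> 2 * \<bar>LINT z|lborel. k j x z * f z\<bar>" by metis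
  define g where "g j x = (LINT z|lborel. k j x z * f z)" for j x
  \<comment> \<open>If T_j denotes the operator with kernel \<open>k j\<close>, then
    \<open>g j\<close> is T_j f and \<open>h j\<close> is the adjoint of T_j applied to
    \<open>g j\<close>. Thus \<open>\<gamma> j\<close>, the squared norm of \<open>g j\<close>, is
    also the inner product of \<open>f\<close> with \<open>h j\<close>.\<close>
  define h where "h j z = (LINT x|lborel. k j x z * g j x)" for j z
  have g: "bdd_supp (g j)" for j unfolding g_def by (rule kernel_op_bdd_supp[OF k f])
  have h: "bdd_supp (h j)" for j unfolding h_def by (rule kernel_op_bdd_supp[OF kernel_op_swap[OF k] g])
  define \<gamma> where "\<gamma> j = (LINT x|lborel. (g j x)\<^sup>2)" for j
  have \<gamma>0: "0 \<le> \<gamma> j" for j by (simp add: \<gamma>_def)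
  define G where "G = (\<Sum>j\<in>J. \<gamma> j)"
  have sq_int: "integrable lborel (\<lambda>x. (w x)\<^sup>2)" if "bdd_supp w" for w :: "'a \<Rightarrow> real"
   using bdd_supp_integrable[OF bdd_supp_mult[OF that that]] by (simp add: power2_eq_square)
  have S1: "(LINT x|lborel. (sup_kern \<beta> (2 powi j) f x)\<^sup>2) \<le> 4 * \<gamma> j" for j
  proof -
   have "(LINT x|lborel. (sup_kern \<beta> (2 powi j) f x)\<^sup>2) \<le> (LINT x|lborel. 4 * (g j x)\<^sup>2)"
   proof (rule integral_mono')
    fix x
    have "(sup_kern \<beta> (t j) f x)\<^sup>2 \<le> (2 * \<bar>g j x\<bar>)\<^sup>2"
     using sel[of j x] sup_kern_nonneg[OF \<beta> t li, of j x] unfolding g_def by (intro power_mono)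
    then show "(sup_kern \<beta> (2 powi j) f x)\<^sup>2 \<le> 4 * (g j x)\<^sup>2" by (simp add: t_def power_mult_distrib)
   qed (use sq_int[OF g] in auto)
   then show ?thesis by (simp add: \<gamma>_def)
  qed
  have S2: "\<gamma> j = (LINT z|lborel. f z * h j z)" for j
   using kernel_op_adjoint[OF k g f, of j] by (simp add: \<gamma>_def h_def g_def power2_eq_square)
  \<comment> \<open>The inner product of \<open>h j\<close> and \<open>h i\<close> is that of
    \<open>g i\<close> with T_i composed with the adjoint of T_j, applied to \<open>g j\<close>. Its
    kernel \<open>m\<close> integrates the product of two intrinsic kernels at scales i \<le> j, so
    almost orthogonality applies and Schur's test finishes.\<close>
  have S3': "\<bar>LINT z|lborel. h j z * h i z\<bar> \<le> c * r ^ nat (j - i) * (\<gamma> i + \<gamma> j)" if ij: "i \<le> j" for i j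
  proof -
   have tij: "t i \<le> t j" using ij by (simp add: t_def power_int_increasing)
   define m where "m x x' = (LINT z|lborel. k j x' z * k i x z)" for x x'
   have *: "(LINT z|lborel. k i x z * h j z) = (LINT x'|lborel. g j x' * m x x')" for x
    using kernel_op_adjoint[OF k[of j] g kern_bdd_supp[OF \<beta> t kk], of j i x] by (simp add: h_def m_def)
   have "(LINT z|lborel. h j z * h i z) = (LINT x|lborel. g i x * (LINT z|lborel. k i x z * h j z))"
    using kernel_op_adjoint[OF k g h, of i i j] by (simp add: h_def)
   then have "\<bar>LINT z|lborel. h j z * h i z\<bar> = \<bar>LINT x|lborel. g i x * (LINT x'|lborel. g j x' * m x x')\<bar>" by (simp add: *)
   also have "... \<le> (3 * v * (t i / t j) powr \<beta> / t j ^ DIM('a)) * (unit_ball_vol DIM('a) * (2 * t j) ^ DIM('a)) *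
     ((LINT x|lborel. (g i x)\<^sup>2) + (LINT x|lborel. (g j x)\<^sup>2))"
   proof (rule schur_bilinear[OF g g])
    fix x x'
    show "\<bar>m x x'\<bar> \<le> 3 * v * (t i / t j) powr \<beta> / t j ^ DIM('a) * indicator (cball x (2 * t j)) x'"
     using kern_almost_orthogonal[OF \<beta> t tij kk kk, of x x'] by (simp add: m_def v_def mult.commute)
   qed (use t v in \<open>auto simp: less_imp_le\<close>)
   also have "(3 * v * (t i / t j) powr \<beta> / t j ^ DIM('a)) * (unit_ball_vol DIM('a) * (2 * t j) ^ DIM('a))
     = c * r ^ nat (j - i)"
    using t[of j] powi_2_ratio_powr[OF ij, of \<beta>]
    by (simp add: c_def v_def[symmetric] power_mult_distrib power2_eq_square t_def r_def)
   finally show ?thesis by (simp add: \<gamma>_def)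
  qed
  have S3: "\<bar>LINT z|lborel. h j z * h i z\<bar> \<le> c * r ^ nat \<bar>j - i\<bar> * (\<gamma> i + \<gamma> j)" for i j
  proof (cases "i \<le> j")
   case False
   then show ?thesis using S3'[of j i] by (simp add: mult.commute[of "h j _"] add.commute)
  qed (use S3'[of i j] in simp)
  define H where "H z = (\<Sum>j\<in>J. h j z)" for z
  have H: "bdd_supp H" unfolding H_def by (rule bdd_supp_sum[OF J h])
  have G_eq: "G = (LINT z|lborel. f z * H z)"
   unfolding G_def S2 H_def sum_distrib_left
   by (subst Bochner_Integration.integral_sum) (auto intro: bdd_supp_integrable bdd_supp_mult f h)
  have "(LINT z|lborel. (H z)\<^sup>2) = (\<Sum>j\<in>J. \<Sum>i\<in>J. LINT z|lborel. h j z * h i z)"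
   unfolding H_def power2_eq_square sum_product
   by (subst Bochner_Integration.integral_sum) (auto intro!: Bochner_Integration.integral_sum sum.cong Bochner_Integration.integrable_sum bdd_supp_integrable bdd_supp_sum J bdd_supp_mult h)
  also have "... \<le> (\<Sum>j\<in>J. \<Sum>i\<in>J. c * r ^ nat \<bar>j - i\<bar> * (\<gamma> i + \<gamma> j))"
   by (intro sum_mono order_trans[OF abs_ge_self S3])
  also have "... = (\<Sum>j\<in>J. \<Sum>i\<in>J. c * r ^ nat \<bar>j - i\<bar> * \<gamma> i) + (\<Sum>j\<in>J. \<Sum>i\<in>J. c * r ^ nat \<bar>j - i\<bar> * \<gamma> j)"
   by (simp add: distrib_left sum.distrib)
  also have "(\<Sum>j\<in>J. \<Sum>i\<in>J. c * r ^ nat \<bar>j - i\<bar> * \<gamma> i) = (\<Sum>j\<in>J. \<Sum>i\<in>J. c * r ^ nat \<bar>i - j\<bar> * \<gamma> j)"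
   by (rule sum.swap)
  also have "... + (\<Sum>j\<in>J. \<Sum>i\<in>J. c * r ^ nat \<bar>j - i\<bar> * \<gamma> j)
    = 2 * (\<Sum>j\<in>J. c * \<gamma> j * (\<Sum>i\<in>J. r ^ nat \<bar>i - j\<bar>))"
   by (simp add: abs_minus_commute sum_distrib_left mult_ac)
  also have "... \<le> 2 * (\<Sum>j\<in>J. c * \<gamma> j * (2 / (1 - r)))"
   using c \<gamma>0 by (intro mult_left_mono sum_mono sum_geometric_int_le2 J r) auto
  also have "... = Q * G" unfolding G_def sum_distrib_left by (intro sum.cong) (simp_all add: Q_def)
  finally have HQ: "(LINT z|lborel. (H z)\<^sup>2) \<le> Q * G" .
  \<comment> \<open>The inner product of \<open>f\<close> and \<open>H\<close> is split with weights
    \<open>Q\<close> and \<open>1 / Q\<close>. Since the squared norm of \<open>H\<close> is at most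
    \<open>Q * G\<close>, its share is \<open>G\<close>, which is absorbed by
    \<open>2 * G\<close>.\<close>
  have "2 * G = (LINT z|lborel. 2 * (f z * H z))" by (simp add: G_eq)
  also have "... \<le> (LINT z|lborel. Q * (f z)\<^sup>2 + (1 / Q) * (H z)\<^sup>2)"
  proof (rule integral_mono)
   fix z
   have e: "(sqrt Q * f z)\<^sup>2 = Q * (f z)\<^sup>2" "(H z / sqrt Q)\<^sup>2 = (1 / Q) * (H z)\<^sup>2"
    "(sqrt Q * f z) * (H z / sqrt Q) = f z * H z"
    using Q by (auto simp: power_mult_distrib power_divide)
   have "2 * ((sqrt Q * f z) * (H z / sqrt Q)) \<le> (sqrt Q * f z)\<^sup>2 + (H z / sqrt Q)\<^sup>2"
    using sum_squares_bound[of "sqrt Q * f z" "H z / sqrt Q"] by (simp only: mult.assoc)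
   then show "2 * (f z * H z) \<le> Q * (f z)\<^sup>2 + (1 / Q) * (H z)\<^sup>2"
    unfolding e .
  qed (intro Bochner_Integration.integrable_add integrable_mult_right sq_int f H bdd_supp_integrable[OF bdd_supp_mult])+
  also have "... = Q * (LINT z|lborel. (f z)\<^sup>2) + (1 / Q) * (LINT z|lborel. (H z)\<^sup>2)"
   using sq_int[OF f] sq_int[OF H] by simp
  also have "... \<le> Q * (LINT z|lborel. (f z)\<^sup>2) + (1 / Q) * (Q * G)"
   using Q HQ by (intro add_left_mono mult_left_mono) auto
  also have "(1 / Q) * (Q * G) = G" using Q by simp
  finally have GQ: "G \<le> Q * (LINT z|lborel. (f z)\<^sup>2)" by simp
  have "(\<Sum>j\<in>J. LINT x|lborel. (sup_kern \<beta> (2 powi j) f x)\<^sup>2) \<le> (\<Sum>j\<in>J. 4 * \<gamma> j)"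
   by (intro sum_mono S1)
  also have "... = 4 * G" by (simp add: G_def sum_distrib_left)
  also have "... \<le> 4 * Q * (LINT x|lborel. (f x)\<^sup>2)" using GQ by simp
  finally show ?thesis .
 qed
 then show ?thesis using Q by (intro exI[of _ "4 * Q"]) auto
qed

section \<open>Dyadic cubes and the Calderon-Zygmund decomposition\<close>

text \<open>The half-open cube of side 2^-k around \<open>x\<close>; larger \<open>k\<close> means
  smaller cubes. Equality of integer parts makes membership an equivalence relation, so cubes of one
  generation form a partition, and nesting reduces to integer division by a power of 2.\<close>

definition dcube :: "int \<Rightarrow> 'a::euclidean_space \<Rightarrow> 'a set" where
 "dcube k x = {y. \<forall>b\<in>Basis. \<lfloor>(y \<bullet> b) * 2 powi k\<rfloor> = \<lfloor>(x \<bullet> b) * 2 powi k\<rfloor>}"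

lemma dcube_self [simp]: "x \<in> dcube k x"
 by (simp add: dcube_def)

lemma dcube_eq: "y \<in> dcube k x \<Longrightarrow> dcube k y = dcube k x"
 by (auto simp: dcube_def)

lemma dcube_antimono:
 assumes "k \<le> k'" shows "dcube k' x \<subseteq> dcube k x"
proof
 fix y assume y: "y \<in> dcube k' x"
 have fl: "\<lfloor>a * 2 powi k\<rfloor> = \<lfloor>a * 2 powi k'\<rfloor> div 2 ^ nat (k' - k)" for a :: real
 proof -
  have "(2::real) powi k' = 2 powi k * 2 ^ nat (k' - k)"
   using assms by (simp flip: power_int_add power_int_of_nat)
  then have "a * 2 powi k = (a * 2 powi k') / real_of_int (2 ^ nat (k' - k))" by simp
  then show ?thesis by (simp only:) (subst floor_divide_real_eq_div, auto)
 qed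
 from y show "y \<in> dcube k x" unfolding dcube_def fl by simp
qed

text \<open>The Euclidean norm is bounded by the sum of the coordinates, which gives
  \<open>DIM('a)\<close> side lengths in place of the square root; only constants are
  affected.\<close>

lemma dcube_dist_le:
 fixes x y :: "'a::euclidean_space"
 assumes "y \<in> dcube k x" shows "dist x y \<le> DIM('a) * 2 powi (- k)"
proof -
 have "\<bar>(x - y) \<bullet> b\<bar> \<le> 2 powi (- k)" if "b \<in> Basis" for b
 proof -
  have "\<lfloor>(y \<bullet> b) * 2 powi k\<rfloor> = \<lfloor>(x \<bullet> b) * 2 powi k\<rfloor>" using assms that by (auto simp: dcube_def)
  then have "\<bar>(x \<bullet> b) * 2 powi k - (y \<bullet> b) * 2 powi k\<bar> \<le> 1" by linarith
  then have "\<bar>(x - y) \<bullet> b\<bar> * 2 powi k \<le> 1"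
   by (simp add: inner_diff_left abs_mult left_diff_distrib[symmetric])
  then show ?thesis by (simp add: power_int_minus field_simps)
 qed
 then have "(\<Sum>b\<in>Basis. \<bar>(x - y) \<bullet> b\<bar>) \<le> of_nat (card (Basis :: 'a set)) * 2 powi (- k)"
  by (intro sum_bounded_above)
 then show ?thesis using norm_le_l1[of "x - y"] by (simp add: dist_norm)
qed

text \<open>The two boxes have the same volume, which gives the measure of the half-open cube; the
  open one provides a point of a countable dense set in every cube.\<close>

lemma dcube_box:
 obtains l :: "'a::euclidean_space" where
  "box l (l + 2 powi (- k) *\<^sub>R One) \<subseteq> dcube k x" "dcube k x \<subseteq> cbox l (l + 2 powi (- k) *\<^sub>R One)"
proof -
 define l where "l = (\<Sum>b\<in>Basis. (of_int \<lfloor>(x \<bullet> b) * 2 powi k\<rfloor> * 2 powi (- k)) *\<^sub>R b)"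
 have l: "l \<bullet> b = of_int \<lfloor>(x \<bullet> b) * 2 powi k\<rfloor> * 2 powi (- k)" if "b \<in> Basis" for b
  using that by (simp add: l_def)
 have eq: "\<lfloor>(y \<bullet> b) * 2 powi k\<rfloor> = \<lfloor>(x \<bullet> b) * 2 powi k\<rfloor> \<longleftrightarrow> l \<bullet> b \<le> y \<bullet> b \<and> y \<bullet> b < l \<bullet> b + 2 powi (- k)"
  if b: "b \<in> Basis" for y b
 proof -
  have "\<lfloor>(y \<bullet> b) * 2 powi k\<rfloor> = \<lfloor>(x \<bullet> b) * 2 powi k\<rfloor> \<longleftrightarrow>
   of_int \<lfloor>(x \<bullet> b) * 2 powi k\<rfloor> \<le> (y \<bullet> b) * 2 powi k \<and> (y \<bullet> b) * 2 powi k < of_int \<lfloor>(x \<bullet> b) * 2 powi k\<rfloor> + 1"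
   by (simp add: floor_eq_iff)
  also have "... \<longleftrightarrow> l \<bullet> b \<le> y \<bullet> b \<and> y \<bullet> b < l \<bullet> b + 2 powi (- k)"
   unfolding l[OF b] by (simp add: power_int_minus field_simps)
  finally show ?thesis .
 qed
 have D: "dcube k x = {y. \<forall>b\<in>Basis. l \<bullet> b \<le> y \<bullet> b \<and> y \<bullet> b < l \<bullet> b + 2 powi (- k)}"
  unfolding dcube_def using eq by blast
 show ?thesis
 proof (rule that[of l])
  show "box l (l + 2 powi (- k) *\<^sub>R One) \<subseteq> dcube k x"
   unfolding D by (rule subsetI) (simp add: mem_box inner_add_left less_imp_le)
  show "dcube k x \<subseteq> cbox l (l + 2 powi (- k) *\<^sub>R One)"
   unfolding D by (rule subsetI) (simp add: mem_box inner_add_left less_imp_le)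
 qed
qed

lemma sets_dcube [measurable]: "dcube k x \<in> sets borel"
proof -
 have "dcube k x = {y\<in>space borel. \<forall>b\<in>Basis. \<lfloor>(y \<bullet> b) * 2 powi k\<rfloor> = \<lfloor>(x \<bullet> b) * 2 powi k\<rfloor>}"
  by (simp add: dcube_def)
 also have "... \<in> sets borel" by measurable
 finally show ?thesis .
qed

lemma emeasure_dcube: "emeasure lborel (dcube k x :: 'a::euclidean_space set) = ennreal ((2 powi (- k)) ^ DIM('a))"
proof -
 obtain l :: 'a where l: "box l (l + 2 powi (- k) *\<^sub>R One) \<subseteq> dcube k x" "dcube k x \<subseteq> cbox l (l + 2 powi (- k) *\<^sub>R One)"
  by (rule dcube_box)
 have "emeasure lborel (box l (l + 2 powi (- k) *\<^sub>R One)) = ennreal ((2 powi (- k)) ^ DIM('a))"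
  "emeasure lborel (cbox l (l + 2 powi (- k) *\<^sub>R One)) = ennreal ((2 powi (- k)) ^ DIM('a))"
  by (simp_all add: emeasure_lborel_box_eq emeasure_lborel_cbox_eq inner_add_left)
 then show ?thesis
  using emeasure_mono[OF l(1), of lborel] emeasure_mono[OF l(2), of lborel] by (intro antisym) auto
qed

lemma countable_dcubes: "countable (range (dcube k :: 'a::euclidean_space \<Rightarrow> _))"
proof -
 obtain D :: "'a set" where D: "countable D" "\<And>X. open X \<Longrightarrow> X \<noteq> {} \<Longrightarrow> \<exists>d\<in>D. d \<in> X"
  using countable_dense_exists by metis
 have "\<exists>d\<in>D. dcube k x = dcube k d" for x :: 'a
 proof -
  obtain l :: 'a where l: "box l (l + 2 powi (- k) *\<^sub>R One) \<subseteq> dcube k x" by (rule dcube_box)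
  have "box l (l + 2 powi (- k) *\<^sub>R One) \<noteq> {}" by (simp add: box_ne_empty inner_add_left)
  then obtain d where "d \<in> D" "d \<in> box l (l + 2 powi (- k) *\<^sub>R One)" using D(2) by blast
  then show ?thesis using l dcube_eq[of d k x] by blast
 qed
 then have "range (dcube k :: 'a \<Rightarrow> _) \<subseteq> dcube k ` D" by blast
 then show ?thesis using D(1) by (meson countable_image countable_subset)
qed

text \<open>Each generation has countably many cubes, so an arbitrary predicate of the cube defines
  a countable union of Borel sets. This makes stopping generations, and functions constant on
  stopping cubes, measurable.\<close>

lemma sets_dcube_pred [measurable]: "{x. P (dcube k x)} \<in> sets borel"
proof -
 have "{x. P (dcube k x)} = (\<Union>Q\<in>{Q\<in>range (dcube k). P Q}. Q)"
  by (auto simp: dcube_eq) (metis dcube_self)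
 also have "... \<in> sets borel"
  by (rule sets.countable_UN'') (use countable_dcubes[of k] in \<open>auto intro: countable_subset\<close>)
 finally show ?thesis .
qed

lemma pred_dcube [measurable]: "Measurable.pred borel (\<lambda>x. P (dcube k x))"
 using sets_dcube_pred[of P k] by (simp add: pred_def)

lemma measurable_dcube_fun:
 fixes F :: "'a::euclidean_space set \<Rightarrow> real"
 shows "(\<lambda>x. F (dcube k x)) \<in> borel_measurable borel"
 by (rule measurableI) (use sets_dcube_pred[of "\<lambda>Q. F Q \<in> _" k] in \<open>auto simp: vimage_def\<close>)

lemma dcube_subset_open:
 fixes x :: "'a::euclidean_space"
 assumes "open U" "x \<in> U" shows "\<exists>m::nat. dcube (k0 + int m) x \<subseteq> U"
proof -
 obtain e where e: "0 < e" "ball x e \<subseteq> U" using assms openE by blast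
 have "((\<lambda>m. real DIM('a) * 2 powi (- k0) * (1/2) ^ m) \<longlongrightarrow> real DIM('a) * 2 powi (- k0) * 0) sequentially"
  by (intro tendsto_intros LIMSEQ_realpow_zero) auto
 then have "\<forall>\<^sub>F m in sequentially. real DIM('a) * 2 powi (- k0) * (1/2) ^ m < e"
  using e(1) by (intro order_tendstoD) auto
 then obtain m :: nat where m: "real DIM('a) * 2 powi (- k0) * (1/2) ^ m < e"
  using eventually_happens trivial_limit_sequentially by blast
 have eq: "(2::real) powi (- (k0 + int m)) = 2 powi (- k0) * (1/2) ^ m"
  by (simp add: power_int_diff power_divide)
 have "dcube (k0 + int m) x \<subseteq> ball x e"
 proof (intro subsetI)
  fix y assume "y \<in> dcube (k0 + int m) x"
  from dcube_dist_le[OF this] show "y \<in> ball x e" using m eq by (simp add: mult.assoc)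
 qed
 with e show ?thesis by blast
qed

section \<open>Stopping cubes\<close>

text \<open>The maximal dyadic cubes of generation at least \<open>k0\<close> with property \<open>P\<close>.\<close>
definition stop_cubes :: "int \<Rightarrow> ('a::euclidean_space set \<Rightarrow> bool) \<Rightarrow> 'a set set" where
 "stop_cubes k0 P = {dcube (k0 + int m) x |m x. P (dcube (k0 + int m) x) \<and> (\<forall>m'<m. \<not> P (dcube (k0 + int m') x))}"

text \<open>The generation, counted from \<open>k0\<close>, of the stopping cube around
  \<open>x\<close>. Where no cube satisfies \<open>P\<close> the value of \<open>LEAST\<close> is
  unspecified; the uses below avoid such points or multiply by a function that vanishes
  there.\<close>

definition stop_gen :: "int \<Rightarrow> ('a::euclidean_space set \<Rightarrow> bool) \<Rightarrow> 'a \<Rightarrow> nat" where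
 "stop_gen k0 P x = (LEAST m. P (dcube (k0 + int m) x))"

lemma stop_gen_eq:
 assumes "P (dcube (k0 + int m) x)" "\<forall>m'<m. \<not> P (dcube (k0 + int m') x)" "y \<in> dcube (k0 + int m) x"
 shows "stop_gen k0 P y = m"
proof -
 have "dcube (k0 + int m') y = dcube (k0 + int m') x" if "m' \<le> m" for m'
  using assms(3) dcube_antimono[of "k0 + int m'" "k0 + int m" x] that by (intro dcube_eq) auto
 then show ?thesis unfolding stop_gen_def
  using assms(1,2) by (intro Least_equality) (auto simp: not_less[symmetric])
qed

text \<open>A stopping cube can be recovered from any of its points, because the coarser cubes
  around that point are also those around the defining point. Disjointness follows at once, and the
  third claim supplies the parent cube on which \<open>P\<close> fails.\<close>

lemma stop_cubes_memD:
 assumes "Q \<in> stop_cubes k0 P" "y \<in> Q"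
 shows "Q = dcube (k0 + int (stop_gen k0 P y)) y" "P Q" "\<forall>m'<stop_gen k0 P y. \<not> P (dcube (k0 + int m') y)"
proof -
 obtain m x where Q: "Q = dcube (k0 + int m) x" "P (dcube (k0 + int m) x)" "\<forall>m'<m. \<not> P (dcube (k0 + int m') x)"
  using assms(1) by (auto simp: stop_cubes_def)
 have m: "stop_gen k0 P y = m" using stop_gen_eq[of P k0 m x y] Q assms(2) by blast
 have eq: "dcube (k0 + int m') y = dcube (k0 + int m') x" if "m' \<le> m" for m'
  using assms(2) Q(1) dcube_antimono[of "k0 + int m'" "k0 + int m" x] that by (intro dcube_eq) auto
 show "Q = dcube (k0 + int (stop_gen k0 P y)) y" "P Q" "\<forall>m'<stop_gen k0 P y. \<not> P (dcube (k0 + int m') y)"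
  using Q eq by (auto simp: m)
qed

lemma stop_cubes_disjoint: "disjoint_family_on (\<lambda>Q. Q) (stop_cubes k0 P)"
 unfolding disjoint_family_on_def using stop_cubes_memD(1) by blast

lemma stop_cubes_dcube: "Q \<in> stop_cubes k0 P \<Longrightarrow> \<exists>m x. Q = dcube (k0 + int m) x"
 by (auto simp: stop_cubes_def)

lemma stop_cubes_sets: "Q \<in> stop_cubes k0 P \<Longrightarrow> Q \<in> sets borel"
 by (auto simp: stop_cubes_def)

lemma stop_cubes_countable: "countable (stop_cubes k0 P)"
proof (rule countable_subset)
 show "stop_cubes k0 P \<subseteq> (\<Union>m. range (dcube (k0 + int m)))" by (auto simp: stop_cubes_def)
qed (auto intro: countable_dcubes)

lemma Union_stop_cubes: "\<Union>(stop_cubes k0 P) = {x. \<exists>m. P (dcube (k0 + int m) x)}"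
proof (intro set_eqI iffI)
 fix x assume "x \<in> {x. \<exists>m. P (dcube (k0 + int m) x)}"
 then obtain m where m: "P (dcube (k0 + int m) x)" by blast
 define m0 where "m0 = (LEAST m. P (dcube (k0 + int m) x))"
 have "P (dcube (k0 + int m0) x)" unfolding m0_def using m by (rule LeastI)
 moreover have "\<forall>m'<m0. \<not> P (dcube (k0 + int m') x)" unfolding m0_def using not_less_Least by blast
 ultimately have "dcube (k0 + int m0) x \<in> stop_cubes k0 P"
  unfolding stop_cubes_def by (intro CollectI exI[of _ m0] exI[of _ x] conjI refl)
 then show "x \<in> \<Union>(stop_cubes k0 P)" by (rule UnionI) simp
next
 fix x assume "x \<in> \<Union>(stop_cubes k0 P)"
 then obtain Q where "Q \<in> stop_cubes k0 P" "x \<in> Q" by blast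
 note D = stop_cubes_memD[OF this]
 have "P (dcube (k0 + int (stop_gen k0 P x)) x)" using D(2) by (subst D(1)[symmetric])
 then show "x \<in> {x. \<exists>m. P (dcube (k0 + int m) x)}" by blast
qed

lemma sets_Union_stop_cubes [measurable]: "\<Union>(stop_cubes k0 P) \<in> sets borel"
 by (rule sets.countable_Union[OF stop_cubes_countable[of k0 P]]) (auto intro: stop_cubes_sets)

lemma nn_integral_stop_cubes:
 assumes "f \<in> borel_measurable borel" "sets M = sets borel"
 shows "(\<integral>\<^sup>+Q. (\<integral>\<^sup>+x\<in>Q. f x \<partial>M) \<partial>count_space (stop_cubes k0 P)) = (\<integral>\<^sup>+x\<in>\<Union>(stop_cubes k0 P). f x \<partial>M)"
proof -
 have 1: "f \<in> borel_measurable M" unfolding measurable_cong_sets[OF assms(2) refl] by (rule assms(1))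
 have 2: "Q \<in> sets M" if "Q \<in> stop_cubes k0 P" for Q unfolding assms(2) by (rule stop_cubes_sets[OF that])
 show ?thesis
  using nn_integral_disjoint_family[OF stop_cubes_countable stop_cubes_disjoint 2 1] by (simp only: image_ident)
qed

lemma measurable_stop_gen [measurable]: "stop_gen k0 P \<in> measurable borel (count_space UNIV)"
 unfolding stop_gen_def by measurable

lemma measurable_stop_fun:
 fixes F :: "'a::euclidean_space set \<Rightarrow> real"
 shows "(\<lambda>x. F (dcube (k0 + int (stop_gen k0 P x)) x)) \<in> borel_measurable borel"
proof -
 have "(\<lambda>x. (\<lambda>m x. F (dcube (k0 + int m) x)) (stop_gen k0 P x) x) \<in> borel_measurable borel"
  by (rule measurable_compose_countable) (auto intro: measurable_dcube_fun)
 then show ?thesis by simp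
qed

text \<open>A substitute for Lebesgue's differentiation theorem: cover the exceptional set by maximal dyadic
 cubes inside a slightly larger open set; each of them contains a point where no stopping occurs.\<close>
lemma AE_le_outside_stop_cubes:
 fixes f :: "'a::euclidean_space \<Rightarrow> ennreal"
 assumes [measurable]: "f \<in> borel_measurable borel" and fin: "(\<integral>\<^sup>+x. f x \<partial>lborel) < top" and l: "0 < l"
  and P: "P = (\<lambda>Q. ennreal l * emeasure lborel Q < (\<integral>\<^sup>+x\<in>Q. f x \<partial>lborel))"
 shows "AE x in lborel. x \<notin> \<Union>(stop_cubes k0 P) \<longrightarrow> f x \<le> ennreal l"
proof -
 define \<Omega> where "\<Omega> = \<Union>(stop_cubes k0 P)"
 have [measurable]: "\<Omega> \<in> sets borel" by (simp add: \<Omega>_def)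
 define N where "N = {x. x \<notin> \<Omega> \<and> ennreal l < f x}"
 have [measurable]: "N \<in> sets borel" unfolding N_def by measurable
 have "ennreal l * emeasure lborel N = (\<integral>\<^sup>+x\<in>N. ennreal l \<partial>lborel)" by (simp add: nn_integral_cmult_indicator)
 also have "... \<le> (\<integral>\<^sup>+x. f x \<partial>lborel)"
  by (intro nn_integral_mono) (auto simp: N_def indicator_def)
 finally have "ennreal l * emeasure lborel N < top" using fin by (rule le_less_trans)
 then have N_fin: "emeasure lborel N < top" using l by (auto simp: ennreal_mult_less_top)
 have le: "(\<integral>\<^sup>+x\<in>N. f x \<partial>lborel) \<le> ennreal l * emeasure lborel N + ennreal e" if e: "0 < e" for e
 proof -
  obtain U where U: "open U" "N \<subseteq> U" "emeasure lborel (U - N) < ennreal (e / l)"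
   using outer_regular_lborel[of N "e / l"] e l by auto
  define R where "R Q \<longleftrightarrow> Q \<subseteq> U \<and> Q \<inter> N \<noteq> {}" for Q
  define T where "T = stop_cubes k0 R"
  have NT: "N \<subseteq> \<Union>T"
  proof
   fix x assume x: "x \<in> N"
   then obtain m where "dcube (k0 + int m) x \<subseteq> U" using dcube_subset_open[OF U(1), of x k0] U(2) by auto
   moreover have "dcube (k0 + int m) x \<inter> N \<noteq> {}"
   proof
    assume "dcube (k0 + int m) x \<inter> N = {}"
    moreover have "x \<in> dcube (k0 + int m) x \<inter> N" by (intro IntI dcube_self x)
    ultimately show False by (simp only: empty_iff)
   qed
   ultimately have "R (dcube (k0 + int m) x)" unfolding R_def by (rule conjI)
   then show "x \<in> \<Union>T" unfolding T_def Union_stop_cubes by (intro CollectI exI)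
  qed
  have TU: "\<Union>T \<subseteq> U"
  proof
   fix x assume "x \<in> \<Union>T"
   then obtain m where "R (dcube (k0 + int m) x)" unfolding T_def Union_stop_cubes by (elim CollectE exE)
   then show "x \<in> U" unfolding R_def by (elim conjE subsetD) (rule dcube_self)
  qed
  have "(\<integral>\<^sup>+x\<in>N. f x \<partial>lborel) \<le> (\<integral>\<^sup>+x\<in>\<Union>T. f x \<partial>lborel)"
   by (intro nn_integral_mono mult_left_mono indicator_leI subsetD[OF NT]) simp_all
  also have "... = (\<integral>\<^sup>+Q. (\<integral>\<^sup>+x\<in>Q. f x \<partial>lborel) \<partial>count_space T)"
   unfolding T_def by (rule nn_integral_stop_cubes[symmetric]) auto
  also have "... \<le> (\<integral>\<^sup>+Q. (\<integral>\<^sup>+x\<in>Q. ennreal l \<partial>lborel) \<partial>count_space T)"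
  proof (rule nn_integral_mono)
   fix Q assume "Q \<in> space (count_space T)"
   then have Q: "Q \<in> T" by simp
   obtain m y where Qy: "Q = dcube (k0 + int m) y" using stop_cubes_dcube[OF Q[unfolded T_def]] by (elim exE)
   have "y \<in> Q" by (simp add: Qy)
   then have "R Q" using stop_cubes_memD(2)[OF Q[unfolded T_def]] by simp
   then obtain x where x: "x \<in> Q" "x \<in> N" by (auto simp: R_def)
   then have "Q = dcube (k0 + int m) x" using dcube_eq[of x "k0 + int m" y] Qy by simp
   moreover have "\<not> P (dcube (k0 + int m) x)" using x(2) by (auto simp: N_def \<Omega>_def Union_stop_cubes)
   ultimately have "(\<integral>\<^sup>+x\<in>Q. f x \<partial>lborel) \<le> ennreal l * emeasure lborel Q" by (auto simp: P not_less)
   then show "(\<integral>\<^sup>+x\<in>Q. f x \<partial>lborel) \<le> (\<integral>\<^sup>+x\<in>Q. ennreal l \<partial>lborel)"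
    using Qy by (simp add: nn_integral_cmult_indicator)
  qed
  also have "... = (\<integral>\<^sup>+x\<in>\<Union>T. ennreal l \<partial>lborel)"
   unfolding T_def by (rule nn_integral_stop_cubes) auto
  also have "... = ennreal l * emeasure lborel (\<Union>T)"
   unfolding T_def by (rule nn_integral_cmult_indicator) simp
  also have "... \<le> ennreal l * emeasure lborel U"
   by (intro mult_left_mono emeasure_mono TU) (simp_all add: U(1))
  also have "emeasure lborel U = emeasure lborel N + emeasure lborel (U - N)"
  proof -
   have "N \<union> (U - N) = U" using U(2) by blast
   then show ?thesis using plus_emeasure[of N lborel "U - N"] U(1) by simp
  qed
  also have "ennreal l * ... \<le> ennreal l * (emeasure lborel N + ennreal (e / l))"
   using U(3) by (intro mult_left_mono add_left_mono) auto
  also have "... = ennreal l * emeasure lborel N + ennreal e"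
   using l e by (simp add: distrib_left ennreal_mult[symmetric])
  finally show ?thesis .
 qed
 have "(\<integral>\<^sup>+x\<in>N. f x \<partial>lborel) = (\<integral>\<^sup>+x. (f x - ennreal l) * indicator N x + ennreal l * indicator N x \<partial>lborel)"
 proof (intro nn_integral_cong)
  fix x
  show "f x * indicator N x = (f x - ennreal l) * indicator N x + ennreal l * indicator N x"
  proof (cases "x \<in> N")
   case True
   then have "ennreal l \<le> f x" unfolding N_def by (auto intro: less_imp_le)
   then have "f x = f x - ennreal l + ennreal l" by (rule diff_add_cancel_ennreal[symmetric])
   then show ?thesis using True by (simp only: indicator_simps mult_1_right)
  qed simp
 qed
 also have "... = (\<integral>\<^sup>+x\<in>N. (f x - ennreal l) \<partial>lborel) + ennreal l * emeasure lborel N"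
  by (subst nn_integral_add) (simp_all add: nn_integral_cmult_indicator)
 finally have split: "(\<integral>\<^sup>+x\<in>N. f x \<partial>lborel) = (\<integral>\<^sup>+x\<in>N. (f x - ennreal l) \<partial>lborel) + ennreal l * emeasure lborel N" .
 \<comment> \<open>Cancelling the finite quantity \<open>ennreal l * emeasure lborel N\<close>
   leaves at most \<open>e\<close> for every \<open>e > 0\<close>. So a function that is positive on
   \<open>N\<close> has integral 0 over \<open>N\<close>, which forces \<open>N\<close> to be
   null.\<close>
 have small: "(\<integral>\<^sup>+x\<in>N. (f x - ennreal l) \<partial>lborel) \<le> ennreal e" if "0 < e" for e
 proof -
  have "ennreal l * emeasure lborel N + (\<integral>\<^sup>+x\<in>N. (f x - ennreal l) \<partial>lborel) \<le> ennreal l * emeasure lborel N + ennreal e"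
   using le[OF that] unfolding split by (simp add: add.commute)
  moreover have "ennreal l * emeasure lborel N \<noteq> top" using N_fin by (auto simp: ennreal_mult_eq_top_iff)
  ultimately show ?thesis by (subst (asm) ennreal_add_left_cancel_le) (simp only: simp_thms infinity_ennreal_def)
 qed
 have "(\<integral>\<^sup>+x\<in>N. (f x - ennreal l) \<partial>lborel) \<le> 0"
  by (rule ennreal_le_epsilon) (simp add: small)
 then have "(\<integral>\<^sup>+x\<in>N. (f x - ennreal l) \<partial>lborel) = 0" by simp
 then have "AE x in lborel. (f x - ennreal l) * indicator N x = 0"
  by (subst (asm) nn_integral_0_iff_AE) auto
 then show ?thesis
 proof eventually_elim
  case (elim x)
  show ?case
  proof (intro impI, rule ccontr)
   assume "x \<notin> \<Union>(stop_cubes k0 P)" "\<not> f x \<le> ennreal l"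
   then have "x \<in> N" "ennreal l < f x" by (auto simp: N_def \<Omega>_def)
   with elim have "f x - ennreal l = 0" by simp
   with \<open>ennreal l < f x\<close> show False by (auto simp: diff_eq_0_iff_ennreal)
  qed
 qed
qed

section \<open>Decomposition of a function at a given height\<close>

lemma emeasure_UN_le_count_space:
 assumes "countable I" and [measurable]: "\<And>i. i \<in> I \<Longrightarrow> X i \<in> sets M"
 shows "emeasure M (\<Union>i\<in>I. X i) \<le> (\<integral>\<^sup>+i. emeasure M (X i) \<partial>count_space I)"
proof -
 have [measurable]: "(\<Union>i\<in>I. X i) \<in> sets M" using assms by (intro sets.countable_UN'') auto
 have "emeasure M (\<Union>i\<in>I. X i) = (\<integral>\<^sup>+x. indicator (\<Union>i\<in>I. X i) x \<partial>M)" by simp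
 also have "... \<le> (\<integral>\<^sup>+x. (\<integral>\<^sup>+i. indicator (X i) x \<partial>count_space I) \<partial>M)"
 proof (intro nn_integral_mono)
  fix x
  show "indicator (\<Union>i\<in>I. X i) x \<le> (\<integral>\<^sup>+i. indicator (X i) x \<partial>count_space I)"
  proof (cases "x \<in> (\<Union>i\<in>I. X i)")
   case True
   then obtain i where i: "i \<in> I" "x \<in> X i" by auto
   have "(1::ennreal) = (\<integral>\<^sup>+j. indicator {i} j \<partial>count_space I)" using i by simp
   also have "... \<le> (\<integral>\<^sup>+i. indicator (X i) x \<partial>count_space I)"
    using i by (intro nn_integral_mono) (auto simp: indicator_def)
   finally show ?thesis using True by simp
  qed simp
 qed
 also have "... = (\<integral>\<^sup>+i. emeasure M (X i) \<partial>count_space I)"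
  by (subst nn_integral_count_space_nn_integral) (auto simp: assms intro!: nn_integral_cong)
 finally show ?thesis .
qed

text \<open>The scales that are at least \<open>L\<close> start at the exponent \<lceil>log 2
  L\<rceil>, and from there the quotients decay geometrically, uniformly in \<open>L\<close> and
  \<open>J\<close>. This is the summation over large scales for the bad part, for localization and
  for distant sources.\<close>

lemma sum_scales_ge:
 fixes L \<beta> :: real
 assumes "0 < \<beta>" "finite J" "0 < L"
 shows "(\<Sum>j\<in>{j\<in>J. L \<le> 2 powi j}. (L / 2 powi j) powr \<beta>) \<le> 1 / (1 - 2 powr - \<beta>)"
proof -
 define j0 where "j0 = \<lceil>log 2 L\<rceil>"
 have L: "L \<le> 2 powi j0"
 proof -
  have "L = 2 powr (log 2 L)" using assms by simp
  also have "... \<le> 2 powr (of_int j0)" by (intro powr_mono) (auto simp: j0_def)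
  finally show ?thesis by (simp add: powr_real_of_int')
 qed
 have j: "j0 \<le> j" if "L \<le> 2 powi j" for j
 proof -
  have "log 2 L \<le> log 2 (2 powr (of_int j))"
   using that assms by (intro log_mono) (auto simp: powr_real_of_int')
  then show ?thesis by (simp add: j0_def ceiling_le_iff)
 qed
 have "(\<Sum>j\<in>{j\<in>J. L \<le> 2 powi j}. (L / 2 powi j) powr \<beta>) \<le> (\<Sum>j\<in>{j\<in>J. L \<le> 2 powi j}. (2 powr - \<beta>) ^ nat (j - j0))"
 proof (rule sum_mono)
  fix j assume "j \<in> {j \<in> J. L \<le> 2 powi j}"
  then have "j0 \<le> j" using j by simp
  have "(L / 2 powi j) powr \<beta> \<le> (2 powi j0 / 2 powi j) powr \<beta>"
   using L assms by (intro powr_mono2 divide_right_mono) auto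
  also have "... = (2 powr - \<beta>) ^ nat (j - j0)" by (rule powi_2_ratio_powr[OF \<open>j0 \<le> j\<close>])
  finally show "(L / 2 powi j) powr \<beta> \<le> (2 powr - \<beta>) ^ nat (j - j0)" .
 qed
 also have "... \<le> 1 / (1 - 2 powr - \<beta>)"
  by (rule sum_geometric_int_le) (use assms j in \<open>auto simp: powr_less_one\<close>)
 finally show ?thesis .
qed

lemma integral_disjoint_family_eq_0:
 fixes h :: "'a \<Rightarrow> real"
 assumes S: "countable S" "disjoint_family_on (\<lambda>Q. Q) S" "\<And>Q. Q \<in> S \<Longrightarrow> Q \<in> sets M"
  and h: "integrable M h" "\<And>x. x \<notin> \<Union>S \<Longrightarrow> h x = 0"
  and zero: "\<And>Q. Q \<in> S \<Longrightarrow> (LINT x|M. indicator Q x * h x) = 0"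
 shows "(LINT x|M. h x) = 0"
proof (cases "S = {}")
 case True
 then have "h = (\<lambda>_. 0)" using h(2) by auto
 then show ?thesis by simp
next
 case False
 define A where "A = from_nat_into S"
 have A: "A i \<in> S" for i using from_nat_into[OF False] by (simp add: A_def)
 \<comment> \<open>\<open>from_nat_into\<close> may enumerate with repetitions; a repeated member of
   \<open>S\<close> is replaced by the empty set, so that the sequence is disjoint.\<close>
 define B where "B i = (if \<exists>j<i. A j = A i then {} else A i)" for i
 have UB: "(\<Union>i. B i) = \<Union>S"
 proof (intro antisym subsetI)
  fix x assume "x \<in> \<Union>S"
  then obtain Q where Q: "Q \<in> S" "x \<in> Q" by auto
  then have ex: "\<exists>i. A i = Q" using from_nat_into_surj[OF S(1)] by (simp add: A_def)
  define i where "i = (LEAST i. A i = Q)"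
  have "A i = Q" unfolding i_def using ex by (rule LeastI_ex)
  moreover have "\<not> (\<exists>j<i. A j = Q)" unfolding i_def using not_less_Least by blast
  ultimately have "B i = Q" unfolding B_def by (metis (full_types))
  then show "x \<in> (\<Union>i. B i)" using Q by auto
 qed (use A in \<open>auto simp: B_def split: if_splits\<close>)
 have disj: "B i \<inter> B j = {}" if "i \<noteq> j" for i j
 proof (cases "A i = A j")
  case True
  have "B i = {} \<or> B j = {}"
  proof (cases "i < j")
   case True
   then have "B j = {}" unfolding B_def using \<open>A i = A j\<close> by (metis (full_types))
   then show ?thesis ..
  next
   case False
   then have "j < i" using that by simp
   then have "B i = {}" unfolding B_def using \<open>A i = A j\<close> by (metis (full_types))
   then show ?thesis ..
  qed
  then show ?thesis by auto
 next
  case False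
  then have "A i \<inter> A j = {}" using S(2) A by (auto simp: disjoint_family_on_def)
  then show ?thesis by (auto simp: B_def)
 qed
 have meas: "B i \<in> sets M" for i using S(3) A by (auto simp: B_def)
 have int: "set_integrable M (\<Union>i. B i) h"
  unfolding set_integrable_def UB
 proof (rule Bochner_Integration.integrable_cong[THEN iffD1, OF refl _ h(1)])
  fix x show "h x = indicat_real (\<Union> S) x *\<^sub>R h x" using h(2)[of x] by (cases "x \<in> \<Union>S") auto
 qed
 have "(LINT x|M. h x) = (LINT x:(\<Union>i. B i)|M. h x)"
  unfolding set_lebesgue_integral_def UB
 proof (rule Bochner_Integration.integral_cong[OF refl])
  fix x show "h x = indicat_real (\<Union> S) x *\<^sub>R h x" using h(2)[of x] by (cases "x \<in> \<Union>S") auto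
 qed
 also have "... = (\<Sum>i. (LINT x:(B i)|M. h x))"
  by (rule lebesgue_integral_countable_add[OF meas disj int])
 also have "... = (\<Sum>i::nat. 0)"
  using zero[OF A] by (intro suminf_cong) (auto simp: B_def set_lebesgue_integral_def)
 finally show ?thesis by simp
qed

text \<open>\<open>g\<close> is the average of \<open>f\<close> on stopping cubes and
  \<open>f\<close> elsewhere; \<open>\<kappa> z\<close> is the generation of the cube at
  \<open>z\<close>, and \<open>c\<close> picks a point of each cube. The mean value zero of
  \<open>b\<close> on every cube is stated as orthogonality to all bounded functions
  \<open>F\<close> of the cube. A kernel can then be corrected by its value at \<open>c\<close> on
  all cubes at once, with no series of integrals over separate cubes.\<close>

lemma calderon_zygmund:
 fixes f :: "'a::euclidean_space \<Rightarrow> real"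
 assumes f: "bdd_supp f" and l: "0 < l"
 obtains g b :: "'a \<Rightarrow> real" and \<kappa> :: "'a \<Rightarrow> int" and \<Omega> \<Omega>' :: "'a set" and c :: "'a set \<Rightarrow> 'a" where
  "bdd_supp g" "bdd_supp b" "\<And>x. f x = g x + b x"
  "(LINT z|lborel. (g z)\<^sup>2) \<le> (1 + 4 ^ DIM('a)) * l * (LINT z|lborel. \<bar>f z\<bar>)"
  "(LINT z|lborel. \<bar>b z\<bar>) \<le> (2 + 2 ^ DIM('a)) * (LINT z|lborel. \<bar>f z\<bar>)"
  "\<And>z. z \<notin> \<Omega> \<Longrightarrow> b z = 0"
  "\<Omega>' \<in> sets borel" "emeasure lborel \<Omega>' \<le> ennreal (unit_ball_vol DIM('a) * (2 * DIM('a)) ^ DIM('a) / l * (LINT z|lborel. \<bar>f z\<bar>))"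
  "\<And>x z. x \<notin> \<Omega>' \<Longrightarrow> z \<in> \<Omega> \<Longrightarrow> DIM('a) * 2 powi (- \<kappa> z) < dist x z"
  "\<And>z. z \<in> \<Omega> \<Longrightarrow> c (dcube (\<kappa> z) z) \<in> \<Omega> \<and> c (dcube (\<kappa> z) z) \<in> dcube (\<kappa> z) z \<and> \<kappa> (c (dcube (\<kappa> z) z)) = \<kappa> z"
  "\<kappa> \<in> measurable borel (count_space UNIV)"
  "\<And>F :: 'a set \<Rightarrow> real. (\<lambda>z. F (dcube (\<kappa> z) z)) \<in> borel_measurable borel"
  "\<And>(F :: 'a set \<Rightarrow> real) B. (\<And>Q. \<bar>F Q\<bar> \<le> B) \<Longrightarrow> (LINT z|lborel. b z * F (dcube (\<kappa> z) z)) = 0"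
proof -
 have [measurable]: "f \<in> borel_measurable borel" by (rule bdd_supp_measurable[OF f])
 define I where "I = (LINT z|lborel. \<bar>f z\<bar>)"
 have fi: "integrable lborel f" by (rule bdd_supp_integrable[OF f])
 have I0: "0 \<le> I" by (simp add: I_def)
 have I_nn: "(\<integral>\<^sup>+z. ennreal \<bar>f z\<bar> \<partial>lborel) = ennreal I"
  unfolding I_def using fi by (intro nn_integral_eq_integral) auto
 have fQ: "integrable lborel (\<lambda>z. \<bar>f z\<bar> * indicator Q z)" if "Q \<in> sets borel" for Q :: "'a set"
  using integrable_mult_indicator[OF _ integrable_abs[OF fi], of Q] that by (simp add: mult.commute)
 have fQ': "integrable lborel (\<lambda>z. f z * indicator Q z)" if "Q \<in> sets borel" for Q :: "'a set"
  using integrable_mult_indicator[OF _ fi, of Q] that by (simp add: mult.commute)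
 have abs_int_nn: "abs_nint f Q = ennreal (abs_int f Q)" if "Q \<in> sets borel" for Q
 proof -
  have "(\<integral>\<^sup>+x. ennreal (\<bar>f x\<bar> * indicator Q x) \<partial>lborel) = ennreal (abs_int f Q)"
   unfolding abs_int_def by (rule nn_integral_eq_integral[OF fQ[OF that]]) auto
  moreover have "(\<integral>\<^sup>+x. ennreal (\<bar>f x\<bar> * indicator Q x) \<partial>lborel) = abs_nint f Q"
   by (intro nn_integral_cong) (auto simp: indicator_def)
  ultimately show ?thesis by simp
 qed
 define V where "V k = ((2::real) powi (- k)) ^ DIM('a)" for k
 have V0: "0 < V k" for k by (simp add: V_def)
 have V_meas: "measure lborel (dcube k x :: 'a set) = V k" for k x
  using emeasure_dcube[of k x] by (simp add: measure_def V_def)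
 have V_parent: "V (k - 1) = 2 ^ DIM('a) * V k" for k
 proof -
  have "(2::real) powi (- (k - 1)) = 2 powi (1 + - k)" by simp
  also have "... = 2 * 2 powi (- k)" by (subst power_int_add) auto
  finally show ?thesis by (simp only: V_def power_mult_distrib)
 qed
 define P where "P = (\<lambda>Q. ennreal l * emeasure lborel Q < abs_nint f Q)"
 have P_iff: "P (dcube k x) \<longleftrightarrow> l * V k < abs_int f (dcube k x)" for k x
 proof -
  have "ennreal l * ennreal (V k) = ennreal (l * V k)"
   using l V0[of k] by (intro ennreal_mult[symmetric]) auto
  then show ?thesis
   unfolding P_def abs_int_nn[OF sets_dcube] emeasure_dcube V_def[symmetric]
   using l V0[of k] by (simp add: ennreal_less_iff)
 qed
 \<comment> \<open>Cubes of generation \<open>- N\<close> have volume at least \<open>2 ^ N\<close>,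
   more than \<open>I / l\<close>, so none of them satisfies \<open>P\<close> and every stopping
   cube has a parent on which \<open>P\<close> fails.\<close>
 obtain N :: nat where N: "I / l < 2 ^ N" using real_arch_pow[of 2 "I / l"] by auto
 define k0 where "k0 = - int N"
 have "I / l \<le> V k0"
 proof -
  have "(2::real) ^ N \<le> (2 ^ N) ^ DIM('a)"
   by (rule self_le_power) auto
  then show ?thesis using N by (simp add: V_def k0_def)
 qed
 then have I_le: "I \<le> l * V k0" using l by (simp add: field_simps)
 have abs_int_le: "abs_int f Q \<le> I" if "Q \<in> sets borel" for Q
  unfolding abs_int_def I_def using fi that
  by (intro integral_mono fQ integrable_abs) (auto simp: indicator_def)
 have not_P0: "\<not> P (dcube k0 x)" for x
  unfolding P_iff using abs_int_le[OF sets_dcube, of k0 x] I_le by simp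
 define S where "S = stop_cubes k0 P"
 define \<Omega> where "\<Omega> = \<Union>S"
 have [measurable]: "\<Omega> \<in> sets borel" by (simp add: \<Omega>_def S_def)
 define \<kappa> where "\<kappa> z = k0 + int (stop_gen k0 P z)" for z
 have cube: "dcube (\<kappa> z) z \<in> S \<and> P (dcube (\<kappa> z) z) \<and> \<not> P (dcube (\<kappa> z - 1) z)" if z: "z \<in> \<Omega>" for z
 proof -
  obtain Q where Q: "Q \<in> S" "z \<in> Q" using z by (auto simp: \<Omega>_def)
  note D = stop_cubes_memD[OF Q(1)[unfolded S_def] Q(2)]
  have eq: "dcube (\<kappa> z) z = Q" using D(1) by (simp add: \<kappa>_def)
  have "stop_gen k0 P z \<noteq> 0"
  proof
   assume "stop_gen k0 P z = 0"
   then have "P (dcube k0 z)" using D(2) eq by (simp add: \<kappa>_def)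
   with not_P0 show False by simp
  qed
  then have "\<not> P (dcube (k0 + int (stop_gen k0 P z - 1)) z)" by (intro D(3)[rule_format]) simp
  moreover have "k0 + int (stop_gen k0 P z - 1) = \<kappa> z - 1" using \<open>stop_gen k0 P z \<noteq> 0\<close> by (simp add: \<kappa>_def)
  ultimately show ?thesis using eq Q(1) D(2) by simp
 qed
 have \<kappa>_ge: "k0 \<le> \<kappa> z" for z by (simp add: \<kappa>_def)
 have cube_same: "y \<in> \<Omega> \<and> \<kappa> y = \<kappa> z" if z: "z \<in> \<Omega>" and y: "y \<in> dcube (\<kappa> z) z" for y z
 proof -
  have "dcube (\<kappa> z) z \<in> stop_cubes k0 P" using cube[OF z] by (simp add: S_def)
  then have "stop_gen k0 P y = stop_gen k0 P z"
  proof -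
   obtain Q where Q: "Q \<in> S" "z \<in> Q" using z by (auto simp: \<Omega>_def)
   note D = stop_cubes_memD[OF Q(1)[unfolded S_def] Q(2)]
   show ?thesis by (rule stop_gen_eq[of P k0 _ z]) (use D y in \<open>auto simp: \<kappa>_def\<close>)
  qed
  moreover have "y \<in> \<Omega>" using cube[OF z] y by (auto simp: \<Omega>_def)
  ultimately show ?thesis by (simp add: \<kappa>_def)
 qed
 \<comment> \<open>The bound comes from the parent, where the mean of \<bar>f\<bar> is at most
   \<open>l\<close> and which is \<open>2 ^ DIM('a)\<close> times as large.\<close>
 have abs_int_cube: "abs_int f (dcube (\<kappa> z) z) \<le> l * (2 ^ DIM('a) * V (\<kappa> z))" if z: "z \<in> \<Omega>" for z
 proof -
  have "abs_int f (dcube (\<kappa> z) z) \<le> abs_int f (dcube (\<kappa> z - 1) z)"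
   unfolding abs_int_def using dcube_antimono[of "\<kappa> z - 1" "\<kappa> z" z]
   by (intro integral_mono fQ) (auto simp: indicator_def)
  also have "... \<le> l * V (\<kappa> z - 1)" using cube[OF z] by (simp add: P_iff not_less)
  finally show ?thesis by (simp add: V_parent)
 qed
 define avg where "avg Q = (LINT y|lborel. f y * indicator Q y) / measure lborel Q" for Q
 have avg_le: "\<bar>avg (dcube (\<kappa> z) z)\<bar> \<le> 2 ^ DIM('a) * l" if z: "z \<in> \<Omega>" for z
 proof -
  have "\<bar>LINT y|lborel. f y * indicator (dcube (\<kappa> z) z) y\<bar> \<le> (LINT y|lborel. norm (f y * indicator (dcube (\<kappa> z) z) y))"
   using integral_norm_bound[of lborel "\<lambda>y. f y * indicator (dcube (\<kappa> z) z) y"] by simp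
  also have "... = abs_int f (dcube (\<kappa> z) z)"
   unfolding abs_int_def by (intro Bochner_Integration.integral_cong) (auto simp: abs_mult)
  also have "... \<le> l * (2 ^ DIM('a) * V (\<kappa> z))" by (rule abs_int_cube[OF z])
  finally show ?thesis using V0[of "\<kappa> z"] by (simp add: avg_def V_meas field_simps)
 qed
 define g where "g z = (if z \<in> \<Omega> then avg (dcube (\<kappa> z) z) else f z)" for z
 define b where "b z = f z - g z" for z
 have Fm: "(\<lambda>z. F (dcube (\<kappa> z) z)) \<in> borel_measurable borel" for F :: "'a set \<Rightarrow> real"
  unfolding \<kappa>_def by (rule measurable_stop_fun)
 note [measurable] = Fm[of avg]
 have [measurable]: "g \<in> borel_measurable borel" unfolding g_def by measurable
 have [measurable]: "b \<in> borel_measurable borel" unfolding b_def by measurable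
 obtain B R where BR: "0 \<le> B" "0 \<le> R" "\<And>x. \<bar>f x\<bar> \<le> B * indicator (cball 0 R) x" using bdd_suppE[OF f] by metis
 \<comment> \<open>A stopping cube has a positive integral of \<bar>f\<bar>, so it meets the support
   of \<open>f\<close>. Its points are therefore at most the diameter bound of generation
   \<open>k0\<close> away from \<open>cball 0 R\<close>.\<close>
 define R' where "R' = R + DIM('a) * 2 powi (- k0)"
 have g_bd: "\<bar>g z\<bar> \<le> max B (2 ^ DIM('a) * l) * indicator (cball 0 R') z" for z
 proof (cases "z \<in> \<Omega>")
  case True
  have "z \<in> cball 0 R'"
  proof (rule ccontr)
   assume z: "z \<notin> cball 0 R'"
   have "f y * indicator (dcube (\<kappa> z) z) y = 0" for y
   proof (cases "y \<in> dcube (\<kappa> z) z")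
    case True
    have "dist z y \<le> DIM('a) * 2 powi (- \<kappa> z)" by (rule dcube_dist_le[OF True])
    also have "... \<le> DIM('a) * 2 powi (- k0)"
     using \<kappa>_ge[of z] by (intro mult_left_mono power_int_increasing) auto
    finally have "norm z \<le> norm y + DIM('a) * 2 powi (- k0)"
     using norm_triangle_ineq[of y "z - y"] by (simp add: dist_norm)
    then have "y \<notin> cball 0 R" using z by (auto simp: R'_def)
    then show ?thesis using BR(3)[of y] by simp
   qed simp
   then have "abs_int f (dcube (\<kappa> z) z) = 0" unfolding abs_int_def
    by (metis (no_types, lifting) abs_zero mult_eq_0_iff integral_zero Bochner_Integration.integral_cong)
   moreover have "l * V (\<kappa> z) < abs_int f (dcube (\<kappa> z) z)" using cube[OF True] by (simp add: P_iff)
   ultimately have "l * V (\<kappa> z) < 0" by simp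
   moreover have "0 < l * V (\<kappa> z)" using l V0[of "\<kappa> z"] by (rule mult_pos_pos)
   ultimately show False by linarith
  qed
  then show ?thesis using True avg_le[OF True] by (simp add: g_def max.coboundedI2)
 next
  case False
  then have "\<bar>g z\<bar> = \<bar>f z\<bar>" by (simp add: g_def)
  also have "... \<le> B * indicator (cball 0 R) z" by (rule BR(3))
  also have "... \<le> max B (2 ^ DIM('a) * l) * indicator (cball 0 R') z"
  proof (intro mult_mono)
   have "R \<le> R'" by (simp add: R'_def)
   then show "indicator (cball 0 R) z \<le> (indicator (cball 0 R') z :: real)" by (auto simp: indicator_def)
  qed (use BR(1) in auto)
  finally show ?thesis .
 qed
 have g: "bdd_supp g" unfolding bdd_supp_def using g_bd by auto
 have "bdd_supp (\<lambda>z. - g z)" using g by (auto simp: bdd_supp_def)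
 then have b: "bdd_supp b" unfolding b_def using bdd_supp_add[OF f, of "\<lambda>z. - g z"] by simp
 have b0: "b z = 0" if "z \<notin> \<Omega>" for z using that by (simp add: b_def g_def)
 have cubes_measure: "ennreal l * emeasure lborel \<Omega> \<le> ennreal I"
 proof -
  have "ennreal l * emeasure lborel \<Omega> = (\<integral>\<^sup>+x\<in>\<Omega>. ennreal l \<partial>lborel)" by (simp add: nn_integral_cmult_indicator)
  also have "... = (\<integral>\<^sup>+Q. (\<integral>\<^sup>+x\<in>Q. ennreal l \<partial>lborel) \<partial>count_space S)"
   unfolding \<Omega>_def S_def by (rule nn_integral_stop_cubes[symmetric]) auto
  also have "... \<le> (\<integral>\<^sup>+Q. (abs_nint f Q) \<partial>count_space S)"
  proof (rule nn_integral_mono)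
   fix Q assume "Q \<in> space (count_space S)"
   then have Q: "Q \<in> stop_cubes k0 P" by (simp add: S_def)
   then obtain m x where "Q = dcube (k0 + int m) x" using stop_cubes_dcube by blast
   then have "x \<in> Q" by simp
   from stop_cubes_memD(2)[OF Q this] have "P Q" .
   then show "(\<integral>\<^sup>+x\<in>Q. ennreal l \<partial>lborel) \<le> abs_nint f Q"
    using stop_cubes_sets[OF Q] by (subst nn_integral_cmult_indicator) (auto simp: P_def)
  qed
  also have "... = abs_nint f (\<Omega>)"
   unfolding \<Omega>_def S_def by (rule nn_integral_stop_cubes) auto
  also have "... \<le> (\<integral>\<^sup>+x. ennreal \<bar>f x\<bar> \<partial>lborel)"
   by (intro nn_integral_mono) (auto simp: indicator_def)
  finally show ?thesis by (simp add: I_nn)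
 qed
 have \<Omega>_fin: "emeasure lborel \<Omega> < top"
 proof -
  have "ennreal l * emeasure lborel \<Omega> < top" using cubes_measure by (rule le_less_trans) simp
  then show ?thesis using l by (auto simp: ennreal_mult_less_top)
 qed
 define w where "w = measure lborel \<Omega>"
 have w: "emeasure lborel \<Omega> = ennreal w" "0 \<le> w" using \<Omega>_fin by (simp_all add: w_def emeasure_eq_ennreal_measure)
 have lw: "l * w \<le> I" using cubes_measure l w I0 by (simp add: ennreal_mult[symmetric])
 have w_int: "integrable lborel (\<lambda>z. K * indicator \<Omega> z :: real)" for K
  using \<Omega>_fin by (intro integrable_mult_right integrable_real_indicator) auto
 have AE_f: "AE z in lborel. z \<notin> \<Omega> \<longrightarrow> \<bar>f z\<bar> \<le> l"
 proof -
  have "AE x in lborel. x \<notin> \<Union>(stop_cubes k0 P) \<longrightarrow> ennreal \<bar>f x\<bar> \<le> ennreal l"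
   by (rule AE_le_outside_stop_cubes[OF _ _ l P_def]) (simp_all add: I_nn)
  then show ?thesis unfolding \<Omega>_def S_def
   using l by (auto elim!: eventually_mono)
 qed
 \<comment> \<open>Outside \<open>\<Omega>\<close> the square is at most
   \<open>l * \<bar>f z\<bar>\<close>. On \<open>\<Omega>\<close> it is at most the square of
   \<open>2 ^ DIM('a) * l\<close>, which gives \<open>4 ^ DIM('a) * l\<close> times
   \<open>l * w\<close>, and \<open>l * w \<le> I\<close>.\<close>
 have g_sq: "(LINT z|lborel. (g z)\<^sup>2) \<le> (1 + 4 ^ DIM('a)) * l * I"
 proof -
  have "(LINT z|lborel. (g z)\<^sup>2) \<le> (LINT z|lborel. l * \<bar>f z\<bar> + (2 ^ DIM('a) * l)\<^sup>2 * indicator \<Omega> z)"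
  proof (rule integral_mono_AE)
   show "integrable lborel (\<lambda>z. (g z)\<^sup>2)"
    using bdd_supp_integrable[OF bdd_supp_mult[OF g g]] by (simp add: power2_eq_square)
   show "integrable lborel (\<lambda>z. l * \<bar>f z\<bar> + (2 ^ DIM('a) * l)\<^sup>2 * indicator \<Omega> z)"
    by (intro Bochner_Integration.integrable_add w_int integrable_mult_right integrable_abs fi)
   show "AE z in lborel. (g z)\<^sup>2 \<le> l * \<bar>f z\<bar> + (2 ^ DIM('a) * l)\<^sup>2 * indicator \<Omega> z"
    using AE_f
   proof eventually_elim
    case (elim z)
    show ?case
    proof (cases "z \<in> \<Omega>")
     case True
     have "(g z)\<^sup>2 = \<bar>g z\<bar>\<^sup>2" by simp
     also have "... \<le> (2 ^ DIM('a) * l)\<^sup>2"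
      using avg_le[OF True] True by (intro power_mono) (auto simp: g_def)
     finally show ?thesis using True l by (simp add: add_increasing)
    next
     case False
     then have "\<bar>f z\<bar> * \<bar>f z\<bar> \<le> l * \<bar>f z\<bar>" using elim by (intro mult_right_mono) auto
     then show ?thesis using False by (simp add: g_def power2_eq_square abs_mult[symmetric])
    qed
   qed
  qed
  also have "... = l * I + (2 ^ DIM('a) * l)\<^sup>2 * w"
   using fi w_int by (subst Bochner_Integration.integral_add) (auto simp: I_def w_def)
  also have "(2 ^ DIM('a) * l)\<^sup>2 * w = 4 ^ DIM('a) * l * (l * w)"
   by (simp add: power2_eq_square power_mult_distrib[symmetric])
  also have "... \<le> 4 ^ DIM('a) * l * I" using l lw by (intro mult_left_mono) auto
  finally show ?thesis by (simp add: algebra_simps)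
 qed
 have b_int: "(LINT z|lborel. \<bar>b z\<bar>) \<le> (2 + 2 ^ DIM('a)) * I"
 proof -
  have "(LINT z|lborel. \<bar>b z\<bar>) \<le> (LINT z|lborel. \<bar>f z\<bar> + (2 ^ DIM('a) * l) * indicator \<Omega> z)"
  proof (rule integral_mono)
   fix z
   show "\<bar>b z\<bar> \<le> \<bar>f z\<bar> + (2 ^ DIM('a) * l) * indicator \<Omega> z"
    using avg_le[of z] b0[of z] by (cases "z \<in> \<Omega>") (auto simp: b_def g_def)
  qed (intro Bochner_Integration.integrable_add w_int integrable_abs fi bdd_supp_integrable[OF b])+
  also have "... = I + 2 ^ DIM('a) * (l * w)"
   using fi w_int by (subst Bochner_Integration.integral_add) (auto simp: I_def w_def)
  also have "... \<le> I + 2 ^ DIM('a) * I" using lw by (intro add_left_mono mult_left_mono) auto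
  also have "... \<le> (2 + 2 ^ DIM('a)) * I" using I0 by (simp add: algebra_simps)
  finally show ?thesis .
 qed
 define c where "c Q = (SOME z. z \<in> Q)" for Q :: "'a set"
 have c_in: "c (dcube k z) \<in> dcube k z" for k z unfolding c_def by (rule someI[of _ z]) simp
 \<comment> \<open>Twice the diameter bound of the cube: a point outside the ball is then farther
   from every point of the cube than that diameter bound, which is the claim
   \<open>far\<close>.\<close>
 define rad where "rad Q = 2 * DIM('a) * 2 powi (- \<kappa> (c Q))" for Q
 define \<Omega>' where "\<Omega>' = (\<Union>Q\<in>S. cball (c Q) (rad Q))"
 have [measurable]: "\<Omega>' \<in> sets borel"
  unfolding \<Omega>'_def S_def by (rule sets.countable_UN''[OF stop_cubes_countable]) simp
 let ?K = "unit_ball_vol DIM('a) * (2 * DIM('a)) ^ DIM('a)"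
 have \<Omega>'_measure: "emeasure lborel \<Omega>' \<le> ennreal (?K / l * I)"
 proof -
  have "emeasure lborel \<Omega>' \<le> (\<integral>\<^sup>+Q. emeasure lborel (cball (c Q) (rad Q)) \<partial>count_space S)"
   unfolding \<Omega>'_def S_def by (rule emeasure_UN_le_count_space[OF stop_cubes_countable]) simp
  also have "... = (\<integral>\<^sup>+Q. (\<integral>\<^sup>+x\<in>Q. ennreal ?K \<partial>lborel) \<partial>count_space S)"
  proof (rule nn_integral_cong)
   fix Q assume "Q \<in> space (count_space S)"
   then have Q: "Q \<in> S" by simp
   obtain m z where Qz: "Q = dcube (k0 + int m) z" using stop_cubes_dcube[OF Q[unfolded S_def]] by blast
   have cQ: "c Q \<in> Q" unfolding Qz by (rule c_in)
   have "Q = dcube (\<kappa> (c Q)) (c Q)"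
    using stop_cubes_memD(1)[OF Q[unfolded S_def] cQ] by (simp only: \<kappa>_def)
   then have "emeasure lborel Q = ennreal (V (\<kappa> (c Q)))" by (metis emeasure_dcube V_def)
   moreover have "emeasure lborel (cball (c Q) (rad Q)) = ennreal (?K * V (\<kappa> (c Q)))"
    by (subst emeasure_cball) (auto simp: rad_def V_def power_mult_distrib mult_ac)
   ultimately show "emeasure lborel (cball (c Q) (rad Q)) = (\<integral>\<^sup>+x\<in>Q. ennreal ?K \<partial>lborel)"
    using stop_cubes_sets[OF Q[unfolded S_def]] V0[of "\<kappa> (c Q)"]
    by (simp add: nn_integral_cmult_indicator ennreal_mult less_imp_le)
  qed
  also have "... = (\<integral>\<^sup>+x\<in>\<Omega>. ennreal ?K \<partial>lborel)"
   unfolding \<Omega>_def S_def by (rule nn_integral_stop_cubes) auto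
  also have "... = ennreal (?K * w)" using w by (simp add: nn_integral_cmult_indicator ennreal_mult)
  also have "... \<le> ennreal (?K / l * I)"
  proof (rule ennreal_leI)
   have "w \<le> I / l" using lw l by (simp add: field_simps)
   then have "?K * w \<le> ?K * (I / l)" by (intro mult_left_mono) auto
   then show "?K * w \<le> ?K / l * I" by simp
  qed
  finally show ?thesis .
 qed
 have far: "DIM('a) * 2 powi (- \<kappa> z) < dist x z" if x: "x \<notin> \<Omega>'" and z: "z \<in> \<Omega>" for x z
 proof -
  let ?Q = "dcube (\<kappa> z) z"
  have Q: "?Q \<in> S" using cube[OF z] by simp
  have cQ: "c ?Q \<in> ?Q" by (rule c_in)
  have \<kappa>c: "\<kappa> (c ?Q) = \<kappa> z" using cube_same[OF z cQ] by simp
  have "x \<notin> cball (c ?Q) (rad ?Q)" using x Q by (auto simp: \<Omega>'_def)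
  then have "2 * DIM('a) * 2 powi (- \<kappa> z) < dist (c ?Q) x" by (simp add: rad_def \<kappa>c not_le)
  moreover have "dist z (c ?Q) \<le> DIM('a) * 2 powi (- \<kappa> z)" by (rule dcube_dist_le[OF cQ])
  ultimately show ?thesis using dist_triangle[of "c ?Q" x z] by (simp add: dist_commute)
 qed
 have mean0: "(LINT z|lborel. indicator Q z * b z) = 0" if Q: "Q \<in> S" for Q
 proof -
  obtain m x where Qx: "Q = dcube (k0 + int m) x" using stop_cubes_dcube[OF Q[unfolded S_def]] by blast
  have Qm: "Q \<in> sets borel" by (rule stop_cubes_sets[OF Q[unfolded S_def]])
  have gQ: "g z = avg Q" if "z \<in> Q" for z
  proof -
   have "Q = dcube (\<kappa> z) z" using stop_cubes_memD(1)[OF Q[unfolded S_def] that] by (simp only: \<kappa>_def)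
   moreover have "z \<in> \<Omega>" using that Q by (auto simp: \<Omega>_def)
   ultimately show ?thesis by (simp add: g_def)
  qed
  have Q_meas: "measure lborel Q \<noteq> 0" "emeasure lborel Q < \<infinity>"
   unfolding Qx V_meas using V0[of "k0 + int m"] by (simp_all add: emeasure_dcube)
  have Qi: "integrable lborel (\<lambda>z. avg Q * indicator Q z)"
   using Qm Q_meas by (intro integrable_mult_right integrable_real_indicator) auto
  have "(LINT z|lborel. indicator Q z * b z) = (LINT z|lborel. f z * indicator Q z - avg Q * indicator Q z)"
   by (intro Bochner_Integration.integral_cong refl) (auto simp: b_def gQ indicator_def)
  also have "... = (LINT z|lborel. f z * indicator Q z) - avg Q * measure lborel Q"
   using fQ'[OF Qm] Qi Qm by (subst Bochner_Integration.integral_diff) auto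
  also have "... = 0" using Q_meas(1) by (simp add: avg_def)
  finally show ?thesis .
 qed
 have orth: "(LINT z|lborel. b z * F (dcube (\<kappa> z) z)) = 0" if F: "\<And>Q. \<bar>F Q\<bar> \<le> B" for F :: "'a set \<Rightarrow> real" and B
 proof (rule integral_disjoint_family_eq_0[of S])
  show "countable S" "disjoint_family_on (\<lambda>Q. Q) S" "\<And>Q. Q \<in> S \<Longrightarrow> Q \<in> sets lborel"
   unfolding S_def using stop_cubes_countable stop_cubes_disjoint stop_cubes_sets by auto
  have "integrable lborel (\<lambda>z. B * b z)" by (intro integrable_mult_right bdd_supp_integrable b)
  then show "integrable lborel (\<lambda>z. b z * F (dcube (\<kappa> z) z))"
  proof (rule Bochner_Integration.integrable_bound)
   show "(\<lambda>z. b z * F (dcube (\<kappa> z) z)) \<in> borel_measurable lborel"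
    using Fm[of F] by simp
   show "AE z in lborel. norm (b z * F (dcube (\<kappa> z) z)) \<le> norm (B * b z)"
   proof (rule AE_I2)
    fix z
    have "\<bar>b z\<bar> * \<bar>F (dcube (\<kappa> z) z)\<bar> \<le> \<bar>b z\<bar> * \<bar>B\<bar>"
     by (intro mult_left_mono order_trans[OF F abs_ge_self]) auto
    then show "norm (b z * F (dcube (\<kappa> z) z)) \<le> norm (B * b z)" by (simp add: abs_mult mult.commute)
   qed
  qed
  show "b x * F (dcube (\<kappa> x) x) = 0" if "x \<notin> \<Union>S" for x using b0[of x] that by (simp add: \<Omega>_def)
  fix Q assume Q: "Q \<in> S"
  have "(LINT x|lborel. indicator Q x * (b x * F (dcube (\<kappa> x) x))) = (LINT x|lborel. F Q * (indicator Q x * b x))"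
  proof (intro Bochner_Integration.integral_cong refl)
   fix z
   show "indicator Q z * (b z * F (dcube (\<kappa> z) z)) = F Q * (indicator Q z * b z)"
   proof (cases "z \<in> Q")
    case True
    have "Q = dcube (\<kappa> z) z" using stop_cubes_memD(1)[OF Q[unfolded S_def] True] by (simp only: \<kappa>_def)
    then show ?thesis by simp
   qed simp
  qed
  also have "... = 0" using mean0[OF Q] by simp
  finally show "(LINT x|lborel. indicator Q x * (b x * F (dcube (\<kappa> x) x))) = 0" .
 qed
 have \<kappa>m: "\<kappa> \<in> measurable borel (count_space UNIV)" unfolding \<kappa>_def by measurable
 show ?thesis
 proof (rule that[of g b \<Omega> \<Omega>' \<kappa> c])
  show "f x = g x + b x" for x by (simp add: b_def)
  show "c (dcube (\<kappa> z) z) \<in> \<Omega> \<and> c (dcube (\<kappa> z) z) \<in> dcube (\<kappa> z) z \<and> \<kappa> (c (dcube (\<kappa> z) z)) = \<kappa> z" if "z \<in> \<Omega>" for z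
   using cube_same[OF that c_in] c_in by auto
  show "(LINT z|lborel. b z * F (dcube (\<kappa> z) z)) = 0" if "\<And>Q. \<bar>F Q\<bar> \<le> B" for F :: "'a set \<Rightarrow> real" and B
   by (rule orth[OF that])
 qed (fact g b b0 far \<kappa>m Fm g_sq[unfolded I_def] b_int[unfolded I_def] \<Omega>'_measure[unfolded I_def] \<open>\<Omega>' \<in> sets borel\<close>)+
qed

section \<open>Weak type of the dyadic square function\<close>

text \<open>Only a finite set \<open>J\<close> of dyadic scales is used, so the function is
  continuous for locally integrable \<open>f\<close> and the sums are finite; all bounds below are
  uniform in \<open>J\<close>.\<close>

definition sq_fun :: "real \<Rightarrow> int set \<Rightarrow> ('a::euclidean_space \<Rightarrow> real) \<Rightarrow> 'a \<Rightarrow> real" where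
 "sq_fun \<beta> J f x = L2_set (\<lambda>j. sup_kern \<beta> (2 powi j) f x) J"

lemma measurable_sq_fun:
 assumes "0 < \<beta>" "\<beta> \<le> 1" "local_int f"
 shows "sq_fun \<beta> J f \<in> borel_measurable borel"
proof -
 have [measurable]: "sup_kern \<beta> (2 powi j) f \<in> borel_measurable borel" for j
  by (rule measurable_sup_kern[OF assms(1,2) _ assms(3)]) simp
 show ?thesis unfolding sq_fun_def L2_set_def by measurable
qed

lemma sq_fun_add:
 assumes "0 < \<beta>" "\<beta> \<le> 1" "local_int f" "local_int g"
 shows "sq_fun \<beta> J (\<lambda>z. f z + g z) x \<le> sq_fun \<beta> J f x + sq_fun \<beta> J g x"
proof -
 have "sq_fun \<beta> J (\<lambda>z. f z + g z) x \<le> L2_set (\<lambda>j. sup_kern \<beta> (2 powi j) f x + sup_kern \<beta> (2 powi j) g x) J"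
  unfolding sq_fun_def using assms
  by (intro L2_set_mono sup_kern_add sup_kern_nonneg local_int_add) auto
 also have "... \<le> sq_fun \<beta> J f x + sq_fun \<beta> J g x"
  unfolding sq_fun_def by (rule L2_set_triangle_ineq)
 finally show ?thesis .
qed

lemma sq_fun_cont:
 assumes "0 < \<beta>" "\<beta> \<le> 1" "local_int f"
 shows "continuous_on UNIV (sq_fun \<beta> J f :: 'a::euclidean_space \<Rightarrow> real)"
proof -
 have "continuous_on UNIV (sup_kern \<beta> (2 powi j) f :: 'a \<Rightarrow> real)" for j
  by (rule continuous_sup_kern[OF assms(1,2) _ assms(3)]) simp
 then show ?thesis unfolding sq_fun_def[abs_def] L2_set_def by (intro continuous_intros)
qed

text \<open>The action of the square function on the bad part, away from the enlarged cubes.\<close>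
lemma bad_part_estimate:
 fixes b :: "'a::euclidean_space \<Rightarrow> real" and c :: "'a set \<Rightarrow> 'a"
 assumes \<beta>: "0 < \<beta>" "\<beta> \<le> 1" and b: "bdd_supp b" and b0: "\<And>z. z \<notin> \<Omega> \<Longrightarrow> b z = 0"
  and \<Omega>': "\<Omega>' \<in> sets borel"
  and far: "\<And>x z. x \<notin> \<Omega>' \<Longrightarrow> z \<in> \<Omega> \<Longrightarrow> DIM('a) * 2 powi (- \<kappa> z) < dist x z"
  and c: "\<And>z. z \<in> \<Omega> \<Longrightarrow> c (dcube (\<kappa> z) z) \<in> \<Omega> \<and> c (dcube (\<kappa> z) z) \<in> dcube (\<kappa> z) z \<and> \<kappa> (c (dcube (\<kappa> z) z)) = \<kappa> z"
  and \<kappa> [measurable]: "\<kappa> \<in> measurable borel (count_space UNIV)"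
  and Fm: "\<And>F :: 'a set \<Rightarrow> real. (\<lambda>z. F (dcube (\<kappa> z) z)) \<in> borel_measurable borel"
  and orth: "\<And>(F :: 'a set \<Rightarrow> real) B. (\<And>Q. \<bar>F Q\<bar> \<le> B) \<Longrightarrow> (LINT z|lborel. b z * F (dcube (\<kappa> z) z)) = 0"
  and J: "finite J"
 shows "(\<integral>\<^sup>+x\<in>- \<Omega>'. ennreal (sq_fun \<beta> J b x) \<partial>lborel)
  \<le> ennreal (unit_ball_vol DIM('a) * 2 ^ DIM('a) / (1 - 2 powr - \<beta>) * (LINT z|lborel. \<bar>b z\<bar>))"
proof -
 have li: "local_int b" by (rule bdd_supp_local_int[OF b])
 have [measurable]: "b \<in> borel_measurable borel" by (rule bdd_supp_measurable[OF b])
 define L where "L z = DIM('a) * 2 powi (- \<kappa> z)" for z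
 have L0: "0 < L z" for z by (simp add: L_def)
 have Lm [measurable]: "L \<in> borel_measurable borel" unfolding L_def by measurable
 define t where "t j = (2::real) powi j" for j :: int
 have t: "0 < t j" for j by (simp add: t_def)
 \<comment> \<open>A majorant for the oscillation of a kernel at \<open>x\<close> of scale
   \<open>t j\<close> between \<open>z\<close> and the chosen point of its cube. It is nonzero only
   if \<open>z\<close> is within \<open>2 * t j\<close> of \<open>x\<close> and the diameter bound
   \<open>L z\<close> is at most \<open>t j\<close>.\<close>
 define k where "k j x z = (if dist x z \<le> 2 * t j then (if L z \<le> t j then ennreal ((L z / t j) powr \<beta> / t j ^ DIM('a)) else 0) else 0)" for j and x z :: 'a
 have point: "ennreal (sup_kern \<beta> (t j) b x) \<le> (\<integral>\<^sup>+z. ennreal \<bar>b z\<bar> * k j x z \<partial>lborel)" if x: "x \<notin> \<Omega>'" for j x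
 proof -
  have le: "ennreal \<bar>LINT z|lborel. b z * \<psi> z\<bar> \<le> (\<integral>\<^sup>+z. ennreal \<bar>b z\<bar> * k j x z \<partial>lborel)" if \<psi>: "\<psi> \<in> kern \<beta> (t j) x" for \<psi>
  proof -
   \<comment> \<open>The value of the kernel at the chosen point of the cube. By orthogonality it
     may be subtracted from \<open>\<psi> z\<close> without changing the integral against
     \<open>b\<close>.\<close>
   define F where "F Q = \<psi> (c Q)" for Q
   have F_le: "\<bar>F Q\<bar> \<le> 3 / t j ^ DIM('a)" for Q
    unfolding F_def by (rule le_mult_indicatorD[OF kern_bound[OF \<beta> t \<psi>]]) (use t[of j] in simp)
   have [measurable]: "(\<lambda>z. F (dcube (\<kappa> z) z)) \<in> borel_measurable borel" by (rule Fm)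
   have i1: "integrable lborel (\<lambda>z. b z * \<psi> z)" by (rule kern_integrable[OF \<beta> t li \<psi>])
   have i2: "integrable lborel (\<lambda>z. b z * F (dcube (\<kappa> z) z))"
   proof (rule Bochner_Integration.integrable_bound)
    show "integrable lborel (\<lambda>z. (3 / t j ^ DIM('a)) * b z)" by (intro integrable_mult_right bdd_supp_integrable b)
    show "AE z in lborel. norm (b z * F (dcube (\<kappa> z) z)) \<le> norm ((3 / t j ^ DIM('a)) * b z)"
    proof (rule AE_I2)
     fix z
     have "\<bar>b z\<bar> * \<bar>F (dcube (\<kappa> z) z)\<bar> \<le> \<bar>b z\<bar> * (3 / t j ^ DIM('a))"
      by (intro mult_left_mono F_le) auto
     then show "norm (b z * F (dcube (\<kappa> z) z)) \<le> norm ((3 / t j ^ DIM('a)) * b z)"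
      using t[of j] by (simp add: abs_mult mult.commute)
    qed
   qed measurable
   have "(LINT z|lborel. b z * \<psi> z) = (LINT z|lborel. b z * \<psi> z) - (LINT z|lborel. b z * F (dcube (\<kappa> z) z))"
    using orth[OF F_le] by simp
   also have "... = (LINT z|lborel. b z * (\<psi> z - F (dcube (\<kappa> z) z)))"
    using i1 i2 by (simp add: right_diff_distrib)
   finally have "ennreal \<bar>LINT z|lborel. b z * \<psi> z\<bar> \<le> (\<integral>\<^sup>+z. ennreal \<bar>b z * (\<psi> z - F (dcube (\<kappa> z) z))\<bar> \<partial>lborel)"
    using ennreal_abs_integral_le[of lborel "\<lambda>z. b z * (\<psi> z - F (dcube (\<kappa> z) z))"] by simp
   also have "... \<le> (\<integral>\<^sup>+z. ennreal \<bar>b z\<bar> * k j x z \<partial>lborel)"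
   proof (rule nn_integral_mono)
    fix z
    show "ennreal \<bar>b z * (\<psi> z - F (dcube (\<kappa> z) z))\<bar> \<le> ennreal \<bar>b z\<bar> * k j x z"
    proof (cases "z \<in> \<Omega>")
     case True
     define c' where "c' = c (dcube (\<kappa> z) z)"
     have c': "c' \<in> \<Omega>" "c' \<in> dcube (\<kappa> z) z" "\<kappa> c' = \<kappa> z" using c[OF True] by (auto simp: c'_def)
     have dc: "dist z c' \<le> L z" unfolding L_def by (rule dcube_dist_le[OF c'(2)])
     have f1: "L z < dist x z" unfolding L_def by (rule far[OF x True])
     have f2: "L z < dist x c'" using far[OF x c'(1)] by (simp add: L_def c'(3))
     have Feq: "F (dcube (\<kappa> z) z) = \<psi> c'" by (simp add: F_def c'_def)
     show ?thesis
     proof (cases "\<psi> z - \<psi> c' = 0")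
      case False
      \<comment> \<open>One of the two points must lie within \<open>t j\<close> of
        \<open>x\<close>, while both are farther than \<open>L z\<close> from \<open>x\<close>.
        Hence scales smaller than the cube do not see it at all.\<close>
      have near: "dist x z \<le> t j \<or> dist x c' \<le> t j"
      proof (rule ccontr)
       assume "\<not> ?thesis"
       then have "\<psi> z = 0" "\<psi> c' = 0" using kern_outside[OF \<psi>, of z] kern_outside[OF \<psi>, of c'] by auto
       with False show False by simp
      qed
      then have Lt: "L z \<le> t j" using f1 f2 by linarith
      have "dist x z \<le> 2 * t j"
       using near Lt dc dist_triangle[of x z c'] t[of j] by (auto simp: dist_commute)
      then have keq: "k j x z = ennreal ((L z / t j) powr \<beta> / t j ^ DIM('a))" using Lt by (simp add: k_def)
      have "\<bar>\<psi> z - \<psi> c'\<bar> \<le> (dist z c' / t j) powr \<beta> / t j ^ DIM('a)" by (rule kern_Hoelder[OF \<psi>])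
      also have "... \<le> (L z / t j) powr \<beta> / t j ^ DIM('a)"
       using dc t[of j] \<beta> by (intro divide_right_mono powr_mono2) auto
      finally have "\<bar>b z\<bar> * \<bar>\<psi> z - \<psi> c'\<bar> \<le> \<bar>b z\<bar> * ((L z / t j) powr \<beta> / t j ^ DIM('a))"
       by (intro mult_left_mono) auto
      then have "ennreal (\<bar>b z\<bar> * \<bar>\<psi> z - \<psi> c'\<bar>) \<le> ennreal (\<bar>b z\<bar> * ((L z / t j) powr \<beta> / t j ^ DIM('a)))"
       by (rule ennreal_leI)
      also have "... = ennreal \<bar>b z\<bar> * k j x z"
       unfolding keq by (rule ennreal_mult) (use t[of j] in auto)
      finally show ?thesis by (simp add: Feq abs_mult)
     qed (simp add: Feq)
    qed (simp add: b0)
   qed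
   finally show ?thesis .
  qed
  show ?thesis
  proof (cases "(\<integral>\<^sup>+z. ennreal \<bar>b z\<bar> * k j x z \<partial>lborel)")
   case (real r)
   have "sup_kern \<beta> (t j) b x \<le> r"
   proof (rule sup_kern_least[OF \<beta> t])
    fix \<psi> assume "\<psi> \<in> kern \<beta> (t j) x"
    from le[OF this] show "\<bar>LINT z|lborel. b z * \<psi> z\<bar> \<le> r" unfolding real(2) using real(1) by (subst (asm) ennreal_le_iff)
   qed
   then show ?thesis unfolding real(2) by (rule ennreal_leI)
  qed simp
 qed
 have km [measurable]: "(\<lambda>p. k j (fst p) (snd p)) \<in> borel_measurable (lborel \<Otimes>\<^sub>M lborel)" for j
  unfolding k_def by measurable
 have k_int: "(\<integral>\<^sup>+x. k j x z \<partial>lborel) = (if L z \<le> t j then ennreal (unit_ball_vol DIM('a) * 2 ^ DIM('a) * (L z / t j) powr \<beta>) else 0)" for j z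
 proof (cases "L z \<le> t j")
  case True
  have "(\<integral>\<^sup>+x. k j x z \<partial>lborel) = (\<integral>\<^sup>+x. ennreal ((L z / t j) powr \<beta> / t j ^ DIM('a)) * indicator (cball z (2 * t j)) x \<partial>lborel)"
   using True by (intro nn_integral_cong) (auto simp: k_def indicator_def dist_commute)
  also have "... = ennreal ((L z / t j) powr \<beta> / t j ^ DIM('a)) * ennreal (unit_ball_vol DIM('a) * (2 * t j) ^ DIM('a))"
   using t[of j] by (subst nn_integral_cmult_indicator) (auto simp: emeasure_cball)
  also have "... = ennreal (unit_ball_vol DIM('a) * 2 ^ DIM('a) * (L z / t j) powr \<beta>)"
   using t[of j] by (subst ennreal_mult[symmetric]) (auto simp: power_mult_distrib)
  finally show ?thesis using True by simp
 qed (simp add: k_def)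
 let ?\<Gamma> = "1 / (1 - 2 powr - \<beta>)" and ?v = "unit_ball_vol DIM('a) * 2 ^ DIM('a)"
 have "(\<integral>\<^sup>+x\<in>- \<Omega>'. ennreal (sq_fun \<beta> J b x) \<partial>lborel) \<le> (\<integral>\<^sup>+x. (\<Sum>j\<in>J. \<integral>\<^sup>+z. ennreal \<bar>b z\<bar> * k j x z \<partial>lborel) \<partial>lborel)"
 proof (rule nn_integral_mono)
  fix x
  show "ennreal (sq_fun \<beta> J b x) * indicator (- \<Omega>') x \<le> (\<Sum>j\<in>J. \<integral>\<^sup>+z. ennreal \<bar>b z\<bar> * k j x z \<partial>lborel)"
  proof (cases "x \<in> \<Omega>'")
   case False
   have nn: "0 \<le> sup_kern \<beta> (t j) b x" for j by (rule sup_kern_nonneg[OF \<beta> t li])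
   \<comment> \<open>The l^2 sum over scales may be replaced by the l^1 sum here, because the
     contributions of large scales decay geometrically.\<close>
   have "sq_fun \<beta> J b x \<le> (\<Sum>j\<in>J. sup_kern \<beta> (t j) b x)"
    unfolding sq_fun_def t_def[symmetric] by (rule L2_set_le_sum) (rule nn)
   then have "ennreal (sq_fun \<beta> J b x) \<le> ennreal (\<Sum>j\<in>J. sup_kern \<beta> (t j) b x)" by (rule ennreal_leI)
   also have "... = (\<Sum>j\<in>J. ennreal (sup_kern \<beta> (t j) b x))" by (rule sum_ennreal[symmetric]) (rule nn)
   also have "... \<le> (\<Sum>j\<in>J. \<integral>\<^sup>+z. ennreal \<bar>b z\<bar> * k j x z \<partial>lborel)" by (intro sum_mono point False)
   finally show ?thesis using False by simp
  qed simp
 qed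
 also have "... = (\<Sum>j\<in>J. \<integral>\<^sup>+x. \<integral>\<^sup>+z. ennreal \<bar>b z\<bar> * k j x z \<partial>lborel \<partial>lborel)"
  by (rule nn_integral_sum) measurable
 also have "... = (\<Sum>j\<in>J. \<integral>\<^sup>+z. \<integral>\<^sup>+x. ennreal \<bar>b z\<bar> * k j x z \<partial>lborel \<partial>lborel)"
 proof (rule sum.cong[OF refl])
  fix j
  show "(\<integral>\<^sup>+x. \<integral>\<^sup>+z. ennreal \<bar>b z\<bar> * k j x z \<partial>lborel \<partial>lborel) = (\<integral>\<^sup>+z. \<integral>\<^sup>+x. ennreal \<bar>b z\<bar> * k j x z \<partial>lborel \<partial>lborel)"
   by (rule lborel_pair.Fubini'[symmetric]) (simp add: case_prod_beta', measurable)
 qed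
 also have "... = (\<Sum>j\<in>J. \<integral>\<^sup>+z. ennreal \<bar>b z\<bar> * (if L z \<le> t j then ennreal (?v * (L z / t j) powr \<beta>) else 0) \<partial>lborel)"
 proof (intro sum.cong refl nn_integral_cong)
  fix j z
  have [measurable]: "(\<lambda>x. k j x z) \<in> borel_measurable lborel" unfolding k_def by measurable
  have "(\<integral>\<^sup>+x. ennreal \<bar>b z\<bar> * k j x z \<partial>lborel) = ennreal \<bar>b z\<bar> * (\<integral>\<^sup>+x. k j x z \<partial>lborel)"
   by (rule nn_integral_cmult) measurable
  then show "(\<integral>\<^sup>+x. ennreal \<bar>b z\<bar> * k j x z \<partial>lborel) = ennreal \<bar>b z\<bar> * (if L z \<le> t j then ennreal (?v * (L z / t j) powr \<beta>) else 0)"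
   by (simp only: k_int)
 qed
 also have "... = (\<integral>\<^sup>+z. (\<Sum>j\<in>J. ennreal \<bar>b z\<bar> * (if L z \<le> t j then ennreal (?v * (L z / t j) powr \<beta>) else 0)) \<partial>lborel)"
  by (rule nn_integral_sum[symmetric]) measurable
 also have "... \<le> (\<integral>\<^sup>+z. ennreal (?v * ?\<Gamma>) * ennreal \<bar>b z\<bar> \<partial>lborel)"
 proof (rule nn_integral_mono)
  fix z
  have "(\<Sum>j\<in>J. (if L z \<le> t j then ennreal (?v * (L z / t j) powr \<beta>) else 0)) = (\<Sum>j\<in>{j\<in>J. L z \<le> t j}. ennreal (?v * (L z / t j) powr \<beta>))"
   by (rule sum.inter_filter[OF J, symmetric])
  also have "... = ennreal (\<Sum>j\<in>{j\<in>J. L z \<le> t j}. ?v * (L z / t j) powr \<beta>)"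
   by (rule sum_ennreal) auto
  also have "(\<Sum>j\<in>{j\<in>J. L z \<le> t j}. ?v * (L z / t j) powr \<beta>) = ?v * (\<Sum>j\<in>{j\<in>J. L z \<le> t j}. (L z / t j) powr \<beta>)"
   by (rule sum_distrib_left[symmetric])
  also have "ennreal ... \<le> ennreal (?v * ?\<Gamma>)"
   unfolding t_def by (intro ennreal_leI mult_left_mono sum_scales_ge \<beta>(1) J L0) auto
  finally have "ennreal \<bar>b z\<bar> * (\<Sum>j\<in>J. (if L z \<le> t j then ennreal (?v * (L z / t j) powr \<beta>) else 0)) \<le> ennreal \<bar>b z\<bar> * ennreal (?v * ?\<Gamma>)"
   by (rule mult_left_mono) simp
  then show "(\<Sum>j\<in>J. ennreal \<bar>b z\<bar> * (if L z \<le> t j then ennreal (?v * (L z / t j) powr \<beta>) else 0)) \<le> ennreal (?v * ?\<Gamma>) * ennreal \<bar>b z\<bar>"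
   by (simp only: sum_distrib_left mult.commute)
 qed
 also have "... = ennreal (?v * ?\<Gamma>) * (\<integral>\<^sup>+z. ennreal \<bar>b z\<bar> \<partial>lborel)" by (rule nn_integral_cmult) measurable
 also have "(\<integral>\<^sup>+z. ennreal \<bar>b z\<bar> \<partial>lborel) = ennreal (LINT z|lborel. \<bar>b z\<bar>)"
  by (rule nn_integral_eq_integral) (use bdd_supp_integrable[OF b] in auto)
 also have "ennreal (?v * ?\<Gamma>) * ... = ennreal (?v / (1 - 2 powr - \<beta>) * (LINT z|lborel. \<bar>b z\<bar>))"
  using \<beta> by (subst ennreal_mult[symmetric]) (auto simp: powr_less_one less_imp_le)
 finally show ?thesis .
qed

lemma emeasure_ge_bound:
 assumes [measurable]: "h \<in> borel_measurable borel" "A \<in> sets borel" and l: "0 < l"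
  and le: "mass h A \<le> ennreal K"
 shows "emeasure lborel {x\<in>A. l < h x} \<le> ennreal (K / l)"
proof -
 have "ennreal l * emeasure lborel {x\<in>A. l < h x} = (\<integral>\<^sup>+x\<in>{x\<in>A. l < h x}. ennreal l \<partial>lborel)"
  by (rule nn_integral_cmult_indicator[symmetric]) measurable
 also have "... \<le> mass h A"
  by (intro nn_integral_mono) (auto simp: indicator_def intro: ennreal_leI)
 also note le
 finally have "ennreal (1 / l) * (ennreal l * emeasure lborel {x\<in>A. l < h x}) \<le> ennreal (1 / l) * ennreal K"
  by (rule mult_left_mono) simp
 moreover have "ennreal (1 / l) * (ennreal l * emeasure lborel {x\<in>A. l < h x}) = emeasure lborel {x\<in>A. l < h x}"
  using l by (simp add: mult.assoc[symmetric] ennreal_mult[symmetric])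
 moreover have "ennreal (1 / l) * ennreal K = ennreal (K / l)"
  using l by (simp add: ennreal_mult'[symmetric])
 ultimately show ?thesis by simp
qed

text \<open>The decomposition is taken at height \<open>l\<close> itself. \<open>K1\<close> belongs
  to the good part, through the L^2 bound and Chebyshev's inequality at level \<open>l / 2\<close>,
  where the factor \<open>l\<close> in the L^2 norm of \<open>g\<close> restores the weak type
  scaling; \<open>K2\<close> to the exceptional set; \<open>K3\<close> to the bad part outside it,
  again at level \<open>l / 2\<close>.\<close>

theorem sq_fun_weak_type:
 assumes \<beta>: "0 < \<beta>" "\<beta> \<le> 1"
 shows "\<exists>C>0. \<forall>J. \<forall>f::'a::euclidean_space \<Rightarrow> real. \<forall>l. finite J \<longrightarrow> bdd_supp f \<longrightarrow> 0 < l \<longrightarrow>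
   emeasure lborel {x. l < sq_fun \<beta> J f x} \<le> ennreal (C / l * (LINT z|lborel. \<bar>f z\<bar>))"
proof -
 obtain C2 where C2: "0 < C2" "\<And>J f. finite J \<Longrightarrow> bdd_supp (f :: 'a \<Rightarrow> real) \<Longrightarrow>
   (\<Sum>j\<in>J. LINT x|lborel. (sup_kern \<beta> (2 powi j) f x)\<^sup>2) \<le> C2 * (LINT x|lborel. (f x)\<^sup>2)"
  using sup_kern_L2[OF \<beta>, where 'a='a] by blast
 define K1 where "K1 = 4 * C2 * (1 + 4 ^ DIM('a))"
 define K2 where "K2 = unit_ball_vol DIM('a) * (2 * DIM('a)) ^ DIM('a)"
 define K3 where "K3 = 2 * (unit_ball_vol DIM('a) * 2 ^ DIM('a) / (1 - 2 powr - \<beta>) * (2 + 2 ^ DIM('a)))"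
 have r1: "0 < 1 - 2 powr - \<beta>" using \<beta> by (simp add: powr_less_one)
 have K: "0 < K1" "0 \<le> K2" "0 \<le> K3"
  using C2(1) r1 by (auto simp: K1_def K2_def K3_def add_pos_pos)
 have "emeasure lborel {x. l < sq_fun \<beta> J f x} \<le> ennreal ((K1 + K2 + K3) / l * (LINT z|lborel. \<bar>f z\<bar>))"
  if J: "finite J" and f: "bdd_supp f" and l: "0 < l" for J l and f :: "'a \<Rightarrow> real"
 proof -
  define I where "I = (LINT z|lborel. \<bar>f z\<bar>)"
  have I0: "0 \<le> I" by (simp add: I_def)
  obtain g b :: "'a \<Rightarrow> real" and \<kappa> :: "'a \<Rightarrow> int" and \<Omega> \<Omega>' :: "'a set" and c :: "'a set \<Rightarrow> 'a" where
   g: "bdd_supp g" and b: "bdd_supp b" and fgb: "\<And>x. f x = g x + b x" and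
   g2: "(LINT z|lborel. (g z)\<^sup>2) \<le> (1 + 4 ^ DIM('a)) * l * (LINT z|lborel. \<bar>f z\<bar>)" and
   b1: "(LINT z|lborel. \<bar>b z\<bar>) \<le> (2 + 2 ^ DIM('a)) * (LINT z|lborel. \<bar>f z\<bar>)" and
   b0: "\<And>z. z \<notin> \<Omega> \<Longrightarrow> b z = 0" and
   \<Omega>'[measurable]: "\<Omega>' \<in> sets borel" and
   \<Omega>'m: "emeasure lborel \<Omega>' \<le> ennreal (unit_ball_vol DIM('a) * (2 * DIM('a)) ^ DIM('a) / l * (LINT z|lborel. \<bar>f z\<bar>))" and
   far: "\<And>x z. x \<notin> \<Omega>' \<Longrightarrow> z \<in> \<Omega> \<Longrightarrow> DIM('a) * 2 powi (- \<kappa> z) < dist x z" and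
   c: "\<And>z. z \<in> \<Omega> \<Longrightarrow> c (dcube (\<kappa> z) z) \<in> \<Omega> \<and> c (dcube (\<kappa> z) z) \<in> dcube (\<kappa> z) z \<and> \<kappa> (c (dcube (\<kappa> z) z)) = \<kappa> z" and
   \<kappa>: "\<kappa> \<in> measurable borel (count_space UNIV)" and
   Fm: "\<And>F :: 'a set \<Rightarrow> real. (\<lambda>z. F (dcube (\<kappa> z) z)) \<in> borel_measurable borel" and
   orth: "\<And>(F :: 'a set \<Rightarrow> real) B. (\<And>Q. \<bar>F Q\<bar> \<le> B) \<Longrightarrow> (LINT z|lborel. b z * F (dcube (\<kappa> z) z)) = 0"
   by (rule calderon_zygmund[OF f l]) blast
  note li = bdd_supp_local_int[OF g] bdd_supp_local_int[OF b]
  have gm [measurable]: "sq_fun \<beta> J g \<in> borel_measurable borel" by (rule measurable_sq_fun[OF \<beta> li(1)])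
  have bm [measurable]: "sq_fun \<beta> J b \<in> borel_measurable borel" by (rule measurable_sq_fun[OF \<beta> li(2)])
  have sub: "{x. l < sq_fun \<beta> J f x} \<subseteq> {x\<in>UNIV. l\<^sup>2 / 4 < (sq_fun \<beta> J g x)\<^sup>2} \<union> (\<Omega>' \<union> {x\<in>- \<Omega>'. l / 2 < sq_fun \<beta> J b x})"
  proof
   fix x assume "x \<in> {x. l < sq_fun \<beta> J f x}"
   moreover have "f = (\<lambda>z. g z + b z)" using fgb by (rule ext)
   ultimately have "l < sq_fun \<beta> J g x + sq_fun \<beta> J b x"
    using sq_fun_add[OF \<beta> li, of J x] by simp
   then consider "l / 2 < sq_fun \<beta> J g x" | "l / 2 < sq_fun \<beta> J b x" by linarith
   then show "x \<in> {x\<in>UNIV. l\<^sup>2 / 4 < (sq_fun \<beta> J g x)\<^sup>2} \<union> (\<Omega>' \<union> {x\<in>- \<Omega>'. l / 2 < sq_fun \<beta> J b x})"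
   proof cases
    case 1
    then have "(l / 2)\<^sup>2 < (sq_fun \<beta> J g x)\<^sup>2" using l by (intro power_strict_mono) auto
    then show ?thesis by (simp add: power_divide)
   qed auto
  qed
  have good: "emeasure lborel {x\<in>UNIV. l\<^sup>2 / 4 < (sq_fun \<beta> J g x)\<^sup>2} \<le> ennreal (C2 * (1 + 4 ^ DIM('a)) * l * I / (l\<^sup>2 / 4))"
  proof (rule emeasure_ge_bound)
   \<comment> \<open>Integrability follows from the selected kernel operator, which dominates the
     supremum up to the factor 2 and maps \<open>g\<close> to a bounded function of bounded
     support.\<close>
   have sqi: "integrable lborel (\<lambda>x. (sup_kern \<beta> (2 powi j) g x)\<^sup>2)" for j
   proof -
    have tj: "0 < (2::real) powi j" by simp
    obtain k where k: "kernel_op k (3 / (2 powi j) ^ DIM('a)) (2 powi j)"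
     "\<And>x. sup_kern \<beta> (2 powi j) g x \<le> 2 * \<bar>LINT z|lborel. k x z * g z\<bar>"
     by (rule measurable_kernel_selection[OF \<beta> tj li(1)]) blast
    have T: "bdd_supp (\<lambda>x. LINT z|lborel. k x z * g z)" by (rule kernel_op_bdd_supp[OF k(1) g])
    have "integrable lborel (\<lambda>x. 4 * ((LINT z|lborel. k x z * g z) * (LINT z|lborel. k x z * g z)))"
     by (intro integrable_mult_right bdd_supp_integrable bdd_supp_mult T)
    then show ?thesis
    proof (rule Bochner_Integration.integrable_bound)
     show "AE x in lborel. norm ((sup_kern \<beta> (2 powi j) g x)\<^sup>2) \<le> norm (4 * ((LINT z|lborel. k x z * g z) * (LINT z|lborel. k x z * g z)))"
     proof (rule AE_I2)
      fix x
      have "(sup_kern \<beta> (2 powi j) g x)\<^sup>2 \<le> (2 * \<bar>LINT z|lborel. k x z * g z\<bar>)\<^sup>2"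
       by (intro power_mono k(2) sup_kern_nonneg[OF \<beta> tj li(1)])
      then show "norm ((sup_kern \<beta> (2 powi j) g x)\<^sup>2) \<le> norm (4 * ((LINT z|lborel. k x z * g z) * (LINT z|lborel. k x z * g z)))"
       by (simp add: power2_eq_square abs_mult)
     qed
    qed (use measurable_sup_kern[OF \<beta> tj li(1)] in measurable)
   qed
   have "(\<integral>\<^sup>+x\<in>UNIV. ennreal ((sq_fun \<beta> J g x)\<^sup>2) \<partial>lborel) = (\<integral>\<^sup>+x. ennreal (\<Sum>j\<in>J. (sup_kern \<beta> (2 powi j) g x)\<^sup>2) \<partial>lborel)"
    by (intro nn_integral_cong) (simp add: sq_fun_def L2_set_def sum_nonneg)
   also have "... = ennreal (LINT x|lborel. (\<Sum>j\<in>J. (sup_kern \<beta> (2 powi j) g x)\<^sup>2))"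
    by (rule nn_integral_eq_integral) (auto intro!: Bochner_Integration.integrable_sum sqi sum_nonneg)
   also have "(LINT x|lborel. (\<Sum>j\<in>J. (sup_kern \<beta> (2 powi j) g x)\<^sup>2)) = (\<Sum>j\<in>J. LINT x|lborel. (sup_kern \<beta> (2 powi j) g x)\<^sup>2)"
    by (rule Bochner_Integration.integral_sum) (rule sqi)
   also have "ennreal ... \<le> ennreal (C2 * (1 + 4 ^ DIM('a)) * l * I)"
   proof (rule ennreal_leI)
    have "(\<Sum>j\<in>J. LINT x|lborel. (sup_kern \<beta> (2 powi j) g x)\<^sup>2) \<le> C2 * (LINT x|lborel. (g x)\<^sup>2)" by (rule C2(2)[OF J g])
    also have "... \<le> C2 * ((1 + 4 ^ DIM('a)) * l * I)" using g2 C2(1) by (intro mult_left_mono) (auto simp: I_def)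
    finally show "(\<Sum>j\<in>J. LINT x|lborel. (sup_kern \<beta> (2 powi j) g x)\<^sup>2) \<le> C2 * (1 + 4 ^ DIM('a)) * l * I" by (simp add: mult.assoc)
   qed
   finally show "(\<integral>\<^sup>+x\<in>UNIV. ennreal ((sq_fun \<beta> J g x)\<^sup>2) \<partial>lborel) \<le> ennreal (C2 * (1 + 4 ^ DIM('a)) * l * I)" .
  qed (use l in auto)
  have bad: "emeasure lborel {x\<in>- \<Omega>'. l / 2 < sq_fun \<beta> J b x} \<le> ennreal (unit_ball_vol DIM('a) * 2 ^ DIM('a) / (1 - 2 powr - \<beta>) * (LINT z|lborel. \<bar>b z\<bar>) / (l / 2))"
   by (rule emeasure_ge_bound[OF bm _ _ bad_part_estimate[OF \<beta> b b0 \<Omega>' far c \<kappa> Fm orth J]]) (use l in auto)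
  have "emeasure lborel {x. l < sq_fun \<beta> J f x} \<le> emeasure lborel ({x\<in>UNIV. l\<^sup>2 / 4 < (sq_fun \<beta> J g x)\<^sup>2} \<union> (\<Omega>' \<union> {x\<in>- \<Omega>'. l / 2 < sq_fun \<beta> J b x}))"
   by (rule emeasure_mono[OF sub]) measurable
  also have "... \<le> emeasure lborel {x\<in>UNIV. l\<^sup>2 / 4 < (sq_fun \<beta> J g x)\<^sup>2} + emeasure lborel (\<Omega>' \<union> {x\<in>- \<Omega>'. l / 2 < sq_fun \<beta> J b x})"
   by (rule emeasure_subadditive) measurable
  also have "... \<le> emeasure lborel {x\<in>UNIV. l\<^sup>2 / 4 < (sq_fun \<beta> J g x)\<^sup>2} + (emeasure lborel \<Omega>' + emeasure lborel {x\<in>- \<Omega>'. l / 2 < sq_fun \<beta> J b x})"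
   by (intro add_left_mono emeasure_subadditive) measurable
  also have "... \<le> ennreal (K1 / l * I) + (ennreal (K2 / l * I) + ennreal (K3 / l * I))"
  proof (intro add_mono)
   have "C2 * (1 + 4 ^ DIM('a)) * l * I / (l\<^sup>2 / 4) = K1 / l * I"
    using l by (simp add: K1_def power2_eq_square field_simps)
   with good show "emeasure lborel {x\<in>UNIV. l\<^sup>2 / 4 < (sq_fun \<beta> J g x)\<^sup>2} \<le> ennreal (K1 / l * I)" by simp
   show "emeasure lborel \<Omega>' \<le> ennreal (K2 / l * I)" using \<Omega>'m by (simp add: K2_def I_def)
   have "unit_ball_vol DIM('a) * 2 ^ DIM('a) / (1 - 2 powr - \<beta>) * (LINT z|lborel. \<bar>b z\<bar>) / (l / 2)
    \<le> unit_ball_vol DIM('a) * 2 ^ DIM('a) / (1 - 2 powr - \<beta>) * ((2 + 2 ^ DIM('a)) * I) / (l / 2)"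
    using r1 l b1 unfolding I_def by (intro divide_right_mono mult_left_mono) auto
   also have "... = K3 / l * I" by (simp add: K3_def)
   finally show "emeasure lborel {x\<in>- \<Omega>'. l / 2 < sq_fun \<beta> J b x} \<le> ennreal (K3 / l * I)"
    by (intro order_trans[OF bad] ennreal_leI)
  qed
  also have "... = ennreal ((K1 + K2 + K3) / l * I)"
   using K l I0 by (simp add: add_divide_distrib distrib_right flip: ennreal_plus)
  finally show ?thesis by (simp add: I_def)
 qed
 then show ?thesis using K by (intro exI[of _ "K1 + K2 + K3"]) auto
qed

section \<open>Weighted bounds for the dyadic square function\<close>

lemma sup_kern_le_integral:
 assumes "0 < \<beta>" "\<beta> \<le> 1" "0 < t" "bdd_supp (f :: 'a::euclidean_space \<Rightarrow> real)"
 shows "sup_kern \<beta> t f x \<le> 3 / t ^ DIM('a) * (LINT z|lborel. \<bar>f z\<bar>)"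
proof -
 have li: "local_int f" by (rule bdd_supp_local_int[OF assms(4)])
 have "sup_kern \<beta> t f x \<le> 3 / t ^ DIM('a) * abs_int f (cball x t)"
  by (rule sup_kern_size[OF assms(1-3) li])
 also have "abs_int f (cball x t) \<le> (LINT z|lborel. \<bar>f z\<bar>)"
  unfolding abs_int_def
  by (rule integral_mono) (use local_int_integrable[OF li] bdd_supp_integrable[OF assms(4)] in \<open>auto simp: indicator_def\<close>)
 finally show ?thesis using assms(3) by (simp add: mult_left_mono divide_right_mono)
qed

text \<open>The a priori information that makes the absorption in \<open>good_lambda\<close>
  possible. The sum \<open>T\<close> of the finitely many scales bounds how far the square function
  can reach beyond the support of \<open>f\<close>.\<close>

lemma sq_fun_bdd_supp:
 fixes f :: "'a::euclidean_space \<Rightarrow> real"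
 assumes \<beta>: "0 < \<beta>" "\<beta> \<le> 1" and J: "finite J" and f: "bdd_supp f"
 shows "bdd_supp (sq_fun \<beta> J f)"
proof -
 have li: "local_int f" by (rule bdd_supp_local_int[OF f])
 obtain B R where BR: "\<And>x. \<bar>f x\<bar> \<le> B * indicator (cball 0 R) x" using bdd_suppE[OF f] by metis
 define I where "I = (LINT z|lborel. \<bar>f z\<bar>)"
 define K where "K = (\<Sum>j\<in>J. 3 / (2 powi j) ^ DIM('a) * I)"
 define T where "T = (\<Sum>j\<in>J. (2::real) powi j)"
 have nn: "0 \<le> sup_kern \<beta> (2 powi j) f x" for j x by (rule sup_kern_nonneg[OF \<beta> _ li]) simp
 have "\<bar>sq_fun \<beta> J f x\<bar> \<le> K * indicator (cball 0 (R + T)) x" for x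
 proof (cases "x \<in> cball 0 (R + T)")
  case True
  have "sq_fun \<beta> J f x \<le> (\<Sum>j\<in>J. sup_kern \<beta> (2 powi j) f x)"
   unfolding sq_fun_def by (rule L2_set_le_sum) (rule nn)
  also have "... \<le> K" unfolding K_def I_def by (intro sum_mono sup_kern_le_integral \<beta> f) simp
  finally show ?thesis using True by (simp add: sq_fun_def)
 next
  case False
  have "sup_kern \<beta> (2 powi j) f x = 0" if j: "j \<in> J" for j
  proof (rule sup_kern_eq_0[OF \<beta>])
   fix z assume z: "z \<in> cball x (2 powi j)"
   have "2 powi j \<le> T" unfolding T_def using J j by (intro member_le_sum) auto
   moreover have "norm x \<le> norm z + dist x z" using norm_triangle_ineq[of z "x - z"] by (simp add: dist_norm)
   ultimately have "z \<notin> cball 0 R" using False z by auto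
   then show "f z = 0" using BR[of z] by simp
  qed simp
  then show ?thesis using False by (simp add: sq_fun_def L2_set_0')
 qed
 then show ?thesis using measurable_sq_fun[OF \<beta> li, of J] by (auto simp: bdd_supp_def)
qed

text \<open>The A_\<infinity> property for cubes. The condition on a ball around the cube Q is
  tested on the indicator of the complement of \<open>E\<close> in Q, which has at least half the
  volume of Q. This gives w(Q) \<le> A w(Q - E), so \<open>E\<close> carries at most the fraction 1
  - 1/A of w(Q).\<close>

lemma ball_avg_weight_dcube:
 fixes w :: "'a::euclidean_space \<Rightarrow> real"
 assumes w: "ball_avg_weight q C w" and q: "1 \<le> q"
 shows "\<exists>\<epsilon>. 0 \<le> \<epsilon> \<and> \<epsilon> < 1 \<and> (\<forall>k x E. E \<in> sets borel \<longrightarrow> E \<subseteq> dcube k x \<longrightarrow> 2 * emeasure lborel E \<le> emeasure lborel (dcube k x)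
   \<longrightarrow> emeasure (density lborel (\<lambda>x. ennreal (w x))) E \<le> ennreal \<epsilon> * emeasure (density lborel (\<lambda>x. ennreal (w x))) (dcube k x))"
proof -
 note D = ball_avg_weightD[OF w]
 note [measurable] = D(1)
 let ?W = "density lborel (\<lambda>x. ennreal (w x))"
 \<comment> \<open>The ratio of the volume of the surrounding ball to that of the cube. The summand
   1 in \<open>A\<close> ensures \<open>1 \<le> A\<close>.\<close>
 define v where "v = unit_ball_vol DIM('a) * (2 * DIM('a)) ^ DIM('a)"
 define A where "A = 1 + C * (2 * v) powr q"
 have v: "0 < v" by (simp add: v_def)
 have A: "1 \<le> A" using D(4) by (simp add: A_def)
 have "emeasure ?W E \<le> ennreal (1 - 1 / A) * emeasure ?W (dcube k x)"
  if [measurable]: "E \<in> sets borel" and E: "E \<subseteq> dcube k x" "2 * emeasure lborel E \<le> emeasure lborel (dcube k x)" for k x E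
 proof -
  let ?Q = "dcube k x"
  define V where "V = ((2::real) powi (- k)) ^ DIM('a)"
  have V: "0 < V" by (simp add: V_def)
  define r where "r = 2 * DIM('a) * 2 powi (- k)"
  have r: "0 < r" by (simp add: r_def)
  have QB: "?Q \<subseteq> ball x r"
  proof
   fix y assume "y \<in> ?Q"
   then have "dist x y \<le> DIM('a) * 2 powi (- k)" by (rule dcube_dist_le)
   also have "... < r" by (simp add: r_def)
   finally show "y \<in> ball x r" by simp
  qed
  have B: "emeasure lborel (ball x r) = ennreal (v * V)"
   using r by (subst emeasure_ball) (auto simp: r_def v_def V_def power_mult_distrib mult_ac)
  have Q: "emeasure lborel ?Q = ennreal V" by (simp add: emeasure_dcube V_def)
  have E_fin: "emeasure lborel E < top"
   using emeasure_mono[OF E(1), of lborel] by (auto simp: Q intro: le_less_trans)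
  then obtain a where a: "emeasure lborel E = ennreal a" "0 \<le> a" by (cases "emeasure lborel E") auto
  have a2: "2 * a \<le> V"
  proof -
   have "ennreal (2 * a) \<le> ennreal V" using E(2) a by (simp add: Q ennreal_mult)
   then show ?thesis using V by (subst (asm) ennreal_le_iff) auto
  qed
  have QE: "emeasure lborel (?Q - E) = ennreal (V - a)"
   using E_fin E(1) a by (subst emeasure_Diff) (auto simp: Q ennreal_minus)
  have W: "emeasure ?W X = mass w X" if "X \<in> sets borel" for X
   using that by (simp add: emeasure_density)
  have "(\<integral>\<^sup>+y\<in>ball x r. indicator (?Q - E) y \<partial>lborel) epowr q * mass w (ball x r)
   \<le> ennreal C * emeasure lborel (ball x r) epowr q * wint_on (ball x r) q w (\<lambda>y. indicator (?Q - E) y)"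
   by (rule D(6)[OF _ r]) measurable
  also have "(\<integral>\<^sup>+y\<in>ball x r. indicator (?Q - E) y \<partial>lborel) = (\<integral>\<^sup>+y. indicator (?Q - E) y \<partial>lborel)"
   using QB by (intro nn_integral_cong) (auto simp: indicator_def)
  also have "... = ennreal (V - a)" by (simp add: QE)
  also have "wint_on (ball x r) q w (\<lambda>y. indicator (?Q - E) y) = emeasure ?W (?Q - E)"
  proof -
   have "indicator (?Q - E) y epowr q * ennreal (w y) * indicator (ball x r) y = ennreal (w y) * indicator (?Q - E) y" for y
    using QB q by (cases "y \<in> ?Q - E") auto
   then show ?thesis by (simp add: W)
  qed
  finally have 0: "ennreal (V - a) epowr q * mass w (ball x r) \<le> ennreal C * emeasure lborel (ball x r) epowr q * emeasure ?W (?Q - E)" .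
  have 1: "ennreal ((V - a) powr q) * mass w (ball x r) \<le> ennreal (C * (v * V) powr q) * emeasure ?W (?Q - E)"
  proof -
   have "ennreal (v * V) epowr q = ennreal ((v * V) powr q)" using v V q by (intro epowr_ennreal) auto
   moreover have "ennreal (V - a) epowr q = ennreal ((V - a) powr q)" using a2 a V q by (intro epowr_ennreal) auto
   moreover have "ennreal (C * (v * V) powr q) = ennreal C * ennreal ((v * V) powr q)" using D(4) by (intro ennreal_mult) auto
   ultimately show ?thesis using 0 unfolding B by simp
  qed
  have "emeasure ?W ?Q \<le> mass w (ball x r)"
   unfolding W[OF sets_dcube] using QB by (intro nn_integral_mono mult_left_mono indicator_leI) auto
  then have "ennreal ((V / 2) powr q) * emeasure ?W ?Q \<le> ennreal ((V - a) powr q) * mass w (ball x r)"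
   using a2 V q by (intro mult_mono ennreal_leI powr_mono2) auto
  also note 1
  also have "(v * V) powr q = (V / 2) powr q * (2 * v) powr q"
   using v V by (simp add: powr_mult[symmetric] mult_ac)
  finally have "ennreal ((V / 2) powr q) * emeasure ?W ?Q \<le> ennreal ((V / 2) powr q) * (ennreal (C * (2 * v) powr q) * emeasure ?W (?Q - E))"
   using D(4) by (simp add: ennreal_mult mult_ac)
  then have "emeasure ?W ?Q \<le> ennreal (C * (2 * v) powr q) * emeasure ?W (?Q - E)"
   using V by (subst (asm) ennreal_mult_le_mult_iff) auto
  also have "... \<le> ennreal A * emeasure ?W (?Q - E)"
   by (intro mult_right_mono ennreal_leI) (auto simp: A_def)
  finally have le: "emeasure ?W ?Q \<le> ennreal A * emeasure ?W (?Q - E)" .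
  have W_fin: "emeasure ?W ?Q < top"
  proof -
   have "emeasure ?W ?Q \<le> emeasure ?W (ball x r)" using QB by (intro emeasure_mono) auto
   also have "... < top" using D(5) by (simp add: W)
   finally show ?thesis .
  qed
  have split: "emeasure ?W ?Q = emeasure ?W E + emeasure ?W (?Q - E)"
  proof -
   have "E \<union> (?Q - E) = ?Q" using E(1) by blast
   then show ?thesis using plus_emeasure[of E ?W "?Q - E"] by simp
  qed
  have "emeasure ?W E < top" "emeasure ?W (?Q - E) < top" using W_fin unfolding split by auto
  then obtain e d where ed: "emeasure ?W E = ennreal e" "0 \<le> e" "emeasure ?W (?Q - E) = ennreal d" "0 \<le> d"
   by (cases "emeasure ?W E"; cases "emeasure ?W (?Q - E)") auto
  have "ennreal (e + d) \<le> ennreal (A * d)" using le A ed unfolding split by (simp add: ennreal_mult flip: ennreal_plus)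
  then have "e + d \<le> A * d" using ed A by (subst (asm) ennreal_le_iff) auto
  then have "e \<le> (1 - 1 / A) * (e + d)" using A by (simp add: field_simps)
  then have "ennreal e \<le> ennreal ((1 - 1 / A) * (e + d))" by (rule ennreal_leI)
  also have "... = ennreal (1 - 1 / A) * ennreal (e + d)" using A ed by (intro ennreal_mult) auto
  finally show ?thesis using ed unfolding split by simp
 qed
 then show ?thesis using A by (intro exI[of _ "1 - 1 / A"]) auto
qed

section \<open>Localization and the good-\<lambda> inequality\<close>

lemma abs_int_le_max_fun:
 fixes f :: "'a::euclidean_space \<Rightarrow> real"
 assumes f: "local_int f" and R: "0 \<le> R" "R < R'" and M: "max_fun lborel (absf f) y \<le> ennreal m" and m: "0 \<le> m"
 shows "abs_int f (cball y R) \<le> m * (unit_ball_vol DIM('a) * R' ^ DIM('a))"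
proof -
 have dbl: "doubling_measure (lborel :: 'a measure) (5 ^ DIM('a))"
  unfolding doubling_measure_def using emeasure_lborel_ball_pos emeasure_lborel_ball_finite' emeasure_lborel_ball_scale[where 'a='a and a=5]
  by auto
 have "ennreal (abs_int f (cball y R)) = abs_nint f (cball y R)" by (rule ennreal_abs_int[OF f])
 also have "... \<le> abs_nint f (ball y R')"
  using R by (intro nn_integral_mono mult_left_mono indicator_leI) auto
 also have "... \<le> max_fun lborel (absf f) y * emeasure lborel (ball y R')"
  by (rule max_fun_upper[OF dbl]) (use R in simp)
 also have "... \<le> ennreal m * emeasure lborel (ball y R')" by (intro mult_right_mono M) simp
 also have "... = ennreal (m * (unit_ball_vol DIM('a) * R' ^ DIM('a)))"
  using R m by (subst emeasure_ball) (auto simp: ennreal_mult)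
 finally show ?thesis using R m by (subst (asm) ennreal_le_iff) auto
qed

lemma L2_set_subset_mono:
 assumes "finite B" "A \<subseteq> B" shows "L2_set f A \<le> L2_set f B"
 unfolding L2_set_def using assms by (intro real_sqrt_le_mono sum_mono2) auto

lemma L2_set_union_le:
 assumes "finite A" "finite B" "A \<inter> B = {}" shows "L2_set f (A \<union> B) \<le> L2_set f A + L2_set f B"
proof -
 have "L2_set f (A \<union> B) = sqrt ((\<Sum>i\<in>A. (f i)\<^sup>2) + (\<Sum>i\<in>B. (f i)\<^sup>2))"
  unfolding L2_set_def using assms by (simp add: sum.union_disjoint)
 also have "... \<le> sqrt (\<Sum>i\<in>A. (f i)\<^sup>2) + sqrt (\<Sum>i\<in>B. (f i)\<^sup>2)"
  by (rule sqrt_add_le_add_sqrt) (auto intro: sum_nonneg)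
 finally show ?thesis by (simp add: L2_set_def)
qed

text \<open>Large scales of the square function hardly vary over a cube; small scales only see \<open>f\<close> nearby.\<close>
lemma sq_fun_localize:
 fixes f :: "'a::euclidean_space \<Rightarrow> real"
 assumes \<beta>: "0 < \<beta>" "\<beta> \<le> 1" and J: "finite J" and f: "local_int f"
  and L: "0 < L" and xy: "dist y x \<le> L" and xx': "dist x x' \<le> L" and yx': "dist y x' \<le> L"
  and m: "0 \<le> m" and M: "max_fun lborel (absf f) y \<le> ennreal m"
 shows "sq_fun \<beta> J f x \<le> sq_fun \<beta> J f x' + m * (unit_ball_vol DIM('a) * 3 ^ DIM('a) / (1 - 2 powr - \<beta>))
   + sq_fun \<beta> J (\<lambda>z. f z * indicator (cball y (3 * L)) z) x"
proof -
 define J2 where "J2 = {j\<in>J. L \<le> 2 powi j}"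
 define J1 where "J1 = {j\<in>J. \<not> L \<le> 2 powi j}"
 have J12: "finite J1" "finite J2" "J1 \<union> J2 = J" "J1 \<inter> J2 = {}" using J by (auto simp: J1_def J2_def)
 define a where "a j x = sup_kern \<beta> (2 powi j) f x" for j x
 define f1 where "f1 z = f z * indicator (cball y (3 * L)) z" for z
 have [measurable]: "f \<in> borel_measurable borel" by (rule local_int_measurable[OF f])
 have f1: "local_int f1" by (rule local_int_le[OF f]) (auto simp: f1_def[abs_def] indicator_def)
 have nn: "0 \<le> a j x" for j x unfolding a_def by (rule sup_kern_nonneg[OF \<beta> _ f]) simp
 let ?v = "unit_ball_vol DIM('a) * 3 ^ DIM('a)"
 have 1: "L2_set (\<lambda>j. a j x) J1 \<le> sq_fun \<beta> J f1 x"
 proof -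
  have "a j x = sup_kern \<beta> (2 powi j) f1 x" if j: "j \<in> J1" for j
   unfolding a_def
  proof (rule sup_kern_local[OF \<beta>])
   fix z assume "z \<in> cball x (2 powi j)"
   then have "dist y z \<le> 3 * L" using j xy dist_triangle[of y z x] L by (auto simp: J1_def)
   then show "f z = f1 z" by (simp add: f1_def)
  qed simp
  then have "L2_set (\<lambda>j. a j x) J1 = L2_set (\<lambda>j. sup_kern \<beta> (2 powi j) f1 x) J1"
   by (intro L2_set_cong) auto
  also have "... \<le> sq_fun \<beta> J f1 x"
   unfolding sq_fun_def by (rule L2_set_subset_mono[OF J]) (auto simp: J1_def)
  finally show ?thesis .
 qed
 have 2: "L2_set (\<lambda>j. a j x) J2 \<le> sq_fun \<beta> J f x' + m * (?v / (1 - 2 powr - \<beta>))"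
 proof -
  \<comment> \<open>Balls of radius \<open>t \<ge> L\<close> about \<open>x\<close> and
    \<open>x'\<close> lie in the ball of radius \<open>2 * t\<close> about \<open>y\<close>, where
    the maximal function at \<open>y\<close> bounds the mean of \<bar>f\<bar>. The displacement, at
    most \<open>L\<close>, gains the factor \<open>(L / t) powr \<beta>\<close>.\<close>
  have step: "a j x \<le> a j x' + (L / 2 powi j) powr \<beta> * (m * ?v)" if j: "j \<in> J2" for j
  proof -
   define t where "t = (2::real) powi j"
   have t: "0 < t" "L \<le> t" using j by (auto simp: t_def J2_def)
   have sub: "cball x t \<subseteq> cball y (2 * t)" "cball x' t \<subseteq> cball y (2 * t)"
   proof -
    show "cball x t \<subseteq> cball y (2 * t)"
    proof
     fix z assume "z \<in> cball x t"
     then show "z \<in> cball y (2 * t)" using xy t dist_triangle[of y z x] by simp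
    qed
    show "cball x' t \<subseteq> cball y (2 * t)"
    proof
     fix z assume "z \<in> cball x' t"
     then show "z \<in> cball y (2 * t)" using yx' t dist_triangle[of y z x'] by simp
    qed
   qed
   have "a j x \<le> a j x' + (dist x x' / t) powr \<beta> / t ^ DIM('a) * abs_int f (cball y (2 * t))"
    unfolding a_def t_def[symmetric] by (rule sup_kern_smooth[OF \<beta> t(1) f sub])
   also have "(dist x x' / t) powr \<beta> / t ^ DIM('a) * abs_int f (cball y (2 * t)) \<le> (L / t) powr \<beta> / t ^ DIM('a) * (m * (unit_ball_vol DIM('a) * (3 * t) ^ DIM('a)))"
   proof (intro mult_mono divide_right_mono powr_mono2)
    show "abs_int f (cball y (2 * t)) \<le> m * (unit_ball_vol DIM('a) * (3 * t) ^ DIM('a))"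
     by (rule abs_int_le_max_fun[OF f _ _ M m]) (use t in auto)
   qed (use t xx' \<beta> in \<open>auto simp: abs_int_nonneg\<close>)
   also have "... = (L / t) powr \<beta> * (m * ?v)" using t by (simp add: power_mult_distrib)
   finally show ?thesis by (simp add: t_def)
  qed
  have "L2_set (\<lambda>j. a j x) J2 \<le> L2_set (\<lambda>j. a j x' + (L / 2 powi j) powr \<beta> * (m * ?v)) J2"
   by (intro L2_set_mono step nn)
  also have "... \<le> L2_set (\<lambda>j. a j x') J2 + L2_set (\<lambda>j. (L / 2 powi j) powr \<beta> * (m * ?v)) J2"
   by (rule L2_set_triangle_ineq)
  also have "L2_set (\<lambda>j. a j x') J2 \<le> sq_fun \<beta> J f x'"
   unfolding sq_fun_def a_def by (rule L2_set_subset_mono[OF J]) (auto simp: J2_def)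
  also have "L2_set (\<lambda>j. (L / 2 powi j) powr \<beta> * (m * ?v)) J2 \<le> (\<Sum>j\<in>J2. (L / 2 powi j) powr \<beta> * (m * ?v))"
   by (rule L2_set_le_sum) (use m in auto)
  also have "... = (\<Sum>j\<in>J2. (L / 2 powi j) powr \<beta>) * (m * ?v)" by (rule sum_distrib_right[symmetric])
  also have "... \<le> 1 / (1 - 2 powr - \<beta>) * (m * ?v)"
   unfolding J2_def using m by (intro mult_right_mono sum_scales_ge \<beta>(1) J L) auto
  finally show ?thesis by simp
 qed
 have "sq_fun \<beta> J f x = L2_set (\<lambda>j. a j x) (J1 \<union> J2)" unfolding sq_fun_def a_def J12(3) ..
 also have "... \<le> L2_set (\<lambda>j. a j x) J1 + L2_set (\<lambda>j. a j x) J2" by (rule L2_set_union_le[OF J12(1,2,4)])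
 finally show ?thesis using 1 2 by (simp add: f1_def[abs_def])
qed

text \<open>The open set where the square function exceeds \<open>l\<close> is cut into maximal
  dyadic cubes. The parent of such a cube contains a point where it is at most \<open>l\<close>, so
  by localization the excess on the cube is due to \<open>f\<close> nearby, up to a multiple of the
  maximal function. The weak type bound then confines the bad points to half of the cube in Lebesgue
  measure, and the hypothesis on \<open>w\<close> converts half into the fraction
  \<open>\<epsilon>\<close>. The choice of \<open>\<gamma>\<close> precedes \<open>w\<close> and
  \<open>\<epsilon>\<close>.\<close>

theorem sq_fun_good_lambda:
 assumes \<beta>: "0 < \<beta>" "\<beta> \<le> 1" and \<eta>: "0 < \<eta>"
 shows "\<exists>\<gamma>>0. \<forall>J. \<forall>f::'a::euclidean_space \<Rightarrow> real. \<forall>l w \<epsilon>. finite J \<longrightarrow> bdd_supp f \<longrightarrow> 0 < l \<longrightarrow> sets w = sets borel \<longrightarrow>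
   (\<forall>k x E. E \<in> sets borel \<longrightarrow> E \<subseteq> dcube k x \<longrightarrow> 2 * emeasure lborel E \<le> emeasure lborel (dcube k x) \<longrightarrow> emeasure w E \<le> ennreal \<epsilon> * emeasure w (dcube k x)) \<longrightarrow>
   emeasure w {x. (1 + \<eta>) * l < sq_fun \<beta> J f x} \<le> ennreal \<epsilon> * emeasure w {x. l < sq_fun \<beta> J f x}
    + emeasure w {x. ennreal (\<gamma> * l) < max_fun lborel (absf f) x}"
proof -
 obtain C1 where C1: "0 < C1" "\<And>J f l. finite J \<Longrightarrow> bdd_supp (f :: 'a \<Rightarrow> real) \<Longrightarrow> 0 < l \<Longrightarrow>
   emeasure lborel {x. l < sq_fun \<beta> J f x} \<le> ennreal (C1 / l * (LINT z|lborel. \<bar>f z\<bar>))"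
  using sq_fun_weak_type[OF \<beta>, where 'a='a] by blast
 define A where "A = unit_ball_vol DIM('a) * 3 ^ DIM('a) / (1 - 2 powr - \<beta>)"
 define v where "v = unit_ball_vol DIM('a) * (8 * DIM('a)) ^ DIM('a)"
 have r1: "0 < 1 - 2 powr - \<beta>" using \<beta> by (simp add: powr_less_one)
 have A: "0 < A" using r1 by (simp add: A_def)
 have v: "0 < v" by (simp add: v_def)
 \<comment> \<open>The first bound leaves at least \<open>\<eta> / 2\<close> times \<open>l\<close>
   for the local part after the large scales are paid for. The second makes the weak type estimate
   at that level at most half of the cube, where \<open>v\<close> is the relative volume of the ball
   of radius \<open>4 * L\<close>.\<close>
 define \<gamma> where "\<gamma> = min (\<eta> / (2 * A)) (\<eta> / (4 * C1 * v))"
 have \<gamma>: "0 < \<gamma>" using \<eta> A v C1 by (simp add: \<gamma>_def)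
 have \<gamma>A: "\<gamma> * A \<le> \<eta> / 2"
 proof -
  have "\<gamma> * A \<le> \<eta> / (2 * A) * A" using A by (intro mult_right_mono) (auto simp: \<gamma>_def)
  then show ?thesis using A by simp
 qed
 have \<gamma>C: "4 * C1 * v * \<gamma> \<le> \<eta>"
 proof -
  have "4 * C1 * v * \<gamma> \<le> 4 * C1 * v * (\<eta> / (4 * C1 * v))" using C1(1) v by (intro mult_left_mono) (auto simp: \<gamma>_def)
  then show ?thesis using C1(1) v by simp
 qed
 have "emeasure w {x. (1 + \<eta>) * l < sq_fun \<beta> J f x} \<le> ennreal \<epsilon> * emeasure w {x. l < sq_fun \<beta> J f x}
    + emeasure w {x. ennreal (\<gamma> * l) < max_fun lborel (absf f) x}"
  if J: "finite J" and f: "bdd_supp f" and l: "0 < l" and sw [measurable_cong]: "sets w = sets borel"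
   and ac: "\<And>k x E. E \<in> sets borel \<Longrightarrow> E \<subseteq> dcube k x \<Longrightarrow> 2 * emeasure lborel E \<le> emeasure lborel (dcube k x) \<Longrightarrow> emeasure w E \<le> ennreal \<epsilon> * emeasure w (dcube k x)"
  for J l \<epsilon> and f :: "'a \<Rightarrow> real" and w
 proof -
  have li: "local_int f" by (rule bdd_supp_local_int[OF f])
  have [measurable]: "f \<in> borel_measurable borel" by (rule bdd_supp_measurable[OF f])
  define F where "F = sq_fun \<beta> J f"
  define M where "M = max_fun lborel (absf f)"
  have Fm [measurable]: "F \<in> borel_measurable borel" unfolding F_def by (rule measurable_sq_fun[OF \<beta> li])
  have Mm [measurable]: "M \<in> borel_measurable borel" unfolding M_def by measurable
  define U where "U = {x. l < F x}"
  have U_open: "open U"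
   unfolding U_def F_def by (intro open_Collect_less continuous_intros sq_fun_cont \<beta> li)
  have U_fin: "emeasure lborel U < top"
  proof -
   obtain B R where BR: "\<And>x. \<bar>F x\<bar> \<le> B * indicator (cball 0 R) x" using bdd_suppE[OF sq_fun_bdd_supp[OF \<beta> J f]] unfolding F_def by metis
   have "U \<subseteq> cball 0 R"
   proof
    fix x assume "x \<in> U"
    then have "l < F x" by (simp add: U_def)
    then have "0 < \<bar>F x\<bar>" using l by linarith
    with BR[of x] show "x \<in> cball 0 R" by (cases "x \<in> cball 0 R") auto
   qed
   then have "emeasure lborel U \<le> emeasure lborel (cball (0::'a) R)" by (rule emeasure_mono) simp
   also have "... < top" using emeasure_bounded_finite[of "cball (0::'a) R"] by simp
   finally show ?thesis .
  qed
  \<comment> \<open>\<open>U\<close> has finite measure, so cubes of a sufficiently coarse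
    generation are too large to fit in it; every maximal cube then has a parent that leaves
    \<open>U\<close>.\<close>
  obtain k0 where k0: "\<And>x. \<not> dcube k0 x \<subseteq> U"
  proof -
   obtain u where u: "emeasure lborel U = ennreal u" "0 \<le> u" using U_fin by (cases "emeasure lborel U") auto
   obtain N :: nat where N: "u < 2 ^ N" using real_arch_pow[of 2 u] by auto
   have "\<not> dcube (- int N) x \<subseteq> U" for x
   proof
    assume "dcube (- int N) x \<subseteq> U"
    then have "emeasure lborel (dcube (- int N) x) \<le> emeasure lborel U"
     by (rule emeasure_mono) (use U_open in simp)
    then have "(2 ^ N) ^ DIM('a) \<le> u" using u by (simp add: emeasure_dcube)
    moreover have "(2::real) ^ N \<le> (2 ^ N) ^ DIM('a)" by (rule self_le_power) auto
    ultimately show False using N by simp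
   qed
   then show ?thesis by (rule that)
  qed
  define P where "P Q \<longleftrightarrow> Q \<subseteq> U" for Q :: "'a set"
  define S where "S = stop_cubes k0 P"
  have US: "\<Union>S = U"
  proof
   show "\<Union>S \<subseteq> U"
   proof
    fix x assume "x \<in> \<Union>S"
    then obtain m where "P (dcube (k0 + int m) x)" unfolding S_def Union_stop_cubes by (elim CollectE exE)
    then show "x \<in> U" unfolding P_def by (rule subsetD) simp
   qed
   show "U \<subseteq> \<Union>S"
   proof
    fix x assume "x \<in> U"
    then obtain m where "dcube (k0 + int m) x \<subseteq> U" using dcube_subset_open[OF U_open \<open>x \<in> U\<close>, of k0] by (elim exE)
    then have "P (dcube (k0 + int m) x)" unfolding P_def .
    then show "x \<in> \<Union>S" unfolding S_def Union_stop_cubes by (intro CollectI exI)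
   qed
  qed
  define G where "G = {x. (1 + \<eta>) * l < F x \<and> M x \<le> ennreal (\<gamma> * l)}"
  have Gm [measurable]: "G \<in> sets borel" unfolding G_def by measurable
  have local: "emeasure w (G \<inter> Q) \<le> ennreal \<epsilon> * emeasure w Q" if Q: "Q \<in> S" for Q
  proof (cases "G \<inter> Q = {}")
   case False
   then obtain y where y: "y \<in> Q" "M y \<le> ennreal (\<gamma> * l)" by (auto simp: G_def)
   note D = stop_cubes_memD[OF Q[unfolded S_def] y(1)]
   define k where "k = k0 + int (stop_gen k0 P y)"
   have Qk: "Q = dcube k y" using D(1) by (simp add: k_def)
   have "stop_gen k0 P y \<noteq> 0"
   proof
    assume "stop_gen k0 P y = 0"
    then have "dcube k0 y \<subseteq> U" using D(2) unfolding Qk by (simp add: k_def P_def)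
    with k0 show False by blast
   qed
   then have "\<not> P (dcube (k0 + int (stop_gen k0 P y - 1)) y)" by (intro D(3)[rule_format]) simp
   moreover have "k0 + int (stop_gen k0 P y - 1) = k - 1" using \<open>stop_gen k0 P y \<noteq> 0\<close> by (simp add: k_def)
   ultimately have "\<not> dcube (k - 1) y \<subseteq> U" by (simp add: P_def)
   then obtain x' where x': "x' \<in> dcube (k - 1) y" "x' \<notin> U" by blast
   \<comment> \<open>The diameter bound of the parent cube, which contains \<open>x\<close>,
     \<open>y\<close> and the reference point \<open>x'\<close>.\<close>
   define L where "L = 2 * DIM('a) * (2::real) powi (- k)"
   have L0: "0 < L" by (simp add: L_def)
   have L_parent: "DIM('a) * 2 powi (- (k - 1)) = L"
   proof -
    have "(2::real) powi (- (k - 1)) = 2 powi (1 + - k)" by simp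
    also have "... = 2 * 2 powi (- k)" by (subst power_int_add) auto
    finally show ?thesis unfolding L_def by simp
   qed
   define f1 where "f1 z = f z * indicator (cball y (3 * L)) z" for z
   have f1: "bdd_supp f1"
   proof -
    obtain B R where BR: "\<And>x. \<bar>f x\<bar> \<le> B * indicator (cball 0 R) x" using bdd_suppE[OF f] by metis
    have "\<bar>f1 x\<bar> \<le> B * indicator (cball 0 R) x" for x
     using BR[of x] by (cases "x \<in> cball y (3 * L)") (auto simp: f1_def intro: order_trans[OF abs_ge_zero])
    moreover have "f1 \<in> borel_measurable borel" unfolding f1_def by measurable
    ultimately show ?thesis unfolding bdd_supp_def by blast
   qed
   have f1_int: "(LINT z|lborel. \<bar>f1 z\<bar>) \<le> \<gamma> * l * (v * (2 powi (- k)) ^ DIM('a))"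
   proof -
    have 1: "(LINT z|lborel. \<bar>f1 z\<bar>) = abs_int f (cball y (3 * L))"
     unfolding abs_int_def f1_def by (intro Bochner_Integration.integral_cong) (auto simp: abs_mult)
    have 2: "abs_int f (cball y (3 * L)) \<le> \<gamma> * l * (unit_ball_vol DIM('a) * (4 * L) ^ DIM('a))"
     by (rule abs_int_le_max_fun[OF li _ _ y(2)[unfolded M_def]]) (use L0 \<gamma> l in auto)
    have e: "4 * L = (8 * DIM('a)) * 2 powi (- k)" by (simp add: L_def)
    have 3: "unit_ball_vol DIM('a) * (4 * L) ^ DIM('a) = v * (2 powi (- k)) ^ DIM('a)"
     unfolding e v_def by (simp add: power_mult_distrib)
    show ?thesis using 2 unfolding 1 3 .
   qed
   have sub: "G \<inter> Q \<subseteq> {x\<in>Q. l * (\<eta> / 2) < sq_fun \<beta> J f1 x}"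
   proof
    fix x assume x: "x \<in> G \<inter> Q"
    have xQ: "x \<in> dcube (k - 1) y" using x dcube_antimono[of "k - 1" k y] by (auto simp: Qk)
    have d1: "dist y x \<le> L" using dcube_dist_le[OF xQ] L_parent by simp
    have d2: "dist y x' \<le> L" using dcube_dist_le[OF x'(1)] L_parent by simp
    have d3: "dist x x' \<le> L"
    proof -
     have "x' \<in> dcube (k - 1) x" using x'(1) dcube_eq[OF xQ] by simp
     from dcube_dist_le[OF this] show ?thesis using L_parent by simp
    qed
    have "F x \<le> F x' + (\<gamma> * l) * A + sq_fun \<beta> J f1 x"
     unfolding F_def A_def f1_def
     by (rule sq_fun_localize[OF \<beta> J li L0 d1 d3 d2 _ y(2)[unfolded M_def]]) (use \<gamma> l in simp)
    moreover have "F x' \<le> l" using x'(2) by (simp add: U_def)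
    moreover have "(1 + \<eta>) * l < F x" using x by (simp add: G_def)
    moreover have "(\<gamma> * l) * A \<le> l * (\<eta> / 2)" using \<gamma>A l by (simp add: mult_left_mono mult.assoc mult.left_commute[of \<gamma>])
    ultimately have "l * (\<eta> / 2) < sq_fun \<beta> J f1 x" by (simp add: algebra_simps)
    then show "x \<in> {x\<in>Q. l * (\<eta> / 2) < sq_fun \<beta> J f1 x}" using x by simp
   qed
   have "emeasure lborel (G \<inter> Q) \<le> emeasure lborel {x. l * (\<eta> / 2) < sq_fun \<beta> J f1 x}"
   proof (rule emeasure_mono)
    have [measurable]: "sq_fun \<beta> J f1 \<in> borel_measurable borel" by (rule measurable_sq_fun[OF \<beta> bdd_supp_local_int[OF f1]])
    show "{x. l * (\<eta> / 2) < sq_fun \<beta> J f1 x} \<in> sets lborel" by measurable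
   qed (use sub in blast)
   also have "... \<le> ennreal (C1 / (l * (\<eta> / 2)) * (LINT z|lborel. \<bar>f1 z\<bar>))"
    by (rule C1(2)[OF J f1]) (use l \<eta> in simp)
   also have "... \<le> ennreal ((2 powi (- k)) ^ DIM('a) / 2)"
   proof (rule ennreal_leI)
    have "C1 / (l * (\<eta> / 2)) * (LINT z|lborel. \<bar>f1 z\<bar>) \<le> C1 / (l * (\<eta> / 2)) * (\<gamma> * l * (v * (2 powi (- k)) ^ DIM('a)))"
     using C1(1) l \<eta> by (intro mult_left_mono f1_int) auto
    also have "... = (4 * C1 * v * \<gamma>) * ((2 powi (- k)) ^ DIM('a) / (2 * \<eta>))"
     using l \<eta> by (simp add: field_simps)
    also have "... \<le> \<eta> * ((2 powi (- k)) ^ DIM('a) / (2 * \<eta>))"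
     using \<eta> by (intro mult_right_mono \<gamma>C) auto
    also have "... = (2 powi (- k)) ^ DIM('a) / 2" using \<eta> by simp
    finally show "C1 / (l * (\<eta> / 2)) * (LINT z|lborel. \<bar>f1 z\<bar>) \<le> (2 powi (- k)) ^ DIM('a) / 2" .
   qed
   finally have half: "emeasure lborel (G \<inter> Q) \<le> ennreal ((2 powi (- k)) ^ DIM('a) / 2)" .
   have "2 * emeasure lborel (G \<inter> Q) \<le> 2 * ennreal ((2 powi (- k)) ^ DIM('a) / 2)" by (rule mult_left_mono[OF half]) simp
   also have "... = ennreal (2 * ((2 powi (- k)) ^ DIM('a) / 2))" by (subst ennreal_mult) auto
   also have "... = emeasure lborel Q" unfolding Qk emeasure_dcube by simp
   finally show ?thesis unfolding Qk by (intro ac) (auto simp: Qk)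
  qed simp
  have "emeasure w G = (\<integral>\<^sup>+x\<in>U. indicator G x \<partial>w)"
  proof -
   have "G \<subseteq> U"
   proof
    fix x assume "x \<in> G"
    then have "(1 + \<eta>) * l < F x" by (simp add: G_def)
    moreover have "l \<le> (1 + \<eta>) * l" using \<eta> l by simp
    ultimately show "x \<in> U" by (simp add: U_def)
   qed
   then have "(\<integral>\<^sup>+x\<in>U. indicator G x \<partial>w) = (\<integral>\<^sup>+x. indicator G x \<partial>w)"
    by (intro nn_integral_cong) (auto simp: indicator_def)
   then show ?thesis by simp
  qed
  also have "... = (\<integral>\<^sup>+Q. (\<integral>\<^sup>+x\<in>Q. indicator G x \<partial>w) \<partial>count_space S)"
   unfolding US[symmetric] S_def by (rule nn_integral_stop_cubes[symmetric]) (auto simp: sw)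
  also have "... \<le> (\<integral>\<^sup>+Q. (\<integral>\<^sup>+x\<in>Q. ennreal \<epsilon> \<partial>w) \<partial>count_space S)"
  proof (rule nn_integral_mono)
   fix Q assume "Q \<in> space (count_space S)"
   then have Q: "Q \<in> S" by simp
   have Qm: "Q \<in> sets w" unfolding sw by (rule stop_cubes_sets[OF Q[unfolded S_def]])
   have Gw: "G \<in> sets w" unfolding sw by (rule Gm)
   have "(\<integral>\<^sup>+x\<in>Q. indicator G x \<partial>w) = emeasure w (G \<inter> Q)"
    unfolding indicator_inter_arith[symmetric] by (rule nn_integral_indicator) (rule sets.Int[OF Gw Qm])
   also have "... \<le> ennreal \<epsilon> * emeasure w Q" by (rule local[OF Q])
   also have "... = (\<integral>\<^sup>+x\<in>Q. ennreal \<epsilon> \<partial>w)" by (rule nn_integral_cmult_indicator[OF Qm, symmetric])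
   finally show "(\<integral>\<^sup>+x\<in>Q. indicator G x \<partial>w) \<le> (\<integral>\<^sup>+x\<in>Q. ennreal \<epsilon> \<partial>w)" .
  qed
  also have "... = (\<integral>\<^sup>+x\<in>U. ennreal \<epsilon> \<partial>w)"
   unfolding US[symmetric] S_def by (rule nn_integral_stop_cubes) (auto simp: sw)
  also have "... = ennreal \<epsilon> * emeasure w U"
   by (rule nn_integral_cmult_indicator) (use U_open in \<open>simp add: sw\<close>)
  finally have G_le: "emeasure w G \<le> ennreal \<epsilon> * emeasure w U" .
  have "emeasure w {x. (1 + \<eta>) * l < F x} \<le> emeasure w (G \<union> {x. ennreal (\<gamma> * l) < M x})"
  proof (rule emeasure_mono)
   show "{x. (1 + \<eta>) * l < F x} \<subseteq> G \<union> {x. ennreal (\<gamma> * l) < M x}" by (auto simp: G_def not_le)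
   have "G \<union> {x. ennreal (\<gamma> * l) < M x} \<in> sets borel" by measurable
   then show "G \<union> {x. ennreal (\<gamma> * l) < M x} \<in> sets w" unfolding sw .
  qed
  also have "... \<le> emeasure w G + emeasure w {x. ennreal (\<gamma> * l) < M x}"
  proof (rule emeasure_subadditive)
   show "G \<in> sets w" unfolding sw by (rule Gm)
   have "{x. ennreal (\<gamma> * l) < M x} \<in> sets borel" by measurable
   then show "{x. ennreal (\<gamma> * l) < M x} \<in> sets w" unfolding sw .
  qed
  also have "... \<le> ennreal \<epsilon> * emeasure w U + emeasure w {x. ennreal (\<gamma> * l) < M x}"
   by (intro add_right_mono G_le)
  finally show ?thesis by (simp add: F_def M_def U_def)
 qed
 then show ?thesis using \<gamma> by (intro exI[of _ \<gamma>]) blast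
qed

text \<open>\<open>good_lambda\<close> is applied to the measure \<open>W\<close> with
  \<open>\<eta> = \<rho> - 1\<close> and \<open>H\<close> the maximal function divided by
  \<open>\<gamma>\<close>. Its finiteness hypothesis holds because the square function is bounded
  with bounded support and balls have finite mass.\<close>

theorem sq_fun_weighted_bdd_supp:
 fixes w :: "'a::euclidean_space \<Rightarrow> real"
 assumes \<beta>: "0 < \<beta>" "\<beta> \<le> 1" and w: "ball_avg_weight q C w" and q: "1 < q"
 shows "\<exists>K\<ge>0. \<forall>J f. finite J \<longrightarrow> bdd_supp f \<longrightarrow>
   (wint q w (\<lambda>x. ennreal (sq_fun \<beta> J f x)))
   \<le> ennreal K * wint q w (absf f)"
proof -
 note D = ball_avg_weightD[OF w]
 note [measurable] = D(1)
 define W where "W = density lborel (\<lambda>x. ennreal (w x))"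
 have sW [measurable_cong]: "sets W = sets borel" by (simp add: W_def)
 then have spW: "space W = UNIV" using sets_eq_imp_space_eq by fastforce
 have dbl: "doubling_measure W (C * 5 powr (real DIM('a) * q))"
  unfolding W_def by (rule ball_avg_weight_doubling[OF w]) (use q in simp)
 interpret W: sigma_finite_measure W by (rule sigma_finite_doubling[OF dbl])
 have W_int: "(\<integral>\<^sup>+x. g x \<partial>W) = (\<integral>\<^sup>+x. g x * ennreal (w x) \<partial>lborel)" if [measurable]: "g \<in> borel_measurable borel" for g
  unfolding W_def by (subst nn_integral_density) (auto simp: mult.commute)
 obtain \<epsilon> where \<epsilon>: "0 \<le> \<epsilon>" "\<epsilon> < 1" and ac: "\<And>k x E. E \<in> sets borel \<Longrightarrow> E \<subseteq> dcube k x \<Longrightarrow> 2 * emeasure lborel E \<le> emeasure lborel (dcube k x) \<Longrightarrow> emeasure W E \<le> ennreal \<epsilon> * emeasure W (dcube k x)"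
  using ball_avg_weight_dcube[OF w] q unfolding W_def by (elim exE conjE meta_impE) auto
 \<comment> \<open>The absorption asks for \<open>1 < \<rho>\<close> and
   \<open>\<epsilon> * \<rho> powr q < 1\<close>. With
   \<open>\<rho> powr q = 2 / (1 + \<epsilon>)\<close> both reduce to
   \<open>\<epsilon> < 1\<close>.\<close>
 define \<rho> where "\<rho> = (2 / (1 + \<epsilon>)) powr (1 / q)"
 have \<rho>q: "\<rho> powr q = 2 / (1 + \<epsilon>)" using q \<epsilon> by (simp add: \<rho>_def powr_powr)
 have \<rho>1: "1 < \<rho>" unfolding \<rho>_def using \<epsilon> q by (intro gr_one_powr) auto
 have \<epsilon>\<rho>: "\<epsilon> * \<rho> powr q < 1" using \<epsilon> by (simp add: \<rho>q field_simps)
 obtain \<gamma> where \<gamma>: "0 < \<gamma>" and gl: "\<forall>J. \<forall>f::'a \<Rightarrow> real. \<forall>l w \<epsilon>. finite J \<longrightarrow> bdd_supp f \<longrightarrow> 0 < l \<longrightarrow> sets w = sets borel \<longrightarrow>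
   (\<forall>k x E. E \<in> sets borel \<longrightarrow> E \<subseteq> dcube k x \<longrightarrow> 2 * emeasure lborel E \<le> emeasure lborel (dcube k x) \<longrightarrow> emeasure w E \<le> ennreal \<epsilon> * emeasure w (dcube k x)) \<longrightarrow>
   emeasure w {x. (1 + (\<rho> - 1)) * l < sq_fun \<beta> J f x} \<le> ennreal \<epsilon> * emeasure w {x. l < sq_fun \<beta> J f x}
    + emeasure w {x. ennreal (\<gamma> * l) < max_fun lborel (absf f) x}"
  using sq_fun_good_lambda[OF \<beta>, of "\<rho> - 1", where 'a='a] \<rho>1 by (elim meta_impE exE conjE) auto
 obtain K where K: "0 \<le> K" and maxK: "\<And>f. f \<in> borel_measurable borel \<Longrightarrow> (wint q w (max_fun lborel f))
   \<le> ennreal K * wint q w f"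
  using max_fun_weighted[OF w q] by blast
 define K' where "K' = \<rho> powr q / (1 - \<epsilon> * \<rho> powr q)"
 have K': "0 \<le> K'" using \<epsilon>\<rho> by (simp add: K'_def)
 have "wint q w (\<lambda>x. ennreal (sq_fun \<beta> J f x))
   \<le> ennreal (K' * (1 / \<gamma>) powr q * K) * wint q w (absf f)"
  if J: "finite J" and f: "bdd_supp f" for J and f :: "'a \<Rightarrow> real"
 proof -
  have [measurable]: "f \<in> borel_measurable borel" by (rule bdd_supp_measurable[OF f])
  have Fm [measurable]: "sq_fun \<beta> J f \<in> borel_measurable borel" by (rule measurable_sq_fun[OF \<beta> bdd_supp_local_int[OF f]])
  define F where "F x = ennreal (sq_fun \<beta> J f x)" for x
  define M where "M = max_fun lborel (absf f)"
  define H where "H x = ennreal (1 / \<gamma>) * M x" for x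
  have [measurable]: "F \<in> borel_measurable borel" "M \<in> borel_measurable borel" unfolding F_def M_def by measurable
  have [measurable]: "H \<in> borel_measurable borel" unfolding H_def by measurable
  have fin: "(\<integral>\<^sup>+x. F x epowr q \<partial>W) < top"
  proof -
   obtain B R where BR: "0 \<le> B" "0 \<le> R" "\<And>x. \<bar>sq_fun \<beta> J f x\<bar> \<le> B * indicator (cball 0 R) x"
    using bdd_suppE[OF sq_fun_bdd_supp[OF \<beta> J f]] by metis
   have "(\<integral>\<^sup>+x. F x epowr q \<partial>W) \<le> (\<integral>\<^sup>+x. ennreal (B powr q) * indicator (ball 0 (R + 1)) x \<partial>W)"
   proof (rule nn_integral_mono)
    fix x
    show "F x epowr q \<le> ennreal (B powr q) * indicator (ball 0 (R + 1)) x"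
    proof (cases "x \<in> cball 0 R")
     case True
     then have "F x \<le> ennreal B" using BR(3)[of x] by (auto simp: F_def intro!: ennreal_leI)
     then have "F x epowr q \<le> ennreal B epowr q" using q by (intro epowr_mono) auto
     then show ?thesis using True BR(1) q by (simp add: epowr_ennreal)
    next
     case False
     then have "F x = 0" using BR(3)[of x] by (simp add: F_def)
     then show ?thesis using q by simp
    qed
   qed
   also have "... = ennreal (B powr q) * emeasure W (ball 0 (R + 1))"
    by (rule nn_integral_cmult_indicator) (simp add: sW)
   also have "... < top"
    using dbl BR(2) unfolding doubling_measure_def by (auto simp: ennreal_mult_less_top)
   finally show ?thesis .
  qed
  have scale: "ennreal l < H x \<longleftrightarrow> ennreal (\<gamma> * l) < M x" if "0 < l" for l x
   using \<gamma> that unfolding H_def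
   by (cases "M x") (auto simp: ennreal_mult[symmetric] ennreal_mult_top field_simps ennreal_less_iff)
  have "(\<integral>\<^sup>+x. F x epowr q \<partial>W) \<le> ennreal K' * (\<integral>\<^sup>+x. H x epowr q \<partial>W)"
   unfolding K'_def
  proof (rule W.good_lambda)
   fix l :: real assume l: "0 < l"
   have "emeasure W {x. (1 + (\<rho> - 1)) * l < sq_fun \<beta> J f x} \<le> ennreal \<epsilon> * emeasure W {x. l < sq_fun \<beta> J f x}
    + emeasure W {x. ennreal (\<gamma> * l) < max_fun lborel (absf f) x}"
    using gl[rule_format, OF J f l sW ac] by simp
   moreover have "{x. (1 + (\<rho> - 1)) * l < sq_fun \<beta> J f x} = {x\<in>space W. ennreal (\<rho> * l) < F x}"
    using l \<rho>1 by (auto simp: F_def spW ennreal_less_iff)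
   moreover have "{x. l < sq_fun \<beta> J f x} = {x\<in>space W. ennreal l < F x}"
    using l by (auto simp: F_def spW ennreal_less_iff)
   moreover have "{x. ennreal (\<gamma> * l) < max_fun lborel (absf f) x} = {x\<in>space W. ennreal l < H x}"
    using scale[OF l] by (simp add: spW M_def)
   ultimately show "emeasure W {x\<in>space W. ennreal (\<rho> * l) < F x} \<le> ennreal \<epsilon> * emeasure W {x\<in>space W. ennreal l < F x} + emeasure W {x\<in>space W. ennreal l < H x}"
    by simp
  qed (use q \<rho>1 \<epsilon> \<epsilon>\<rho> fin in auto)
  also have "(\<integral>\<^sup>+x. H x epowr q \<partial>W) = ennreal ((1 / \<gamma>) powr q) * wint q w M"
   using q \<gamma> unfolding H_def by (simp add: epowr_mult epowr_ennreal W_int mult.assoc nn_integral_cmult)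
  also have "wint q w M \<le> ennreal K * wint q w (absf f)"
   unfolding M_def by (rule maxK) measurable
  finally have "(\<integral>\<^sup>+x. F x epowr q \<partial>W) \<le> ennreal K' * (ennreal ((1 / \<gamma>) powr q) * (ennreal K * wint q w (absf f)))"
   by (simp add: mult_left_mono)
  then show ?thesis using K K' by (simp add: W_int F_def ennreal_mult mult.assoc)
 qed
 then show ?thesis using K K' by (intro exI[of _ "K' * (1 / \<gamma>) powr q * K"]) auto
qed

text \<open>The averaging condition tested on \<bar>f\<bar>: its right side is finite and w(B) is
  positive, so the integral of \<bar>f\<bar> over B is finite.\<close>

lemma ball_avg_weight_local_int:
 fixes w :: "'a::euclidean_space \<Rightarrow> real"
 assumes w: "ball_avg_weight q C w" and q: "1 \<le> q" and [measurable]: "f \<in> borel_measurable borel"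
  and fin: "wint q w (absf f) < top"
 shows "local_int f"
 unfolding local_int_def
proof (intro conjI allI)
 note D = ball_avg_weightD[OF w]
 fix c :: 'a and r :: real
 define R where "R = max r 0 + 1"
 have R: "0 < R" by (simp add: R_def)
 let ?F = "\<integral>\<^sup>+z\<in>ball c R. ennreal \<bar>f z\<bar> \<partial>lborel" and ?w = "\<integral>\<^sup>+z\<in>ball c R. ennreal (w z) \<partial>lborel"
 have "?F epowr q * ?w \<le> ennreal C * emeasure lborel (ball c R) epowr q * wint_on (ball c R) q w (absf f)"
  by (rule D(6)) (use R in auto)
 also have "... \<le> ennreal C * emeasure lborel (ball c R) epowr q * wint q w (absf f)"
  by (intro mult_left_mono nn_integral_mono) (auto simp: indicator_def)
 also have "... < top"
  using fin emeasure_lborel_ball_finite'[of c R] q by (auto simp: ennreal_mult_less_top epowr_less_top_iff)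
 finally have "?F epowr q * ?w < top" .
 moreover have "?w \<noteq> 0" using nn_integral_ball_pos[OF D(1) D(2) R, of c] by auto
 ultimately have "?F < top" using q by (auto simp: ennreal_mult_less_top epowr_less_top_iff epowr_eq_0_iff)
 moreover have "abs_nint f (cball c r) \<le> ?F"
  by (intro nn_integral_mono mult_left_mono indicator_leI) (auto simp: R_def)
 ultimately show "abs_nint f (cball c r) < top" by (rule le_less_trans[rotated])
qed fact

section \<open>Passage to general functions and to all scales\<close>

lemma sq_fun_size:
 fixes f :: "'a::euclidean_space \<Rightarrow> real"
 assumes \<beta>: "0 < \<beta>" "\<beta> \<le> 1" and f: "local_int f"
 shows "sq_fun \<beta> J f x \<le> (\<Sum>j\<in>J. 3 / (2 powi j) ^ DIM('a) * abs_int f (cball x (2 powi j)))"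
proof -
 have "sq_fun \<beta> J f x \<le> (\<Sum>j\<in>J. sup_kern \<beta> (2 powi j) f x)"
  unfolding sq_fun_def by (rule L2_set_le_sum) (rule sup_kern_nonneg[OF \<beta> _ f], simp)
 also have "... \<le> (\<Sum>j\<in>J. 3 / (2 powi j) ^ DIM('a) * abs_int f (cball x (2 powi j)))"
  by (intro sum_mono sup_kern_size \<beta> f) simp
 finally show ?thesis .
qed

text \<open>By subadditivity the two square functions differ by at most that of the difference,
  which is bounded by finitely many local L^1 norms of \<open>f - g N\<close>. These tend to 0 by
  dominated convergence.\<close>

lemma sq_fun_truncation:
 fixes f :: "'a::euclidean_space \<Rightarrow> real"
 assumes \<beta>: "0 < \<beta>" "\<beta> \<le> 1" and f: "local_int f"
  and g: "\<And>N. local_int (g N)" "\<And>N z. \<bar>g N z\<bar> \<le> \<bar>f z\<bar>" "\<And>z. (\<lambda>N. g N z) \<longlonglongrightarrow> f z"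
 shows "(\<lambda>N. sq_fun \<beta> J (g N) x) \<longlonglongrightarrow> sq_fun \<beta> J f x"
proof -
 have [measurable]: "f \<in> borel_measurable borel" "g N \<in> borel_measurable borel" for N
  using f g(1) by (auto intro: local_int_measurable)
 define h where "h N z = f z - g N z" for N z
 have neg: "local_int (\<lambda>z. - u z)" if "local_int u" for u :: "'a \<Rightarrow> real"
  using that by (auto simp: local_int_def)
 have h: "local_int (h N)" for N
  using local_int_add[OF f neg[OF g(1)]] by (simp add: h_def[abs_def])
 define e where "e N = (\<Sum>j\<in>J. 3 / (2 powi j) ^ DIM('a) * abs_int (h N) (cball x (2 powi j)))" for N
 have abs_neg: "abs_int (\<lambda>z. - h N z) S = abs_int (h N) S" for N S by (simp add: abs_int_def)
 have bound: "norm (sq_fun \<beta> J (g N) x - sq_fun \<beta> J f x) \<le> e N" for N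
 proof -
  have "sq_fun \<beta> J f x \<le> sq_fun \<beta> J (g N) x + sq_fun \<beta> J (h N) x"
   using sq_fun_add[OF \<beta> g(1) h, of J N N x] by (simp add: h_def)
  moreover have "sq_fun \<beta> J (g N) x \<le> sq_fun \<beta> J f x + sq_fun \<beta> J (\<lambda>z. - h N z) x"
   using sq_fun_add[OF \<beta> f neg[OF h], of J N x] by (simp add: h_def)
  moreover have "sq_fun \<beta> J (h N) x \<le> e N" "sq_fun \<beta> J (\<lambda>z. - h N z) x \<le> e N"
   using sq_fun_size[OF \<beta> h, of J N x] sq_fun_size[OF \<beta> neg[OF h], of J N x] by (simp_all add: e_def abs_neg)
  ultimately show ?thesis by (simp add: abs_le_iff)
 qed
 have "e \<longlonglongrightarrow> (\<Sum>j\<in>J. 3 / (2 powi j) ^ DIM('a) * 0)"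
  unfolding e_def
 proof (intro tendsto_sum tendsto_mult_left)
  fix j
  let ?i = "indicator (cball x (2 powi j)) :: 'a \<Rightarrow> real"
  have "(\<lambda>N. LINT z|lborel. \<bar>h N z\<bar> * ?i z) \<longlonglongrightarrow> (LINT z|(lborel :: 'a measure). 0)"
  proof (rule integral_dominated_convergence[where w="\<lambda>z. 2 * (\<bar>f z\<bar> * ?i z)"])
   show "AE z in lborel. (\<lambda>N. \<bar>h N z\<bar> * ?i z) \<longlonglongrightarrow> 0"
   proof (rule AE_I2)
    fix z
    have "(\<lambda>N. h N z) \<longlonglongrightarrow> f z - f z" unfolding h_def by (intro tendsto_intros g(3))
    then have "(\<lambda>N. \<bar>h N z\<bar> * ?i z) \<longlonglongrightarrow> 0 * ?i z" by (intro tendsto_mult_right tendsto_rabs_zero) simp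
    then show "(\<lambda>N. \<bar>h N z\<bar> * ?i z) \<longlonglongrightarrow> 0" by simp
   qed
   show "integrable lborel (\<lambda>z. 2 * (\<bar>f z\<bar> * ?i z))" by (intro integrable_mult_right local_int_integrable f)
   show "AE z in lborel. norm (\<bar>h N z\<bar> * ?i z) \<le> 2 * (\<bar>f z\<bar> * ?i z)" for N
   proof (rule AE_I2)
    fix z
    have "\<bar>h N z\<bar> \<le> 2 * \<bar>f z\<bar>" using g(2)[of N z] unfolding h_def by linarith
    then have "\<bar>h N z\<bar> * ?i z \<le> 2 * \<bar>f z\<bar> * ?i z" by (rule mult_right_mono) simp
    then show "norm (\<bar>h N z\<bar> * ?i z) \<le> 2 * (\<bar>f z\<bar> * ?i z)" by (simp add: abs_mult)
   qed
  qed (auto simp: h_def)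
  then show "(\<lambda>N. abs_int (h N) (cball x (2 powi j))) \<longlonglongrightarrow> 0" by (simp add: abs_int_def)
 qed
 then have "e \<longlonglongrightarrow> 0" by simp
 then have "(\<lambda>N. sq_fun \<beta> J (g N) x - sq_fun \<beta> J f x) \<longlonglongrightarrow> 0"
  by (rule Lim_null_comparison[rotated]) (simp add: bound[unfolded real_norm_def])
 then show ?thesis by (rule LIM_zero_cancel)
qed

text \<open>Truncation of \<open>f\<close> in height and in space gives functions covered by the
  previous theorem; Fatou's lemma passes to the limit. The hypothesis of a finite weighted norm
  provides the local integrability needed for pointwise convergence.\<close>

theorem sq_fun_weighted:
 fixes w :: "'a::euclidean_space \<Rightarrow> real"
 assumes \<beta>: "0 < \<beta>" "\<beta> \<le> 1" and w: "ball_avg_weight q C w" and q: "1 < q"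
 shows "\<exists>K\<ge>0. \<forall>J f. finite J \<longrightarrow> f \<in> borel_measurable borel \<longrightarrow> (wint q w (absf f)) < top \<longrightarrow>
   (wint q w (\<lambda>x. ennreal (sq_fun \<beta> J f x)))
   \<le> ennreal K * wint q w (absf f)"
proof -
 note D = ball_avg_weightD[OF w]
 note [measurable] = D(1)
 obtain K where K: "0 \<le> K" and bd: "\<And>J f. finite J \<Longrightarrow> bdd_supp f \<Longrightarrow>
   (wint q w (\<lambda>x. ennreal (sq_fun \<beta> J f x)))
   \<le> ennreal K * wint q w (absf f)"
  using sq_fun_weighted_bdd_supp[OF \<beta> w q] by blast
 have "wint q w (\<lambda>x. ennreal (sq_fun \<beta> J f x))
   \<le> ennreal K * wint q w (absf f)"
  if J: "finite J" and fm [measurable]: "f \<in> borel_measurable borel"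
   and fin: "wint q w (absf f) < top" for J and f :: "'a \<Rightarrow> real"
 proof -
  have li: "local_int f" by (rule ball_avg_weight_local_int[OF w _ fm fin]) (use q in simp)
  define g where "g N z = (if \<bar>f z\<bar> \<le> real N \<and> norm z \<le> real N then f z else 0)" for N :: nat and z
  have gm [measurable]: "g N \<in> borel_measurable borel" for N unfolding g_def by measurable
  have g_le: "\<bar>g N z\<bar> \<le> \<bar>f z\<bar>" for N z by (simp add: g_def)
  have g_bd: "bdd_supp (g N)" for N
   unfolding bdd_supp_def
   by (intro conjI gm exI[of _ "real N"]) (auto simp: g_def indicator_def)
  have g_lim: "(\<lambda>N. g N z) \<longlonglongrightarrow> f z" for z
  proof (rule tendsto_eventually)
   obtain N0 :: nat where "max \<bar>f z\<bar> (norm z) \<le> N0" using real_arch_simple by blast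
   then have "g N z = f z" if "N0 \<le> N" for N using that by (auto simp: g_def)
   then show "\<forall>\<^sub>F N in sequentially. g N z = f z" by (auto simp: eventually_sequentially)
  qed
  have lim: "(\<lambda>N. sq_fun \<beta> J (g N) x) \<longlonglongrightarrow> sq_fun \<beta> J f x" for x
   by (rule sq_fun_truncation[OF \<beta> li bdd_supp_local_int[OF g_bd] g_le g_lim])
  have nn: "0 \<le> sq_fun \<beta> J u x" for u x by (simp add: sq_fun_def)
  have Fm [measurable]: "sq_fun \<beta> J (g N) \<in> borel_measurable borel" for N
   by (rule measurable_sq_fun[OF \<beta> bdd_supp_local_int[OF g_bd]])
  have "wint q w (\<lambda>x. ennreal (sq_fun \<beta> J f x))
   = (\<integral>\<^sup>+x. liminf (\<lambda>N. ennreal (sq_fun \<beta> J (g N) x) epowr q * ennreal (w x)) \<partial>lborel)"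
  proof (rule nn_integral_cong)
   fix x
   have e: "ennreal (sq_fun \<beta> J u x) epowr q * ennreal (w x) = ennreal (sq_fun \<beta> J u x powr q * w x)" for u
    using q nn[of u x] D(3)[of x] by (simp add: epowr_ennreal ennreal_mult)
   have "(\<lambda>N. ennreal (sq_fun \<beta> J (g N) x powr q * w x)) \<longlonglongrightarrow> ennreal (sq_fun \<beta> J f x powr q * w x)"
    using q nn by (intro tendsto_ennrealI tendsto_mult_right tendsto_powr' lim tendsto_const) (auto intro: always_eventually)
   then have "liminf (\<lambda>N. ennreal (sq_fun \<beta> J (g N) x powr q * w x)) = ennreal (sq_fun \<beta> J f x powr q * w x)"
    by (intro lim_imp_Liminf) auto
   then show "ennreal (sq_fun \<beta> J f x) epowr q * ennreal (w x) = liminf (\<lambda>N. ennreal (sq_fun \<beta> J (g N) x) epowr q * ennreal (w x))"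
    by (simp only: e)
  qed
  also have "... \<le> liminf (\<lambda>N. \<integral>\<^sup>+x. ennreal (sq_fun \<beta> J (g N) x) epowr q * ennreal (w x) \<partial>lborel)"
   by (rule nn_integral_liminf) measurable
  also have "... \<le> liminf (\<lambda>N::nat. ennreal K * wint q w (absf f))"
  proof (intro Liminf_mono always_eventually allI)
   fix N
   have "wint q w (\<lambda>x. ennreal (sq_fun \<beta> J (g N) x)) \<le> ennreal K * wint q w (\<lambda>x. ennreal \<bar>g N x\<bar>)"
    by (rule bd[OF J g_bd])
   also have "... \<le> ennreal K * wint q w (absf f)"
    using q by (intro mult_left_mono nn_integral_mono mult_right_mono epowr_mono ennreal_leI g_le) auto
   finally show "wint q w (\<lambda>x. ennreal (sq_fun \<beta> J (g N) x)) \<le> ennreal K * wint q w (absf f)" .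
  qed
  also have "... = ennreal K * wint q w (absf f)"
   by (rule Liminf_const) simp
  finally show ?thesis .
 qed
 then show ?thesis using K by blast
qed

lemma epowr_SUP:
 fixes f :: "'i \<Rightarrow> ennreal"
 assumes "0 < r" "I \<noteq> {}" shows "(SUP i\<in>I. f i) epowr r = (SUP i\<in>I. f i epowr r)"
proof (rule antisym)
 have "(SUP i\<in>I. f i) \<le> (SUP i\<in>I. f i epowr r) epowr (1 / r)"
  using assms by (intro SUP_least) (auto simp: epowr_le_swap[symmetric] intro: SUP_upper)
 then show "(SUP i\<in>I. f i) epowr r \<le> (SUP i\<in>I. f i epowr r)" using assms by (simp add: epowr_le_swap)
 show "(SUP i\<in>I. f i epowr r) \<le> (SUP i\<in>I. f i) epowr r"
  using assms by (intro SUP_least epowr_mono SUP_upper) auto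
qed

text \<open>The intervals of scales increase with \<open>N\<close> and exhaust the integers, so
  suprema commute with integrals by monotone convergence and with powers by
  \<open>epowr_SUP\<close>.\<close>

definition sq_full :: "real \<Rightarrow> ('a::euclidean_space \<Rightarrow> real) \<Rightarrow> 'a \<Rightarrow> ennreal" where
 "sq_full \<beta> f x = (SUP N::nat. ennreal (sq_fun \<beta> {- int N..int N} f x))"

lemma sq_fun_le_sq_full: "finite J \<Longrightarrow> ennreal (sq_fun \<beta> J f x) \<le> sq_full \<beta> f x"
proof -
 assume J: "finite J"
 define N where "N = (\<Sum>j\<in>J. nat \<bar>j\<bar>)"
 have "J \<subseteq> {- int N..int N}"
 proof
  fix j assume "j \<in> J"
  then have "nat \<bar>j\<bar> \<le> N" unfolding N_def using J by (intro member_le_sum) auto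
  then show "j \<in> {- int N..int N}" by auto
 qed
 then have "sq_fun \<beta> J f x \<le> sq_fun \<beta> {- int N..int N} f x"
  unfolding sq_fun_def by (intro L2_set_subset_mono) auto
 then show ?thesis unfolding sq_full_def by (intro SUP_upper2[of N] ennreal_leI) auto
qed

lemma measurable_sq_full:
 assumes "0 < \<beta>" "\<beta> \<le> 1" "local_int f"
 shows "sq_full \<beta> f \<in> borel_measurable borel"
proof -
 have [measurable]: "sq_fun \<beta> J f \<in> borel_measurable borel" for J by (rule measurable_sq_fun[OF assms])
 show ?thesis unfolding sq_full_def[abs_def] by measurable
qed

lemma sq_full_add:
 assumes "0 < \<beta>" "\<beta> \<le> 1" "local_int f" "local_int g"
 shows "sq_full \<beta> (\<lambda>z. f z + g z) x \<le> sq_full \<beta> f x + sq_full \<beta> g x"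
 unfolding sq_full_def[of _ "\<lambda>z. f z + g z"]
proof (rule SUP_least)
 fix N
 have "ennreal (sq_fun \<beta> {- int N..int N} (\<lambda>z. f z + g z) x) \<le> ennreal (sq_fun \<beta> {- int N..int N} f x + sq_fun \<beta> {- int N..int N} g x)"
  by (intro ennreal_leI sq_fun_add assms)
 also have "... = ennreal (sq_fun \<beta> {- int N..int N} f x) + ennreal (sq_fun \<beta> {- int N..int N} g x)"
  by (rule ennreal_plus) (auto simp: sq_fun_def)
 also have "... \<le> sq_full \<beta> f x + sq_full \<beta> g x"
  by (intro add_mono sq_fun_le_sq_full) auto
 finally show "ennreal (sq_fun \<beta> {- int N..int N} (\<lambda>z. f z + g z) x) \<le> sq_full \<beta> f x + sq_full \<beta> g x" .
qed

theorem sq_full_weighted: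
 fixes w :: "'a::euclidean_space \<Rightarrow> real"
 assumes \<beta>: "0 < \<beta>" "\<beta> \<le> 1" and w: "ball_avg_weight q C w" and q: "1 < q"
 shows "\<exists>K\<ge>0. \<forall>f. f \<in> borel_measurable borel \<longrightarrow> (wint q w (absf f)) < top \<longrightarrow>
   (wint q w (sq_full \<beta> f))
   \<le> ennreal K * wint q w (absf f)"
proof -
 note D = ball_avg_weightD[OF w]
 note [measurable] = D(1)
 obtain K where K: "0 \<le> K" and bd: "\<And>J f. finite J \<Longrightarrow> f \<in> borel_measurable borel \<Longrightarrow> (wint q w (absf f)) < top \<Longrightarrow>
   (wint q w (\<lambda>x. ennreal (sq_fun \<beta> J f x)))
   \<le> ennreal K * wint q w (absf f)"
  using sq_fun_weighted[OF \<beta> w q] by blast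
 have "wint q w (sq_full \<beta> f)
   \<le> ennreal K * wint q w (absf f)"
  if fm [measurable]: "f \<in> borel_measurable borel"
   and fin: "wint q w (absf f) < top" for f :: "'a \<Rightarrow> real"
 proof -
  have li: "local_int f" by (rule ball_avg_weight_local_int[OF w _ fm fin]) (use q in simp)
  have [measurable]: "sq_fun \<beta> J f \<in> borel_measurable borel" for J by (rule measurable_sq_fun[OF \<beta> li])
  define F where "F N x = ennreal (sq_fun \<beta> {- int N..int N} f x) epowr q * ennreal (w x)" for N x
  have [measurable]: "F N \<in> borel_measurable borel" for N unfolding F_def by measurable
  have inc: "incseq F"
  proof (intro incseq_SucI le_funI)
   fix N x
   have "sq_fun \<beta> {- int N..int N} f x \<le> sq_fun \<beta> {- int (Suc N)..int (Suc N)} f x"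
    unfolding sq_fun_def by (rule L2_set_subset_mono) auto
   then show "F N x \<le> F (Suc N) x" unfolding F_def using q by (intro mult_right_mono epowr_mono ennreal_leI) auto
  qed
  have "sq_full \<beta> f x epowr q * ennreal (w x) = (SUP N. F N x)" for x
   unfolding sq_full_def F_def using q by (subst epowr_SUP) (auto simp: SUP_mult_right_ennreal)
  then have "wint q w (sq_full \<beta> f) = (\<integral>\<^sup>+x. (SUP N. F N x) \<partial>lborel)" by simp
  also have "... = (SUP N. \<integral>\<^sup>+x. F N x \<partial>lborel)"
   by (rule nn_integral_monotone_convergence_SUP[OF inc]) measurable
  also have "... \<le> ennreal K * wint q w (absf f)"
   unfolding F_def by (intro SUP_least bd fin fm) simp
  finally show ?thesis .
 qed
 then show ?thesis using K by blast
qed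

section \<open>Geometric decay between annuli\<close>

lemma nn_integral_count_space_SUP:
 fixes f :: "'i \<Rightarrow> ennreal"
 assumes "countable A"
 shows "(\<integral>\<^sup>+i. f i \<partial>count_space A) = (SUP F\<in>{F. finite F \<and> F \<subseteq> A}. sum f F)"
proof (rule antisym)
 show "(SUP F\<in>{F. finite F \<and> F \<subseteq> A}. sum f F) \<le> (\<integral>\<^sup>+i. f i \<partial>count_space A)"
 proof (rule SUP_least)
  fix F assume "F \<in> {F. finite F \<and> F \<subseteq> A}"
  then have F: "finite F" "F \<subseteq> A" by auto
  have "sum f F = (\<integral>\<^sup>+i. f i \<partial>count_space F)" by (simp add: nn_integral_count_space_finite F)
  also have "... = (\<integral>\<^sup>+i. f i * indicator F i \<partial>count_space A)"
   using F by (subst nn_integral_count_space_indicator) (auto simp: nn_integral_count_space_indicator Int_absorb1 intro!: nn_integral_cong split: split_indicator)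
  also have "... \<le> (\<integral>\<^sup>+i. f i \<partial>count_space A)" by (intro nn_integral_mono) (auto simp: indicator_def)
  finally show "sum f F \<le> (\<integral>\<^sup>+i. f i \<partial>count_space A)" .
 qed
next
 show "(\<integral>\<^sup>+i. f i \<partial>count_space A) \<le> (SUP F\<in>{F. finite F \<and> F \<subseteq> A}. sum f F)"
 proof (cases "A = {}")
  case True
  then show ?thesis by (simp add: nn_integral_empty)
 next
  case False
  define B where "B n = from_nat_into A ` {..<n}" for n
  have BA: "B n \<subseteq> A" for n using from_nat_into[OF False] by (auto simp: B_def)
  have inc: "incseq (\<lambda>n i. f i * indicator (B n) i)"
   by (intro incseq_SucI le_funI mult_left_mono indicator_leI) (auto simp: B_def)
  have "(\<integral>\<^sup>+i. f i \<partial>count_space A) = (\<integral>\<^sup>+i. (SUP n. f i * indicator (B n) i) \<partial>count_space A)"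
  proof (rule nn_integral_cong)
   fix i assume "i \<in> space (count_space A)"
   then obtain n where "from_nat_into A n = i" using from_nat_into_surj[OF assms] by auto
   then have "i \<in> B (Suc n)" by (auto simp: B_def)
   then have "f i \<le> (SUP n. f i * indicator (B n) i)" by (intro SUP_upper2[of "Suc n"]) auto
   moreover have "(SUP n. f i * indicator (B n) i) \<le> f i" by (rule SUP_least) (auto simp: indicator_def)
   ultimately show "f i = (SUP n. f i * indicator (B n) i)" by (rule antisym)
  qed
  also have "... = (SUP n. \<integral>\<^sup>+i. f i * indicator (B n) i \<partial>count_space A)"
   by (rule nn_integral_monotone_convergence_SUP[OF inc]) auto
  also have "... \<le> (SUP F\<in>{F. finite F \<and> F \<subseteq> A}. sum f F)"
  proof (rule SUP_least)
   fix n
   have "(\<integral>\<^sup>+i. f i * indicator (B n) i \<partial>count_space A) = (\<integral>\<^sup>+i. f i \<partial>count_space (B n))"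
    using BA[of n] by (subst (1 2) nn_integral_count_space_indicator) (auto intro!: nn_integral_cong split: split_indicator)
   also have "... = sum f (B n)" by (rule nn_integral_count_space_finite) (simp add: B_def)
   also have "... \<le> (SUP F\<in>{F. finite F \<and> F \<subseteq> A}. sum f F)"
    by (rule SUP_upper) (use BA in \<open>auto simp: B_def\<close>)
   finally show "(\<integral>\<^sup>+i. f i * indicator (B n) i \<partial>count_space A) \<le> (SUP F\<in>{F. finite F \<and> F \<subseteq> A}. sum f F)" .
  qed
  finally show ?thesis .
 qed
qed

text \<open>The bridge from the sums in the Herz norms to integrals over \<open>count_space\<close>,
  where Fubini and monotonicity are available.\<close>

lemma infsum_ennreal_eq_nn_integral:
 fixes f :: "'i \<Rightarrow> ennreal"
 assumes "countable A"
 shows "infsum f A = (\<integral>\<^sup>+i. f i \<partial>count_space A)"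
 unfolding nn_integral_count_space_SUP[OF assms] by (rule nonneg_infsum_complete) simp

lemma nn_integral_count_space_upper:
 fixes f :: "'i \<Rightarrow> ennreal"
 assumes "i \<in> A" shows "f i \<le> (\<integral>\<^sup>+i. f i \<partial>count_space A)"
proof -
 have "f i = (\<integral>\<^sup>+j. f i * indicator {i} j \<partial>count_space A)" using assms by (simp add: nn_integral_cmult)
 also have "... \<le> (\<integral>\<^sup>+i. f i \<partial>count_space A)" by (intro nn_integral_mono) (auto simp: indicator_def)
 finally show ?thesis .
qed

lemma nn_integral_geometric_int:
 fixes r :: real
 assumes "0 \<le> r" "r < 1"
 shows "(\<integral>\<^sup>+i. ennreal (r ^ nat \<bar>i - k\<bar>) \<partial>count_space I) \<le> ennreal (2 / (1 - r))"
 unfolding nn_integral_count_space_SUP[OF countableI_type]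
proof (rule SUP_least)
 fix F :: "int set" assume "F \<in> {F. finite F \<and> F \<subseteq> I}"
 then have F: "finite F" by simp
 have "(\<Sum>i\<in>F. ennreal (r ^ nat \<bar>i - k\<bar>)) = ennreal (\<Sum>i\<in>F. r ^ nat \<bar>i - k\<bar>)" by (rule sum_ennreal) (use assms in simp)
 also have "... \<le> ennreal (2 / (1 - r))" by (intro ennreal_leI sum_geometric_int_le2 F assms)
 finally show "(\<Sum>i\<in>F. ennreal (r ^ nat \<bar>i - k\<bar>)) \<le> ennreal (2 / (1 - r))" .
qed

text \<open>Writing \<open>r = s\<^sup>2\<close> and bounding one factor \<open>s\<^bsup>|i-k|\<^esup>\<close> by a supremum treats all exponents \<open>p > 0\<close> alike.\<close>
lemma geometric_convolution_lp:
 fixes b :: "int \<Rightarrow> ennreal"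
 assumes s: "0 < s" "s < 1" and p: "0 < p"
 shows "(\<integral>\<^sup>+i. (\<integral>\<^sup>+k. ennreal ((s * s) ^ nat \<bar>i - k\<bar>) * b k \<partial>count_space I) epowr p \<partial>count_space I)
  \<le> ennreal ((2 / (1 - s)) powr p * (2 / (1 - s powr p))) * (\<integral>\<^sup>+k. b k epowr p \<partial>count_space I)"
proof -
 have sp: "0 \<le> s powr p" "s powr p < 1" using powr_less_mono2[of p s 1] s p by auto
 have pow: "ennreal (s ^ m) epowr p = ennreal ((s powr p) ^ m)" for m
  using s p by (simp add: epowr_ennreal powr_power powr_powr powr_realpow[symmetric] mult.commute)
 have inner: "(\<integral>\<^sup>+k. ennreal ((s * s) ^ nat \<bar>i - k\<bar>) * b k \<partial>count_space I) epowr p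
   \<le> ennreal ((2 / (1 - s)) powr p) * (\<integral>\<^sup>+k. ennreal ((s powr p) ^ nat \<bar>k - i\<bar>) * b k epowr p \<partial>count_space I)" for i
 proof -
  let ?X = "\<integral>\<^sup>+k. ennreal ((s powr p) ^ nat \<bar>k - i\<bar>) * b k epowr p \<partial>count_space I"
  have up: "ennreal (s ^ nat \<bar>k - i\<bar>) * b k \<le> ?X epowr (1 / p)" if "k \<in> I" for k
  proof -
   have "(ennreal (s ^ nat \<bar>k - i\<bar>) * b k) epowr p \<le> ?X"
    using nn_integral_count_space_upper[OF that, of "\<lambda>k. ennreal ((s powr p) ^ nat \<bar>k - i\<bar>) * b k epowr p"] p
    by (simp add: epowr_mult pow)
   then show ?thesis using p by (simp add: epowr_le_swap)
  qed
  have "(\<integral>\<^sup>+k. ennreal ((s * s) ^ nat \<bar>i - k\<bar>) * b k \<partial>count_space I)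
   \<le> (\<integral>\<^sup>+k. ennreal (s ^ nat \<bar>k - i\<bar>) * ?X epowr (1 / p) \<partial>count_space I)"
  proof (rule nn_integral_mono)
   fix k assume "k \<in> space (count_space I)"
   then have k: "k \<in> I" by simp
   have "ennreal ((s * s) ^ nat \<bar>i - k\<bar>) * b k = ennreal (s ^ nat \<bar>k - i\<bar>) * (ennreal (s ^ nat \<bar>k - i\<bar>) * b k)"
    using s by (simp add: power_mult_distrib ennreal_mult mult.assoc abs_minus_commute)
   also have "... \<le> ennreal (s ^ nat \<bar>k - i\<bar>) * ?X epowr (1 / p)" by (intro mult_left_mono up k) simp
   finally show "ennreal ((s * s) ^ nat \<bar>i - k\<bar>) * b k \<le> ennreal (s ^ nat \<bar>k - i\<bar>) * ?X epowr (1 / p)" .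
  qed
  also have "... = (\<integral>\<^sup>+k. ennreal (s ^ nat \<bar>k - i\<bar>) \<partial>count_space I) * ?X epowr (1 / p)"
   by (rule nn_integral_multc) simp
  also have "... \<le> ennreal (2 / (1 - s)) * ?X epowr (1 / p)"
   by (intro mult_right_mono nn_integral_geometric_int) (use s in auto)
  finally have "(\<integral>\<^sup>+k. ennreal ((s * s) ^ nat \<bar>i - k\<bar>) * b k \<partial>count_space I) epowr p \<le> (ennreal (2 / (1 - s)) * ?X epowr (1 / p)) epowr p"
   using p by (intro epowr_mono) auto
  also have "... = ennreal ((2 / (1 - s)) powr p) * ?X"
   using p s by (simp add: epowr_mult epowr_epowr epowr_ennreal)
  finally show ?thesis .
 qed
 have "(\<integral>\<^sup>+i. (\<integral>\<^sup>+k. ennreal ((s * s) ^ nat \<bar>i - k\<bar>) * b k \<partial>count_space I) epowr p \<partial>count_space I)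
  \<le> (\<integral>\<^sup>+i. ennreal ((2 / (1 - s)) powr p) * (\<integral>\<^sup>+k. ennreal ((s powr p) ^ nat \<bar>k - i\<bar>) * b k epowr p \<partial>count_space I) \<partial>count_space I)"
  by (intro nn_integral_mono inner)
 also have "... = ennreal ((2 / (1 - s)) powr p) * (\<integral>\<^sup>+i. (\<integral>\<^sup>+k. ennreal ((s powr p) ^ nat \<bar>k - i\<bar>) * b k epowr p \<partial>count_space I) \<partial>count_space I)"
  by (rule nn_integral_cmult) simp
 also have "(\<integral>\<^sup>+i. (\<integral>\<^sup>+k. ennreal ((s powr p) ^ nat \<bar>k - i\<bar>) * b k epowr p \<partial>count_space I) \<partial>count_space I)
   = (\<integral>\<^sup>+k. (\<integral>\<^sup>+i. ennreal ((s powr p) ^ nat \<bar>k - i\<bar>) * b k epowr p \<partial>count_space I) \<partial>count_space I)"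
  by (rule nn_integral_count_space_nn_integral) auto
 also have "... \<le> (\<integral>\<^sup>+k. ennreal (2 / (1 - s powr p)) * b k epowr p \<partial>count_space I)"
 proof (rule nn_integral_mono)
  fix k
  have "(\<integral>\<^sup>+i. ennreal ((s powr p) ^ nat \<bar>k - i\<bar>) * b k epowr p \<partial>count_space I) = (\<integral>\<^sup>+i. ennreal ((s powr p) ^ nat \<bar>i - k\<bar>) \<partial>count_space I) * b k epowr p"
   by (subst nn_integral_multc) (simp_all add: abs_minus_commute)
  also have "... \<le> ennreal (2 / (1 - s powr p)) * b k epowr p"
   by (intro mult_right_mono nn_integral_geometric_int sp) simp
  finally show "(\<integral>\<^sup>+i. ennreal ((s powr p) ^ nat \<bar>k - i\<bar>) * b k epowr p \<partial>count_space I) \<le> ennreal (2 / (1 - s powr p)) * b k epowr p" .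
 qed
 also have "... = ennreal (2 / (1 - s powr p)) * (\<integral>\<^sup>+k. b k epowr p \<partial>count_space I)"
  by (rule nn_integral_cmult) simp
 finally have *: "(\<integral>\<^sup>+i. (\<integral>\<^sup>+k. ennreal ((s * s) ^ nat \<bar>i - k\<bar>) * b k \<partial>count_space I) epowr p \<partial>count_space I)
  \<le> ennreal ((2 / (1 - s)) powr p) * (ennreal (2 / (1 - s powr p)) * (\<integral>\<^sup>+k. b k epowr p \<partial>count_space I))"
  by (simp add: mult_left_mono)
 have eq: "ennreal ((2 / (1 - s)) powr p * (2 / (1 - s powr p))) = ennreal ((2 / (1 - s)) powr p) * ennreal (2 / (1 - s powr p))"
  by (rule ennreal_mult) (use sp in auto)
 show ?thesis unfolding eq mult.assoc by (rule *)
qed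

section \<open>Distant sources and the general Herz estimate\<close>

text \<open>A function supported away from \<open>x\<close> only meets the large scales.\<close>
lemma sq_full_far:
 fixes f :: "'a::euclidean_space \<Rightarrow> real" and \<rho> :: "'a \<Rightarrow> real"
 assumes \<beta>: "0 < \<beta>" "\<beta> \<le> 1" and f: "local_int f" and [measurable]: "\<rho> \<in> borel_measurable borel"
  and \<rho>: "\<And>z. 0 < \<rho> z" and far: "AE z in lborel. f z \<noteq> 0 \<longrightarrow> \<rho> z \<le> dist x z"
 shows "sq_full \<beta> f x \<le> (\<integral>\<^sup>+z. ennreal (6 / \<rho> z ^ DIM('a)) * ennreal \<bar>f z\<bar> \<partial>lborel)"
 unfolding sq_full_def
proof (rule SUP_least)
 fix N
 let ?J = "{- int N..int N}"
 have [measurable]: "f \<in> borel_measurable borel" by (rule local_int_measurable[OF f])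
 have "ennreal (sq_fun \<beta> ?J f x) \<le> ennreal (\<Sum>j\<in>?J. 3 / (2 powi j) ^ DIM('a) * abs_int f (cball x (2 powi j)))"
  by (intro ennreal_leI sq_fun_size \<beta> f)
 also have "... = (\<Sum>j\<in>?J. ennreal (3 / (2 powi j) ^ DIM('a) * abs_int f (cball x (2 powi j))))"
  by (rule sum_ennreal[symmetric]) (simp add: abs_int_nonneg)
 also have "... = (\<Sum>j\<in>?J. \<integral>\<^sup>+z. ennreal (3 / (2 powi j) ^ DIM('a)) * (ennreal \<bar>f z\<bar> * indicator (cball x (2 powi j)) z) \<partial>lborel)"
 proof (rule sum.cong[OF refl])
  fix j
  have "(\<integral>\<^sup>+z. ennreal (3 / (2 powi j) ^ DIM('a)) * (ennreal \<bar>f z\<bar> * indicator (cball x (2 powi j)) z) \<partial>lborel)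
    = ennreal (3 / (2 powi j) ^ DIM('a)) * ennreal (abs_int f (cball x (2 powi j)))"
   unfolding ennreal_abs_int[OF f] by (rule nn_integral_cmult) measurable
  then show "ennreal (3 / (2 powi j) ^ DIM('a) * abs_int f (cball x (2 powi j)))
   = (\<integral>\<^sup>+z. ennreal (3 / (2 powi j) ^ DIM('a)) * (ennreal \<bar>f z\<bar> * indicator (cball x (2 powi j)) z) \<partial>lborel)"
   by (simp only:) (rule ennreal_mult, simp_all add: abs_int_nonneg)
 qed
 also have "... = (\<integral>\<^sup>+z. (\<Sum>j\<in>?J. ennreal (3 / (2 powi j) ^ DIM('a)) * (ennreal \<bar>f z\<bar> * indicator (cball x (2 powi j)) z)) \<partial>lborel)"
  by (rule nn_integral_sum[symmetric]) measurable
 also have "... \<le> (\<integral>\<^sup>+z. ennreal (6 / \<rho> z ^ DIM('a)) * ennreal \<bar>f z\<bar> \<partial>lborel)"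
 proof (intro nn_integral_mono_AE, use far in eventually_elim)
  case (elim z)
  show ?case
  proof (cases "f z = 0")
   case False
   with elim have rz: "\<rho> z \<le> dist x z" by simp
   \<comment> \<open>Only scales with \<open>\<rho> z \<le> 2 powi j\<close> reach \<open>z\<close>.
     Of the \<open>DIM('a)\<close> powers of the quotient \<open>\<rho> z / 2 powi j\<close> one is
     kept, which makes the sum over \<open>j\<close> geometric with value at most 2; hence 6 from
     3.\<close>
   have "(\<Sum>j\<in>?J. ennreal (3 / (2 powi j) ^ DIM('a)) * (ennreal \<bar>f z\<bar> * indicator (cball x (2 powi j)) z))
    \<le> (\<Sum>j\<in>?J. if \<rho> z \<le> 2 powi j then ennreal (3 / \<rho> z ^ DIM('a) * (\<rho> z / 2 powi j) powr 1) * ennreal \<bar>f z\<bar> else 0)"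
   proof (rule sum_mono)
    fix j
    show "ennreal (3 / (2 powi j) ^ DIM('a)) * (ennreal \<bar>f z\<bar> * indicator (cball x (2 powi j)) z)
     \<le> (if \<rho> z \<le> 2 powi j then ennreal (3 / \<rho> z ^ DIM('a) * (\<rho> z / 2 powi j) powr 1) * ennreal \<bar>f z\<bar> else 0)"
    proof (cases "dist x z \<le> 2 powi j")
     case True
     then have le: "\<rho> z \<le> 2 powi j" using rz by simp
     have "(\<rho> z / 2 powi j) ^ DIM('a) \<le> (\<rho> z / 2 powi j) ^ 1"
      using le \<rho>[of z] by (intro power_decreasing) auto
     then have "3 / (2 powi j) ^ DIM('a) \<le> 3 / \<rho> z ^ DIM('a) * (\<rho> z / 2 powi j) powr 1"
      using \<rho>[of z] by (simp add: power_divide field_simps)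
     then have "ennreal (3 / (2 powi j) ^ DIM('a)) \<le> ennreal (3 / \<rho> z ^ DIM('a) * (\<rho> z / 2 powi j) powr 1)"
      by (rule ennreal_leI)
     then show ?thesis using True le by (simp add: mult_right_mono)
    qed simp
   qed
   also have "... = (\<Sum>j\<in>{j\<in>?J. \<rho> z \<le> 2 powi j}. ennreal (3 / \<rho> z ^ DIM('a) * (\<rho> z / 2 powi j) powr 1) * ennreal \<bar>f z\<bar>)"
    by (rule sum.inter_filter[symmetric]) simp
   also have "... = (\<Sum>j\<in>{j\<in>?J. \<rho> z \<le> 2 powi j}. ennreal (3 / \<rho> z ^ DIM('a) * (\<rho> z / 2 powi j) powr 1)) * ennreal \<bar>f z\<bar>"
    by (rule sum_distrib_right[symmetric])
   also have "(\<Sum>j\<in>{j\<in>?J. \<rho> z \<le> 2 powi j}. ennreal (3 / \<rho> z ^ DIM('a) * (\<rho> z / 2 powi j) powr 1))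
     = ennreal (\<Sum>j\<in>{j\<in>?J. \<rho> z \<le> 2 powi j}. 3 / \<rho> z ^ DIM('a) * (\<rho> z / 2 powi j) powr 1)"
    by (rule sum_ennreal) (use \<rho>[of z] in simp)
   also have "(\<Sum>j\<in>{j\<in>?J. \<rho> z \<le> 2 powi j}. 3 / \<rho> z ^ DIM('a) * (\<rho> z / 2 powi j) powr 1)
     = 3 / \<rho> z ^ DIM('a) * (\<Sum>j\<in>{j\<in>?J. \<rho> z \<le> 2 powi j}. (\<rho> z / 2 powi j) powr 1)"
    by (rule sum_distrib_left[symmetric])
   also have "ennreal ... \<le> ennreal (6 / \<rho> z ^ DIM('a))"
   proof (rule ennreal_leI)
    have "(\<Sum>j\<in>{j\<in>?J. \<rho> z \<le> 2 powi j}. (\<rho> z / 2 powi j) powr 1) \<le> 1 / (1 - 2 powr - 1)"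
     by (rule sum_scales_ge) (use \<rho> in auto)
    also have "1 / (1 - 2 powr - 1) = (2::real)" by (simp add: powr_minus_divide)
    finally have "3 / \<rho> z ^ DIM('a) * (\<Sum>j\<in>{j\<in>?J. \<rho> z \<le> 2 powi j}. (\<rho> z / 2 powi j) powr 1) \<le> 3 / \<rho> z ^ DIM('a) * 2"
     using \<rho>[of z] by (intro mult_left_mono) auto
    then show "3 / \<rho> z ^ DIM('a) * (\<Sum>j\<in>{j\<in>?J. \<rho> z \<le> 2 powi j}. (\<rho> z / 2 powi j) powr 1) \<le> 6 / \<rho> z ^ DIM('a)" by simp
   qed
   finally show ?thesis by (simp add: mult_right_mono)
  qed simp
 qed
 finally show "ennreal (sq_fun \<beta> ?J f x) \<le> (\<integral>\<^sup>+z. ennreal (6 / \<rho> z ^ DIM('a)) * ennreal \<bar>f z\<bar> \<partial>lborel)" .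
qed

text \<open>The common shape of the p-th powers of both Herz norms: \<open>c k\<close> stands for
  the power \<alpha>/n of the mass of the k-th ball, and \<open>A\<close> and \<open>I\<close> for
  the blocks and their indices.\<close>

definition herz_sum :: "int set \<Rightarrow> (int \<Rightarrow> 'a::euclidean_space set) \<Rightarrow> (int \<Rightarrow> real) \<Rightarrow> real \<Rightarrow> real \<Rightarrow> ('a \<Rightarrow> real) \<Rightarrow> ('a \<Rightarrow> ennreal) \<Rightarrow> ennreal" where
 "herz_sum I A c p q w F = (\<integral>\<^sup>+k. (ennreal (c k) * wint_on (A k) q w F epowr (1 / q)) epowr p \<partial>count_space I)"

lemma ennreal_cancel_pos: "0 < v \<Longrightarrow> x = ennreal (1 / v) * (ennreal v * x)"
 unfolding mult.assoc[symmetric] by (subst ennreal_mult[symmetric]) auto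

lemma ennreal_mult_assoc: "0 \<le> u \<Longrightarrow> 0 \<le> v \<Longrightarrow> ennreal u * (ennreal v * x) = ennreal (u * v) * x"
 by (simp add: ennreal_mult mult.assoc)

text \<open>The averaging condition on the ball of radius \<open>2 * R\<close>, tested on
  \<bar>f\<bar> restricted to \<open>A\<close>. Doubling the radius puts the closed ball inside an
  open one, and \<open>m\<close> is a lower bound for the mass of the larger ball.\<close>

lemma herz_block_L1:
 fixes w :: "'a::euclidean_space \<Rightarrow> real"
 assumes w: "ball_avg_weight q C w" and q: "1 < q" and [measurable]: "f \<in> borel_measurable borel" "A \<in> sets borel"
  and A: "A \<subseteq> cball 0 R" and R: "0 < R" and m: "0 < m" "ennreal m = mass w (cball 0 R)"
 shows "abs_nint f A
  \<le> ennreal (C powr (1 / q) * (unit_ball_vol DIM('a) * 2 ^ DIM('a)) * R ^ DIM('a) / m powr (1 / q))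
   * wint_on A q w (absf f) epowr (1 / q)"
proof -
 note D = ball_avg_weightD[OF w]
 let ?F = "\<integral>\<^sup>+z\<in>A. ennreal \<bar>f z\<bar> \<partial>lborel" and ?J = "\<integral>\<^sup>+x\<in>A. ennreal \<bar>f x\<bar> epowr q * ennreal (w x) \<partial>lborel"
 let ?b = "unit_ball_vol DIM('a) * 2 ^ DIM('a) * R ^ DIM('a)"
 have R2: "0 < 2 * R" using R by simp
 have AB: "x \<in> A \<Longrightarrow> x \<in> ball 0 (2 * R)" for x using A R by auto
 have 0: "(\<integral>\<^sup>+x\<in>ball 0 (2 * R). ennreal \<bar>f x\<bar> * indicator A x \<partial>lborel) epowr q * mass w (ball 0 (2 * R))
   \<le> ennreal C * emeasure lborel (ball (0::'a) (2 * R)) epowr q * wint_on (ball 0 (2 * R)) q w (\<lambda>x. ennreal \<bar>f x\<bar> * indicator A x)"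
  by (rule D(6)[OF _ R2]) measurable
 have e1: "(\<integral>\<^sup>+x\<in>ball 0 (2 * R). ennreal \<bar>f x\<bar> * indicator A x \<partial>lborel) = ?F"
  using AB by (intro nn_integral_cong) (auto simp: indicator_def)
 have e2: "wint_on (ball 0 (2 * R)) q w (\<lambda>x. ennreal \<bar>f x\<bar> * indicator A x) = ?J"
 proof (intro nn_integral_cong)
  fix x
  show "(ennreal \<bar>f x\<bar> * indicator A x) epowr q * ennreal (w x) * indicator (ball 0 (2 * R)) x = ennreal \<bar>f x\<bar> epowr q * ennreal (w x) * indicator A x"
   using AB[of x] q by (cases "x \<in> A") auto
 qed
 have e3: "emeasure lborel (ball (0::'a) (2 * R)) = ennreal ?b"
  using R by (subst emeasure_ball) (auto simp: power_mult_distrib mult_ac)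
 have e4: "ennreal m \<le> mass w (ball 0 (2 * R))"
  unfolding m(2) using R by (intro nn_integral_mono mult_left_mono indicator_leI) auto
 have 1: "?F epowr q * ennreal m \<le> ennreal C * ennreal ?b epowr q * ?J"
  by (rule order_trans[OF mult_left_mono[OF e4 zero_le] 0[unfolded e1 e2 e3]])
 have "(?F epowr q * ennreal m) epowr (1 / q) \<le> (ennreal C * ennreal ?b epowr q * ?J) epowr (1 / q)"
  using q by (intro epowr_mono[OF 1]) auto
 then have 2: "?F * ennreal (m powr (1 / q)) \<le> ennreal (C powr (1 / q)) * ennreal ?b * ?J epowr (1 / q)"
  using q m(1) D(4) R by (simp add: epowr_mult epowr_epowr epowr_ennreal powr_powr)
 have mq: "0 < m powr (1 / q)" using m by simp
 have "?F = ?F * ennreal (m powr (1 / q)) * ennreal (1 / m powr (1 / q))"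
  unfolding mult.assoc using mq by (subst ennreal_mult[symmetric]) auto
 also have "... \<le> ennreal (C powr (1 / q)) * ennreal ?b * ?J epowr (1 / q) * ennreal (1 / m powr (1 / q))"
  by (rule mult_right_mono[OF 2]) simp
 also have "... = (ennreal (C powr (1 / q)) * ennreal ?b * ennreal (1 / m powr (1 / q))) * ?J epowr (1 / q)"
  by (simp only: mult_ac)
 also have "ennreal (C powr (1 / q)) * ennreal ?b * ennreal (1 / m powr (1 / q)) = ennreal (C powr (1 / q) * ?b * (1 / m powr (1 / q)))"
  using R mq by (subst ennreal_mult, simp, simp, subst ennreal_mult, simp_all)
 finally show ?thesis by (simp add: mult.assoc)
qed

text \<open>The blocks \<open>A k\<close> are annuli over all integers or shells over the naturals,
  so both spaces are treated together. The core is the estimate \<open>block\<close>: the weighted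
  norm on block \<open>i\<close> is at most a constant times the sum over \<open>k\<close> of
  r^\<bar>i - k\<bar> times the weighted norm of \<open>f\<close> on block \<open>k\<close>, with r
  = s^2. Hypothesis \<open>M\<close> supplies the decay for distant blocks, \<open>M3\<close> the
  comparability of the coefficients for neighbours.\<close>

theorem herz_bound:
 fixes w :: "'a::euclidean_space \<Rightarrow> real" and A :: "int \<Rightarrow> 'a set" and c m :: "int \<Rightarrow> real"
 assumes \<beta>: "0 < \<beta>" "\<beta> \<le> 1" and w: "ball_avg_weight q C w" and q: "1 < q" and p: "0 < p" and s: "0 < s" "s < 1"
  and A_meas: "\<And>k. A k \<in> sets borel" and A_sub: "\<And>k. A k \<subseteq> cball 0 (2 powi k)"
  and A_sep: "\<And>i k. i \<in> I \<Longrightarrow> k \<in> I \<Longrightarrow> k < i \<Longrightarrow> A i \<inter> cball 0 (2 powi (i - 1)) = {}"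
  and A_cover: "\<And>z. z \<noteq> 0 \<Longrightarrow> \<exists>k\<in>I. z \<in> A k" and I: "\<And>i. 0 \<le> i \<Longrightarrow> i \<in> I"
  and m: "\<And>k. 0 < m k" "\<And>k. ennreal (m k) = mass w (cball 0 (2 powi k))"
  and c: "\<And>k. 0 < c k" and D: "0 \<le> D"
  and M: "\<And>i k. c i * (m i / m k) powr (1 / q) * (2 powi (k - max i k)) ^ DIM('a) \<le> D * (s * s) ^ nat \<bar>i - k\<bar> * c k"
  and M3: "\<And>i k. \<bar>i - k\<bar> \<le> 1 \<Longrightarrow> c i \<le> D * c k"
 shows "\<exists>K\<ge>0. \<forall>f\<in>borel_measurable borel. herz_sum I A c p q w (absf f) < top \<longrightarrow>
   local_int f \<and> herz_sum I A c p q w (sq_full \<beta> f) \<le> ennreal K * herz_sum I A c p q w (absf f)"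
proof -
 note W = ball_avg_weightD[OF w]
 note [measurable] = W(1) A_meas
 obtain K0 where K0: "0 \<le> K0" and L2w: "\<And>f. f \<in> borel_measurable borel \<Longrightarrow> (wint q w (absf f)) < top \<Longrightarrow>
   (wint q w (sq_full \<beta> f)) \<le> ennreal K0 * wint q w (absf f)"
  using sq_full_weighted[OF \<beta> w q] by blast
 define D1 where "D1 = C powr (1 / q) * (unit_ball_vol DIM('a) * 2 ^ DIM('a))"
 have D1: "0 \<le> D1" by (simp add: D1_def)
 define r where "r = s * s"
 have r: "0 < r" "r < 1" using s mult_strict_mono[of s 1 s 1] by (auto simp: r_def)
 define Kf where "Kf = 6 * 8 ^ DIM('a) * D1 * D"
 define Kn where "Kn = K0 powr (1 / q) * 3 powr (1 / q) * D / r"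
 define K1 where "K1 = 2 * 2 powr (1 / q) * (Kn + Kf)"
 have Kf0: "0 \<le> Kf" and Kn0: "0 \<le> Kn" using D D1 r by (auto simp: Kf_def Kn_def)
 have K10: "0 \<le> K1" using Kf0 Kn0 by (simp add: K1_def)
 define K where "K = K1 powr p * ((2 / (1 - s)) powr p * (2 / (1 - s powr p)))"
 have K: "0 \<le> K" using powr_less_mono2[of p s 1] s p by (auto simp: K_def)
 have "local_int f \<and> herz_sum I A c p q w (sq_full \<beta> f) \<le> ennreal K * herz_sum I A c p q w (absf f)"
  if fm [measurable]: "f \<in> borel_measurable borel" and fin: "herz_sum I A c p q w (absf f) < top" for f
 proof -
  define a where "a k = wint_on (A k) q w (absf f) epowr (1 / q)" for k
  define b where "b k = ennreal (c k) * a k" for k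
  define S where "S i = (\<integral>\<^sup>+k. ennreal (r ^ nat \<bar>i - k\<bar>) * b k \<partial>count_space I)" for i
  define F where "F k = abs_nint f (A k)" for k
  have N: "herz_sum I A c p q w (absf f) = (\<integral>\<^sup>+k. b k epowr p \<partial>count_space I)"
   by (simp add: herz_sum_def b_def a_def)
  define \<nu> where "\<nu> = (\<integral>\<^sup>+k. b k epowr p \<partial>count_space I) epowr (1 / p)"
  have \<nu>: "\<nu> < top" using fin p by (simp add: \<nu>_def N epowr_less_top_iff)
  have b_le: "b k \<le> \<nu>" if "k \<in> I" for k
   unfolding \<nu>_def using nn_integral_count_space_upper[OF that, of "\<lambda>k. b k epowr p"] p by (simp add: epowr_le_swap)
  have a_fin: "a k < top" if "k \<in> I" for k
  proof -
   have "b k < top" using b_le[OF that] \<nu> by (rule le_less_trans)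
   then show ?thesis using c[of k] by (auto simp: b_def ennreal_mult_less_top)
  qed
  have F_le: "F k \<le> ennreal (D1 * (2 powi k) ^ DIM('a) / m k powr (1 / q)) * a k" for k
   unfolding F_def a_def D1_def by (rule herz_block_L1[OF w q fm A_meas A_sub _ m]) simp
  \<comment> \<open>The factors are the size 2^(-n max(i,k)) of the kernels that connect the two
    blocks, the L^1 bound on block \<open>k\<close>, and the power of \<open>m i\<close> from
    integrating a constant over block \<open>i\<close>. Their product is hypothesis
    \<open>M\<close>.\<close>
  have coef: "c i * m i powr (1 / q) / (2 powi (max i k)) ^ DIM('a) * (D1 * (2 powi k) ^ DIM('a) / m k powr (1 / q)) \<le> D1 * D * r ^ nat \<bar>i - k\<bar> * c k" for i k
  proof -
   have "c i * m i powr (1 / q) / (2 powi (max i k)) ^ DIM('a) * (D1 * (2 powi k) ^ DIM('a) / m k powr (1 / q))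
    = D1 * (c i * (m i / m k) powr (1 / q) * (2 powi (k - max i k)) ^ DIM('a))"
    using m(1)[of i] m(1)[of k] by (simp add: powr_divide power_int_diff power_divide mult_ac)
   also have "... \<le> D1 * (D * (s * s) ^ nat \<bar>i - k\<bar> * c k)" by (intro mult_left_mono M D1)
   finally show ?thesis by (simp add: r_def mult.assoc)
  qed
  have cF: "ennreal (c i * m i powr (1 / q) / (2 powi (max i k)) ^ DIM('a)) * F k \<le> ennreal (D1 * D) * (ennreal (r ^ nat \<bar>i - k\<bar>) * b k)" for i k
  proof -
   have "ennreal (c i * m i powr (1 / q) / (2 powi (max i k)) ^ DIM('a)) * F k
    \<le> ennreal (c i * m i powr (1 / q) / (2 powi (max i k)) ^ DIM('a)) * (ennreal (D1 * (2 powi k) ^ DIM('a) / m k powr (1 / q)) * a k)"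
    by (intro mult_left_mono F_le) simp
   also have "... = ennreal (c i * m i powr (1 / q) / (2 powi (max i k)) ^ DIM('a) * (D1 * (2 powi k) ^ DIM('a) / m k powr (1 / q))) * a k"
    unfolding mult.assoc[symmetric] using c[of i] D1 by (subst ennreal_mult[symmetric]) auto
   also have "... \<le> ennreal (D1 * D * r ^ nat \<bar>i - k\<bar> * c k) * a k"
    by (intro mult_right_mono ennreal_leI coef) simp
   also have "... = ennreal (D1 * D) * (ennreal (r ^ nat \<bar>i - k\<bar>) * b k)"
   proof -
    have "ennreal (D1 * D * r ^ nat \<bar>i - k\<bar> * c k) = ennreal (D1 * D) * ennreal (r ^ nat \<bar>i - k\<bar>) * ennreal (c k)"
     using c[of k] D1 D r by (subst ennreal_mult, simp, simp, subst ennreal_mult, simp_all)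
    then show ?thesis by (simp only: b_def mult.assoc)
   qed
   finally show ?thesis .
  qed
  have AE0: "AE z in lborel. z \<noteq> (0::'a)" by (rule AE_lborel_singleton)
  \<comment> \<open>A ball is contained in some \<open>cball 0 (2 powi i)\<close>, hence up to the
    origin in the blocks with \<open>k \<le> i\<close>. For these \<open>max i k = i\<close>, so
    \<open>cF\<close> bounds the integrals of \<bar>f\<bar> by a geometric series times the norm
    \<open>\<nu>\<close>.\<close>
  have li: "local_int f"
   unfolding local_int_def
  proof (intro conjI allI fm)
   fix x0 :: 'a and R :: real
   obtain N :: nat where N: "norm x0 + \<bar>R\<bar> < 2 ^ N" using real_arch_pow[of 2 "norm x0 + \<bar>R\<bar>"] by auto
   define i where "i = int N"
   have iI: "i \<in> I" using I by (simp add: i_def)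
   have "abs_nint f (cball x0 R) \<le> (\<integral>\<^sup>+z. (\<integral>\<^sup>+k. ennreal \<bar>f z\<bar> * indicator (A k) z \<partial>count_space {k\<in>I. k \<le> i}) \<partial>lborel)"
   proof (intro nn_integral_mono_AE, use AE0 in eventually_elim)
    case (elim z)
    show ?case
    proof (cases "z \<in> cball x0 R")
     case True
     have "norm z \<le> norm x0 + dist x0 z" using norm_triangle_ineq[of x0 "z - x0"] by (simp add: dist_norm norm_minus_commute)
     then have zi: "z \<in> cball 0 (2 powi i)" using True N by (simp add: i_def)
     obtain k where k: "k \<in> I" "z \<in> A k" using A_cover[OF elim] by blast
     have "k \<le> i"
     proof (rule ccontr)
      assume "\<not> k \<le> i"
      then have "i < k" by simp
      then have "(2::real) powi i \<le> 2 powi (k - 1)" by (intro power_int_increasing) auto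
      then have "z \<in> cball 0 (2 powi (k - 1))" using zi by auto
      then show False using A_sep[OF k(1) iI \<open>i < k\<close>] k(2) by blast
     qed
     then show ?thesis using True k nn_integral_count_space_upper[of k "{k\<in>I. k \<le> i}" "\<lambda>k. ennreal \<bar>f z\<bar> * indicator (A k) z"] by simp
    qed simp
   qed
   also have "... = (\<integral>\<^sup>+k. F k \<partial>count_space {k\<in>I. k \<le> i})"
    unfolding F_def by (rule nn_integral_count_space_nn_integral) auto
   also have "... \<le> (\<integral>\<^sup>+k. ennreal ((2 powi i) ^ DIM('a) / (c i * m i powr (1 / q)) * (D1 * D)) * (ennreal (r ^ nat \<bar>k - i\<bar>) * \<nu>) \<partial>count_space {k\<in>I. k \<le> i})"
   proof (rule nn_integral_mono)
    fix k assume "k \<in> space (count_space {k\<in>I. k \<le> i})"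
    then have k: "k \<in> I" "k \<le> i" by auto
    let ?u = "c i * m i powr (1 / q) / (2 powi i) ^ DIM('a)"
    have u: "0 < ?u" using c[of i] m(1)[of i] by simp
    have iu: "1 / ?u = (2 powi i) ^ DIM('a) / (c i * m i powr (1 / q))" by simp
    have "F k = ennreal (1 / ?u) * (ennreal ?u * F k)" by (rule ennreal_cancel_pos[OF u])
    also have "... \<le> ennreal (1 / ?u) * (ennreal (D1 * D) * (ennreal (r ^ nat \<bar>i - k\<bar>) * b k))"
     using cF[of i k] k(2) by (intro mult_left_mono) (auto simp: max_def)
    also have "... \<le> ennreal (1 / ?u) * (ennreal (D1 * D) * (ennreal (r ^ nat \<bar>k - i\<bar>) * \<nu>))"
     unfolding abs_minus_commute[of i k] using b_le[OF k(1)] by (intro mult_left_mono) simp_all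
    also have "... = ennreal (1 / ?u * (D1 * D)) * (ennreal (r ^ nat \<bar>k - i\<bar>) * \<nu>)"
    proof -
     have "0 \<le> 1 / ?u" using less_imp_le[OF u] by (rule divide_nonneg_nonneg[OF zero_le_one])
     then have "ennreal (1 / ?u * (D1 * D)) = ennreal (1 / ?u) * ennreal (D1 * D)"
      using D1 D by (intro ennreal_mult) simp_all
     then show ?thesis by (simp only: mult.assoc)
    qed
    finally show "F k \<le> ennreal ((2 powi i) ^ DIM('a) / (c i * m i powr (1 / q)) * (D1 * D)) * (ennreal (r ^ nat \<bar>k - i\<bar>) * \<nu>)"
     unfolding iu .
   qed
   also have "... = ennreal ((2 powi i) ^ DIM('a) / (c i * m i powr (1 / q)) * (D1 * D)) * ((\<integral>\<^sup>+k. ennreal (r ^ nat \<bar>k - i\<bar>) \<partial>count_space {k\<in>I. k \<le> i}) * \<nu>)"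
    by (subst nn_integral_cmult, simp, subst nn_integral_multc, simp_all)
   also have "... < top"
   proof -
    have "(\<integral>\<^sup>+k. ennreal (r ^ nat \<bar>k - i\<bar>) \<partial>count_space {k\<in>I. k \<le> i}) < top"
     by (rule le_less_trans[OF nn_integral_geometric_int[OF less_imp_le[OF r(1)] r(2)]]) simp
    then show ?thesis using \<nu> by (simp add: ennreal_mult_less_top)
   qed
   finally show "abs_nint f (cball x0 R) < top" .
  qed
  have block: "ennreal (c i) * wint_on (A i) q w (sq_full \<beta> f) epowr (1 / q) \<le> ennreal K1 * S i" if i: "i \<in> I" for i
  proof -
   define J where "J = I \<inter> {i - 1..i + 1}"
   have J: "finite J" "J \<subseteq> I" "card J \<le> 3" "i \<in> J"
    using card_mono[of "{i - 1..i + 1}" J] i by (auto simp: J_def)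
   define Nr where "Nr = (\<Union>k\<in>J. A k)"
   have [measurable]: "Nr \<in> sets borel" unfolding Nr_def using J(1) by (intro sets.finite_UN) auto
   define fn where "fn z = f z * indicator Nr z" for z
   define ff where "ff z = f z * indicator (- Nr) z" for z
   have [measurable]: "fn \<in> borel_measurable borel" "ff \<in> borel_measurable borel" unfolding fn_def ff_def by measurable
   have f_split: "f = (\<lambda>z. fn z + ff z)" by (auto simp: fn_def ff_def indicator_def)
   have lin: "local_int fn" by (rule local_int_le[OF li]) (auto simp: fn_def[abs_def] indicator_def)
   have lif: "local_int ff" by (rule local_int_le[OF li]) (auto simp: ff_def[abs_def] indicator_def)
   have near_int: "wint q w (absf fn) \<le> (\<Sum>k\<in>J. a k epowr q)"
   proof -
    have "wint q w (absf fn) \<le> (\<integral>\<^sup>+x. (\<Sum>k\<in>J. ennreal \<bar>f x\<bar> epowr q * ennreal (w x) * indicator (A k) x) \<partial>lborel)"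
    proof (rule nn_integral_mono)
     fix x
     show "ennreal \<bar>fn x\<bar> epowr q * ennreal (w x) \<le> (\<Sum>k\<in>J. ennreal \<bar>f x\<bar> epowr q * ennreal (w x) * indicator (A k) x)"
     proof (cases "x \<in> Nr")
      case True
      then obtain k where k: "k \<in> J" "x \<in> A k" by (auto simp: Nr_def)
      have "ennreal \<bar>f x\<bar> epowr q * ennreal (w x) * indicator (A k) x \<le> (\<Sum>k\<in>J. ennreal \<bar>f x\<bar> epowr q * ennreal (w x) * indicator (A k) x)"
       by (rule member_le_sum[OF k(1)]) (use J in auto)
      then show ?thesis using True k by (simp add: fn_def)
     next
      case False
      then show ?thesis using q by (simp add: fn_def)
     qed
    qed
    also have "... = (\<Sum>k\<in>J. \<integral>\<^sup>+x\<in>A k. ennreal \<bar>f x\<bar> epowr q * ennreal (w x) \<partial>lborel)"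
     by (rule nn_integral_sum) measurable
    also have "... = (\<Sum>k\<in>J. a k epowr q)" using q by (simp add: a_def epowr_epowr)
    finally show ?thesis .
   qed
   have near_fin: "wint q w (absf fn) < top"
   proof (rule le_less_trans[OF near_int])
    have "a k epowr q < top" if "k \<in> J" for k using a_fin[of k] that J(2) q by (auto simp: epowr_less_top_iff)
    then show "(\<Sum>k\<in>J. a k epowr q) < top" using J(1) by simp
   qed
   define X where "X = wint q w (sq_full \<beta> fn)"
   have near: "ennreal (c i) * X epowr (1 / q) \<le> ennreal Kn * S i"
   proof -
    have "X \<le> ennreal K0 * (\<Sum>k\<in>J. a k epowr q)"
     unfolding X_def by (rule order_trans[OF L2w[OF _ near_fin] mult_left_mono[OF near_int]]) auto
    then have "X epowr (1 / q) \<le> (ennreal K0 * (\<Sum>k\<in>J. a k epowr q)) epowr (1 / q)"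
     using q by (intro epowr_mono) auto
    also have "... = ennreal (K0 powr (1 / q)) * (\<Sum>k\<in>J. a k epowr q) epowr (1 / q)"
     using q K0 by (simp add: epowr_mult epowr_ennreal)
    also have "... \<le> ennreal (K0 powr (1 / q)) * (ennreal (real (card J) powr (1 / q)) * (\<Sum>k\<in>J. (a k epowr q) epowr (1 / q)))"
     using q by (intro mult_left_mono epowr_sum_le J(1)) auto
    also have "... \<le> ennreal (K0 powr (1 / q)) * (ennreal (3 powr (1 / q)) * (\<Sum>k\<in>J. a k))"
     using q J(3) by (intro mult_left_mono mult_mono ennreal_leI powr_mono2) (auto simp: epowr_epowr)
    finally have 1: "X epowr (1 / q) \<le> ennreal (K0 powr (1 / q)) * (ennreal (3 powr (1 / q)) * (\<Sum>k\<in>J. a k))" .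
    have 2: "ennreal (c i) * (\<Sum>k\<in>J. a k) \<le> ennreal (D / r) * S i"
    proof -
     have "ennreal (c i) * (\<Sum>k\<in>J. a k) = (\<Sum>k\<in>J. ennreal (c i) * a k)" by (rule sum_distrib_left)
     also have "... \<le> (\<Sum>k\<in>J. ennreal (D / r) * (ennreal (r ^ nat \<bar>i - k\<bar>) * b k))"
     proof (rule sum_mono)
      fix k assume "k \<in> J"
      then have k: "\<bar>i - k\<bar> \<le> 1" by (auto simp: J_def)
      \<comment> \<open>Neighbouring blocks carry no decay of their own. The factor r^\<bar>i -
        k\<bar>, which is at least \<open>r\<close> here, is inserted at the cost of
        \<open>1 / r\<close> in \<open>Kn\<close>.\<close>
      have "nat \<bar>i - k\<bar> \<le> 1" using k by simp
      then have "r ^ 1 \<le> r ^ nat \<bar>i - k\<bar>" using r by (intro power_decreasing) auto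
      then have "1 \<le> 1 / r * r ^ nat \<bar>i - k\<bar>" using r by (simp add: field_simps)
      then have "D * c k * 1 \<le> D * c k * (1 / r * r ^ nat \<bar>i - k\<bar>)"
       using D c[of k] by (intro mult_left_mono) auto
      then have "c i \<le> D / r * r ^ nat \<bar>i - k\<bar> * c k" using M3[OF k] by (simp add: mult_ac)
      then have "ennreal (c i) * a k \<le> ennreal (D / r * r ^ nat \<bar>i - k\<bar> * c k) * a k"
       by (intro mult_right_mono ennreal_leI) auto
      also have "ennreal (D / r * r ^ nat \<bar>i - k\<bar> * c k) = ennreal (D / r) * ennreal (r ^ nat \<bar>i - k\<bar>) * ennreal (c k)"
       using c[of k] D r by (subst ennreal_mult, simp, simp, subst ennreal_mult, simp_all)
      finally show "ennreal (c i) * a k \<le> ennreal (D / r) * (ennreal (r ^ nat \<bar>i - k\<bar>) * b k)"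
       by (simp only: b_def mult.assoc)
     qed
     also have "... = ennreal (D / r) * (\<Sum>k\<in>J. ennreal (r ^ nat \<bar>i - k\<bar>) * b k)" by (rule sum_distrib_left[symmetric])
     also have "(\<Sum>k\<in>J. ennreal (r ^ nat \<bar>i - k\<bar>) * b k) \<le> S i"
      unfolding S_def nn_integral_count_space_SUP[OF countableI_type]
      by (rule SUP_upper) (use J in auto)
     finally show ?thesis by (simp add: mult_left_mono)
    qed
    have "ennreal (c i) * X epowr (1 / q) \<le> ennreal (c i) * (ennreal (K0 powr (1 / q)) * (ennreal (3 powr (1 / q)) * (\<Sum>k\<in>J. a k)))"
     by (intro mult_left_mono 1) simp
    also have "... = ennreal (K0 powr (1 / q)) * ennreal (3 powr (1 / q)) * (ennreal (c i) * (\<Sum>k\<in>J. a k))"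
     by (simp only: mult_ac)
    also have "... \<le> ennreal (K0 powr (1 / q)) * ennreal (3 powr (1 / q)) * (ennreal (D / r) * S i)"
     by (intro mult_left_mono 2) simp
    also have "... = ennreal Kn * S i"
    proof -
     have "Kn = K0 powr (1 / q) * 3 powr (1 / q) * (D / r)" by (simp add: Kn_def)
     then have "ennreal Kn = ennreal (K0 powr (1 / q)) * ennreal (3 powr (1 / q)) * ennreal (D / r)"
      using D r by (simp only:) (subst ennreal_mult, simp, simp, subst ennreal_mult, simp_all)
     then show ?thesis by (simp only: mult.assoc)
    qed
    finally show ?thesis .
   qed
   define T where "T = (\<integral>\<^sup>+k. ennreal (6 * 8 ^ DIM('a) / (2 powi (max i k)) ^ DIM('a)) * F k \<partial>count_space I)"
   have farx: "sq_full \<beta> ff x \<le> T" if x: "x \<in> A i" for x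
   proof -
    \<comment> \<open>A lower bound for the distance from any point of block \<open>i\<close> to a
      point \<open>z\<close> of a block at least two steps away. It is comparable to 2^max(i,k) but
      defined without \<open>k\<close>, so \<open>sq_full_far\<close> applies to all distant blocks
      in one go.\<close>
    define \<rho> where "\<rho> z = max (2 powi i) (norm z) / 4" for z :: 'a
    have \<rho>m: "\<rho> \<in> borel_measurable borel" unfolding \<rho>_def by measurable
    have \<rho>0: "0 < \<rho> z" for z by (simp add: \<rho>_def less_max_iff_disj)
    have xi: "norm x \<le> 2 powi i" using x A_sub[of i] by auto
    have geom: "\<rho> z \<le> dist x z \<and> 2 powi (max i k) / 8 \<le> \<rho> z" if k: "k \<in> I" "k \<notin> J" "z \<in> A k" for k z
    proof -
     have zk: "norm z \<le> 2 powi k" using k(3) A_sub[of k] by auto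
     have step: "(2::real) powi (j + 1) = 2 * 2 powi j" for j by (simp add: power_int_add)
     consider "k \<le> i - 2" | "i + 2 \<le> k" using k by (auto simp: J_def)
     then show ?thesis
     proof cases
      case 1
      have "x \<notin> cball 0 (2 powi (i - 1))" using A_sep[OF i k(1)] 1 x by auto
      then have x1: "2 powi (i - 1) < norm x" by simp
      define u :: real where "u = 2 powi (i - 2)"
      have "(2::real) powi k \<le> u" unfolding u_def using 1 by (intro power_int_increasing) auto
      then have zu: "norm z \<le> u" using zk by simp
      have u: "(2::real) powi i = 4 * u" "(2::real) powi (i - 1) = 2 * u" "0 < u"
       using step[of "i - 1"] step[of "i - 2"] by (simp_all add: u_def)
      have "max (4 * u) (norm z) = 4 * u" "max i k = i" using zu u 1 by auto
      then have "\<rho> z = u" "2 powi (max i k) / 8 = u / 2" by (simp_all add: \<rho>_def u)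
      moreover have "norm x \<le> dist x z + norm z" using norm_triangle_ineq[of "x - z" z] by (simp add: dist_norm)
      ultimately show ?thesis using x1 zu u by simp
     next
      case 2
      have "z \<notin> cball 0 (2 powi (k - 1))" using A_sep[OF k(1) i] 2 k(3) by auto
      then have z1: "2 powi (k - 1) < norm z" by simp
      define u :: real where "u = 2 powi (k - 2)"
      have iu: "(2::real) powi i \<le> u" unfolding u_def using 2 by (intro power_int_increasing) auto
      have u: "(2::real) powi k = 4 * u" "(2::real) powi (k - 1) = 2 * u" "0 < u"
       using step[of "k - 1"] step[of "k - 2"] by (simp_all add: u_def)
      have "max (2 powi i) (norm z) = norm z" "max i k = k" using iu z1 u 2 by auto
      then have "\<rho> z = norm z / 4" "2 powi (max i k) / 8 = u / 2" by (simp_all add: \<rho>_def u)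
      moreover have "norm z \<le> dist x z + norm x" using norm_triangle_ineq[of "z - x" x] by (simp add: dist_norm norm_minus_commute)
      ultimately show ?thesis using z1 iu xi u by simp
     qed
    qed
    have farz: "\<exists>k\<in>I. k \<notin> J \<and> z \<in> A k" if z: "z \<noteq> 0" "ff z \<noteq> 0" for z
    proof -
     obtain k where k: "k \<in> I" "z \<in> A k" using A_cover[OF z(1)] by blast
     have "z \<notin> Nr" using z(2) by (auto simp: ff_def indicator_def)
     then have "k \<notin> J" using k by (auto simp: Nr_def)
     with k show ?thesis by blast
    qed
    have "sq_full \<beta> ff x \<le> (\<integral>\<^sup>+z. ennreal (6 / \<rho> z ^ DIM('a)) * ennreal \<bar>ff z\<bar> \<partial>lborel)"
    proof (rule sq_full_far[OF \<beta> lif \<rho>m \<rho>0])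
     show "AE z in lborel. ff z \<noteq> 0 \<longrightarrow> \<rho> z \<le> dist x z"
      using AE0
     proof eventually_elim
      case (elim z)
      show ?case
      proof
       assume "ff z \<noteq> 0"
       then obtain k where "k \<in> I" "k \<notin> J" "z \<in> A k" using farz[OF elim] by blast
       then show "\<rho> z \<le> dist x z" using geom by blast
      qed
     qed
    qed
    also have "... \<le> (\<integral>\<^sup>+z. (\<integral>\<^sup>+k. ennreal (6 * 8 ^ DIM('a) / (2 powi (max i k)) ^ DIM('a)) * (ennreal \<bar>f z\<bar> * indicator (A k) z) \<partial>count_space I) \<partial>lborel)"
    proof (intro nn_integral_mono_AE, use AE0 in eventually_elim)
     case (elim z)
     show ?case
     proof (cases "ff z = 0")
      case False
      then obtain k where k: "k \<in> I" "k \<notin> J" "z \<in> A k" using farz[OF elim] by blast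
      have le: "2 powi (max i k) / 8 \<le> \<rho> z" using geom[OF k] by blast
      have pos: "0 < (2::real) powi (max i k) / 8" by simp
      have "6 / \<rho> z ^ DIM('a) \<le> 6 / (2 powi (max i k) / 8) ^ DIM('a)"
      proof (rule divide_left_mono)
       show "(2 powi (max i k) / 8) ^ DIM('a) \<le> \<rho> z ^ DIM('a)" by (rule power_mono[OF le]) simp
       show "0 < \<rho> z ^ DIM('a) * (2 powi (max i k) / 8) ^ DIM('a)"
        by (intro mult_pos_pos zero_less_power \<rho>0 pos)
      qed simp
      also have "... = 6 * 8 ^ DIM('a) / (2 powi (max i k)) ^ DIM('a)" by (simp add: power_divide)
      finally have "ennreal (6 / \<rho> z ^ DIM('a)) * ennreal \<bar>ff z\<bar> \<le> ennreal (6 * 8 ^ DIM('a) / (2 powi (max i k)) ^ DIM('a)) * (ennreal \<bar>f z\<bar> * indicator (A k) z)"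
       using k(3) by (intro mult_mono ennreal_leI) (auto simp: ff_def indicator_def)
      also have "... \<le> (\<integral>\<^sup>+k. ennreal (6 * 8 ^ DIM('a) / (2 powi (max i k)) ^ DIM('a)) * (ennreal \<bar>f z\<bar> * indicator (A k) z) \<partial>count_space I)"
       by (rule nn_integral_count_space_upper[OF k(1)])
      finally show ?thesis .
     qed simp
    qed
    also have "... = (\<integral>\<^sup>+k. (\<integral>\<^sup>+z. ennreal (6 * 8 ^ DIM('a) / (2 powi (max i k)) ^ DIM('a)) * (ennreal \<bar>f z\<bar> * indicator (A k) z) \<partial>lborel) \<partial>count_space I)"
     by (rule nn_integral_count_space_nn_integral) auto
    also have "... = T"
     unfolding T_def F_def by (intro nn_integral_cong nn_integral_cmult) measurable
    finally show ?thesis .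
   qed
   have far: "ennreal (c i) * (T * ennreal (m i powr (1 / q))) \<le> ennreal Kf * S i"
   proof -
    have ci: "0 \<le> c i * m i powr (1 / q)" using c[of i] by simp
    have "ennreal (c i) * (T * ennreal (m i powr (1 / q))) = ennreal (c i * m i powr (1 / q)) * T"
     using c[of i] by (simp add: ennreal_mult mult_ac)
    also have "... = (\<integral>\<^sup>+k. ennreal (c i * m i powr (1 / q)) * (ennreal (6 * 8 ^ DIM('a) / (2 powi (max i k)) ^ DIM('a)) * F k) \<partial>count_space I)"
     unfolding T_def by (rule nn_integral_cmult[symmetric]) simp
    also have "... \<le> (\<integral>\<^sup>+k. ennreal Kf * (ennreal (r ^ nat \<bar>i - k\<bar>) * b k) \<partial>count_space I)"
    proof (rule nn_integral_mono)
     fix k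
     have "ennreal (c i * m i powr (1 / q)) * (ennreal (6 * 8 ^ DIM('a) / (2 powi (max i k)) ^ DIM('a)) * F k)
      = ennreal (c i * m i powr (1 / q) * (6 * 8 ^ DIM('a) / (2 powi (max i k)) ^ DIM('a))) * F k"
      by (rule ennreal_mult_assoc[OF ci]) simp
     also have "c i * m i powr (1 / q) * (6 * 8 ^ DIM('a) / (2 powi (max i k)) ^ DIM('a)) = (6 * 8 ^ DIM('a)) * (c i * m i powr (1 / q) / (2 powi (max i k)) ^ DIM('a))" by simp
     also have "ennreal ... = ennreal (6 * 8 ^ DIM('a)) * ennreal (c i * m i powr (1 / q) / (2 powi (max i k)) ^ DIM('a))"
      using ci by (intro ennreal_mult) auto
     also have "... * F k \<le> ennreal (6 * 8 ^ DIM('a)) * (ennreal (D1 * D) * (ennreal (r ^ nat \<bar>i - k\<bar>) * b k))"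
      unfolding mult.assoc by (intro mult_left_mono cF) simp
     also have "... = ennreal Kf * (ennreal (r ^ nat \<bar>i - k\<bar>) * b k)"
     proof -
      have "Kf = 6 * 8 ^ DIM('a) * (D1 * D)" by (simp add: Kf_def)
      then have "ennreal Kf = ennreal (6 * 8 ^ DIM('a)) * ennreal (D1 * D)"
       using D1 D by (simp only:) (rule ennreal_mult, simp_all)
      then show ?thesis by (simp only: mult.assoc)
     qed
     finally show "ennreal (c i * m i powr (1 / q)) * (ennreal (6 * 8 ^ DIM('a) / (2 powi (max i k)) ^ DIM('a)) * F k) \<le> ennreal Kf * (ennreal (r ^ nat \<bar>i - k\<bar>) * b k)" .
    qed
    also have "... = ennreal Kf * S i" unfolding S_def by (rule nn_integral_cmult) simp
    finally show ?thesis .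
   qed
   have [measurable]: "sq_full \<beta> fn \<in> borel_measurable borel" by (rule measurable_sq_full[OF \<beta> lin])
   have "wint_on (A i) q w (sq_full \<beta> f)
    \<le> (\<integral>\<^sup>+x. ennreal (2 powr q) * (sq_full \<beta> fn x epowr q * ennreal (w x) + T epowr q * (ennreal (w x) * indicator (cball 0 (2 powi i)) x)) \<partial>lborel)"
   proof (rule nn_integral_mono)
    fix x
    show "sq_full \<beta> f x epowr q * ennreal (w x) * indicator (A i) x \<le> ennreal (2 powr q) * (sq_full \<beta> fn x epowr q * ennreal (w x) + T epowr q * (ennreal (w x) * indicator (cball 0 (2 powi i)) x))"
    proof (cases "x \<in> A i")
     case True
     then have xb: "x \<in> cball 0 (2 powi i)" using A_sub[of i] by blast
     have "sq_full \<beta> f x \<le> sq_full \<beta> fn x + sq_full \<beta> ff x"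
      by (subst f_split) (rule sq_full_add[OF \<beta> lin lif])
     also have "... \<le> sq_full \<beta> fn x + T" by (intro add_left_mono farx True)
     finally have "sq_full \<beta> f x epowr q \<le> (sq_full \<beta> fn x + T) epowr q" using q by (intro epowr_mono) auto
     also have "... \<le> ennreal (2 powr q) * (sq_full \<beta> fn x epowr q + T epowr q)" using q by (intro epowr_add_le) auto
     finally have "sq_full \<beta> f x epowr q * ennreal (w x) \<le> ennreal (2 powr q) * (sq_full \<beta> fn x epowr q + T epowr q) * ennreal (w x)"
      by (rule mult_right_mono) simp
     also have "... = ennreal (2 powr q) * (sq_full \<beta> fn x epowr q * ennreal (w x) + T epowr q * ennreal (w x))"
      by (simp only: mult.assoc distrib_right)
     finally show ?thesis using True xb by (simp del: mem_cball)
    qed simp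
   qed
   also have "... = ennreal (2 powr q) * (X + T epowr q * ennreal (m i))"
    unfolding m(2) X_def
    by (simp add: nn_integral_cmult nn_integral_add)
   finally have "wint_on (A i) q w (sq_full \<beta> f) epowr (1 / q) \<le> (ennreal (2 powr q) * (X + T epowr q * ennreal (m i))) epowr (1 / q)"
    using q by (intro epowr_mono) auto
   also have "... = ennreal 2 * (X + T epowr q * ennreal (m i)) epowr (1 / q)"
    using q by (subst epowr_mult) (auto simp: epowr_ennreal powr_powr)
   also have "... \<le> ennreal 2 * (ennreal (2 powr (1 / q)) * (X epowr (1 / q) + (T epowr q * ennreal (m i)) epowr (1 / q)))"
    using q by (intro mult_left_mono epowr_add_le) auto
   also have "(T epowr q * ennreal (m i)) epowr (1 / q) = T * ennreal (m i powr (1 / q))"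
    using q m(1)[of i] by (simp add: epowr_mult epowr_epowr epowr_ennreal)
   finally have "ennreal (c i) * wint_on (A i) q w (sq_full \<beta> f) epowr (1 / q)
     \<le> ennreal (c i) * (ennreal 2 * (ennreal (2 powr (1 / q)) * (X epowr (1 / q) + T * ennreal (m i powr (1 / q)))))"
    by (rule mult_left_mono) simp
   also have "... = ennreal 2 * ennreal (2 powr (1 / q)) * (ennreal (c i) * X epowr (1 / q) + ennreal (c i) * (T * ennreal (m i powr (1 / q))))"
    by (simp only: distrib_left mult_ac)
   also have "... \<le> ennreal 2 * ennreal (2 powr (1 / q)) * (ennreal Kn * S i + ennreal Kf * S i)"
    by (intro mult_left_mono add_mono near far) simp
   also have "... = ennreal K1 * S i"
   proof -
    have "ennreal K1 = ennreal 2 * ennreal (2 powr (1 / q)) * (ennreal Kn + ennreal Kf)"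
     unfolding K1_def using Kn0 Kf0 by (simp only: ennreal_plus[symmetric]) (subst ennreal_mult, simp, simp, subst ennreal_mult, simp_all)
    then show ?thesis by (simp only: distrib_right mult.assoc)
   qed
   finally show ?thesis .
  qed
  have "herz_sum I A c p q w (sq_full \<beta> f) \<le> (\<integral>\<^sup>+i. (ennreal K1 * S i) epowr p \<partial>count_space I)"
   unfolding herz_sum_def using p by (intro nn_integral_mono epowr_mono block) auto
  also have "... = ennreal (K1 powr p) * (\<integral>\<^sup>+i. S i epowr p \<partial>count_space I)"
   using p K10 by (simp add: epowr_mult epowr_ennreal nn_integral_cmult)
  also have "... \<le> ennreal (K1 powr p) * (ennreal ((2 / (1 - s)) powr p * (2 / (1 - s powr p))) * (\<integral>\<^sup>+k. b k epowr p \<partial>count_space I))"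
   unfolding S_def r_def by (intro mult_left_mono geometric_convolution_lp s p) simp
  also have "... = ennreal K * (\<integral>\<^sup>+k. b k epowr p \<partial>count_space I)"
  proof -
   have "ennreal K = ennreal (K1 powr p) * ennreal ((2 / (1 - s)) powr p * (2 / (1 - s powr p)))"
    unfolding K_def using powr_less_mono2[of p s 1] s p by (intro ennreal_mult) auto
   then show ?thesis by (simp only: mult.assoc)
  qed
  finally show ?thesis using li by (simp add: N)
 qed
 then show ?thesis using K by blast
qed

section \<open>Growth of the weights over dyadic balls\<close>

text \<open>Spheres are null sets. The Herz norms use closed balls, the averaging condition open
  ones.\<close>

lemma nn_integral_cball_eq_ball: "(\<integral>\<^sup>+x\<in>cball c r. F x \<partial>lborel) = (\<integral>\<^sup>+x\<in>ball c r. F x \<partial>lborel)" for c :: "'a::euclidean_space"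
proof (cases "0 \<le> r")
 case True
 have "emeasure lborel (cball c r - ball c r) = emeasure lborel (cball c r) - emeasure lborel (ball c r)"
  using emeasure_lborel_ball_finite'[of c r] by (intro emeasure_Diff) auto
 also have "... = 0" using True by (simp add: emeasure_cball emeasure_ball)
 finally have "AE x in lborel. x \<notin> cball c r - ball c r" by (intro AE_not_in) (auto simp: null_sets_def)
 then show ?thesis
  by (intro nn_integral_cong_AE, eventually_elim) (auto simp: indicator_def)
qed (simp add: ball_empty)

text \<open>Doubling and reverse doubling for \<open>m k = w(B\<^sub>k)\<close>.\<close>
definition mass_growth :: "real \<Rightarrow> real \<Rightarrow> real \<Rightarrow> (int \<Rightarrow> real) \<Rightarrow> bool" where
 "mass_growth Q C \<gamma> m \<longleftrightarrow> (\<forall>k. 0 < m k) \<and> 0 < \<gamma> \<and> \<gamma> < 1 \<and> 1 \<le> C \<and> 1 \<le> Q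
   \<and> (\<forall>i k. k \<le> i \<longrightarrow> m i \<le> C * Q ^ nat (i - k) * m k) \<and> (\<forall>i k. i \<le> k \<longrightarrow> m i \<le> \<gamma> ^ nat (k - i) * m k)"

text \<open>Both properties come from testing on indicators. The smaller ball gives doubling with
  the sharp base 2^(n s). The outer shell of a ball has at least half its volume, hence carries at
  least the fraction 2^-s / C of its mass, which gives reverse doubling with \<gamma> = 1 - 2^-s /
  C.\<close>

lemma ball_avg_weight_mass_growth:
 fixes w :: "'a::euclidean_space \<Rightarrow> real"
 assumes w: "ball_avg_weight s C w" and s: "1 \<le> s"
 shows "\<exists>m \<gamma>. (\<forall>k. ennreal (m k) = mass w (cball 0 (2 powi k))) \<and> mass_growth (2 powr (real DIM('a) * s)) C \<gamma> m"
proof -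
 note W = ball_avg_weightD[OF w]
 note [measurable] = W(1)
 define V where "V k = unit_ball_vol (real DIM('a)) * (2 powi k) ^ DIM('a)" for k :: int
 define m where "m k = enn2real (mass w (ball 0 (2 powi k)))" for k
 have m: "ennreal (m k) = mass w (ball 0 (2 powi k))" for k
  unfolding m_def using W(5) by (intro ennreal_enn2real)
 have m0: "0 < m k" for k
  using nn_integral_ball_pos[OF W(1) W(2), of "2 powi k" 0] by (simp add: m[symmetric])
 have vol: "emeasure lborel (ball (0::'a) (2 powi k)) = ennreal (V k)" for k unfolding V_def by (subst emeasure_ball) auto
 have b0: "0 < V k" for k by (simp add: V_def)
 have sub: "ball 0 (2 powi k) \<subseteq> ball (0::'a) (2 powi i)" if "k \<le> i" for i k :: int
  using power_int_increasing[of k i "2::real"] that by auto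
 have test: "emeasure lborel E epowr s * ennreal (m i) \<le> ennreal C * ennreal (V i) epowr s * mass w E"
  if [measurable]: "E \<in> sets borel" and E: "E \<subseteq> ball 0 (2 powi i)" for E i
 proof -
  have "(\<integral>\<^sup>+x\<in>ball 0 (2 powi i). indicator E x \<partial>lborel) epowr s * mass w (ball 0 (2 powi i))
    \<le> ennreal C * emeasure lborel (ball (0::'a) (2 powi i)) epowr s * wint_on (ball 0 (2 powi i)) s w (indicator E)"
   by (rule W(6)) auto
  moreover have "(\<integral>\<^sup>+x\<in>ball 0 (2 powi i). indicator E x \<partial>lborel) = (\<integral>\<^sup>+x. indicator E x \<partial>lborel)"
   using E by (intro nn_integral_cong) (auto split: split_indicator)
  moreover have "wint_on (ball 0 (2 powi i)) s w (indicator E) = mass w E"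
   using E s by (intro nn_integral_cong) (auto split: split_indicator)
  ultimately show ?thesis by (simp only: m vol) simp
 qed
 have up: "m i \<le> C * (2 powr (real DIM('a) * s)) ^ nat (i - k) * m k" if "k \<le> i" for i k
 proof -
  have "ennreal (V k) epowr s * ennreal (m i) \<le> ennreal C * ennreal (V i) epowr s * ennreal (m k)"
   using test[OF _ sub[OF that]] by (simp add: vol m)
  then have "ennreal (V k powr s * m i) \<le> ennreal (C * V i powr s * m k)"
   using W(4) s m0[of i] m0[of k] less_imp_le[OF b0[of i]] less_imp_le[OF b0[of k]] by (simp add: epowr_ennreal ennreal_mult)
  then have "V k powr s * m i \<le> C * V i powr s * m k"
   using W(4) m0[of k] by (subst (asm) ennreal_le_iff) auto
  moreover have "V i = V k * 2 powr (real DIM('a) * real (nat (i - k)))"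
  proof -
   have "(2::real) powi i = 2 powi k * 2 ^ nat (i - k)"
    using that by (simp add: power_int_add[symmetric] flip: power_int_of_nat)
   then show ?thesis by (simp add: V_def power_mult_distrib powr_powr[symmetric] powr_realpow power_mult[symmetric] mult.commute[of "DIM('a)"])
  qed
  ultimately have "V k powr s * m i \<le> V k powr s * (C * 2 powr (real DIM('a) * real (nat (i - k)) * s) * m k)"
   by (simp add: powr_mult powr_powr mult_ac)
  then have "m i \<le> C * 2 powr (real DIM('a) * real (nat (i - k)) * s) * m k"
   using b0[of k] by (subst (asm) mult_le_cancel_left_pos) auto
  also have "2 powr (real DIM('a) * real (nat (i - k)) * s) = (2 powr (real DIM('a) * s)) ^ nat (i - k)"
   by (simp add: powr_realpow[symmetric] powr_powr mult_ac)
  finally show ?thesis .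
 qed
 have C1: "1 \<le> C" using up[of 0 0] m0[of 0] by simp
 define \<gamma> where "\<gamma> = 1 - (1 / 2) powr s / C"
 have step: "m (k - 1) \<le> \<gamma> * m k" for k
 proof -
  let ?E = "ball (0::'a) (2 powi k) - ball 0 (2 powi (k - 1))"
  have s1: "ball (0::'a) (2 powi (k - 1)) \<subseteq> ball 0 (2 powi k)" by (rule sub) simp
  have "2 powi k = 2 * (2::real) powi (k - 1)" by (simp add: power_int_diff)
  then have bk: "V k = 2 ^ DIM('a) * V (k - 1)" by (simp add: V_def power_mult_distrib)
  have half: "V k / 2 \<le> V k - V (k - 1)"
  proof -
   have "(2::real) ^ 1 \<le> 2 ^ DIM('a)" by (intro power_increasing) (auto simp: Suc_le_eq)
   then have "2 * V (k - 1) \<le> V k" unfolding bk using b0[of "k - 1"] by (intro mult_right_mono) auto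
   then show ?thesis by simp
  qed
  have "emeasure lborel ?E = ennreal (V k) - ennreal (V (k - 1))"
   using s1 emeasure_lborel_ball_finite'[of "0::'a" "2 powi (k - 1)"] by (subst emeasure_Diff) (auto simp: vol)
  also have "... = ennreal (V k - V (k - 1))" using b0[of "k - 1"] by (intro ennreal_minus) auto
  finally have vE: "ennreal (V k / 2) \<le> emeasure lborel ?E" using half by (simp add: ennreal_leI)
  have "ennreal (m (k - 1)) + mass w ?E = ennreal (m k)"
   unfolding m using s1 by (subst nn_integral_add[symmetric]) (auto intro!: nn_integral_cong split: split_indicator)
  then have wE: "mass w ?E = ennreal (m k - m (k - 1))"
   using m0[of "k - 1"] by (metis ennreal_add_diff_cancel_left ennreal_minus ennreal_neq_top less_imp_le)
  have le: "m (k - 1) \<le> m k"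
  proof -
   have "ennreal (m (k - 1)) \<le> ennreal (m k)"
    unfolding m using s1 by (intro nn_integral_mono mult_left_mono indicator_leI) auto
   then show ?thesis using m0[of k] by simp
  qed
  have "ennreal (V k / 2) epowr s * ennreal (m k) \<le> emeasure lborel ?E epowr s * ennreal (m k)"
   using vE s by (intro mult_right_mono epowr_mono) auto
  also have "... \<le> ennreal C * ennreal (V k) epowr s * ennreal (m k - m (k - 1))"
   using test[of ?E k] by (simp add: wE)
  finally have "ennreal ((V k / 2) powr s * m k) \<le> ennreal (C * V k powr s * (m k - m (k - 1)))"
   using W(4) s m0[of k] le less_imp_le[OF b0[of k]] by (simp add: epowr_ennreal ennreal_mult)
  then have "(V k * (1 / 2)) powr s * m k \<le> C * V k powr s * (m k - m (k - 1))"
   using W(4) le by (subst (asm) ennreal_le_iff) auto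
  then have "V k powr s * ((1 / 2) powr s * m k) \<le> V k powr s * (C * (m k - m (k - 1)))"
   unfolding powr_mult by (simp add: mult_ac)
  then have "(1 / 2) powr s * m k \<le> C * (m k - m (k - 1))"
   using b0[of k] by (subst (asm) mult_le_cancel_left_pos) auto
  then show ?thesis using C1 by (simp add: \<gamma>_def field_simps)
 qed
 \<comment> \<open>Positivity is read off from \<open>step\<close>, since \<open>m\<close> is
   positive at both indices.\<close>
 have \<gamma>: "0 < \<gamma>" "\<gamma> < 1"
  using step[of 0] m0[of "-1"] m0[of 0] C1 by (auto simp: zero_less_mult_iff \<gamma>_def dest: order.strict_trans2)
 have down: "m (k - int n) \<le> \<gamma> ^ n * m k" for k n
 proof (induction n)
  case (Suc n)
  have "m (k - int (Suc n)) \<le> \<gamma> * m (k - int n)" using step[of "k - int n"] by (simp add: algebra_simps)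
  also have "... \<le> \<gamma> * (\<gamma> ^ n * m k)" using Suc \<gamma> by (intro mult_left_mono) auto
  finally show ?case by simp
 qed simp
 have "m i \<le> \<gamma> ^ nat (k - i) * m k" if "i \<le> k" for i k
  using down[of k "nat (k - i)"] that by simp
 then have "mass_growth (2 powr (real DIM('a) * s)) C \<gamma> m"
  unfolding mass_growth_def using m0 \<gamma> C1 up s by (auto intro!: ge_one_powr_ge_zero)
 then show ?thesis using m by (intro exI[of _ m] exI[of _ \<gamma>]) (simp add: nn_integral_cball_eq_ball)
qed

lemma mass_growth_powr:
 assumes m: "mass_growth Q C \<gamma> m" and e: "0 \<le> e"
 shows "i \<le> k \<Longrightarrow> (m i / m k) powr e \<le> (\<gamma> powr e) ^ nat (k - i)"
  and "k \<le> i \<Longrightarrow> (m i / m k) powr e \<le> C powr e * (Q powr e) ^ nat (i - k)"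
proof -
 have m0: "0 < m i" "0 < m k" and \<gamma>: "0 < \<gamma>" and CQ: "1 \<le> C" "1 \<le> Q" using m by (auto simp: mass_growth_def)
 have pw: "(x ^ j) powr e = (x powr e) ^ j" if "0 < x" for x :: real and j
  using that by (simp add: powr_realpow[symmetric] powr_powr mult.commute)
 show "(m i / m k) powr e \<le> (\<gamma> powr e) ^ nat (k - i)" if "i \<le> k"
 proof -
  have "m i / m k \<le> \<gamma> ^ nat (k - i)" using m that m0 by (simp add: mass_growth_def pos_divide_le_eq)
  then have "(m i / m k) powr e \<le> (\<gamma> ^ nat (k - i)) powr e" using m0 e by (intro powr_mono2) auto
  then show ?thesis using \<gamma> by (simp add: pw)
 qed
 show "(m i / m k) powr e \<le> C powr e * (Q powr e) ^ nat (i - k)" if "k \<le> i"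
 proof -
  have "m i / m k \<le> C * Q ^ nat (i - k)" using m that m0 by (simp add: mass_growth_def pos_divide_le_eq)
  then have "(m i / m k) powr e \<le> (C * Q ^ nat (i - k)) powr e" using m0 e by (intro powr_mono2) auto
  then show ?thesis using CQ by (simp add: pw powr_mult)
 qed
qed

text \<open>The restrictions on \<alpha> are used here, with a = \<alpha>/n and b = 1/q. For i \<le>
  k the power of 2 equals 1 and the decay must come from the masses. If they coincide, the exponents
  add up, so \<open>a\<close> may be negative as long as \<open>0 < a + b\<close>; if not,
  \<open>0 < a\<close> lets both factors decay separately. For k \<le> i the masses grow at a rate
  below 2^n, and the factor 2^(-n (i - k)) prevails.\<close>

lemma mass_growth_coefficients:
 assumes m1: "mass_growth Q1 C1 \<gamma>1 m1" and m2: "mass_growth Q2 C2 \<gamma>2 m2" and b: "0 < b"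
  and ab: "m1 = m2 \<and> 0 < a + b \<and> Q1 powr (a + b) < 2 ^ n \<or> 0 < a \<and> Q1 powr a * Q2 powr b < 2 ^ n"
 shows "\<exists>s D. 0 < s \<and> s < 1 \<and> 0 \<le> D
  \<and> (\<forall>i k. m1 i powr a * (m2 i / m2 k) powr b * (2 powi (k - max i k)) ^ n \<le> D * (s * s) ^ nat \<bar>i - k\<bar> * m1 k powr a)
  \<and> (\<forall>i k. \<bar>i - k\<bar> \<le> 1 \<longrightarrow> m1 i powr a \<le> D * m1 k powr a)"
proof -
 note M1 = m1[unfolded mass_growth_def] and M2 = m2[unfolded mass_growth_def]
 have pos: "0 < m1 k" "0 < m2 k" for k using M1 M2 by auto
 have "\<exists>u v D0. 0 < u \<and> u < 1 \<and> 0 < v \<and> v < 2 ^ n \<and> 0 \<le> D0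
  \<and> (\<forall>i k. i \<le> k \<longrightarrow> (m1 i / m1 k) powr a * (m2 i / m2 k) powr b \<le> u ^ nat (k - i))
  \<and> (\<forall>i k. k \<le> i \<longrightarrow> (m1 i / m1 k) powr a * (m2 i / m2 k) powr b \<le> D0 * v ^ nat (i - k))"
  using ab
 proof
  assume H: "m1 = m2 \<and> 0 < a + b \<and> Q1 powr (a + b) < 2 ^ n"
  then have e: "0 \<le> a + b" by simp
  have eq: "(m1 i / m1 k) powr a * (m2 i / m2 k) powr b = (m1 i / m1 k) powr (a + b)" for i k
   using H by (simp add: powr_add)
  have "\<gamma>1 powr (a + b) < 1" using powr_less_mono2[of "a + b" \<gamma>1 1] H M1 by simp
  then show ?thesis unfolding eq using mass_growth_powr[OF m1 e] H M1
   by (intro exI[of _ "\<gamma>1 powr (a + b)"] exI[of _ "Q1 powr (a + b)"] exI[of _ "C1 powr (a + b)"]) auto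
 next
  assume H: "0 < a \<and> Q1 powr a * Q2 powr b < 2 ^ n"
  then have a: "0 \<le> a" by simp
  have b': "0 \<le> b" using b by simp
  have g1: "\<gamma>1 powr a < 1" using powr_less_mono2[of a \<gamma>1 1] H M1 by simp
  have g2: "\<gamma>2 powr b < 1" using powr_less_mono2[of b \<gamma>2 1] b M2 by simp
  have d: "(m1 i / m1 k) powr a * (m2 i / m2 k) powr b \<le> (\<gamma>1 powr a * \<gamma>2 powr b) ^ nat (k - i)" if "i \<le> k" for i k
   unfolding power_mult_distrib by (intro mult_mono mass_growth_powr[OF m1 a] mass_growth_powr[OF m2 b'] that) auto
  have u: "(m1 i / m1 k) powr a * (m2 i / m2 k) powr b \<le> C1 powr a * C2 powr b * (Q1 powr a * Q2 powr b) ^ nat (i - k)" if "k \<le> i" for i k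
  proof -
   have "(m1 i / m1 k) powr a * (m2 i / m2 k) powr b \<le> (C1 powr a * (Q1 powr a) ^ nat (i - k)) * (C2 powr b * (Q2 powr b) ^ nat (i - k))"
    by (intro mult_mono mass_growth_powr[OF m1 a] mass_growth_powr[OF m2 b'] that) auto
   then show ?thesis by (simp add: power_mult_distrib mult_ac)
  qed
  have "\<gamma>1 powr a * \<gamma>2 powr b < 1 * 1" using g1 g2 M1 M2 by (intro mult_strict_mono) auto
  then show ?thesis using d u H M1 M2
   by (intro exI[of _ "\<gamma>1 powr a * \<gamma>2 powr b"] exI[of _ "Q1 powr a * Q2 powr b"] exI[of _ "C1 powr a * C2 powr b"]) auto
 qed
 then obtain u v D0 where u: "0 < u" "u < 1" and v: "0 < v" "v < 2 ^ n" and D0: "0 \<le> D0"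
  and d': "\<forall>i k. i \<le> k \<longrightarrow> (m1 i / m1 k) powr a * (m2 i / m2 k) powr b \<le> u ^ nat (k - i)"
  and up': "\<forall>i k. k \<le> i \<longrightarrow> (m1 i / m1 k) powr a * (m2 i / m2 k) powr b \<le> D0 * v ^ nat (i - k)"
  by (elim exE conjE) (rule that)
 note d = d'[rule_format] and up = up'[rule_format]
 define t where "t = max u (v / 2 ^ n)"
 have t: "0 < t" "t < 1" "u \<le> t" "v / 2 ^ n \<le> t" using u v by (auto simp: t_def)
 \<comment> \<open>The last summand serves neighbouring indices: consecutive masses are comparable
   with constant \<open>C1 * Q1\<close> in both directions, so the exponent is \<bar>a\<bar> for
   either sign of \<open>a\<close>.\<close>
 define D where "D = max 1 D0 + (C1 * Q1) powr \<bar>a\<bar>"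
 have Dge: "1 \<le> D" "D0 \<le> D" "(C1 * Q1) powr \<bar>a\<bar> \<le> D" "0 \<le> D"
  unfolding D_def using powr_ge_zero[of "C1 * Q1" "\<bar>a\<bar>"] by linarith+
 have split: "m1 i powr a = (m1 i / m1 k) powr a * m1 k powr a" for i k
  using pos(1)[of i] pos(1)[of k] by (simp add: powr_divide)
 have M: "m1 i powr a * (m2 i / m2 k) powr b * (2 powi (k - max i k)) ^ n \<le> D * t ^ nat \<bar>i - k\<bar> * m1 k powr a" for i k
 proof -
  have "(m1 i / m1 k) powr a * (m2 i / m2 k) powr b * (2 powi (k - max i k)) ^ n \<le> D * t ^ nat \<bar>i - k\<bar>"
  proof (cases "i \<le> k")
   case True
   have "(m1 i / m1 k) powr a * (m2 i / m2 k) powr b \<le> u ^ nat (k - i)" by (rule d[OF True])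
   also have "... \<le> t ^ nat (k - i)" using t u by (intro power_mono) auto
   also have "... \<le> D * t ^ nat (k - i)" using mult_right_mono[OF Dge(1), of "t ^ nat (k - i)"] t by simp
   finally have "(m1 i / m1 k) powr a * (m2 i / m2 k) powr b * (2 powi 0) ^ n \<le> D * t ^ nat (k - i)" by simp
   moreover have "k - max i k = 0" "\<bar>i - k\<bar> = k - i" using True by auto
   ultimately show ?thesis by (simp only:)
  next
   case False
   have "(m1 i / m1 k) powr a * (m2 i / m2 k) powr b * (2 powi (k - max i k)) ^ n \<le> D0 * v ^ nat (i - k) * (2 powi (k - max i k)) ^ n"
    using up[of k i] False by (intro mult_right_mono) auto
   also have pw: "(2 powi (k - max i k) :: real) ^ n = (1 / 2 ^ n) ^ nat (i - k)"
   proof -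
    have "(2::real) powi (k - max i k) = inverse (2 powi (i - k))" using False by (simp add: max_def flip: power_int_minus)
    also have "(2::real) powi (i - k) = 2 ^ nat (i - k)" using False by (simp flip: power_int_of_nat)
    finally show ?thesis by (simp add: power_divide power_inverse[symmetric] inverse_eq_divide power_mult[symmetric] mult.commute)
   qed
   also have "D0 * v ^ nat (i - k) * (1 / 2 ^ n) ^ nat (i - k) = D0 * (v / 2 ^ n) ^ nat (i - k)"
    by (simp add: power_divide)
   also have "... \<le> D * t ^ nat (i - k)" using Dge D0 t v by (intro mult_mono power_mono) auto
   finally have "(m1 i / m1 k) powr a * (m2 i / m2 k) powr b * (2 powi (k - max i k)) ^ n \<le> D * t ^ nat (i - k)" by (simp only: pw)
   moreover have "\<bar>i - k\<bar> = i - k" using False by auto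
   ultimately show ?thesis by (simp only:)
  qed
  then have "(m1 i / m1 k) powr a * (m2 i / m2 k) powr b * (2 powi (k - max i k)) ^ n * m1 k powr a \<le> D * t ^ nat \<bar>i - k\<bar> * m1 k powr a"
   by (rule mult_right_mono) simp
  then show ?thesis by (subst split[of i k]) (simp only: mult_ac)
 qed
 have C1Q1: "m1 i \<le> C1 * Q1 * m1 k" if "\<bar>i - k\<bar> \<le> 1" for i k
 proof (cases "k \<le> i")
  case True
  have "Q1 ^ nat (i - k) \<le> Q1 ^ 1" using M1 that by (intro power_increasing) auto
  then have "C1 * Q1 ^ nat (i - k) * m1 k \<le> C1 * Q1 * m1 k" using M1 less_imp_le[OF pos(1)[of k]] by (intro mult_right_mono mult_left_mono) auto
  moreover have "m1 i \<le> C1 * Q1 ^ nat (i - k) * m1 k" using M1 True by auto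
  ultimately show ?thesis by linarith
 next
  case False
  have "\<gamma>1 ^ nat (k - i) \<le> 1" using M1 by (intro power_le_one) auto
  moreover have "1 * 1 \<le> C1 * Q1" using M1 by (intro mult_mono) simp_all
  ultimately have "\<gamma>1 ^ nat (k - i) * m1 k \<le> C1 * Q1 * m1 k" using less_imp_le[OF pos(1)[of k]] by (intro mult_right_mono) auto
  moreover have "m1 i \<le> \<gamma>1 ^ nat (k - i) * m1 k" using M1 False by auto
  ultimately show ?thesis by simp
 qed
 have M3: "m1 i powr a \<le> D * m1 k powr a" if "\<bar>i - k\<bar> \<le> 1" for i k
 proof -
  have "(m1 i / m1 k) powr a \<le> (C1 * Q1) powr \<bar>a\<bar>"
  proof (cases "0 \<le> a")
   case True
   have "m1 i / m1 k \<le> C1 * Q1" using C1Q1[OF that] pos(1)[of k] by (simp add: pos_divide_le_eq)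
   then have "(m1 i / m1 k) powr a \<le> (C1 * Q1) powr a" using True less_imp_le[OF pos(1)[of i]] less_imp_le[OF pos(1)[of k]] by (intro powr_mono2) auto
   then show ?thesis using True by simp
  next
   case False
   have "m1 k / m1 i \<le> C1 * Q1" using C1Q1[of k i] that pos(1)[of i] by (simp add: pos_divide_le_eq abs_minus_commute)
   then have "(m1 k / m1 i) powr (- a) \<le> (C1 * Q1) powr (- a)"
    using False pos(1)[of i] pos(1)[of k] by (intro powr_mono2) auto
   moreover have "(m1 k / m1 i) powr (- a) = (m1 i / m1 k) powr a"
    using pos(1)[of i] pos(1)[of k] by (simp add: powr_minus powr_divide)
   ultimately show ?thesis using False by simp
  qed
  then have "(m1 i / m1 k) powr a * m1 k powr a \<le> D * m1 k powr a" using Dge(3) by (intro mult_right_mono) auto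
  then show ?thesis by (subst split[of i k])
 qed
 \<comment> \<open>A square root is taken because \<open>geometric_convolution_lp\<close> spends one
   factor on the supremum and the other on the sum.\<close>
 have "sqrt t * sqrt t = t" "0 < sqrt t" "sqrt t < 1" using t by simp_all
 then show ?thesis using M M3 Dge(4) by (intro exI[of _ "sqrt t"] exI[of _ D]) simp
qed

section \<open>The intrinsic function and its dyadic version\<close>

lemma C_class_continuous:
 assumes "0 < \<beta>" "\<phi> \<in> C_class \<beta>" shows "continuous_on UNIV \<phi>"
 by (rule Hoelder_continuous[where \<beta>=\<beta> and t=1 and K=1]) (use assms in \<open>auto simp: C_class_def dist_norm\<close>)

text \<open>Support, Hoelder condition and mean value zero scale to those of \<open>kern\<close>.
  For the mean the substitution z = y - t x is used, whose Jacobian cancels the normalization of the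
  dilation.\<close>

lemma dilate_in_kern:
 fixes \<phi> :: "real^'n \<Rightarrow> real"
 assumes \<beta>: "0 < \<beta>" and \<phi>: "\<phi> \<in> C_class \<beta>" and t: "0 < t"
 shows "(\<lambda>z. dilate t \<phi> (y - z)) \<in> kern \<beta> t y"
 unfolding kern_def
proof (intro CollectI conjI allI impI)
 have [measurable]: "\<phi> \<in> borel_measurable borel" by (intro borel_measurable_continuous_onI C_class_continuous[OF \<beta> \<phi>])
 fix z assume "t < dist y z"
 moreover have "norm ((y - z) /\<^sub>R t) = norm (y - z) / t"
  unfolding norm_scaleR using t by (simp add: divide_inverse mult.commute)
 ultimately have "1 < norm ((y - z) /\<^sub>R t)" using t by (simp add: dist_norm)
 then have "(y - z) /\<^sub>R t \<notin> closure {x. \<phi> x \<noteq> 0}" using \<phi> by (auto simp: C_class_def)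
 then have "\<phi> ((y - z) /\<^sub>R t) = 0" using closure_subset[of "{x. \<phi> x \<noteq> 0}"] by blast
 then show "dilate t \<phi> (y - z) = 0" by (simp add: dilate_def)
next
 fix z z'
 have H: "\<bar>\<phi> a - \<phi> b\<bar> \<le> norm (a - b) powr \<beta>" for a b using \<phi> by (simp add: C_class_def)
 have "norm ((y - z) /\<^sub>R t - (y - z') /\<^sub>R t) = dist z z' / t"
 proof -
  have "(y - z) /\<^sub>R t - (y - z') /\<^sub>R t = (z' - z) /\<^sub>R t" by (simp add: scaleR_diff_right)
  then show ?thesis using t by (simp add: dist_norm norm_minus_commute divide_inverse mult.commute)
 qed
 then have "\<bar>\<phi> ((y - z) /\<^sub>R t) - \<phi> ((y - z') /\<^sub>R t)\<bar> \<le> (dist z z' / t) powr \<beta>"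
  using H[of "(y - z) /\<^sub>R t" "(y - z') /\<^sub>R t"] by (simp only:)
 then show "\<bar>dilate t \<phi> (y - z) - dilate t \<phi> (y - z')\<bar> \<le> (dist z z' / t) powr \<beta> / t ^ DIM(real^'n)"
  using t by (simp add: dilate_def diff_divide_distrib[symmetric] divide_right_mono)
next
 have [measurable]: "\<phi> \<in> borel_measurable borel" by (intro borel_measurable_continuous_onI C_class_continuous[OF \<beta> \<phi>])
 have "lborel = density (distr lborel borel (\<lambda>x. y + (- t) *\<^sub>R x)) (\<lambda>_. ennreal (\<bar>- t\<bar> ^ DIM(real^'n)))"
  by (rule lborel_affine) (use t in auto)
 then have "(LINT z|lborel. dilate t \<phi> (y - z)) = (LINT z|density (distr lborel borel (\<lambda>x. y + (- t) *\<^sub>R x)) (\<lambda>_. ennreal (\<bar>- t\<bar> ^ DIM(real^'n))). dilate t \<phi> (y - z))"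
  by simp
 also have "... = (LINT x|lborel. \<bar>- t\<bar> ^ DIM(real^'n) *\<^sub>R dilate t \<phi> (y - (y + (- t) *\<^sub>R x)))"
  unfolding dilate_def by (subst integral_density, simp, simp, simp, subst integral_distr, simp_all)
 also have "... = (LINT x|lborel. \<phi> x)" using t by (simp add: dilate_def)
 also have "... = (LINT x|lebesgue. \<phi> x)" by (rule integral_completion[symmetric]) simp
 finally show "(LINT z|lborel. dilate t \<phi> (y - z)) = 0" using \<phi> by (simp add: C_class_def)
qed

section \<open>Measurability in position and scale\<close>

lemma convolution_dilate_eq:
 fixes f g :: "real^'n \<Rightarrow> real"
 assumes \<beta>: "0 < \<beta>" "\<phi> \<in> C_class \<beta>" "0 < t" and g: "g \<in> borel_measurable borel" and f: "f \<in> borel_measurable lebesgue" and eq: "AE x in lborel. f x = g x"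
 shows "convolution f (dilate t \<phi>) y = (LINT z|lborel. g z * dilate t \<phi> (y - z))"
proof -
 have [measurable]: "(\<lambda>z. dilate t \<phi> (y - z)) \<in> borel_measurable borel"
  by (rule kern_measurable[OF \<beta>(1,3) dilate_in_kern[OF \<beta>]])
 note [measurable] = g
 have "AE x in lebesgue. f x = g x" using eq by (simp add: AE_completion)
 then have "AE z in lebesgue. f z * dilate t \<phi> (y - z) = g z * dilate t \<phi> (y - z)" by eventually_elim simp
 moreover have "(\<lambda>z. f z * dilate t \<phi> (y - z)) \<in> borel_measurable lebesgue"
  by (rule borel_measurable_times[OF f measurable_completion]) measurable
 moreover have "(\<lambda>z. g z * dilate t \<phi> (y - z)) \<in> borel_measurable lebesgue"
  by (rule measurable_completion) measurable
 ultimately have "convolution f (dilate t \<phi>) y = (LINT z|lebesgue. g z * dilate t \<phi> (y - z))"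
  unfolding convolution_def by (intro integral_cong_AE)
 also have "... = (LINT z|lborel. g z * dilate t \<phi> (y - z))" by (rule integral_completion) measurable
 finally show ?thesis .
qed

text \<open>Near \<open>(y0, t0)\<close> the scales stay between \<open>t0 / 2\<close> and
  \<open>2 * t0\<close>, so all kernels share the bound 3 / (t0/2)^n and the ball of radius
  \<open>2 * t0 + 1\<close>; dominated convergence applies.\<close>

lemma continuous_dilate_integral:
 fixes g :: "real^'n \<Rightarrow> real"
 assumes \<beta>: "0 < \<beta>" "\<beta> \<le> 1" and \<phi>: "\<phi> \<in> C_class \<beta>" and g: "local_int g"
 shows "continuous_on (UNIV \<times> {0<..}) (\<lambda>(y, t). LINT z|lborel. g z * dilate t \<phi> (y - z))"
 unfolding continuous_on_sequentially
proof (intro allI ballI impI)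
 let ?F = "\<lambda>(y, t). LINT z|lborel. g z * dilate t \<phi> (y - z)"
 fix x :: "nat \<Rightarrow> (real^'n) \<times> real" and a
 assume a: "a \<in> UNIV \<times> {0<..}" and x: "(\<forall>n. x n \<in> UNIV \<times> {0<..}) \<and> x \<longlonglongrightarrow> a"
 obtain y0 t0 where a_eq: "a = (y0, t0)" and t0: "0 < t0" using a by auto
 define y where "y n = fst (x n)" for n
 define t where "t n = snd (x n)" for n
 have x_eq: "x n = (y n, t n)" and t: "0 < t n" for n using x by (auto simp: y_def t_def mem_Times_iff)
 have lim: "y \<longlonglongrightarrow> y0" "t \<longlonglongrightarrow> t0"
  using x tendsto_fst[of x a sequentially] tendsto_snd[of x a sequentially] by (auto simp: y_def[abs_def] t_def[abs_def] a_eq)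
 have "\<forall>\<^sub>F n in sequentially. dist (y n) y0 < 1 \<and> t0 / 2 < t n \<and> t n < 2 * t0"
  using t0 by (intro eventually_conj tendstoD[OF lim(1)] order_tendstoD[OF lim(2)]) auto
 then obtain N where N: "\<And>n. N \<le> n \<Longrightarrow> dist (y n) y0 < 1 \<and> t0 / 2 < t n \<and> t n < 2 * t0"
  unfolding eventually_sequentially by auto
 note lim1 = LIMSEQ_ignore_initial_segment[OF lim(1), of N] and lim2 = LIMSEQ_ignore_initial_segment[OF lim(2), of N]
 have gm [measurable]: "g \<in> borel_measurable borel" by (rule local_int_measurable[OF g])
 have dm [measurable]: "(\<lambda>z. dilate t \<phi> (y - z)) \<in> borel_measurable borel" if "0 < t" for t y
  by (rule kern_measurable[OF \<beta>(1) that dilate_in_kern[OF \<beta>(1) \<phi> that]])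
 have "(\<lambda>n. LINT z|lborel. g z * dilate (t (n + N)) \<phi> (y (n + N) - z)) \<longlonglongrightarrow> (LINT z|lborel. g z * dilate t0 \<phi> (y0 - z))"
 proof (rule integral_dominated_convergence)
  show "integrable lborel (\<lambda>z. (\<bar>g z\<bar> * indicator (cball y0 (2 * t0 + 1)) z) * (3 / (t0 / 2) ^ CARD('n)))"
   by (intro integrable_mult_left local_int_integrable[OF g])
  show "AE z in lborel. (\<lambda>n. g z * dilate (t (n + N)) \<phi> (y (n + N) - z)) \<longlonglongrightarrow> g z * dilate t0 \<phi> (y0 - z)"
  proof (rule AE_I2)
   fix z
   have L: "(\<lambda>n. (y (n + N) - z) /\<^sub>R t (n + N)) \<longlonglongrightarrow> (y0 - z) /\<^sub>R t0"
    by (intro tendsto_scaleR tendsto_inverse tendsto_diff tendsto_const lim1 lim2) (use t0 in simp)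
   have "isCont \<phi> ((y0 - z) /\<^sub>R t0)" using C_class_continuous[OF \<beta>(1) \<phi>] by (simp add: continuous_on_eq_continuous_at)
   then have "(\<lambda>n. \<phi> ((y (n + N) - z) /\<^sub>R t (n + N))) \<longlonglongrightarrow> \<phi> ((y0 - z) /\<^sub>R t0)"
    by (rule isCont_tendsto_compose[OF _ L])
   then have "(\<lambda>n. \<phi> ((y (n + N) - z) /\<^sub>R t (n + N)) / t (n + N) ^ CARD('n)) \<longlonglongrightarrow> \<phi> ((y0 - z) /\<^sub>R t0) / t0 ^ CARD('n)"
    by (rule tendsto_divide[OF _ tendsto_power[OF lim2]]) (use t0 in simp)
   then show "(\<lambda>n. g z * dilate (t (n + N)) \<phi> (y (n + N) - z)) \<longlonglongrightarrow> g z * dilate t0 \<phi> (y0 - z)"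
    unfolding dilate_def by (rule tendsto_mult_left)
  qed
  fix n
  show "AE z in lborel. norm (g z * dilate (t (n + N)) \<phi> (y (n + N) - z)) \<le> \<bar>g z\<bar> * indicator (cball y0 (2 * t0 + 1)) z * (3 / (t0 / 2) ^ CARD('n))"
  proof (rule AE_I2)
   fix z
   let ?y = "y (n + N)" and ?t = "t (n + N)"
   have n: "dist ?y y0 < 1" "t0 / 2 < ?t" "?t < 2 * t0" using N[of "n + N"] by auto
   have "\<bar>dilate ?t \<phi> (?y - z)\<bar> \<le> 3 / ?t ^ CARD('n) * indicator (cball ?y ?t) z"
    using kern_bound[OF \<beta> t dilate_in_kern[OF \<beta>(1) \<phi> t], of "n + N" ?y z] by simp
   also have "... \<le> 3 / (t0 / 2) ^ CARD('n) * indicator (cball y0 (2 * t0 + 1)) z"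
   proof (intro mult_mono)
    show "3 / ?t ^ CARD('n) \<le> 3 / (t0 / 2) ^ CARD('n)"
     using n t0 t[of "n + N"] by (intro divide_left_mono power_mono) auto
    have "dist y0 z \<le> dist ?y y0 + dist ?y z" using dist_triangle[of y0 z ?y] by (simp add: dist_commute)
    then show "indicator (cball ?y ?t) z \<le> (indicator (cball y0 (2 * t0 + 1)) z :: real)"
     using n by (auto split: split_indicator)
   qed (use t0 in auto)
   finally have "\<bar>g z\<bar> * \<bar>dilate ?t \<phi> (?y - z)\<bar> \<le> \<bar>g z\<bar> * (3 / (t0 / 2) ^ CARD('n) * indicator (cball y0 (2 * t0 + 1)) z)"
    by (rule mult_left_mono) simp
   then show "norm (g z * dilate ?t \<phi> (?y - z)) \<le> \<bar>g z\<bar> * indicator (cball y0 (2 * t0 + 1)) z * (3 / (t0 / 2) ^ CARD('n))"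
    by (simp only: real_norm_def abs_mult mult.assoc mult.commute[of "3 / (t0 / 2) ^ CARD('n)"])
  qed
 qed (use t t0 in simp_all)
 then have "(\<lambda>n. LINT z|lborel. g z * dilate (t n) \<phi> (y n - z)) \<longlonglongrightarrow> (LINT z|lborel. g z * dilate t0 \<phi> (y0 - z))"
  by (rule LIMSEQ_offset)
 then show "(?F \<circ> x) \<longlonglongrightarrow> ?F a" by (simp add: a_eq x_eq comp_def)
qed

text \<open>A supremum of continuous functions is lower semicontinuous, so its superlevel sets are
  open even though the class of kernels is uncountable. The indicator discards the scales
  \<open>t \<le> 0\<close>.\<close>

lemma measurable_A_sup:
 fixes f g :: "real^'n \<Rightarrow> real"
 assumes \<beta>: "0 < \<beta>" "\<beta> \<le> 1" and g: "local_int g" and f: "f \<in> borel_measurable lebesgue" and eq: "AE x in lborel. f x = g x"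
 shows "(\<lambda>(y, t). A_sup \<beta> f y t * indicator {0<..} t) \<in> borel_measurable borel"
proof (rule borel_measurableI_greater)
 fix c :: ennreal
 let ?F = "\<lambda>\<phi> (y, t). LINT z|lborel. g z * dilate t \<phi> (y - z)"
 let ?U = "UNIV \<times> {0<..} :: ((real^'n) \<times> real) set"
 have U: "open ?U" by (intro open_Times) auto
 have A: "A_sup \<beta> f y t = (SUP \<phi>\<in>C_class \<beta>. ennreal \<bar>?F \<phi> (y, t)\<bar>)" if "0 < t" for y t
  unfolding A_sup_def
  by (rule SUP_cong[OF refl]) (simp add: convolution_dilate_eq[OF \<beta>(1) _ that local_int_measurable[OF g] f eq])
 have "{x \<in> space borel. c < (\<lambda>(y, t). A_sup \<beta> f y t * indicator {0<..} t) x} = (\<Union>\<phi>\<in>C_class \<beta>. (\<lambda>x. ennreal \<bar>?F \<phi> x\<bar>) -` {c<..} \<inter> ?U)"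
 proof (rule set_eqI)
  fix p :: "(real^'n) \<times> real"
  obtain y t where p: "p = (y, t)" by (cases p)
  have "c < A_sup \<beta> f y t * indicator {0<..} t \<longleftrightarrow> (\<exists>\<phi>\<in>C_class \<beta>. c < ennreal \<bar>?F \<phi> (y, t)\<bar> \<and> 0 < t)"
  proof (cases "0 < t")
   case True
   then have "indicator {0<..} t = (1 :: ennreal)" by simp
   then show ?thesis unfolding A[OF True] using True by (simp only: mult_1_right simp_thms less_SUP_iff)
  qed simp
  then show "p \<in> {x \<in> space borel. c < (\<lambda>(y, t). A_sup \<beta> f y t * indicator {0<..} t) x} \<longleftrightarrow> p \<in> (\<Union>\<phi>\<in>C_class \<beta>. (\<lambda>x. ennreal \<bar>?F \<phi> x\<bar>) -` {c<..} \<inter> ?U)"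
   unfolding p by (simp only: mem_Collect_eq prod.case space_borel UNIV_I simp_thms UN_iff Int_iff vimage_eq greaterThan_iff mem_Times_iff fst_conv snd_conv)
 qed
 also have "open ..."
 proof (intro open_UN ballI)
  fix \<phi> :: "real^'n \<Rightarrow> real" assume "\<phi> \<in> C_class \<beta>"
  then have "continuous_on ?U (?F \<phi>)" by (rule continuous_dilate_integral[OF \<beta> _ g])
  then have "continuous_on ?U (\<lambda>x. ennreal \<bar>?F \<phi> x\<bar>)" by (rule continuous_on_ennreal[OF continuous_on_rabs])
  then show "open ((\<lambda>x. ennreal \<bar>?F \<phi> x\<bar>) -` {c<..} \<inter> ?U)"
   by (rule continuous_on_open_vimage[OF U, THEN iffD1, rule_format]) (rule open_greaterThan)
 qed
 finally show "{x \<in> space borel. c < (\<lambda>(y, t). A_sup \<beta> f y t * indicator {0<..} t) x} \<in> sets borel" by simp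
qed

lemma measurable_A_sup_section:
 fixes f g :: "real^'n \<Rightarrow> real"
 assumes \<beta>: "0 < \<beta>" "\<beta> \<le> 1" and g: "local_int g" and f: "f \<in> borel_measurable lebesgue" and eq: "AE x in lborel. f x = g x"
 shows "(\<lambda>(y, t). (A_sup \<beta> f y t)\<^sup>2 / ennreal t * indicator {0<..} t) \<in> borel_measurable (borel \<Otimes>\<^sub>M borel)"
proof -
 have [measurable]: "(\<lambda>(y, t). A_sup \<beta> f y t * indicator {0<..} t) \<in> borel_measurable (borel \<Otimes>\<^sub>M borel)"
  using measurable_A_sup[OF assms] by (simp add: borel_prod)
 have "(\<lambda>(y, t). (A_sup \<beta> f y t)\<^sup>2 / ennreal t * indicator {0<..} t) = (\<lambda>p. ((\<lambda>(y, t). A_sup \<beta> f y t * indicator {0<..} t) p)\<^sup>2 / ennreal (snd p))"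
  by (auto split: split_indicator)
 also have "... \<in> borel_measurable (borel \<Otimes>\<^sub>M borel)" by measurable
 finally show ?thesis .
qed

lemma measurable_intrinsic_G:
 fixes f g :: "real^'n \<Rightarrow> real"
 assumes \<beta>: "0 < \<beta>" "\<beta> \<le> 1" and g: "local_int g" and f: "f \<in> borel_measurable lebesgue" and eq: "AE x in lborel. f x = g x"
 shows "intrinsic_G \<beta> f \<in> borel_measurable borel"
proof -
 have [measurable]: "(\<lambda>(y, t). (A_sup \<beta> f y t)\<^sup>2 / ennreal t * indicator {0<..} t) \<in> borel_measurable (borel \<Otimes>\<^sub>M lborel)"
  using measurable_A_sup_section[OF assms] by (subst measurable_cong_sets[OF sets_pair_measure_cong[OF refl sets_lborel] refl])
 have [measurable]: "(\<lambda>y. \<integral>\<^sup>+t\<in>{0<..}. (A_sup \<beta> f y t)\<^sup>2 / ennreal t \<partial>lborel) \<in> borel_measurable borel"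
  by (rule lborel.borel_measurable_nn_integral) measurable
 show ?thesis
  unfolding intrinsic_G_def[abs_def] nn_integral_completion by measurable
qed

text \<open>On the octave (2^(j-1), 2^j] the supremum at scale \<open>t\<close> is at most 2^(n+1)
  times that at scale 2^j by \<open>sup_kern_rescale\<close>, and dt/t has mass at most 1 there.
  Each octave therefore contributes at most one term of the dyadic square sum.\<close>

lemma intrinsic_G_le_sq_full:
 fixes f g :: "real^'n \<Rightarrow> real"
 assumes \<beta>: "0 < \<beta>" "\<beta> \<le> 1" and g: "local_int g" and f: "f \<in> borel_measurable lebesgue" and eq: "AE x in lborel. f x = g x"
 shows "intrinsic_G \<beta> f x \<le> ennreal (2 ^ (CARD('n) + 1)) * sq_full \<beta> g x"
proof -
 define K :: real where "K = 2 ^ (CARD('n) + 1)"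
 have K: "0 \<le> K" by (simp add: K_def)
 define a where "a j = sup_kern \<beta> (2 powi j) g x" for j :: int
 have a0: "0 \<le> a j" for j unfolding a_def by (rule sup_kern_nonneg[OF \<beta> _ g]) simp
 have A_le: "A_sup \<beta> f x t \<le> ennreal (K * a j)" if t: "2 powi (j - 1) < t" "t \<le> 2 powi j" for t j
 proof -
  have t0: "0 < t" using t(1) by (rule less_trans[rotated]) simp
  have "t \<le> 2 powi j" "2 powi j \<le> 2 * t" using t by (auto simp: power_int_diff)
  then have r: "sup_kern \<beta> t g x \<le> K * a j"
   unfolding K_def a_def using sup_kern_rescale[OF \<beta> t0 g] by simp
  show ?thesis
   unfolding A_sup_def
  proof (rule SUP_least)
   fix \<phi> :: "real^'n \<Rightarrow> real" assume \<phi>: "\<phi> \<in> C_class \<beta>"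
   have "\<bar>convolution f (dilate t \<phi>) x\<bar> \<le> sup_kern \<beta> t g x"
    unfolding convolution_dilate_eq[OF \<beta>(1) \<phi> t0 local_int_measurable[OF g] f eq]
    by (rule sup_kern_upper[OF \<beta> t0 g dilate_in_kern[OF \<beta>(1) \<phi> t0]])
   with r show "ennreal \<bar>convolution f (dilate t \<phi>) x\<bar> \<le> ennreal (K * a j)" by (intro ennreal_leI) simp
  qed
 qed
 have "(\<integral>\<^sup>+t\<in>{0<..}. (A_sup \<beta> f x t)\<^sup>2 / ennreal t \<partial>lborel)
  \<le> (\<integral>\<^sup>+t. (\<integral>\<^sup>+j. ennreal ((K * a j)\<^sup>2 / 2 powi (j - 1)) * indicator {2 powi (j - 1)<..2 powi j :: real} t \<partial>count_space UNIV) \<partial>lborel)"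
 proof (rule nn_integral_mono)
  fix t :: real
  show "(A_sup \<beta> f x t)\<^sup>2 / ennreal t * indicator {0<..} t \<le> (\<integral>\<^sup>+j. ennreal ((K * a j)\<^sup>2 / 2 powi (j - 1)) * indicator {2 powi (j - 1)<..2 powi j :: real} t \<partial>count_space UNIV)"
  proof (cases "0 < t")
   case True
   define j where "j = \<lceil>log 2 t\<rceil>"
   have "2 powi (j - 1) < t" "t \<le> 2 powi j"
   proof -
    have "2 powr real_of_int (j - 1) < 2 powr log 2 t" "2 powr log 2 t \<le> 2 powr real_of_int j"
     unfolding j_def using ceiling_correct[of "log 2 t"] by (auto intro!: powr_less_mono powr_mono)
    moreover have "2 powr real_of_int i = (2::real) powi i" for i by (simp add: powr_real_of_int')
    ultimately show "2 powi (j - 1) < t" "t \<le> 2 powi j" using True by (simp_all del: of_int_diff)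
   qed
   note tj = this
   have p0: "0 < (2::real) powi (j - 1)" by simp
   have "(A_sup \<beta> f x t)\<^sup>2 / ennreal t \<le> (ennreal (K * a j))\<^sup>2 / ennreal (2 powi (j - 1))"
   proof -
    have "inverse (ennreal t) \<le> inverse (ennreal (2 powi (j - 1)))"
     unfolding inverse_ennreal[OF True] inverse_ennreal[OF p0] using tj by (intro ennreal_leI le_imp_inverse_le p0) auto
    then show ?thesis unfolding divide_ennreal_def using A_le[OF tj] by (intro mult_mono power_mono) auto
   qed
   also have "... = ennreal ((K * a j)\<^sup>2 / 2 powi (j - 1))"
    using K a0[of j] p0 by (simp add: ennreal_power divide_ennreal)
   also have "... = ennreal ((K * a j)\<^sup>2 / 2 powi (j - 1)) * indicator {2 powi (j - 1)<..2 powi j :: real} t"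
    using tj by simp
   also have "... \<le> (\<integral>\<^sup>+j. ennreal ((K * a j)\<^sup>2 / 2 powi (j - 1)) * indicator {2 powi (j - 1)<..2 powi j :: real} t \<partial>count_space UNIV)"
    by (rule nn_integral_count_space_upper) simp
   finally show ?thesis using True by simp
  qed simp
 qed
 also have "... = (\<integral>\<^sup>+j. (\<integral>\<^sup>+t. ennreal ((K * a j)\<^sup>2 / 2 powi (j - 1)) * indicator {2 powi (j - 1)<..2 powi j :: real} t \<partial>lborel) \<partial>count_space UNIV)"
  by (rule nn_integral_count_space_nn_integral) auto
 also have "... = (\<integral>\<^sup>+j. ennreal ((K * a j)\<^sup>2) \<partial>count_space UNIV)"
 proof (rule nn_integral_cong)
  fix j :: int
  have p0: "0 < (2::real) powi (j - 1)" by simp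
  have l: "(2::real) powi j = 2 * 2 powi (j - 1)" by (simp add: power_int_diff)
  have "(\<integral>\<^sup>+t. ennreal ((K * a j)\<^sup>2 / 2 powi (j - 1)) * indicator {2 powi (j - 1)<..2 powi j :: real} t \<partial>lborel)
   = ennreal ((K * a j)\<^sup>2 / 2 powi (j - 1)) * ennreal (2 powi (j - 1))"
   by (subst nn_integral_cmult_indicator) (simp_all add: l)
  also have "... = ennreal ((K * a j)\<^sup>2)" using p0 by (subst ennreal_mult[symmetric]) auto
  finally show "(\<integral>\<^sup>+t. ennreal ((K * a j)\<^sup>2 / 2 powi (j - 1)) * indicator {2 powi (j - 1)<..2 powi j :: real} t \<partial>lborel) = ennreal ((K * a j)\<^sup>2)" .
 qed
 also have "... \<le> (ennreal K * sq_full \<beta> g x)\<^sup>2"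
  unfolding nn_integral_count_space_SUP[OF countableI_type]
 proof (rule SUP_least)
  fix J :: "int set" assume "J \<in> {F. finite F \<and> F \<subseteq> UNIV}"
  then have J: "finite J" by simp
  have "(\<Sum>j\<in>J. ennreal ((K * a j)\<^sup>2)) = ennreal (\<Sum>j\<in>J. (K * a j)\<^sup>2)" by (rule sum_ennreal) simp
  also have "(\<Sum>j\<in>J. (K * a j)\<^sup>2) = (K * sq_fun \<beta> J g x)\<^sup>2"
   by (simp add: sq_fun_def L2_set_def a_def[symmetric] power_mult_distrib sum_distrib_left sum_nonneg)
  also have "ennreal ... = (ennreal K * ennreal (sq_fun \<beta> J g x))\<^sup>2"
   using K by (simp add: sq_fun_def L2_set_nonneg ennreal_mult[symmetric] ennreal_power)
  also have "... \<le> (ennreal K * sq_full \<beta> g x)\<^sup>2"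
   by (intro power_mono mult_left_mono sq_fun_le_sq_full J) auto
  finally show "(\<Sum>j\<in>J. ennreal ((K * a j)\<^sup>2)) \<le> (ennreal K * sq_full \<beta> g x)\<^sup>2" .
 qed
 finally have "(\<integral>\<^sup>+t\<in>{0<..}. (A_sup \<beta> f x t)\<^sup>2 / ennreal t \<partial>lborel) \<le> (ennreal K * sq_full \<beta> g x) epowr 2"
  by (simp add: epowr_numeral)
 then have "intrinsic_G \<beta> f x \<le> ((ennreal K * sq_full \<beta> g x) epowr 2) epowr (1 / 2)"
  unfolding intrinsic_G_def nn_integral_completion by (rule epowr_mono) simp
 then show ?thesis by (simp add: epowr_epowr K_def)
qed

section \<open>Herz spaces\<close>

lemma nn_integral_lebesgue_cong:
 assumes "g \<in> borel_measurable borel" "AE x in lborel. f x = g x"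
 shows "(\<integral>\<^sup>+x. f x \<partial>lebesgue) = (\<integral>\<^sup>+x. g x \<partial>lborel)"
 unfolding nn_integral_completion by (rule nn_integral_cong_AE) (rule assms(2))

lemma Lq_norm_restrict:
 fixes F F' :: "real^'n \<Rightarrow> ennreal"
 assumes q: "0 < q" and [measurable]: "A \<in> sets borel" "w' \<in> borel_measurable borel" "F' \<in> borel_measurable borel"
  and w: "AE x in lborel. w x = w' x" and F: "AE x in lborel. F x = F' x"
 shows "Lq_norm q w (\<lambda>x. F x * indicator A x) = wint_on A q w' F' epowr (1 / q)"
proof -
 have "AE x in lborel. (F x * indicator A x) epowr q * ennreal (w x) = F' x epowr q * ennreal (w' x) * indicator A x"
  using w F by eventually_elim (use q in \<open>simp split: split_indicator\<close>)
 then have "(\<integral>\<^sup>+x. (F x * indicator A x) epowr q * ennreal (w x) \<partial>lebesgue) = wint_on A q w' F'"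
  by (rule nn_integral_lebesgue_cong[rotated]) measurable
 then show ?thesis by (simp only: Lq_norm_def)
qed

text \<open>The parameter \<open>\<alpha>\<close> may be negative, so the power of the mass is
  evaluated from \<open>0 < m\<close> through the definition of \<open>epowr\<close> instead of the
  rules for positive exponents.\<close>

lemma herz_summand:
 fixes F F' :: "real^'n \<Rightarrow> ennreal" and w1 :: "real^'n \<Rightarrow> real"
 assumes p: "0 < p" and q: "0 < q" and [measurable]: "A \<in> sets borel" "w2' \<in> borel_measurable borel" "F' \<in> borel_measurable borel"
  and w1: "w1' \<in> borel_measurable borel" "AE x in lborel. w1 x = w1' x"
  and w2: "AE x in lborel. w2 x = w2' x" and F: "AE x in lborel. F x = F' x"
  and m: "0 < m" "ennreal m = mass w1' (cball 0 (2 powi k))"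
 shows "wmeasure w1 (dyadic_ball k) epowr (\<alpha> * p / real CARD('n)) * Lq_norm q w2 (\<lambda>x. F x * indicator A x) epowr p
  = (ennreal (m powr (\<alpha> / real CARD('n))) * wint_on A q w2' F' epowr (1 / q)) epowr p"
proof -
 note [measurable] = w1(1)
 have db: "dyadic_ball k = cball (0::real^'n) (2 powi k)" by (auto simp: dyadic_ball_def)
 have "wmeasure w1 (dyadic_ball k) = mass w1' (cball 0 (2 powi k))"
  unfolding wmeasure_def db
 proof (rule nn_integral_lebesgue_cong)
  show "AE x in lborel. ennreal (w1 x) * indicator (cball 0 (2 powi k)) x = ennreal (w1' x) * indicator (cball 0 (2 powi k)) x"
   using w1(2) by eventually_elim simp
 qed simp
 then have "wmeasure w1 (dyadic_ball k) = ennreal m" by (simp add: m(2))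
 moreover have "ennreal m epowr (\<alpha> * p / real CARD('n)) = ennreal (m powr (\<alpha> / real CARD('n))) epowr p"
  using m(1) p by (simp add: epowr_def powr_powr)
 moreover have "Lq_norm q w2 (\<lambda>x. F x * indicator A x) = wint_on A q w2' F' epowr (1 / q)"
  by (rule Lq_norm_restrict[OF q _ _ _ w2 F]) measurable
 ultimately show ?thesis using p by (simp add: epowr_mult)
qed

section \<open>Annuli, shells and coverings of compact sets\<close>

lemma annulus_sets [measurable]: "(annulus k :: (real^'n) set) \<in> sets borel"
proof -
 have eq: "annulus k = cball 0 (2 powi k) - cball (0::real^'n) (2 powi (k - 1))" by (auto simp: annulus_def dyadic_ball_def)
 show ?thesis unfolding eq by simp
qed

lemma annulus_nonhom_sets [measurable]: "(annulus_nonhom k :: (real^'n) set) \<in> sets borel"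
proof -
 have "dyadic_ball 0 = cball (0::real^'n) 1" by (auto simp: dyadic_ball_def)
 then show ?thesis by (simp add: annulus_nonhom_def annulus_sets)
qed

lemma ex_annulus:
 assumes "z \<noteq> (0::real^'n)" shows "\<exists>k. z \<in> annulus k"
proof
 let ?j = "\<lceil>log 2 (norm z)\<rceil>"
 have z: "0 < norm z" using assms by simp
 have "2 powr real_of_int (?j - 1) < 2 powr log 2 (norm z)" "2 powr log 2 (norm z) \<le> 2 powr real_of_int ?j"
  using ceiling_correct[of "log 2 (norm z)"] by (auto intro!: powr_less_mono powr_mono)
 moreover have "2 powr real_of_int i = (2::real) powi i" for i by (simp add: powr_real_of_int')
 ultimately show "z \<in> annulus ?j" using z by (simp add: annulus_def dyadic_ball_def del: of_int_diff)
qed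

lemma annulus_index_less:
 assumes z: "z \<in> annulus k" and j: "norm z \<le> 2 powi j" shows "k \<le> j"
proof (rule ccontr)
 assume "\<not> k \<le> j"
 then have "(2::real) powi j \<le> 2 powi (k - 1)" by (intro power_int_increasing) auto
 then show False using z j by (auto simp: annulus_def dyadic_ball_def)
qed

lemma annulus_index_greater:
 assumes z: "z \<in> annulus k" and j: "2 powi j \<le> norm z" shows "j \<le> k"
proof (rule ccontr)
 assume "\<not> j \<le> k"
 then have "(2::real) powi k < 2 powi j" by (intro power_int_strict_increasing) auto
 then show False using z j by (auto simp: annulus_def dyadic_ball_def)
qed

text \<open>A compact set that avoids the origin keeps a positive distance from it, hence meets only
  finitely many annuli. This is what the local integrability in \<open>herz_hom\<close>
  requires.\<close>

lemma compact_annulus_cover: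
 fixes T :: "(real^'n) set"
 assumes T: "compact T" "T \<subseteq> - {0}"
 shows "\<exists>J. finite J \<and> T \<subseteq> (\<Union>k\<in>J. annulus k)"
proof -
 obtain R where R: "\<And>z. z \<in> T \<Longrightarrow> norm z \<le> R" using compact_imp_bounded[OF T(1)] by (auto simp: bounded_iff)
 obtain e where e: "0 < e" "\<And>z. z \<in> T \<Longrightarrow> e \<le> norm z"
  using separate_point_closed[OF compact_imp_closed[OF T(1)], of 0] T(2) by (auto simp: dist_norm)
 obtain N where N: "R < 2 ^ N" using real_arch_pow[of 2 R] by auto
 obtain M where M: "1 / e < 2 ^ M" using real_arch_pow[of 2 "1 / e"] by auto
 have M': "2 powi (- int M) \<le> e" using M e(1) by (simp add: power_int_minus field_simps)
 have "z \<in> (\<Union>k\<in>{- int M..int N}. annulus k)" if z: "z \<in> T" for z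
 proof -
  obtain k where k: "z \<in> annulus k" using ex_annulus[of z] z T(2) by blast
  have "k \<le> int N" using R[OF z] N by (intro annulus_index_less[OF k]) simp
  moreover have "- int M \<le> k" using e(2)[OF z] M' by (intro annulus_index_greater[OF k]) linarith
  ultimately show ?thesis using k by auto
 qed
 then show ?thesis by (intro exI[of _ "{- int M..int N}"]) auto
qed

text \<open>The decomposition of the non-homogeneous space, indexed by all integers.\<close>
definition shell :: "int \<Rightarrow> (real^'n) set" where
 "shell k = (if k < 0 then {} else annulus_nonhom (nat k))"

lemma shell_of_nat [simp]: "shell (int k) = (annulus_nonhom k :: (real^'n) set)"
 by (simp add: shell_def)

lemma shell_sets [measurable]: "(shell k :: (real^'n) set) \<in> sets borel"
 by (simp add: shell_def annulus_nonhom_sets)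

lemma shell_sub: "shell k \<subseteq> cball (0::real^'n) (2 powi k)"
 by (auto simp: shell_def annulus_nonhom_def annulus_def dyadic_ball_def split: if_splits)

lemma shell_sep: "0 < k \<Longrightarrow> shell k \<inter> cball (0::real^'n) (2 powi (k - 1)) = {}"
 by (auto simp: shell_def annulus_nonhom_def annulus_def dyadic_ball_def)

lemma ex_shell: "\<exists>k\<in>{0..}. (z::real^'n) \<in> shell k"
proof (cases "norm z \<le> 1")
 case True
 then show ?thesis by (intro bexI[of _ 0]) (auto simp: shell_def annulus_nonhom_def dyadic_ball_def)
next
 case False
 then obtain k where k: "z \<in> annulus k" using ex_annulus[of z] by force
 have "\<not> k \<le> 0"
 proof
  assume "k \<le> 0"
  then have "(2::real) powi k \<le> 2 powi 0" by (intro power_int_increasing) auto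
  then show False using k False by (auto simp: annulus_def dyadic_ball_def)
 qed
 then show ?thesis using k by (intro bexI[of _ k]) (auto simp: shell_def annulus_nonhom_def)
qed

lemma compact_shell_cover:
 fixes T :: "(real^'n) set"
 assumes T: "compact T"
 shows "\<exists>J\<subseteq>{0..}. finite J \<and> T \<subseteq> (\<Union>k\<in>J. shell k)"
proof -
 obtain R where R: "\<And>z. z \<in> T \<Longrightarrow> norm z \<le> R" using compact_imp_bounded[OF T] by (auto simp: bounded_iff)
 obtain N where N: "R < 2 ^ N" using real_arch_pow[of 2 R] by auto
 have "z \<in> (\<Union>k\<in>{0..int N}. shell k)" if z: "z \<in> T" for z
 proof -
  obtain k where k: "0 \<le> k" "z \<in> shell k" using ex_shell[of z] by auto
  have "k \<le> int N"
  proof (rule ccontr)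
   assume n: "\<not> k \<le> int N"
   then have "z \<in> annulus k" using k by (auto simp: shell_def annulus_nonhom_def split: if_splits)
   then have "k \<le> int N" using R[OF z] N by (intro annulus_index_less) auto
   with n show False by simp
  qed
  with k show ?thesis by auto
 qed
 then show ?thesis by (intro exI[of _ "{0..int N}"]) auto
qed

section \<open>Herz norms as sums over blocks, and the transfer to the intrinsic function\<close>

lemma herz_hom_norm_eq:
 fixes F F' :: "real^'n \<Rightarrow> ennreal"
 assumes p: "0 < p" and q: "0 < q" and [measurable]: "w2' \<in> borel_measurable borel" "F' \<in> borel_measurable borel"
  and w1: "w1' \<in> borel_measurable borel" "AE x in lborel. w1 x = w1' x"
  and w2: "AE x in lborel. w2 x = w2' x" and F: "AE x in lborel. F x = F' x"
  and m: "\<And>k. 0 < m k" "\<And>k. ennreal (m k) = mass w1' (cball 0 (2 powi k))"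
 shows "herz_hom_norm \<alpha> p q w1 w2 F = herz_sum UNIV annulus (\<lambda>k. m k powr (\<alpha> / real CARD('n))) p q w2' F' epowr (1 / p)"
 unfolding herz_hom_norm_def herz_sum_def infsum_ennreal_eq_nn_integral[OF countableI_type]
 by (simp only: herz_summand[OF p q annulus_sets assms(3,4) w1 w2 F m])

lemma herz_nonhom_norm_eq:
 fixes F F' :: "real^'n \<Rightarrow> ennreal"
 assumes p: "0 < p" and q: "0 < q" and [measurable]: "w2' \<in> borel_measurable borel" "F' \<in> borel_measurable borel"
  and w1: "w1' \<in> borel_measurable borel" "AE x in lborel. w1 x = w1' x"
  and w2: "AE x in lborel. w2 x = w2' x" and F: "AE x in lborel. F x = F' x"
  and m: "\<And>k. 0 < m k" "\<And>k. ennreal (m k) = mass w1' (cball 0 (2 powi k))"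
 shows "herz_nonhom_norm \<alpha> p q w1 w2 F
  = herz_sum {0..} shell (\<lambda>k. m k powr (\<alpha> / real CARD('n))) p q w2' F' epowr (1 / p)"
proof -
 let ?g = "\<lambda>k. (ennreal (m k powr (\<alpha> / real CARD('n))) * wint_on (shell k) q w2' F' epowr (1 / q)) epowr p"
 \<comment> \<open>The norm sums over natural numbers, whereas \<open>herz_bound\<close> indexes
   blocks by integers.\<close>
 have "bij_betw int UNIV {0..}" by (rule bij_betwI[where g=nat]) auto
 then have "(\<integral>\<^sup>+k. ?g (int k) \<partial>count_space UNIV) = (\<integral>\<^sup>+k. ?g k \<partial>count_space {0..})"
  by (rule nn_integral_bij_count_space)
 then show ?thesis
  unfolding herz_nonhom_norm_def herz_sum_def infsum_ennreal_eq_nn_integral[OF countableI_type]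
   herz_summand[OF p q annulus_nonhom_sets assms(3,4) w1 w2 F m] by (simp only: shell_of_nat)
qed

lemma herz_sum_block_finite:
 fixes F :: "'a::euclidean_space \<Rightarrow> ennreal"
 assumes p: "0 < p" and q: "0 < q" and c: "0 < c k" and k: "k \<in> I" and fin: "herz_sum I A c p q w F < top"
 shows "wint_on (A k) q w F < top"
proof -
 let ?a = "\<lambda>k. \<integral>\<^sup>+x\<in>A k. F x epowr q * ennreal (w x) \<partial>lborel"
 have "(ennreal (c k) * ?a k epowr (1 / q)) epowr p \<le> herz_sum I A c p q w F"
  unfolding herz_sum_def by (rule nn_integral_count_space_upper[OF k])
 then have "ennreal (c k) * ?a k epowr (1 / q) < top"
  using fin p by (metis epowr_less_top_iff le_less_trans)
 then have "?a k epowr (1 / q) < top" using c by (auto simp: ennreal_mult_less_top)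
 then show ?thesis using q by (simp add: epowr_less_top_iff)
qed

lemma herz_sum_le_scaled:
 fixes F G :: "'a::euclidean_space \<Rightarrow> ennreal"
 assumes p: "0 < p" and q: "0 < q" and b: "0 \<le> b" and le: "\<And>x. F x \<le> ennreal b * G x"
  and [measurable]: "G \<in> borel_measurable borel" "w \<in> borel_measurable borel" "\<And>k. A k \<in> sets borel"
 shows "herz_sum I A c p q w F \<le> ennreal (b powr p) * herz_sum I A c p q w G"
proof -
 let ?a = "\<lambda>k. \<integral>\<^sup>+x\<in>A k. G x epowr q * ennreal (w x) \<partial>lborel"
 have "wint_on (A k) q w F epowr (1 / q) \<le> ennreal b * ?a k epowr (1 / q)" for k
 proof -
  have "wint_on (A k) q w F \<le> (\<integral>\<^sup>+x. ennreal b epowr q * (G x epowr q * ennreal (w x) * indicator (A k) x) \<partial>lborel)"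
  proof (rule nn_integral_mono)
   fix x
   have "F x epowr q \<le> ennreal b epowr q * G x epowr q"
    using epowr_mono[OF le, of q x] q by (simp add: epowr_mult)
   then show "F x epowr q * ennreal (w x) * indicator (A k) x \<le> ennreal b epowr q * (G x epowr q * ennreal (w x) * indicator (A k) x)"
    unfolding mult.assoc[symmetric] by (intro mult_right_mono) auto
  qed
  also have "... = ennreal b epowr q * ?a k" by (rule nn_integral_cmult) measurable
  finally have "wint_on (A k) q w F epowr (1 / q) \<le> (ennreal b epowr q * ?a k) epowr (1 / q)"
   using q by (intro epowr_mono) auto
  then show ?thesis using q by (simp add: epowr_mult epowr_epowr)
 qed
 then have "herz_sum I A c p q w F \<le> (\<integral>\<^sup>+k. (ennreal (c k) * (ennreal b * ?a k epowr (1 / q))) epowr p \<partial>count_space I)"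
  unfolding herz_sum_def using p by (intro nn_integral_mono epowr_mono mult_left_mono) auto
 also have "... = (\<integral>\<^sup>+k. ennreal b epowr p * (ennreal (c k) * ?a k epowr (1 / q)) epowr p \<partial>count_space I)"
  using p by (intro nn_integral_cong) (simp only: epowr_mult mult.left_commute)
 also have "... = ennreal (b powr p) * herz_sum I A c p q w G"
  unfolding herz_sum_def using p b by (subst nn_integral_cmult) (auto simp: epowr_ennreal)
 finally show ?thesis .
qed

text \<open>The last step shared by both spaces. \<open>N\<close> is either norm, described through
  Borel representatives, and \<open>U\<close> is the open set on which local integrability is
  required. That part of membership follows because a compact subset of \<open>U\<close> is covered
  by finitely many blocks, on each of which the finite norm bounds the integral.\<close>

lemma intrinsic_G_bounded:
 fixes A :: "int \<Rightarrow> (real^'n) set" and N :: "(real^'n \<Rightarrow> ennreal) \<Rightarrow> ennreal"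
 assumes \<beta>: "0 < \<beta>" "\<beta> \<le> 1" and p: "0 < p" and q: "0 < q"
  and w': "w' \<in> borel_measurable borel" "AE x in lborel. w x = w' x"
  and A: "\<And>k. A k \<in> sets borel" and c: "\<And>k. 0 < c k"
  and N: "\<And>F F'. F' \<in> borel_measurable borel \<Longrightarrow> AE x in lborel. F x = F' x \<Longrightarrow> N F = herz_sum I A c p q w' F' epowr (1 / p)"
  and cover: "\<And>T. compact T \<Longrightarrow> T \<subseteq> U \<Longrightarrow> \<exists>J\<subseteq>I. finite J \<and> T \<subseteq> (\<Union>k\<in>J. A k)"
  and K: "0 \<le> K" "\<And>g. g \<in> borel_measurable borel \<Longrightarrow> herz_sum I A c p q w' (absf g) < top \<Longrightarrow>
    local_int g \<and> herz_sum I A c p q w' (sq_full \<beta> g) \<le> ennreal K * herz_sum I A c p q w' (absf g)"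
  and f: "f \<in> borel_measurable lebesgue" and fin: "N (eabs f) < \<infinity>"
 shows "intrinsic_G \<beta> f \<in> Lq_loc q U w \<and> N (intrinsic_G \<beta> f) < \<infinity>
  \<and> N (intrinsic_G \<beta> f) \<le> ennreal (2 ^ (CARD('n) + 1) * K powr (1 / p)) * N (eabs f)"
proof -
 note [measurable] = w'(1) A
 define b :: real where "b = 2 ^ (CARD('n) + 1)"
 have b: "0 < b" by (simp add: b_def)
 obtain g where g [measurable]: "g \<in> borel_measurable borel" and "AE x in lborel. f x = g x"
  using completion_ex_borel_measurable_real[OF f] by auto
 then have eq: "AE x in lborel. f x = g x" by simp
 have Nf: "N (eabs f) = herz_sum I A c p q w' (absf g) epowr (1 / p)"
 proof (rule N)
  show "AE x in lborel. eabs f x = ennreal \<bar>g x\<bar>" using eq by eventually_elim simp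
 qed simp
 then have fing: "herz_sum I A c p q w' (absf g) < top" using fin p by (simp add: epowr_less_top_iff)
 have li: "local_int g" and Ks: "herz_sum I A c p q w' (sq_full \<beta> g) \<le> ennreal K * herz_sum I A c p q w' (absf g)"
  using K(2)[OF g fing] by auto
 have [measurable]: "sq_full \<beta> g \<in> borel_measurable borel" by (rule measurable_sq_full[OF \<beta> li])
 have Gm [measurable]: "intrinsic_G \<beta> f \<in> borel_measurable borel" by (rule measurable_intrinsic_G[OF \<beta> li f eq])
 have NG: "N (intrinsic_G \<beta> f) = herz_sum I A c p q w' (intrinsic_G \<beta> f) epowr (1 / p)"
  by (rule N[OF Gm]) simp
 have "herz_sum I A c p q w' (intrinsic_G \<beta> f) \<le> ennreal (b powr p) * herz_sum I A c p q w' (sq_full \<beta> g)"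
 proof (rule herz_sum_le_scaled[OF p q])
  show "intrinsic_G \<beta> f x \<le> ennreal b * sq_full \<beta> g x" for x
   unfolding b_def by (rule intrinsic_G_le_sq_full[OF \<beta> li f eq])
 qed (use b in simp_all)
 also have "... \<le> ennreal (b powr p) * (ennreal K * herz_sum I A c p q w' (absf g))"
  by (rule mult_left_mono[OF Ks]) simp
 finally have le: "herz_sum I A c p q w' (intrinsic_G \<beta> f) \<le> ennreal (b powr p) * (ennreal K * herz_sum I A c p q w' (absf g))" .
 have "N (intrinsic_G \<beta> f) \<le> (ennreal (b powr p) * (ennreal K * herz_sum I A c p q w' (absf g))) epowr (1 / p)"
  unfolding NG using p by (intro epowr_mono le) auto
 also have "... = ennreal (b * K powr (1 / p)) * N (eabs f)"
  using p b K(1) by (simp add: Nf epowr_mult epowr_ennreal powr_powr ennreal_mult mult.assoc)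
 finally have bound: "N (intrinsic_G \<beta> f) \<le> ennreal (b * K powr (1 / p)) * N (eabs f)" .
 also have "... < \<infinity>" using fin by (simp add: ennreal_mult_less_top)
 finally have finG: "N (intrinsic_G \<beta> f) < \<infinity>" .
 then have finS: "herz_sum I A c p q w' (intrinsic_G \<beta> f) < top" using p by (simp add: NG epowr_less_top_iff)
 have "Lq_norm q w (\<lambda>x. intrinsic_G \<beta> f x * indicator T x) < \<infinity>" if T: "compact T" "T \<subseteq> U" for T
 proof -
  obtain J where J: "J \<subseteq> I" "finite J" "T \<subseteq> (\<Union>k\<in>J. A k)" using cover[OF T] by auto
  have [measurable]: "T \<in> sets borel" using T(1) by (rule borel_compact)
  have "wint_on T q w' (intrinsic_G \<beta> f)
   \<le> (\<integral>\<^sup>+x. (\<Sum>k\<in>J. intrinsic_G \<beta> f x epowr q * ennreal (w' x) * indicator (A k) x) \<partial>lborel)"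
  proof (rule nn_integral_mono)
   fix x
   let ?h = "intrinsic_G \<beta> f x epowr q * ennreal (w' x)"
   show "?h * indicator T x \<le> (\<Sum>k\<in>J. ?h * indicator (A k) x)"
   proof (cases "x \<in> T")
    case True
    then obtain k where k: "k \<in> J" "x \<in> A k" using J(3) by blast
    have "?h * indicator (A k) x \<le> (\<Sum>k\<in>J. ?h * indicator (A k) x)"
     by (rule member_le_sum[OF k(1)]) (use J in auto)
    then show ?thesis using True k by simp
   qed simp
  qed
  also have "... = (\<Sum>k\<in>J. \<integral>\<^sup>+x\<in>A k. intrinsic_G \<beta> f x epowr q * ennreal (w' x) \<partial>lborel)"
   by (rule nn_integral_sum) measurable
  also have "... < top"
  proof -
   have "wint_on (A k) q w' (intrinsic_G \<beta> f) < top" if "k \<in> J" for k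
    using J(1) that by (intro herz_sum_block_finite[OF p q c _ finS]) auto
   then show ?thesis using J(2) by simp
  qed
  finally show ?thesis
   unfolding Lq_norm_restrict[OF q \<open>T \<in> sets borel\<close> w'(1) Gm w'(2) AE_I2[OF refl]] using q by (simp add: epowr_less_top_iff)
 qed
 moreover have "intrinsic_G \<beta> f \<in> borel_measurable lebesgue" by (rule measurable_completion) (simp add: Gm)
 ultimately have "intrinsic_G \<beta> f \<in> Lq_loc q U w" by (simp add: Lq_loc_def)
 then show ?thesis using finG bound by (simp add: b_def)
qed

theorem corollary1p5:
  fixes w1 w2 :: "real^'n \<Rightarrow> real"
    and \<alpha> \<beta> p q q1 q2 :: real
  assumes "0 < \<beta>" and "\<beta> \<le> 1" and "0 < p" and "1 < q"
    and "w1 \<in> muckenhoupt q1" and "w2 \<in> muckenhoupt q2"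
    and "(w1 = w2 \<and> 1 \<le> q1 \<and> q1 = q2 \<and> q2 \<le> q
            \<and> - real CARD('n) * q1 / q < \<alpha> * q1 \<and> \<alpha> * q1 < real CARD('n) * (1 - q2 / q))
         \<or> (w1 \<noteq> w2 \<and> 1 \<le> q1 \<and> 1 \<le> q2 \<and> q2 \<le> q
            \<and> 0 < \<alpha> * q1 \<and> \<alpha> * q1 < real CARD('n) * (1 - q2 / q))"
  shows "\<exists>C::real. C > 0
    \<and> (\<forall>f. f \<in> borel_measurable lebesgue \<and> eabs f \<in> herz_hom \<alpha> p q w1 w2 \<longrightarrow>
          intrinsic_G \<beta> f \<in> herz_hom \<alpha> p q w1 w2
          \<and> herz_hom_norm \<alpha> p q w1 w2 (intrinsic_G \<beta> f)
              \<le> ennreal C * herz_hom_norm \<alpha> p q w1 w2 (eabs f))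
    \<and> (\<forall>f. f \<in> borel_measurable lebesgue \<and> eabs f \<in> herz_nonhom \<alpha> p q w1 w2 \<longrightarrow>
          intrinsic_G \<beta> f \<in> herz_nonhom \<alpha> p q w1 w2
          \<and> herz_nonhom_norm \<alpha> p q w1 w2 (intrinsic_G \<beta> f)
              \<le> ennreal C * herz_nonhom_norm \<alpha> p q w1 w2 (eabs f))"
proof -
 note \<beta> = assms(1,2) and p = assms(3) and q = assms(4)
 have q0: "0 < q" using q by simp
 have s12: "1 \<le> q1" "1 \<le> q2" "q2 \<le> q" using assms(7) by auto
 define n where "n = real CARD('n)"
 have n: "0 < n" by (simp add: n_def)
 obtain w2' C2 where w2': "ball_avg_weight q2 C2 w2'" "AE x in lborel. w2 x = w2' x"
  using muckenhoupt_ball_avg_weight[OF assms(6)] by auto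
 \<comment> \<open>If the weights coincide, the same representative must be chosen for both, and
   below the same masses: the first alternative of \<open>mass_growth_coefficients\<close> relies on
   \<open>m1 = m2\<close>.\<close>
 obtain w1' C1 where w1': "ball_avg_weight q1 C1 w1'" "AE x in lborel. w1 x = w1' x" and same: "w1 = w2 \<Longrightarrow> w1' = w2' \<and> C1 = C2"
 proof (cases "w1 = w2")
  case True
  then have "q1 = q2" using assms(7) by auto
  with True w2' show ?thesis by (intro that[of C2 w2']) auto
 next
  case False
  then show ?thesis using muckenhoupt_ball_avg_weight[OF assms(5)] that by blast
 qed
 \<comment> \<open>The exponent of \<open>w2'\<close> is raised to \<open>q\<close> for the bound of
   the square function. The growth of its masses is still measured with \<open>q2\<close>, which is
   the exponent in the condition on \<open>\<alpha>\<close>.\<close>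
 obtain C2' where w2q: "ball_avg_weight q C2' w2'"
  using ball_avg_weight_mono[OF w2'(1) s12(2,3)] w2'(1) by auto
 obtain m2 \<gamma>2 where m2: "\<And>k. ennreal (m2 k) = mass w2' (cball 0 (2 powi k))"
  and g2: "mass_growth (2 powr (n * q2)) C2 \<gamma>2 m2"
  using ball_avg_weight_mass_growth[OF w2'(1) s12(2)] unfolding DIM_cart DIM_real mult_1_right n_def[symmetric] by auto
 obtain m1 \<gamma>1 where m1: "\<And>k. ennreal (m1 k) = mass w1' (cball 0 (2 powi k))"
  and g1: "mass_growth (2 powr (n * q1)) C1 \<gamma>1 m1" and m12: "w1 = w2 \<Longrightarrow> m1 = m2"
 proof (cases "w1 = w2")
  case True
  then have "q1 = q2" using assms(7) by auto
  with True same m2 g2 show ?thesis by (intro that[of m2 \<gamma>2]) auto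
 next
  case False
  then show ?thesis using ball_avg_weight_mass_growth[OF w1'(1) s12(1)] that
   unfolding DIM_cart DIM_real mult_1_right n_def[symmetric] by auto
 qed
 have mpos: "0 < m1 k" "0 < m2 k" for k using g1 g2 by (auto simp: mass_growth_def)
 define c where "c k = m1 k powr (\<alpha> / n)" for k
 have c: "0 < c k" for k using mpos(1)[of k] by (simp add: c_def)
 have two: "2 powr x < 2 ^ CARD('n)" if "x < n" for x :: real
  using powr_less_mono[OF that, of 2] by (simp add: n_def powr_realpow)
 \<comment> \<open>In terms of growth rates, the upper bound on \<open>\<alpha>\<close> says that
   \<alpha> q1 + n q2 / q < n. In the first case q1 = q2, and dividing the lower bound by the
   positive \<open>q1\<close> gives 0 < \<alpha>/n + 1/q.\<close>
 have "m1 = m2 \<and> 0 < \<alpha> / n + 1 / q \<and> (2 powr (n * q1)) powr (\<alpha> / n + 1 / q) < 2 ^ CARD('n)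
  \<or> 0 < \<alpha> / n \<and> (2 powr (n * q1)) powr (\<alpha> / n) * (2 powr (n * q2)) powr (1 / q) < 2 ^ CARD('n)"
  using assms(7)
 proof
  assume H: "w1 = w2 \<and> 1 \<le> q1 \<and> q1 = q2 \<and> q2 \<le> q \<and> - real CARD('n) * q1 / q < \<alpha> * q1 \<and> \<alpha> * q1 < real CARD('n) * (1 - q2 / q)"
  have "- n * q1 / q < \<alpha> * q1" using H unfolding n_def by blast
  then have "q1 * (- n / q) < q1 * \<alpha>" by (simp add: mult.commute)
  then have "- n / q < \<alpha>" using s12 by (subst (asm) mult_less_cancel_left_pos) auto
  then have "0 < \<alpha> / n + 1 / q" using n q0 by (simp add: field_simps)
  moreover have "(2 powr (n * q1)) powr (\<alpha> / n + 1 / q) = 2 powr (\<alpha> * q1 + n * q1 / q)"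
   using n by (simp add: powr_powr distrib_left mult.commute)
  moreover have "\<alpha> * q1 + n * q1 / q < n"
  proof -
   have "\<alpha> * q1 < n * (1 - q1 / q)" using H unfolding n_def by blast
   then show ?thesis by (simp add: right_diff_distrib)
  qed
  ultimately show ?thesis using two m12 H by (intro disjI1) simp
 next
  assume H: "w1 \<noteq> w2 \<and> 1 \<le> q1 \<and> 1 \<le> q2 \<and> q2 \<le> q \<and> 0 < \<alpha> * q1 \<and> \<alpha> * q1 < real CARD('n) * (1 - q2 / q)"
  have "0 < \<alpha>" using H s12 by (simp add: zero_less_mult_iff)
  moreover have "(2 powr (n * q1)) powr (\<alpha> / n) * (2 powr (n * q2)) powr (1 / q) = 2 powr (\<alpha> * q1 + n * q2 / q)"
   using n by (simp add: powr_powr powr_add mult.commute)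
  moreover have "\<alpha> * q1 + n * q2 / q < n"
  proof -
   have "\<alpha> * q1 < n * (1 - q2 / q)" using H unfolding n_def by blast
   then show ?thesis by (simp add: right_diff_distrib)
  qed
  ultimately show ?thesis using two n by (intro disjI2) simp
 qed
 then obtain s D where s: "0 < s" "s < 1" and D: "0 \<le> D"
  and M: "\<And>i k. c i * (m2 i / m2 k) powr (1 / q) * (2 powi (k - max i k)) ^ CARD('n) \<le> D * (s * s) ^ nat \<bar>i - k\<bar> * c k"
  and M3: "\<And>i k. \<bar>i - k\<bar> \<le> 1 \<Longrightarrow> c i \<le> D * c k"
  using mass_growth_coefficients[OF g1 g2, of "1 / q" "\<alpha> / n" "CARD('n)"] q0 unfolding c_def by auto
 have MD: "c i * (m2 i / m2 k) powr (1 / q) * (2 powi (k - max i k)) ^ DIM(real^'n) \<le> D * (s * s) ^ nat \<bar>i - k\<bar> * c k" for i k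
  using M[of i k] by simp
 have "\<exists>K\<ge>0. \<forall>f\<in>borel_measurable borel. herz_sum UNIV annulus c p q w2' (absf f) < top \<longrightarrow>
   local_int f \<and> herz_sum UNIV annulus c p q w2' (sq_full \<beta> f) \<le> ennreal K * herz_sum UNIV annulus c p q w2' (absf f)"
 proof (rule herz_bound[OF \<beta> w2q q p s annulus_sets _ _ _ _ mpos(2) m2 c D MD M3])
  show "annulus k \<subseteq> cball (0::real^'n) (2 powi k)" for k by (auto simp: annulus_def dyadic_ball_def)
  show "annulus i \<inter> cball (0::real^'n) (2 powi (i - 1)) = {}" for i by (auto simp: annulus_def dyadic_ball_def)
  show "\<exists>k\<in>UNIV. z \<in> annulus k" if "z \<noteq> 0" for z :: "real^'n" using ex_annulus[OF that] by simp
 qed simp_all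
 then obtain Ka where Ka: "0 \<le> Ka" "\<And>g. g \<in> borel_measurable borel \<Longrightarrow> herz_sum UNIV annulus c p q w2' (absf g) < top \<Longrightarrow>
   local_int g \<and> herz_sum UNIV annulus c p q w2' (sq_full \<beta> g) \<le> ennreal Ka * herz_sum UNIV annulus c p q w2' (absf g)"
  by (elim exE conjE) (rule that, assumption, drule (1) bspec, drule (1) mp)
 have "\<exists>K\<ge>0. \<forall>f\<in>borel_measurable borel. herz_sum {0..} shell c p q w2' (absf f) < top \<longrightarrow>
   local_int f \<and> herz_sum {0..} shell c p q w2' (sq_full \<beta> f) \<le> ennreal K * herz_sum {0..} shell c p q w2' (absf f)"
 proof (rule herz_bound[OF \<beta> w2q q p s shell_sets _ _ _ _ mpos(2) m2 c D MD M3])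
  show "shell k \<subseteq> cball (0::real^'n) (2 powi k)" for k by (rule shell_sub)
  show "shell i \<inter> cball (0::real^'n) (2 powi (i - 1)) = {}" if "i \<in> {0..}" "k \<in> {0..}" "k < i" for i k
   using that by (intro shell_sep) auto
  show "\<exists>k\<in>{0..}. z \<in> shell k" for z :: "real^'n" by (rule ex_shell)
 qed simp_all
 then obtain Kb where Kb: "0 \<le> Kb" "\<And>g. g \<in> borel_measurable borel \<Longrightarrow> herz_sum {0..} shell c p q w2' (absf g) < top \<Longrightarrow>
   local_int g \<and> herz_sum {0..} shell c p q w2' (sq_full \<beta> g) \<le> ennreal Kb * herz_sum {0..} shell c p q w2' (absf g)"
  by (elim exE conjE) (rule that, assumption, drule (1) bspec, drule (1) mp)
 note W = ball_avg_weightD(1)[OF w1'(1)] and W2 = ball_avg_weightD(1)[OF w2'(1)]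
 define b :: real where "b = 2 ^ (CARD('n) + 1)"
 have hom: "intrinsic_G \<beta> f \<in> herz_hom \<alpha> p q w1 w2
   \<and> herz_hom_norm \<alpha> p q w1 w2 (intrinsic_G \<beta> f) \<le> ennreal (b * Ka powr (1 / p)) * herz_hom_norm \<alpha> p q w1 w2 (eabs f)"
  if "f \<in> borel_measurable lebesgue" "eabs f \<in> herz_hom \<alpha> p q w1 w2" for f
 proof -
  have "intrinsic_G \<beta> f \<in> Lq_loc q (- {0}) w2 \<and> herz_hom_norm \<alpha> p q w1 w2 (intrinsic_G \<beta> f) < \<infinity>
   \<and> herz_hom_norm \<alpha> p q w1 w2 (intrinsic_G \<beta> f) \<le> ennreal (2 ^ (CARD('n) + 1) * Ka powr (1 / p)) * herz_hom_norm \<alpha> p q w1 w2 (eabs f)"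
  proof (rule intrinsic_G_bounded[OF \<beta> p q0 W2 w2'(2) annulus_sets c _ _ Ka that(1)])
   show "herz_hom_norm \<alpha> p q w1 w2 F = herz_sum UNIV annulus c p q w2' F' epowr (1 / p)"
    if "F' \<in> borel_measurable borel" "AE x in lborel. F x = F' x" for F F'
    unfolding c_def n_def by (rule herz_hom_norm_eq[OF p q0 W2 that(1) W w1'(2) w2'(2) that(2) mpos(1) m1])
   show "\<exists>J\<subseteq>UNIV. finite J \<and> T \<subseteq> (\<Union>k\<in>J. annulus k)" if "compact T" "T \<subseteq> - {0}" for T :: "(real^'n) set"
    using compact_annulus_cover[OF that] by simp
   show "herz_hom_norm \<alpha> p q w1 w2 (eabs f) < \<infinity>" using that(2) by (simp add: herz_hom_def)
  qed
  then show ?thesis by (simp add: herz_hom_def b_def)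
 qed
 have nonhom: "intrinsic_G \<beta> f \<in> herz_nonhom \<alpha> p q w1 w2
   \<and> herz_nonhom_norm \<alpha> p q w1 w2 (intrinsic_G \<beta> f) \<le> ennreal (b * Kb powr (1 / p)) * herz_nonhom_norm \<alpha> p q w1 w2 (eabs f)"
  if "f \<in> borel_measurable lebesgue" "eabs f \<in> herz_nonhom \<alpha> p q w1 w2" for f
 proof -
  have "intrinsic_G \<beta> f \<in> Lq_loc q UNIV w2 \<and> herz_nonhom_norm \<alpha> p q w1 w2 (intrinsic_G \<beta> f) < \<infinity>
   \<and> herz_nonhom_norm \<alpha> p q w1 w2 (intrinsic_G \<beta> f) \<le> ennreal (2 ^ (CARD('n) + 1) * Kb powr (1 / p)) * herz_nonhom_norm \<alpha> p q w1 w2 (eabs f)"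
  proof (rule intrinsic_G_bounded[OF \<beta> p q0 W2 w2'(2) shell_sets c _ _ Kb that(1)])
   show "herz_nonhom_norm \<alpha> p q w1 w2 F = herz_sum {0..} shell c p q w2' F' epowr (1 / p)"
    if "F' \<in> borel_measurable borel" "AE x in lborel. F x = F' x" for F F'
    unfolding c_def n_def by (rule herz_nonhom_norm_eq[OF p q0 W2 that(1) W w1'(2) w2'(2) that(2) mpos(1) m1])
   show "\<exists>J\<subseteq>{0..}. finite J \<and> T \<subseteq> (\<Union>k\<in>J. shell k)" if "compact T" for T :: "(real^'n) set"
    by (rule compact_shell_cover[OF that])
   show "herz_nonhom_norm \<alpha> p q w1 w2 (eabs f) < \<infinity>" using that(2) by (simp add: herz_nonhom_def)
  qed
  then show ?thesis by (simp add: herz_nonhom_def b_def)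
 qed
 define C where "C = b * (Ka powr (1 / p) + Kb powr (1 / p)) + 1"
 have b0: "0 \<le> b" by (simp add: b_def)
 have C: "0 < C" "b * Ka powr (1 / p) \<le> C" "b * Kb powr (1 / p) \<le> C"
  using b0 by (auto simp: C_def distrib_left add_nonneg_pos add_increasing add_increasing2)
 show ?thesis
 proof (intro exI[of _ C] conjI allI impI C(1))
  fix f :: "real^'n \<Rightarrow> real"
  assume f: "f \<in> borel_measurable lebesgue \<and> eabs f \<in> herz_hom \<alpha> p q w1 w2"
  show "intrinsic_G \<beta> f \<in> herz_hom \<alpha> p q w1 w2" using hom f by blast
  have "herz_hom_norm \<alpha> p q w1 w2 (intrinsic_G \<beta> f) \<le> ennreal (b * Ka powr (1 / p)) * herz_hom_norm \<alpha> p q w1 w2 (eabs f)"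
   using hom f by blast
  also have "\<dots> \<le> ennreal C * herz_hom_norm \<alpha> p q w1 w2 (eabs f)"
   by (intro mult_right_mono ennreal_leI C(2)) simp
  finally show "herz_hom_norm \<alpha> p q w1 w2 (intrinsic_G \<beta> f) \<le> ennreal C * herz_hom_norm \<alpha> p q w1 w2 (eabs f)" .
 next
  fix f :: "real^'n \<Rightarrow> real"
  assume f: "f \<in> borel_measurable lebesgue \<and> eabs f \<in> herz_nonhom \<alpha> p q w1 w2"
  show "intrinsic_G \<beta> f \<in> herz_nonhom \<alpha> p q w1 w2" using nonhom f by blast
  have "herz_nonhom_norm \<alpha> p q w1 w2 (intrinsic_G \<beta> f) \<le> ennreal (b * Kb powr (1 / p)) * herz_nonhom_norm \<alpha> p q w1 w2 (eabs f)"
   using nonhom f by blast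
  also have "\<dots> \<le> ennreal C * herz_nonhom_norm \<alpha> p q w1 w2 (eabs f)"
   by (intro mult_right_mono ennreal_leI C(3)) simp
  finally show "herz_nonhom_norm \<alpha> p q w1 w2 (intrinsic_G \<beta> f) \<le> ennreal C * herz_nonhom_norm \<alpha> p q w1 w2 (eabs f)" .
 qed
qed

end
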